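(* Let $\Sigma=\Sigma_{g,p}$ with $p\geqslant1$, and with $p\geqslant3$ if $g=0$. The connected components of the space of type-preserving $\mathrm{PSL}(2,\mathbb R)$-characters of $\Sigma$ are indexed by the pairs $(n,s)\in\mathbb Z\times\{\pm1\}^p$ (relative Euler class and sign) satisfying: if $g\geqslant1$, $\chi(\Sigma)+p_+(s)\leqslant n\leqslant-\chi(\Sigma)-p_-(s)$; and if $g=0$, one of (i) $\chi(\Sigma)+p_+(s)\leqslant n\leqslant-\chi(\Sigma)-p_-(s)$, (ii) $n=0$ and either $p_-(s)=1$ or $p_+(s)=1$, (iii) $n=1$ and $p_-(s)=0$, or $n=-1$ and $p_+(s)=0$. In particular the number of connected components is $$\sum_{n=\chi(\Sigma)}^{-\chi(\Sigma)}\ \sum_{k=\max\{n+p+\chi(\Sigma),0\}}^{\min\{n-\chi(\Sigma),p\}}\binom pk\quad\text{if } g\geqslant 1,$$ and this same expression plus $2p+2$ if $g=0$ (a sum whose lower limit exceeds its upper limit is $0$).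
   Context: $\Sigma_{g,p}$ is the surface obtained from a closed connected oriented surface of genus $g$ by removing $p$ points; $\chi(\Sigma_{g,p})=2-2g-p$. Fix a presentation $\pi_1(\Sigma)=\langle a_1,b_1,\dots,a_g,b_g,c_1,\dots,c_p\mid [a_1,b_1]\cdots[a_g,b_g]c_1\cdots c_p\rangle$, where $c_1,\dots,c_p$ are the preferred peripheral elements, $c_i$ being represented by a loop freely homotopic to a circle around the $i$-th puncture. A non-trivial element $\pm A\in\mathrm{PSL}(2,\mathbb R)$ is hyperbolic, parabolic, or elliptic if $|\mathrm{tr}(A)|>2$, $=2$, or $<2$ respectively. A parabolic element is positive if it is $\mathrm{PSL}(2,\mathbb R)$-conjugate to $\pm\begin{bmatrix}1&1\\0&1\end{bmatrix}$ and negative if it is conjugate to $\pm\begin{bmatrix}1&-1\\0&1\end{bmatrix}$. A representation $\phi:\pi_1(\Sigma)\to\mathrm{PSL}(2,\mathbb R)$ is type-preserving if every $\phi(c_i)$ is parabolic. $\mathcal R(\Sigma)$ is the space of type-preserving representations (compact-open topology), and the space of type-preserving $\mathrm{PSL}(2,\mathbb R)$-characters is the quotient space of $\mathcal R(\Sigma)$ by the conjugation action of $\mathrm{PSL}(2,\mathbb R)$, with the quotient topology. The sign $s(\phi)\in\{\pm1\}^p$ has $i$-th component $+1$ if $\phi(c_i)$ is positive and $-1$ if $\phi(c_i)$ is negative. For $s\in\{\pm1\}^p$, $p_+(s)$ and $p_-(s)$ are the numbers of components equal to $+1$ and $-1$. Relative Euler class: let $\widetilde{\mathrm{SL}}(2,\mathbb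 R)$ be the universal covering group of $\mathrm{PSL}(2,\mathbb R)$, with exponential map $\widetilde{\exp}$, and let $z=\widetilde{\exp}\begin{bmatrix}0&\pi\\-\pi&0\end{bmatrix}$, a generator of the center. A parabolic element has a unique lift lying in the image of $\widetilde{\exp}$. Let $\widetilde{\phi(c_i)}$ be this lift of $\phi(c_i)$, and $\widetilde{\phi(a_j)},\widetilde{\phi(b_j)}$ arbitrary lifts. Then $e(\phi)=n$ is the integer with $[\widetilde{\phi(a_1)},\widetilde{\phi(b_1)}]\cdots[\widetilde{\phi(a_g)},\widetilde{\phi(b_g)}]\,\widetilde{\phi(c_1)}\cdots\widetilde{\phi(c_p)}=z^n$. Both $e(\phi)$ and $s(\phi)$ are invariant under $\mathrm{PSL}(2,\mathbb R)$-conjugation. *)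

theory Defs
  imports "HOL-Analysis.Analysis" "HOL-Algebra.Coset"
begin

section \<open>Topological preliminaries\<close>

definition quotient_topology :: "'a topology \<Rightarrow> ('a \<Rightarrow> 'b) \<Rightarrow> 'b topology" where
  "quotient_topology X f =
     topology (\<lambda>U. U \<subseteq> f ` topspace X \<and> openin X {x \<in> topspace X. f x \<in> U})"

lemma openin_quotient_topology:
  "openin (quotient_topology X f) U \<longleftrightarrow>
     U \<subseteq> f ` topspace X \<and> openin X {x \<in> topspace X. f x \<in> U}"
proof -
  let ?P = "\<lambda>U. U \<subseteq> f ` topspace X \<and> openin X {x \<in> topspace X. f x \<in> U}"
  have I: "?P (S \<inter> T)" if "?P S" "?P T" for S T
  proof -
    have eq: "{x \<in> topspace X. f x \<in> S \<inter> T}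
        = {x \<in> topspace X. f x \<in> S} \<inter> {x \<in> topspace X. f x \<in> T}"
      by blast
    have "openin X {x \<in> topspace X. f x \<in> S \<inter> T}"
      unfolding eq using that by (intro openin_Int) simp_all
    moreover have "S \<inter> T \<subseteq> f ` topspace X"
      using that(1) by (intro le_infI1) simp
    ultimately show ?thesis by (intro conjI)
  qed
  have U: "?P (\<Union>\<K>)" if K: "\<forall>K\<in>\<K>. ?P K" for \<K>
  proof -
    have eq: "{x \<in> topspace X. f x \<in> \<Union>\<K>} = \<Union>((\<lambda>K. {x \<in> topspace X. f x \<in> K}) ` \<K>)"
      by blast
    have "openin X {x \<in> topspace X. f x \<in> \<Union>\<K>}"
      unfolding eq using K by (intro openin_Union ballI; elim imageE; simp)
    moreover have "\<Union>\<K> \<subseteq> f ` topspace X"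
      using K by (intro Union_least) simp
    ultimately show ?thesis by (intro conjI)
  qed
  have "istopology ?P"
    unfolding istopology_def
    by (rule conjI; (intro allI impI); (rule I U; assumption))
  then show ?thesis
    unfolding quotient_topology_def by (subst topology_inverse') (assumption, rule refl)
qed

lemma topspace_quotient_topology [simp]:
  "topspace (quotient_topology X f) = f ` topspace X"
proof
  show "topspace (quotient_topology X f) \<subseteq> f ` topspace X"
    using openin_quotient_topology[THEN iffD1, OF openin_topspace] by (rule conjunct1)
  have "{x \<in> topspace X. f x \<in> f ` topspace X} = topspace X"
    by auto
  then have "openin (quotient_topology X f) (f ` topspace X)"
    by (simp add: openin_quotient_topology)
  then show "f ` topspace X \<subseteq> topspace (quotient_topology X f)"
    by (rule openin_subset)
qed

text \<open>Maps are normalised to be \<^const>\<open>undefined\<close> outside the source, so that equality of maps on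
  the source is equality.\<close>

definition compact_open_topology :: "'a topology \<Rightarrow> 'b topology \<Rightarrow> ('a \<Rightarrow> 'b) topology" where
  "compact_open_topology X Y = topology_generated_by
     {{f \<in> extensional (topspace X). continuous_map X Y f \<and> f ` K \<subseteq> U} | K U.
        compactin X K \<and> openin Y U}"


section \<open>Products in groups\<close>

definition group_commutator :: "('a, 'b) monoid_scheme \<Rightarrow> 'a \<Rightarrow> 'a \<Rightarrow> 'a" where
  "group_commutator G x y = x \<otimes>\<^bsub>G\<^esub> y \<otimes>\<^bsub>G\<^esub> inv\<^bsub>G\<^esub> x \<otimes>\<^bsub>G\<^esub> inv\<^bsub>G\<^esub> y"

definition ordered_prod :: "('a, 'b) monoid_scheme \<Rightarrow> (nat \<Rightarrow> 'a) \<Rightarrow> nat \<Rightarrow> 'a" where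
  "ordered_prod G f n = foldr (\<otimes>\<^bsub>G\<^esub>) (map f [0..<n]) \<one>\<^bsub>G\<^esub>"


section \<open>Groups given by presentations\<close>

text \<open>A letter \<open>(x, True)\<close> stands for the generator \<open>x\<close>, and \<open>(x, False)\<close> for its inverse.\<close>

type_synonym 'a word = "('a \<times> bool) list"

definition words :: "'a set \<Rightarrow> 'a word set" where
  "words X = lists (X \<times> UNIV)"

inductive pres_eq :: "'a set \<Rightarrow> 'a word set \<Rightarrow> 'a word \<Rightarrow> 'a word \<Rightarrow> bool"
  for X :: "'a set" and R :: "'a word set" where
  cancel: "\<lbrakk>u \<in> words X; v \<in> words X; x \<in> X\<rbrakk>
             \<Longrightarrow> pres_eq X R (u @ [(x, b), (x, \<not> b)] @ v) (u @ v)"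
| relator: "\<lbrakk>u \<in> words X; v \<in> words X; r \<in> R\<rbrakk> \<Longrightarrow> pres_eq X R (u @ r @ v) (u @ v)"
| refl: "u \<in> words X \<Longrightarrow> pres_eq X R u u"
| sym: "pres_eq X R u v \<Longrightarrow> pres_eq X R v u"
| trans: "\<lbrakk>pres_eq X R u v; pres_eq X R v w\<rbrakk> \<Longrightarrow> pres_eq X R u w"

definition pres_class :: "'a set \<Rightarrow> 'a word set \<Rightarrow> 'a word \<Rightarrow> 'a word set" where
  "pres_class X R u = {v. pres_eq X R u v}"

definition presented_group :: "'a set \<Rightarrow> 'a word set \<Rightarrow> 'a word set monoid" where
  "presented_group X R =
     \<lparr>carrier = pres_class X R ` words X,
      mult = (\<lambda>P Q. {w. \<exists>u\<in>P. \<exists>v\<in>Q. pres_eq X R (u @ v) w}),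
      one = pres_class X R []\<rparr>"


section \<open>The fundamental group of \<open>\<Sigma>\<^sub>g\<^sub>,\<^sub>p\<close>\<close>

text \<open>All indices start at \<open>0\<close>: the generators are \<open>a\<^sub>j, b\<^sub>j\<close> for \<open>j < g\<close> and \<open>c\<^sub>i\<close> for \<open>i < p\<close>.\<close>

datatype surface_gen = GenA nat | GenB nat | GenC nat

definition surface_gens :: "nat \<Rightarrow> nat \<Rightarrow> surface_gen set" where
  "surface_gens g p = GenA ` {..<g} \<union> GenB ` {..<g} \<union> GenC ` {..<p}"

definition surface_relator :: "nat \<Rightarrow> nat \<Rightarrow> surface_gen word" where
  "surface_relator g p =
     concat (map (\<lambda>j. [(GenA j, True), (GenB j, True), (GenA j, False), (GenB j, False)]) [0..<g])
     @ map (\<lambda>i. (GenC i, True)) [0..<p]"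

definition surface_group :: "nat \<Rightarrow> nat \<Rightarrow> surface_gen word set monoid" where
  "surface_group g p = presented_group (surface_gens g p) {surface_relator g p}"

definition surface_elem :: "nat \<Rightarrow> nat \<Rightarrow> surface_gen \<Rightarrow> surface_gen word set" where
  "surface_elem g p x = pres_class (surface_gens g p) {surface_relator g p} [(x, True)]"

definition euler_char :: "nat \<Rightarrow> nat \<Rightarrow> int" where
  "euler_char g p = 2 - 2 * int g - int p"


section \<open>The topological group \<open>PSL(2,\<real>)\<close>\<close>

definition SL2 :: "(real^2^2) monoid" where
  "SL2 = \<lparr>carrier = {A. det A = 1}, mult = (**), one = mat 1\<rparr>"

definition PSL2 :: "(real^2^2) set monoid" where
  "PSL2 = SL2 Mod {mat 1, - mat 1}"

definition psl :: "real^2^2 \<Rightarrow> (real^2^2) set" where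
  "psl A = {mat 1, - mat 1} #>\<^bsub>SL2\<^esub> A"

definition PSL2_top :: "(real^2^2) set topology" where
  "PSL2_top = quotient_topology (top_of_set (carrier SL2)) psl"

definition parabolic :: "(real^2^2) set \<Rightarrow> bool" where
  "parabolic P \<longleftrightarrow> P \<in> carrier PSL2 \<and> P \<noteq> \<one>\<^bsub>PSL2\<^esub> \<and> (\<exists>A\<in>P. \<bar>trace A\<bar> = 2)"

definition psl_conjugate :: "(real^2^2) set \<Rightarrow> (real^2^2) set \<Rightarrow> bool" where
  "psl_conjugate P Q \<longleftrightarrow> (\<exists>h\<in>carrier PSL2. P = h \<otimes>\<^bsub>PSL2\<^esub> Q \<otimes>\<^bsub>PSL2\<^esub> inv\<^bsub>PSL2\<^esub> h)"

definition positive_parabolic :: "(real^2^2) set \<Rightarrow> bool" where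
  "positive_parabolic P \<longleftrightarrow>
     parabolic P \<and> psl_conjugate P (psl (vector [vector [1, 1], vector [0, 1]]))"

definition negative_parabolic :: "(real^2^2) set \<Rightarrow> bool" where
  "negative_parabolic P \<longleftrightarrow>
     parabolic P \<and> psl_conjugate P (psl (vector [vector [1, - 1], vector [0, 1]]))"


section \<open>The universal covering group and its exponential map\<close>

text \<open>The universal covering group of a path-connected topological group is constructed as the set
  of homotopy classes, relative to the endpoints, of paths starting at the identity, with pointwise
  multiplication; the covering map sends a class to its endpoint. Paths are functions on \<open>\<real>\<close> of
  which only the restriction to \<open>[0,1]\<close> matters.\<close>

definition path_homotopic :: "'a topology \<Rightarrow> (real \<Rightarrow> 'a) \<Rightarrow> (real \<Rightarrow> 'a) \<Rightarrow> bool" where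
  "path_homotopic T \<gamma> \<delta> \<longleftrightarrow>
     homotopic_with (\<lambda>r. r 0 = \<gamma> 0 \<and> r 1 = \<gamma> 1) (top_of_set {0..1}) T \<gamma> \<delta>"

definition path_class :: "'a topology \<Rightarrow> (real \<Rightarrow> 'a) \<Rightarrow> (real \<Rightarrow> 'a) set" where
  "path_class T \<gamma> = {\<delta>. path_homotopic T \<gamma> \<delta>}"

definition universal_cover :: "('a, 'b) monoid_scheme \<Rightarrow> 'a topology \<Rightarrow> (real \<Rightarrow> 'a) set monoid" where
  "universal_cover G T =
     \<lparr>carrier = path_class T ` {\<gamma>. pathin T \<gamma> \<and> \<gamma> 0 = \<one>\<^bsub>G\<^esub>},
      mult = (\<lambda>P Q. {\<gamma>. \<exists>\<alpha>\<in>P. \<exists>\<beta>\<in>Q. path_homotopic T (\<lambda>t. \<alpha> t \<otimes>\<^bsub>G\<^esub> \<beta> t) \<gamma>}),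
      one = path_class T (\<lambda>_. \<one>\<^bsub>G\<^esub>)\<rparr>"

definition cover_proj :: "(real \<Rightarrow> 'a) set \<Rightarrow> 'a" where
  "cover_proj P = the_elem ((\<lambda>\<gamma>. \<gamma> 1) ` P)"

definition SL2_cover :: "(real \<Rightarrow> (real^2^2) set) set monoid" where
  "SL2_cover = universal_cover PSL2 PSL2_top"

definition mat_exp :: "real^2^2 \<Rightarrow> real^2^2" where
  "mat_exp X = (\<Sum>k. inverse (fact k) *\<^sub>R (((**) X ^^ k) (mat 1)))"

text \<open>The exponential map of the covering group sends \<open>X\<close> to the endpoint of the lift of the
  one-parameter subgroup \<open>t \<mapsto> \<plusminus>exp(tX)\<close>, that is, to the class of this path on \<open>[0,1]\<close>.\<close>

definition cover_exp :: "real^2^2 \<Rightarrow> (real \<Rightarrow> (real^2^2) set) set" where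
  "cover_exp X = path_class PSL2_top (\<lambda>t. psl (mat_exp (t *\<^sub>R X)))"

definition sl2_algebra :: "(real^2^2) set" where
  "sl2_algebra = {X. trace X = 0}"

definition cover_z :: "(real \<Rightarrow> (real^2^2) set) set" where
  "cover_z = cover_exp (vector [vector [0, pi], vector [- pi, 0]])"

definition parabolic_lift :: "(real^2^2) set \<Rightarrow> (real \<Rightarrow> (real^2^2) set) set" where
  "parabolic_lift P = (THE u. u \<in> cover_exp ` sl2_algebra \<and> cover_proj u = P)"


section \<open>Type-preserving representations, their invariants and characters\<close>

type_synonym surface_rep = "surface_gen word set \<Rightarrow> (real^2^2) set"

definition type_preserving :: "nat \<Rightarrow> nat \<Rightarrow> surface_rep set" where
  "type_preserving g p =
     {\<phi> \<in> hom (surface_group g p) PSL2 \<inter> extensional (carrier (surface_group g p)).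
        \<forall>i<p. parabolic (\<phi> (surface_elem g p (GenC i)))}"

text \<open>The fundamental group carries the discrete topology.\<close>

definition rep_space :: "nat \<Rightarrow> nat \<Rightarrow> surface_rep topology" where
  "rep_space g p = subtopology
     (compact_open_topology (discrete_topology (carrier (surface_group g p))) PSL2_top)
     (type_preserving g p)"

definition conj_rep :: "nat \<Rightarrow> nat \<Rightarrow> (real^2^2) set \<Rightarrow> surface_rep \<Rightarrow> surface_rep" where
  "conj_rep g p h \<phi> =
     (\<lambda>x\<in>carrier (surface_group g p). h \<otimes>\<^bsub>PSL2\<^esub> \<phi> x \<otimes>\<^bsub>PSL2\<^esub> inv\<^bsub>PSL2\<^esub> h)"

definition conj_orbit :: "nat \<Rightarrow> nat \<Rightarrow> surface_rep \<Rightarrow> surface_rep set" where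
  "conj_orbit g p \<phi> = (\<lambda>h. conj_rep g p h \<phi>) ` carrier PSL2"

definition character_space :: "nat \<Rightarrow> nat \<Rightarrow> surface_rep set topology" where
  "character_space g p = quotient_topology (rep_space g p) (conj_orbit g p)"

definition rel_euler_class :: "nat \<Rightarrow> nat \<Rightarrow> surface_rep \<Rightarrow> int" where
  "rel_euler_class g p \<phi> = (THE n.
     \<forall>\<alpha> \<beta>. (\<forall>j<g. \<alpha> j \<in> carrier SL2_cover \<and> cover_proj (\<alpha> j) = \<phi> (surface_elem g p (GenA j)) \<and>
                 \<beta> j \<in> carrier SL2_cover \<and> cover_proj (\<beta> j) = \<phi> (surface_elem g p (GenB j))) \<longrightarrow>
       ordered_prod SL2_cover (\<lambda>j. group_commutator SL2_cover (\<alpha> j) (\<beta> j)) g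
         \<otimes>\<^bsub>SL2_cover\<^esub>
       ordered_prod SL2_cover (\<lambda>i. parabolic_lift (\<phi> (surface_elem g p (GenC i)))) p
       = cover_z [^]\<^bsub>SL2_cover\<^esub> n)"

text \<open>Sign vectors are elements of \<open>{..<p} \<rightarrow>\<^sub>E {1, - 1}\<close>. The value \<open>0\<close> below does not occur for
  type-preserving representations.\<close>

definition sign_vec :: "nat \<Rightarrow> nat \<Rightarrow> surface_rep \<Rightarrow> nat \<Rightarrow> int" where
  "sign_vec g p \<phi> = (\<lambda>i\<in>{..<p}.
     if positive_parabolic (\<phi> (surface_elem g p (GenC i))) then 1
     else if negative_parabolic (\<phi> (surface_elem g p (GenC i))) then - 1
     else 0)"

definition p_plus :: "nat \<Rightarrow> (nat \<Rightarrow> int) \<Rightarrow> nat" where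
  "p_plus p s = card {i. i < p \<and> s i = 1}"

definition p_minus :: "nat \<Rightarrow> (nat \<Rightarrow> int) \<Rightarrow> nat" where
  "p_minus p s = card {i. i < p \<and> s i = - 1}"

definition characters_with :: "nat \<Rightarrow> nat \<Rightarrow> int \<times> (nat \<Rightarrow> int) \<Rightarrow> surface_rep set set" where
  "characters_with g p = (\<lambda>(n, s). {c \<in> topspace (character_space g p).
     \<forall>\<phi>\<in>c. rel_euler_class g p \<phi> = n \<and> sign_vec g p \<phi> = s})"

definition admissible_pairs :: "nat \<Rightarrow> nat \<Rightarrow> (int \<times> (nat \<Rightarrow> int)) set" where
  "admissible_pairs g p = {(n, s). s \<in> {..<p} \<rightarrow>\<^sub>E {1, - 1} \<and>
     (euler_char g p + int (p_plus p s) \<le> n \<and> n \<le> - euler_char g p - int (p_minus p s) \<or>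
      g = 0 \<and> (n = 0 \<and> (p_minus p s = 1 \<or> p_plus p s = 1) \<or>
               n = 1 \<and> p_minus p s = 0 \<or>
               n = - 1 \<and> p_plus p s = 0))}"

end

theory Submission
  imports Defs
begin

text \<open>The universal covering group of \<open>PSL(2,\<real>)\<close> is modelled on \<open>\<real> \<times> \<complex>\<close>, and a representation with relative Euler
  class \<open>n\<close> and sign \<open>s\<close> is lifted to a solution of \<open>\<Prod> [a\<^sub>j, b\<^sub>j] \<Prod> c\<^sub>i = z\<^sup>n\<close> there, with \<open>c\<^sub>i\<close> a parabolic one-parameter
  element of sign \<open>s\<^sub>i\<close>. Multiplication by a parabolic element moves the covering group upwards or downwards by
  less than one turn, and the set of parabolic elements moving a given element into the region between two
  hyperbolic levels is connected; so the set of tuples of parabolic elements with product in such a region is connected.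
  In genus zero, forgetting two non-commuting punctures is a fibration over such a set of tuples with conics
  as fibres. In positive genus, each commutator is a product of four parabolic elements of signs \<open>+ + - -\<close>, and
  the fibre of the commutator map over a non-trivial element is connected up to central translations.
  Hence all solutions for given \<open>(n, s)\<close> lie in one component once the commuting handles are deformed
  away. The level sets of \<open>(n, s)\<close> are open because \<open>PSL(2,\<real>)\<close> has local sections to its covering.\<close>

section \<open>A model of the universal covering group\<close>

text \<open>Why the induction over the parabolic factors closes: half the trace is affine along a
  one-parameter ray of parabolics, and an element with \<open>th\<close> in pi Z has half-trace of
  absolute value at least 1. So a hyperbolic level can be passed in one direction only, and the
  elements that some positive parabolic carries into \<open>between a b\<close> form exactly
  \<open>between (a - 1) b\<close>, a region of the same kind. A central value z^n is not such a
  region, and the product and commutator maps degenerate where factors commute. In genus zero this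
  forces a separate treatment of configurations with a common fixed point, which exist only for n =
  0. When one sign occurs exactly once they are all there is, which accounts for the components
  (ii). In positive genus a commuting handle absorbs part of a puncture: if conjugation by A doubles
  a parabolic P, then [A, P] = P. The signs + + - - are chosen because such words fill exactly the
  range of the commutator map. Connectedness is tested by Boolean functions that are locally
  constant, so that a fibre made of several central translates can count as one.\<close>

text \<open>\<open>SL(2,\<real>)\<close> is \<open>SU(1,1) = {(\<alpha>,\<beta>). \<bar>\<alpha>\<bar>\<^sup>2 - \<bar>\<beta>\<bar>\<^sup>2 = 1}\<close>, and an element of the covering group is
  determined by \<open>\<beta>\<close> and a choice of the argument of \<open>\<alpha>\<close>. The group is written additively because
  \<^class>\<open>group_add\<close> is the class of not necessarily commutative groups.\<close>

datatype cov = Cov (th: real) (be: complex)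

definition al :: "cov \<Rightarrow> complex" where
  "al y = of_real (sqrt (1 + (cmod (be y))\<^sup>2)) * cis (th y)"

lemma cmod_al_sq: "(cmod (al y))\<^sup>2 = 1 + (cmod (be y))\<^sup>2"
  by (simp add: al_def norm_mult)

lemma cmod_al: "cmod (al y) = sqrt (1 + (cmod (be y))\<^sup>2)"
  by (simp add: al_def norm_mult)

lemma cmod_al_ge_1: "cmod (al y) \<ge> 1"
  by (simp add: cmod_al)

lemma al_nz [simp]: "al y \<noteq> 0"
  using cmod_al_ge_1[of y] by auto

lemma cmod_be_less: "cmod (be y) < cmod (al y)"
  by (rule power2_less_imp_less) (simp_all add: cmod_al_sq)

lemma al_polar: "al y = of_real (cmod (al y)) * cis (th y)"
  unfolding cmod_al by (rule al_def)

lemma Re_al: "Re (al y) = cmod (al y) * cos (th y)" and Im_al: "Im (al y) = cmod (al y) * sin (th y)"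
  by (simp_all add: al_def norm_mult)

lemma SU_sq: "(Re (al y))\<^sup>2 + (Im (al y))\<^sup>2 = 1 + (cmod (be y))\<^sup>2"
  using cmod_al_sq[of y] by (simp add: cmod_power2)

lemma Arg_pos_bound: "Re w > 0 \<Longrightarrow> \<bar>Arg w\<bar> < pi / 2"
  using Arg_Re_pos[of w] by auto

lemma cis_Arg_pos: "w \<noteq> 0 \<Longrightarrow> of_real (cmod w) * cis (Arg w) = w"
  by (metis Arg_eq cis_conv_exp)

lemma cov_eqI: "th x = th y \<Longrightarrow> be x = be y \<Longrightarrow> x = y"
  by (cases x; cases y) simp

lemma cis_eq_near:
  assumes "cis s = cis t" "\<bar>s - t\<bar> < 2 * pi" shows "s = t"
proof -
  have "cis (s - t) = 1" using assms(1) by (simp flip: cis_divide)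
  then have "cos (s - t) = 1" by (simp add: complex_eq_iff)
  then obtain n :: int where n: "s - t = of_int n * (2 * pi)" by (auto simp: cos_one_2pi_int)
  then have "\<bar>real_of_int n\<bar> * (2 * pi) < 2 * pi" using assms(2) by (simp add: abs_mult)
  then have "\<bar>real_of_int n\<bar> < 1" by simp
  then have "n = 0" by linarith
  then show ?thesis using n by simp
qed

lemma cis_th_eq: "al x = al y \<Longrightarrow> cis (th x) = cis (th y)"
proof -
  assume a: "al x = al y"
  then have "of_real (cmod (al x)) * cis (th x) = of_real (cmod (al x)) * cis (th y)"
    using al_polar[of x] al_polar[of y] by simp
  then show ?thesis by simp
qed

text \<open>Elements over the same matrix differ in \<open>th\<close> by a multiple of 2 pi, so an
  identity in the covering group is proved as a matrix identity together with a crude bound on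
  angles.\<close>

lemma cov_eqI_near:
  assumes "al x = al y" "be x = be y" "\<bar>th x - th y\<bar> < 2 * pi" shows "x = y"
  using cis_eq_near[OF cis_th_eq[OF assms(1)] assms(3)] assms(2) by (rule cov_eqI)

text \<open>The factor by which \<open>al (x + y)\<close> differs from \<open>al x * al y\<close>.
  Its real part is positive, so its principal argument is a continuous correction of the angle, and
  addition is continuous.\<close>

definition crel :: "cov \<Rightarrow> cov \<Rightarrow> complex" where
  "crel x y = 1 + be x * cnj (be y) / (al x * al y)"

lemma Re_crel: "Re (crel x y) > 0"
proof -
  have "cmod (be x) * cmod (be y) < cmod (al x) * cmod (al y)"
    by (intro mult_strict_mono' cmod_be_less norm_ge_zero)
  then have "cmod (be x * cnj (be y) / (al x * al y)) < 1"
    by (simp add: norm_mult norm_divide)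
  then have "\<bar>Re (be x * cnj (be y) / (al x * al y))\<bar> < 1"
    using abs_Re_le_cmod order.strict_trans1 by blast
  then show ?thesis by (simp add: crel_def)
qed

lemma crel_nz: "crel x y \<noteq> 0"
  using Re_crel[of x y] by force

instantiation cov :: group_add
begin

definition "0 = Cov 0 0"
definition "x + y = Cov (th x + th y + Arg (crel x y)) (al x * be y + be x * cnj (al y))"
definition "- x = Cov (- th x) (- be x)"
definition "x - y = x + - (y::cov)"

lemma be_plus: "be (x + y) = al x * be y + be x * cnj (al y)"
  and th_plus: "th (x + y) = th x + th y + Arg (crel x y)"
  by (simp_all add: plus_cov_def)

lemma al_uminus': "al (- x) = cnj (al x)" and be_uminus': "be (- x) = - be x"
  and th_uminus': "th (- x) = - th x"
  by (simp_all add: uminus_cov_def al_def cis_cnj)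

lemma al_zero': "al 0 = 1" and be_zero': "be 0 = 0" and th_zero': "th 0 = 0"
  by (simp_all add: zero_cov_def al_def)

lemma SU_mult_norm:
  fixes a b c d :: complex
  shows "(cmod (a * c + b * cnj d))\<^sup>2 - (cmod (a * d + b * cnj c))\<^sup>2
       = ((cmod a)\<^sup>2 - (cmod b)\<^sup>2) * ((cmod c)\<^sup>2 - (cmod d)\<^sup>2)"
  unfolding cmod_power2 by (simp add: algebra_simps power2_eq_square)

lemma al_plus: "al (x + y) = al x * al y + be x * cnj (be y)"
proof -
  let ?w = "crel x y"
  have e: "al x * al y + be x * cnj (be y) = al x * al y * ?w"
    by (simp add: crel_def field_simps)
  have "(cmod (al x * al y + be x * cnj (be y)))\<^sup>2 = 1 + (cmod (be (x + y)))\<^sup>2"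
    using SU_mult_norm[of "al x" "al y" "be x" "be y"] by (simp add: be_plus cmod_al_sq)
  then have n: "sqrt (1 + (cmod (be (x + y)))\<^sup>2) = cmod (al x * al y * ?w)"
    using e by (metis norm_ge_zero real_sqrt_unique)
  have "al (x + y) = of_real (cmod (al x * al y * ?w)) * (cis (th x) * cis (th y) * cis (Arg ?w))"
    by (simp add: al_def n th_plus cis_mult)
  also have "\<dots> = (of_real (cmod (al x)) * cis (th x)) * (of_real (cmod (al y)) * cis (th y)) *
      (of_real (cmod ?w) * cis (Arg ?w))"
    by (simp add: norm_mult)
  also have "\<dots> = al x * al y * ?w"
    using al_polar[of x] al_polar[of y] cis_Arg_pos[OF crel_nz[of x y]] by simp
  finally show ?thesis using e by simp
qed

instance
proof
  fix a b c :: cov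
  \<comment> \<open>The two sides differ by four principal arguments, each below pi / 2 in absolute
    value.\<close>
  have "\<bar>th (a + b + c) - th (a + (b + c))\<bar> < 2 * pi"
    using Arg_pos_bound[OF Re_crel[of "a + b" c]] Arg_pos_bound[OF Re_crel[of a b]]
      Arg_pos_bound[OF Re_crel[of a "b + c"]] Arg_pos_bound[OF Re_crel[of b c]]
    unfolding th_plus by linarith
  then show "a + b + c = a + (b + c)"
    by (intro cov_eqI_near) (simp_all add: al_plus be_plus algebra_simps)
next
  fix a :: cov
  have "al (- a) * al a = of_real ((cmod (al a))\<^sup>2)"
    using complex_norm_square[of "al a"] by (simp add: al_uminus' mult.commute)
  moreover have "be (- a) * cnj (be a) = - of_real ((cmod (be a))\<^sup>2)"
    using complex_norm_square[of "be a"] by (simp add: be_uminus')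
  ultimately have "crel (- a) a = of_real (1 - (cmod (be a))\<^sup>2 / (cmod (al a))\<^sup>2)"
    by (simp add: crel_def)
  then have "Re (crel (- a) a) > 0" "Im (crel (- a) a) = 0"
    using Re_crel[of "- a" a] by simp_all
  then have "Arg (crel (- a) a) = 0" by (simp add: Arg_eq_0 complex_is_Real_iff)
  then show "- a + a = 0"
    by (intro cov_eqI) (simp_all add: be_plus th_plus al_uminus' be_uminus' th_uminus' be_zero' th_zero')
next
  fix a :: cov
  show "0 + a = a" "a + 0 = a"
    by (intro cov_eqI; simp add: be_plus th_plus al_zero' be_zero' th_zero' crel_def)+
qed (simp add: minus_cov_def)
end

lemmas al_uminus [simp] = al_uminus' and be_uminus [simp] = be_uminus' and th_uminus [simp] = th_uminus'
  and al_zero [simp] = al_zero' and be_zero [simp] = be_zero' and th_zero [simp] = th_zero'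

lemma th_plus_bound: "\<bar>th (x + y) - th x - th y\<bar> < pi / 2"
  using Arg_pos_bound[OF Re_crel[of x y]] by (simp add: th_plus)

instantiation cov :: metric_space
begin
definition "dist x y = dist (th x, be x) (th y, be y)"
definition "uniformity = (INF e\<in>{0<..}. principal {(x::cov, y). dist x y < e})"
definition "open (U :: cov set) \<longleftrightarrow> (\<forall>x\<in>U. eventually (\<lambda>(x', y). x' = x \<longrightarrow> y \<in> U) uniformity)"
instance
  by standard (auto simp: dist_cov_def uniformity_cov_def open_cov_def dist_triangle2 intro: cov_eqI)
end

lemma tendsto_cov_iff:
  "(f \<longlongrightarrow> y) F \<longleftrightarrow> ((\<lambda>x. th (f x)) \<longlongrightarrow> th y) F \<and> ((\<lambda>x. be (f x)) \<longlongrightarrow> be y) F"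
proof -
  have "(f \<longlongrightarrow> y) F \<longleftrightarrow> ((\<lambda>x. (th (f x), be (f x))) \<longlongrightarrow> (th y, be y)) F"
    by (simp add: tendsto_iff dist_cov_def)
  also have "\<dots> \<longleftrightarrow> ((\<lambda>x. th (f x)) \<longlongrightarrow> th y) F \<and> ((\<lambda>x. be (f x)) \<longlongrightarrow> be y) F"
    using tendsto_fst[of "\<lambda>x. (th (f x), be (f x))" "(th y, be y)" F]
      tendsto_snd[of "\<lambda>x. (th (f x), be (f x))" "(th y, be y)" F] by (auto intro: tendsto_Pair)
  finally show ?thesis .
qed

lemma continuous_on_cov_iff:
  "continuous_on S f \<longleftrightarrow> continuous_on S (\<lambda>x. th (f x)) \<and> continuous_on S (\<lambda>x. be (f x))"
  by (auto simp: continuous_on_def tendsto_cov_iff)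

lemma continuous_on_th [continuous_intros]: "continuous_on S f \<Longrightarrow> continuous_on S (\<lambda>x. th (f x))"
  and continuous_on_be [continuous_intros]: "continuous_on S f \<Longrightarrow> continuous_on S (\<lambda>x. be (f x))"
  by (simp_all add: continuous_on_cov_iff)

lemma continuous_on_al [continuous_intros]: "continuous_on S f \<Longrightarrow> continuous_on S (\<lambda>x. al (f x))"
  unfolding al_def cis_conv_exp by (intro continuous_intros)

lemma continuous_on_Cov [continuous_intros]:
  "continuous_on S f \<Longrightarrow> continuous_on S g \<Longrightarrow> continuous_on S (\<lambda>x. Cov (f x) (g x))"
  by (simp add: continuous_on_cov_iff)

lemma continuous_on_crel [continuous_intros]:
  "continuous_on S f \<Longrightarrow> continuous_on S g \<Longrightarrow> continuous_on S (\<lambda>x. crel (f x) (g x))"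
  unfolding crel_def by (intro continuous_intros) auto

lemma continuous_on_cov_plus [continuous_intros]:
  "continuous_on S f \<Longrightarrow> continuous_on S g \<Longrightarrow> continuous_on S (\<lambda>x. f x + g x :: cov)"
  unfolding plus_cov_def using Re_crel
  by (intro continuous_intros) (auto simp: complex_nonpos_Reals_iff not_le)

lemma continuous_on_cov_uminus [continuous_intros]:
  "continuous_on S f \<Longrightarrow> continuous_on S (\<lambda>x. - f x :: cov)"
  unfolding uminus_cov_def by (intro continuous_intros)

lemma continuous_on_cov_minus [continuous_intros]:
  "continuous_on S f \<Longrightarrow> continuous_on S g \<Longrightarrow> continuous_on S (\<lambda>x. f x - g x :: cov)"
  unfolding minus_cov_def by (intro continuous_intros)

subsection \<open>The centre\<close>

text \<open>The kernel of the projection to PSL(2,R); the parity of n is the sign of the matrix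
  below.\<close>

definition cz :: "int \<Rightarrow> cov" where
  "cz n = Cov (of_int n * pi) 0"

definition sg :: "int \<Rightarrow> real" where
  "sg n = (if even n then 1 else - 1)"

lemma sg_simps [simp]: "sg 0 = 1" "sg (m + n) = sg m * sg n" "sg (- n) = sg n" "sg n * sg n = 1"
  "sg (m - n) = sg m * sg n" "\<bar>sg n\<bar> = 1" "sg 1 = -1" "sg n \<noteq> 0"
  by (auto simp: sg_def)

lemma cos_int_pi: "cos (of_int n * pi) = sg n"
proof (cases n)
  case (nonneg m)
  then show ?thesis by (simp add: sg_def)
next
  case (neg m)
  then have "real_of_int n = - real (Suc m)" by simp
  then have "of_int n * pi = - (real (Suc m) * pi)" by (simp only: mult_minus_left)
  then have "cos (of_int n * pi) = (- 1) ^ Suc m" by (simp only: cos_minus cos_npi)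
  then show ?thesis using neg by (simp add: sg_def)
qed

lemma sin_int_pi: "sin (of_int n * pi) = 0"
  by (metis mult.commute sin_npi_int)

lemma cz_simps [simp]: "th (cz n) = of_int n * pi" "be (cz n) = 0" "al (cz n) = of_real (sg n)"
  by (simp_all add: cz_def al_def cis.ctr cos_int_pi sin_int_pi complex_eq_iff)

lemma crel_cz [simp]: "crel (cz n) y = 1" "crel y (cz n) = 1"
  by (simp_all add: crel_def)

lemma cz_plus_simps [simp]:
  "th (cz n + y) = of_int n * pi + th y" "be (cz n + y) = of_real (sg n) * be y"
  "al (cz n + y) = of_real (sg n) * al y"
  by (simp_all add: th_plus be_plus al_plus)

lemma cz_commute: "y + cz n = cz n + y"
  by (rule cov_eqI) (simp_all add: th_plus be_plus)

lemma cz_add: "cz m + cz n = cz (m + n)" and cz_uminus: "- cz n = cz (- n)" and cz_0: "cz 0 = 0"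
  by (rule cov_eqI; simp add: algebra_simps)+

lemma cz_inj: "cz m = cz n \<longleftrightarrow> m = n"
  by (metis cz_simps(1) mult_cancel_right of_int_eq_iff pi_neq_zero)

lemma cov_lifts:
  assumes "al x = of_real (sg k) * al y" "be x = of_real (sg k) * be y"
  shows "\<exists>n. x = cz n + y \<and> sg n = sg k"
proof -
  have "al (cz (- k) + x) = al y" using assms(1) by (simp flip: of_real_mult mult.assoc)
  then have "cis (th x - of_int k * pi - th y) = 1"
    using cis_th_eq[of "cz (- k) + x" y] by (simp flip: cis_divide)
  then have "cos (th x - of_int k * pi - th y) = 1" by (simp add: complex_eq_iff)
  then obtain n :: int where n: "th x - of_int k * pi - th y = of_int n * (2 * pi)" by (auto simp: cos_one_2pi_int)
  have "x = cz (k + 2 * n) + y"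
    by (rule cov_eqI) (use n assms(2) in \<open>simp_all add: algebra_simps\<close>, simp add: sg_def)
  moreover have "sg (k + 2 * n) = sg k" by (simp add: sg_def)
  ultimately show ?thesis by blast
qed

lemma sg_cases: "sg n = 1 \<or> sg n = -1"
  by (simp add: sg_def)

lemma cov_eq_SU: "al x = al y \<Longrightarrow> be x = be y \<Longrightarrow> \<exists>n. x = cz n + y \<and> sg n = 1"
  using cov_lifts[of x 0 y] by simp

subsection \<open>Orientation reversal\<close>

text \<open>Conjugation by a reflection. It exchanges positive with negative parabolics and upper
  with lower regions, so that most statements about one sign follow from those about the
  other.\<close>

definition mir :: "cov \<Rightarrow> cov" where
  "mir y = Cov (- th y) (cnj (be y))"

lemma mir_simps [simp]: "th (mir y) = - th y" "be (mir y) = cnj (be y)" "al (mir y) = cnj (al y)"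
  by (simp_all add: mir_def al_def cis_cnj)

lemma mir_mir [simp]: "mir (mir y) = y"
  by (rule cov_eqI) simp_all

lemma mir_plus: "mir (x + y) = mir x + mir y"
proof -
  have "crel (mir x) (mir y) = cnj (crel x y)" by (simp add: crel_def)
  moreover have "Arg (cnj (crel x y)) = - Arg (crel x y)"
    using Re_crel[of x y] by (auto simp: Arg_cnj Arg_eq_0 complex_is_Real_iff)
  ultimately show ?thesis
    by (intro cov_eqI) (simp_all add: th_plus be_plus)
qed

lemma mir_zero [simp]: "mir 0 = 0"
  by (rule cov_eqI) simp_all

lemma mir_uminus: "mir (- x) = - mir x"
  by (rule cov_eqI) simp_all

lemma mir_cz: "mir (cz n) = cz (- n)"
  by (rule cov_eqI) simp_all

lemma mir_inj: "mir x = mir y \<longleftrightarrow> x = y"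
  by (metis mir_mir)

subsection \<open>Parabolic elements\<close>

text \<open>For \<open>e = 1\<close> and \<open>e = - 1\<close> these are the lifts, in the image of the exponential map, of the positive
  and of the negative parabolic elements; \<open>e * cmod c\<close> is the imaginary part of \<open>al\<close>.\<close>

definition para :: "real \<Rightarrow> complex \<Rightarrow> cov" where
  "para e c = Cov (e * arctan (cmod c)) c"

lemma be_para [simp]: "be (para e c) = c"
  and th_para: "th (para e c) = e * arctan (cmod c)"
  by (simp_all add: para_def)

lemma al_para [simp]:
  assumes "\<bar>e\<bar> = 1" shows "al (para e c) = Complex 1 (e * cmod c)"
proof -
  have "e = 1 \<or> e = -1" using assms by linarith
  then show ?thesis
    by (auto simp: al_def para_def complex_eq_iff cos_arctan sin_arctan add_nonneg_eq_0_iff)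
qed

lemma mir_para: "mir (para e c) = para (- e) (cnj c)"
  by (rule cov_eqI) (simp_all add: th_para)

lemma uminus_para: "- para e c = para (- e) (- c)"
  by (rule cov_eqI) (simp_all add: th_para)

lemma al_plus_para:
  "\<bar>e\<bar> = 1 \<Longrightarrow> al (y + para e c) = al y * Complex 1 (e * cmod c) + be y * cnj c"
  by (simp add: al_plus)

lemma Re_plus_para:
  "\<bar>e\<bar> = 1 \<Longrightarrow> Re (al (y + para e c)) = Re (al y) + (Re (be y * cnj c) - e * Im (al y) * cmod c)"
  by (simp add: al_plus_para)

text \<open>The quotient of the two values of \<open>al\<close> lies in the upper half-plane because
  \<open>cmod (be y) < cmod (al y)\<close>. So the increase of \<open>th\<close> has positive sine,
  and the crude bound already confines it to (-pi, pi).\<close>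

lemma th_plus_para:
  assumes "c \<noteq> 0" shows "th y < th (y + para 1 c)" "th (y + para 1 c) < th y + pi"
proof -
  define d where "d = th (y + para 1 c) - th y"
  have "\<bar>d - arctan (cmod c)\<bar> < pi / 2"
    using th_plus_bound[of y "para 1 c"] by (simp add: d_def th_para)
  moreover have "0 < arctan (cmod c)" "arctan (cmod c) < pi / 2"
    using assms arctan_ubound by auto
  ultimately have d: "- pi < d" "d < pi" by linarith+
  define v where "v = Complex 1 (cmod c) + be y * cnj c / al y"
  have av: "al (y + para 1 c) = al y * v" by (simp add: al_plus_para v_def field_simps)
  have "cmod (be y * cnj c / al y) < cmod c"
    using cmod_be_less[of y] assms by (simp add: norm_mult norm_divide field_simps)
  then have iv: "Im v > 0" using abs_Im_le_cmod[of "be y * cnj c / al y"] by (simp add: v_def)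
  have "of_real (cmod (al y * v)) * cis (th (y + para 1 c)) = of_real (cmod (al y)) * cis (th y) * v"
    using al_polar[of "y + para 1 c"] al_polar[of y] av by metis
  then have "of_real (cmod v) * cis (th (y + para 1 c)) * cis (- th y) = cis (th y) * cis (- th y) * v"
    by (simp add: norm_mult mult_ac)
  then have "of_real (cmod v) * cis d = v"
    by (simp add: d_def cis_mult mult.assoc)
  then have "Im (of_real (cmod v) * cis d) > 0" using iv by simp
  then have "cmod v * sin d > 0" by simp
  then have "sin d > 0" by (simp add: zero_less_mult_iff)
  then have "d > 0" using d by (metis not_le sin_ge_zero sin_minus neg_le_0_iff_le minus_less_iff less_eq_real_def neg_0_le_iff_le)
  then show "th y < th (y + para 1 c)" "th (y + para 1 c) < th y + pi" using d by (auto simp: d_def)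
qed

section \<open>Regions of the covering group and multiplication by a parabolic element\<close>

text \<open>\<open>Up a\<close> consists of the hyperbolic elements with translation number \<open>a\<close> together with everything
  above them; \<open>Dn b\<close> is its mirror image. So \<open>Up a \<and> Dn b\<close> is the open region from the hyperbolic
  elements of level \<open>a\<close> to those of level \<open>b\<close>, both included.\<close>

definition Up :: "int \<Rightarrow> cov \<Rightarrow> bool" where
  "Up a y \<longleftrightarrow> th y > of_int a * pi \<or> th y > of_int a * pi - pi / 2 \<and> sg a * Re (al y) > 1"

definition Dn :: "int \<Rightarrow> cov \<Rightarrow> bool" where
  "Dn b y \<longleftrightarrow> th y < of_int b * pi \<or> th y < of_int b * pi + pi / 2 \<and> sg b * Re (al y) > 1"

lemma Up_shift: "Up a (cz n + y) \<longleftrightarrow> Up (a - n) y"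
  by (simp add: Up_def algebra_simps)

lemma Dn_shift: "Dn b (cz n + y) \<longleftrightarrow> Dn (b - n) y"
  by (simp add: Dn_def algebra_simps)

lemma Dn_mir: "Dn b y \<longleftrightarrow> Up (- b) (mir y)"
  by (auto simp: Up_def Dn_def)

lemma Up_mir: "Up a y \<longleftrightarrow> Dn (- a) (mir y)"
  by (simp add: Dn_mir)

lemma open_Up: "open {y. Up a y}" and open_Dn: "open {y. Dn a y}"
  unfolding Up_def Dn_def
  by (intro open_Collect_disj open_Collect_conj open_Collect_less continuous_intros)+

lemma Up_mono_index: "Up a y \<Longrightarrow> b < a \<Longrightarrow> Up b y"
proof -
  assume "Up a y" "b < a"
  then have "real_of_int b * pi \<le> (of_int a - 1) * pi" by (intro mult_right_mono) auto
  then have "real_of_int b * pi \<le> of_int a * pi - pi" by (simp only: left_diff_distrib mult_1)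
  then have "real_of_int b * pi < of_int a * pi - pi / 2" using pi_gt_zero by linarith
  then show ?thesis using \<open>Up a y\<close> unfolding Up_def using pi_gt_zero by linarith
qed

lemma para_0 [simp]: "para e 0 = 0"
  by (rule cov_eqI) (simp_all add: th_para)

lemma continuous_on_para [continuous_intros]:
  "continuous_on S f \<Longrightarrow> continuous_on S (\<lambda>x. para e (f x))"
  unfolding para_def by (intro continuous_intros)

text \<open>A ray is the non-negative half of a one-parameter group; multiplication by a parabolic
  can therefore be stopped midway.\<close>

lemma para_add_ray:
  assumes "\<bar>e\<bar> = 1" "s \<ge> 0" "t \<ge> 0"
  shows "para e (of_real s * c) + para e (of_real t * c) = para e (of_real (s + t) * c)"
proof -
  let ?x = "para e (of_real s * c)" let ?y = "para e (of_real t * c)" let ?z = "para e (of_real (s + t) * c)"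
  have A: "al (?x + ?y) = al ?z"
  proof -
    have c: "cmod c * cmod c = Re c * Re c + Im c * Im c"
      using cmod_power2[of c] by (simp add: power2_eq_square)
    have n: "cmod (of_real (s + t) * c) = (s + t) * cmod c" "cmod (of_real s * c) = s * cmod c"
      "cmod (of_real t * c) = t * cmod c"
      using assms by (simp_all add: norm_mult del: of_real_add)
    have "e = 1 \<or> e = -1" using assms(1) by linarith
    then show ?thesis using assms
      by (auto simp: al_plus n simp del: of_real_add) (simp_all add: complex_eq_iff algebra_simps c)
  qed
  have B: "be (?x + ?y) = be ?z"
    using assms by (simp add: be_plus complex_eq_iff norm_mult algebra_simps)
  have e: "\<bar>e * arctan r\<bar> < pi / 2" for r
    using arctan_bounded[of r] assms(1) by (auto simp: abs_mult)
  have "\<bar>th (?x + ?y) - th ?z\<bar> < 2 * pi"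
    using th_plus_bound[of ?x ?y] e[of "cmod (of_real s * c)"] e[of "cmod (of_real t * c)"]
      e[of "cmod (of_real (s + t) * c)"] unfolding th_para by linarith
  then show ?thesis using A B by (intro cov_eqI_near)
qed

text \<open>The change of half the trace under multiplication by a positive parabolic. It is
  homogeneous in c, which makes half the trace affine along every ray.\<close>

definition gain :: "cov \<Rightarrow> complex \<Rightarrow> real" where
  "gain y c = Re (be y * cnj c) - Im (al y) * cmod c"

lemma Re_para_gain: "Re (al (y + para 1 c)) = Re (al y) + gain y c"
  by (simp add: Re_plus_para gain_def)

lemma gain_scale: "t \<ge> 0 \<Longrightarrow> gain y (of_real t * c) = t * gain y c"
  by (simp add: gain_def norm_mult algebra_simps)

lemma th_eq_int_pi: "th y = of_int m * pi \<Longrightarrow> sg m * Re (al y) = cmod (al y)"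
  by (simp add: Re_al cos_int_pi)

text \<open>An element with \<open>th\<close> in pi Z has \<open>Re (al y)\<close> equal to plus or
  minus \<open>cmod (al y)\<close>, hence of absolute value at least 1; at a crossing this bounds
  the affine half-trace.\<close>

lemma ray_cross:
  assumes "0 \<le> s" "s \<le> T" "th (y + para 1 (of_real s * c)) \<le> of_int m * pi"
    "of_int m * pi \<le> th (y + para 1 (of_real T * c))"
  obtains t where "s \<le> t" "t \<le> T" "th (y + para 1 (of_real t * c)) = of_int m * pi"
    "sg m * (Re (al y) + t * gain y c) \<ge> 1"
proof -
  have "continuous_on {s..T} (\<lambda>t. th (y + para 1 (of_real t * c)))"
    by (intro continuous_intros)
  then obtain t where t: "s \<le> t" "t \<le> T" "th (y + para 1 (of_real t * c)) = of_int m * pi"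
    using IVT'[of "\<lambda>t. th (y + para 1 (of_real t * c))" s "of_int m * pi" T] assms by blast
  have "sg m * Re (al (y + para 1 (of_real t * c))) \<ge> 1"
    using th_eq_int_pi[OF t(3)] cmod_al_ge_1 by simp
  then show ?thesis using that[OF t] t assms(1) by (simp add: Re_para_gain gain_scale)
qed

lemma cos_pos_range: "cos x > 0 \<Longrightarrow> - 3 * pi / 2 < x \<Longrightarrow> x < 3 * pi / 2 \<Longrightarrow> - pi / 2 < x \<and> x < pi / 2"
proof (rule ccontr)
  assume a: "cos x > 0" "- 3 * pi / 2 < x" "x < 3 * pi / 2" "\<not> (- pi / 2 < x \<and> x < pi / 2)"
  then have "pi / 2 \<le> \<bar>x\<bar>" "\<bar>x\<bar> < 3 * pi / 2" by auto
  then have "cos (\<bar>x\<bar> - pi) \<ge> 0" by (intro cos_ge_zero) auto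
  then have "cos \<bar>x\<bar> \<le> 0" by (simp add: cos_diff)
  then show False using a(1) by simp
qed

lemma Re_al_pos_cos: "Re (al y) > 0 \<longleftrightarrow> cos (th y) > 0"
  using al_nz[of y] by (simp add: Re_al zero_less_mult_iff del: al_nz)

text \<open>If y left the region, half the trace would decrease along the ray and finally be
  negative. By then \<open>th\<close> must have crossed 0, at a time from 1 on and with half-trace
  at least 1. This is possible only at time 1 and at the identity, and then y would be
  parabolic.\<close>

lemma Up_0_para:
  assumes "Up 0 y" "c \<noteq> 0" shows "Up 0 (y + para 1 c)"
proof (rule ccontr)
  let ?y = "y + para 1 c"
  assume n: "\<not> Up 0 ?y"
  have th: "th y < th ?y" "th ?y < th y + pi" using th_plus_para[OF assms(2)] by auto
  have *: "- pi / 2 < th y" "Re (al y) > 1" "th ?y \<le> 0" "Re (al ?y) \<le> 1"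
    using n assms(1) th by (auto simp: Up_def)
  have g: "gain y c < 0" using * by (simp add: Re_para_gain)
  \<comment> \<open>At time T the half-trace equals the gain itself, which is negative.\<close>
  define T where "T = 1 - Re (al y) / gain y c"
  have T: "T > 1" "Re (al y) + T * gain y c < 0" using g *(2)
    by (simp_all add: T_def field_simps)
  let ?z = "y + para 1 (of_real T * c)"
  have "Re (al ?z) < 0" using T by (simp add: Re_para_gain gain_scale)
  moreover have "th y < th ?z" "th ?z < th y + pi" using th_plus_para[of "of_real T * c" y] assms(2) T by auto
  ultimately have "th ?z \<ge> 0"
    using *(1) cos_gt_zero_pi[of "th ?z"] Re_al_pos_cos[of ?z] by (cases "th ?z < pi / 2") auto
  then obtain t where t: "1 \<le> t" "th (y + para 1 (of_real t * c)) = 0" "Re (al y) + t * gain y c \<ge> 1"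
    using ray_cross[of 1 T y c 0] T *(3) by auto
  have "Re (al y) + gain y c \<le> 1" using *(4) by (simp add: Re_para_gain)
  then have "(t - 1) * gain y c \<ge> 0" using t(3) by (simp add: algebra_simps)
  then have "t = 1" using g t(1) by (simp add: zero_le_mult_iff)
  then have th0: "th ?y = 0" "Re (al ?y) = 1" using t *(4) by (auto simp: Re_para_gain)
  then have "cmod (al ?y) = 1" using th_eq_int_pi[of ?y 0] by simp
  then have "be ?y = 0" by (simp add: cmod_al)
  then have "?y = 0" using th0 by (intro cov_eqI) auto
  then have "y = - para 1 c" by (simp add: eq_neg_iff_add_eq_0)
  then show False using *(2) by simp
qed

text \<open>Here half the trace lies between -1 and 0 and \<open>Im (al y)\<close> is non-negative,
  so \<open>cmod (be y) \<le> Im (al y)\<close> and no direction has positive gain.\<close>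

lemma not_Up_minus_1_gain:
  assumes "\<not> Up (- 1) y" "th y > - 3 * pi / 2"
  shows "Re (al (y + para 1 c)) \<le> 0"
proof -
  have *: "th y \<le> - pi" "Re (al y) \<ge> - 1"
    using assms by (auto simp: Up_def sg_def)
  have c: "cos (th y) \<le> 0" using cos_pos_range[of "th y"] * assms(2) pi_gt_zero by linarith
  have "sin (th y + 2 * pi) \<ge> 0" by (intro sin_ge_zero) (use * assms(2) in auto)
  then have i: "Im (al y) \<ge> 0" by (simp add: Im_al)
  have r: "Re (al y) \<le> 0" using c by (simp add: Re_al mult_nonneg_nonpos)
  then have "(Re (al y))\<^sup>2 \<le> 1\<^sup>2" using *(2) by (intro power2_le_iff_abs_le[THEN iffD2]) auto
  then have "(cmod (be y))\<^sup>2 \<le> (Im (al y))\<^sup>2" using SU_sq[of y] by simp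
  then have b: "cmod (be y) \<le> Im (al y)" using i by (rule power2_le_imp_le)
  have "Re (be y * cnj c) \<le> cmod (be y) * cmod c"
    by (metis complex_Re_le_cmod complex_mod_cnj norm_mult)
  also have "\<dots> \<le> Im (al y) * cmod c" using b by (intro mult_right_mono) auto
  finally have "gain y c \<le> 0" by (simp add: gain_def)
  then show ?thesis using r by (simp add: Re_para_gain)
qed

lemma Up_minus_1_if:
  assumes "Up 0 (y + para 1 c)" "c \<noteq> 0" shows "Up (- 1) y"
proof (rule ccontr)
  let ?y = "y + para 1 c"
  assume n: "\<not> Up (- 1) y"
  have th: "th y < th ?y" "th ?y < th y + pi" using th_plus_para[OF assms(2)] by auto
  have "th y > - 3 * pi / 2" "Re (al ?y) > 1"
    using n assms(1) th by (auto simp: Up_def sg_def)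
  then show False using not_Up_minus_1_gain[OF n, of c] by simp
qed

lemma not_Up_0_Re:
  assumes "Up (- 1) y" "\<not> Up 0 y"
  shows "th y \<le> 0" "th y > - 3 * pi / 2" "Re (al y) \<le> 1"
proof -
  show th: "th y \<le> 0" "th y > - 3 * pi / 2" using assms by (auto simp: Up_def)
  show "Re (al y) \<le> 1"
  proof (rule ccontr)
    assume r: "\<not> Re (al y) \<le> 1"
    then have "cos (th y) > 0" using Re_al_pos_cos[of y] by linarith
    then show False using cos_pos_range[of "th y"] th r assms(2) pi_gt_zero by (auto simp: Up_def)
  qed
qed

text \<open>The conclusion says that some direction has positive gain: over the unit circle the gain
  has maximum \<open>cmod (be y) - Im (al y)\<close>.\<close>

lemma not_Up_0_be:
  assumes "Up (- 1) y" "\<not> Up 0 y" "y \<noteq> 0"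
  shows "Im (al y) < cmod (be y)"
proof -
  note th = not_Up_0_Re[OF assms(1,2)]
  consider "th y < 0" "th y > - pi" | "th y = 0" | "th y \<le> - pi" using th by linarith
  then show ?thesis
  proof cases
    case 1
    then have "sin (- th y) > 0" by (intro sin_gt_zero) auto
    then have "Im (al y) < 0" using al_nz[of y] by (simp add: Im_al mult_pos_neg del: al_nz)
    then show ?thesis using norm_ge_zero[of "be y"] by linarith
  next
    case 2
    then have "cmod (al y) = 1" using th_eq_int_pi[of y 0] th cmod_al_ge_1[of y] by simp
    then have "be y = 0" by (simp add: cmod_al)
    then have "y = 0" using 2 by (intro cov_eqI) auto
    then show ?thesis using assms(3) by simp
  next
    case 3
    then have "Re (al y) < - 1" using assms(1) by (auto simp: Up_def sg_def)
    then have "(Re (al y))\<^sup>2 > 1"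
      using mult_strict_mono[of 1 "- Re (al y)" 1 "- Re (al y)"] by (simp add: power2_eq_square)
    then have "(Im (al y))\<^sup>2 < (cmod (be y))\<^sup>2" using SU_sq[of y] by simp
    then show ?thesis using power2_less_imp_less[of "Im (al y)" "cmod (be y)"] by simp
  qed
qed

text \<open>Since y lies below level 0, and \<open>th\<close> grows by less than pi, half-trace
  above 1 can only mean hyperbolic of level 0. The condition on c becomes the inequality of a
  conic.\<close>

lemma Hyp_0_iff:
  assumes "Up (- 1) y" "\<not> Up 0 y" "c \<noteq> 0"
  shows "Up 0 (y + para 1 c) \<and> Dn 0 (y + para 1 c) \<longleftrightarrow> gain y c > 1 - Re (al y)"
proof -
  let ?y = "y + para 1 c"
  have th: "th y < th ?y" "th ?y < th y + pi" using th_plus_para[OF assms(3)] by auto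
  note r = not_Up_0_Re[OF assms(1,2)]
  have "Up 0 ?y \<and> Dn 0 ?y \<longleftrightarrow> Re (al ?y) > 1"
  proof
    assume a: "Re (al ?y) > 1"
    then have "cos (th ?y) > 0" using Re_al_pos_cos[of ?y] by linarith
    then have "- pi / 2 < th ?y \<and> th ?y < pi / 2"
      using cos_pos_range[of "th ?y"] th r pi_gt_zero by auto
    then show "Up 0 ?y \<and> Dn 0 ?y" using a by (auto simp: Up_def Dn_def)
  qed (auto simp: Up_def Dn_def)
  then show ?thesis by (auto simp: Re_para_gain)
qed

section \<open>Conics with focus 0\<close>

lemma cmod_sq: "(cmod b)\<^sup>2 = Re (b * cnj b)"
  by (simp add: cmod_power2) (simp add: power2_eq_square)

text \<open>Level sets of \<open>c \<mapsto> Re (b cnj c) - h |c|\<close> are conics with focus \<open>0\<close>; in polar coordinates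
  centred at the direction of \<open>b\<close> they are graphs over an interval of angles.\<close>

lemma connected_conic:
  assumes "connected T" "T \<subseteq> {0<..}"
  shows "connected {c. Re (b * cnj c) - h * cmod c \<in> T}"
proof -
  \<comment> \<open>For \<open>b = 0\<close> the level sets are circles and any axis will
    do.\<close>
  define u where "u = (if b = 0 then 1 else b / of_real (cmod b))"
  have u: "cmod u = 1" "b = of_real (cmod b) * u" by (simp_all add: u_def norm_divide)
  define X where "X = {x \<in> {-pi..pi}. cmod b * cos x > h}"
  define f where "f = (\<lambda>(x, r). of_real (r / (cmod b * cos x - h)) * (u * cis x))"
  have "connected X"
  proof (cases "X = {}")
    case False
    \<comment> \<open>The cosine decreases in the absolute value of the angle, so the admissible
      angles form an interval symmetric about 0.\<close>
    have down: "x' \<in> X" if "x \<in> X" "\<bar>x'\<bar> \<le> \<bar>x\<bar>" for x x'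
    proof -
      have "cos \<bar>x\<bar> \<le> cos \<bar>x'\<bar>" using that by (intro cos_monotone_0_pi_le) (auto simp: X_def)
      then have "cmod b * cos x \<le> cmod b * cos x'" by (intro mult_left_mono) auto
      then show ?thesis using that by (auto simp: X_def)
    qed
    have "0 \<in> X" using False down[of _ 0] by auto
    moreover have "closed_segment 0 x \<subseteq> X" if "x \<in> X" for x
      using down[OF that] by (auto simp: closed_segment_eq_real_ivl split: if_splits)
    ultimately have "starlike X" unfolding starlike_def by blast
    then show ?thesis by (rule starlike_imp_connected)
  qed simp
  then have "connected (X \<times> T)" using assms(1) by (rule connected_Times)
  moreover have "continuous_on (X \<times> T) f"
    unfolding f_def case_prod_unfold X_def cis_conv_exp by (intro continuous_intros) auto
  ultimately have "connected (f ` (X \<times> T))" by (metis connected_continuous_image)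
  also have "f ` (X \<times> T) = {c. Re (b * cnj c) - h * cmod c \<in> T}"
  proof (intro equalityI subsetI)
    fix c assume "c \<in> f ` (X \<times> T)"
    then obtain x r where x: "x \<in> X" "r \<in> T" "c = of_real (r / (cmod b * cos x - h)) * (u * cis x)"
      by (auto simp: f_def)
    define q where "q = r / (cmod b * cos x - h)"
    have pos: "cmod b * cos x - h > 0" "r > 0" using x assms(2) by (auto simp: X_def)
    then have q: "q > 0" by (simp add: q_def)
    have "b * cnj c = of_real (cmod b) * of_real q * (u * cnj u) * cnj (cis x)"
      using u(2) by (simp add: x(3)[folded q_def] mult_ac)
    also have "u * cnj u = 1" using u(1) by (metis complex_norm_square of_real_1 power_one)
    finally have "Re (b * cnj c) = cmod b * q * cos x" by simp
    moreover have "cmod c = q" using x(3)[folded q_def] u(1) q by (simp add: norm_mult)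
    ultimately have "Re (b * cnj c) - h * cmod c = q * (cmod b * cos x - h)" by (simp add: algebra_simps)
    also have "\<dots> = r" using pos by (simp add: q_def)
    finally show "c \<in> {c. Re (b * cnj c) - h * cmod c \<in> T}" using x(2) by (metis mem_Collect_eq)
  next
    fix c assume "c \<in> {c. Re (b * cnj c) - h * cmod c \<in> T}"
    then have T: "Re (b * cnj c) - h * cmod c \<in> T" by simp
    then have "c \<noteq> 0" using assms(2) by auto
    define x where "x = Arg (c / u)"
    have un: "u \<noteq> 0" using u(1) by auto
    have cu: "c = of_real (cmod c) * (u * cis x)"
    proof -
      have "c / u = of_real (cmod c) * cis x"
        using cis_Arg_pos[of "c / u"] \<open>c \<noteq> 0\<close> un u(1) by (simp add: x_def norm_divide)
      then show ?thesis using un by (simp add: field_simps)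
    qed
    have "b * cnj c = of_real (cmod b) * of_real (cmod c) * (u * cnj u) * cnj (cis x)"
      using u(2) by (subst cu) (simp add: mult_ac)
    also have "u * cnj u = 1" using u(1) by (metis complex_norm_square of_real_1 power_one)
    finally have "Re (b * cnj c) = cmod b * cmod c * cos x" by simp
    then have e: "Re (b * cnj c) - h * cmod c = cmod c * (cmod b * cos x - h)" by (simp add: algebra_simps)
    then have "cmod c * (cmod b * cos x - h) > 0" using T assms(2) by auto
    then have p: "cmod b * cos x - h > 0" using \<open>c \<noteq> 0\<close> by (simp add: zero_less_mult_iff)
    then have "x \<in> X" using mpi_less_Arg[of "c / u"] Arg_le_pi[of "c / u"] by (simp add: X_def x_def)
    moreover have "c = f (x, Re (b * cnj c) - h * cmod c)"
    proof -
      have "(Re (b * cnj c) - h * cmod c) / (cmod b * cos x - h) = cmod c" using e p by simp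
      then show ?thesis unfolding f_def by (simp only: prod.case cu[symmetric])
    qed
    ultimately show "c \<in> f ` (X \<times> T)" using T by blast
  qed
  finally show ?thesis .
qed

text \<open>On the ray through b the equation is linear in the radius; if b vanishes, the level set
  is a circle about 0.\<close>

lemma conic_nonempty:
  assumes "h < cmod b" "r > 0" obtains c where "Re (b * cnj c) - h * cmod c = r"
proof (cases "b = 0")
  case True
  moreover have "cmod (of_real (r / - h)) = r / - h" using True assms by (simp del: of_real_divide)
  ultimately have "Re (b * cnj (of_real (r / - h))) - h * cmod (of_real (r / - h)) = r"
    using assms by simp
  then show ?thesis by (rule that)
next
  case False
  define q where "q = r / (cmod b * (cmod b - h))"
  have q: "q > 0" using assms False by (simp add: q_def)
  have "Re (b * cnj (of_real q * b)) = q * (cmod b)\<^sup>2" unfolding cmod_sq by (simp add: algebra_simps)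
  then have "Re (b * cnj (of_real q * b)) - h * cmod (of_real q * b) = q * cmod b * (cmod b - h)"
    using q by (simp add: norm_mult power2_eq_square algebra_simps)
  also have "\<dots> = r" using assms False by (simp add: q_def)
  finally show ?thesis by (rule that)
qed

text \<open>Here y is a negative parabolic and the gain is non-negative, vanishing only on the ray
  opposite to \<open>be y\<close>. Moving c perpendicularly to \<open>be y\<close> lengthens it
  without changing the linear part of the gain, hence makes the gain positive.\<close>

lemma closure_gain_pos:
  assumes "Re (al y) = 1" "Im (al y) < cmod (be y)"
  shows "c \<in> closure {c. gain y c > 0}"
proof -
  have "(cmod (be y))\<^sup>2 = (Im (al y))\<^sup>2" using SU_sq[of y] assms(1) by simp
  then have h: "- Im (al y) = cmod (be y)" using assms(2) by (auto simp: power2_eq_iff)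
  have h0: "cmod (be y) > 0" using assms(2) h norm_ge_zero[of "be y"] by linarith
  have g: "gain y c = Re (be y * cnj c) + cmod (be y) * cmod c" for c by (simp add: gain_def flip: h)
  have g0: "gain y c \<ge> 0"
    using abs_Re_le_cmod[of "be y * cnj c"] unfolding g by (simp add: norm_mult)
  show ?thesis unfolding closure_approachable
  proof (intro allI impI)
    fix e :: real assume "e > 0"
    \<comment> \<open>The sign is chosen such that the displacement does not point back towards
      0.\<close>
    define s where "s = (if Re (c * cnj (\<i> * be y)) \<ge> 0 then 1 else - 1 :: real)"
    define d where "d = e / (2 * cmod (be y))"
    have d: "d > 0" "d * cmod (be y) < e" using \<open>e > 0\<close> h0 by (simp_all add: d_def)
    define c' where "c' = c + of_real (s * d) * (\<i> * be y)"
    have "(cmod c')\<^sup>2 = (cmod c)\<^sup>2 + 2 * (s * d) * Re (c * cnj (\<i> * be y)) + (s * d)\<^sup>2 * (cmod (be y))\<^sup>2"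
      unfolding cmod_power2 c'_def by (simp add: algebra_simps power2_eq_square)
    moreover have "s * Re (c * cnj (\<i> * be y)) \<ge> 0" by (simp add: s_def)
    then have "2 * (s * d) * Re (c * cnj (\<i> * be y)) \<ge> 0" using d(1)
      by (metis mult.assoc mult.commute mult_nonneg_nonneg less_imp_le zero_le_numeral)
    moreover have "(s * d)\<^sup>2 * (cmod (be y))\<^sup>2 > 0" using d h0 by (simp add: s_def)
    ultimately have "(cmod c)\<^sup>2 < (cmod c')\<^sup>2" by linarith
    then have "cmod c < cmod c'" by (rule power2_less_imp_less) simp
    moreover have "Re (be y * cnj c') = Re (be y * cnj c)"
      by (simp add: c'_def algebra_simps)
    ultimately have "gain y c' > gain y c" using h0 by (simp add: g)
    moreover have "dist c' c < e" using d by (simp add: c'_def dist_norm norm_mult s_def)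
    ultimately show "\<exists>y'\<in>{c. gain y c > 0}. dist y' c < e" using g0 by force
  qed
qed

text \<open>What is asked of the upper end of a region: openness and stability under undoing a
  positive parabolic. It covers both \<open>Dn b\<close> and \<open>Below n\<close>.\<close>

definition lower_set :: "(cov \<Rightarrow> bool) \<Rightarrow> bool" where
  "lower_set D \<longleftrightarrow> open {y. D y} \<and> (\<forall>y c. c \<noteq> 0 \<longrightarrow> D (y + para 1 c) \<longrightarrow> D y)"

text \<open>If y is already in \<open>Up 0\<close>, the parabolics staying in D form a star-shaped
  set, less its centre. Otherwise the relevant set is the interior of a conic, where half the trace
  exceeds 1. Boundary points are added only if y has half-trace 1, and for y = 0 every non-zero c is
  allowed.\<close>

lemma para_step_0:
  assumes D: "lower_set D"
    "D = Dn 0 \<or> (\<forall>y. - pi / 2 < th y \<and> th y < pi / 2 \<and> Re (al y) \<ge> 1 \<longrightarrow> D y)"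
  shows "connected {c. c \<noteq> 0 \<and> Up 0 (y + para 1 c) \<and> D (y + para 1 c)}" (is "connected ?K")
    and "(\<exists>c. c \<noteq> 0 \<and> Up 0 (y + para 1 c) \<and> D (y + para 1 c)) \<longleftrightarrow> Up (- 1) y \<and> D y"
proof -
  have oD: "open {y. D y}" and dD: "\<And>y c. c \<noteq> 0 \<Longrightarrow> D (y + para 1 c) \<Longrightarrow> D y"
    using D(1) by (auto simp: lower_set_def)
  define H where "H = {c. gain y c > 1 - Re (al y)}"
  have conc: "connected ?K \<and> ?K \<noteq> {}" if y: "Up (- 1) y" "D y"
  proof (cases "Up 0 y")
    case True
    \<comment> \<open>Star-shaped about 0: stopping earlier on a ray undoes part of a positive
      parabolic, which does not leave D.\<close>
    define S where "S = {c. D (y + para 1 c)}"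
    have "open S"
    proof -
      have "continuous_on UNIV (\<lambda>c. y + para 1 c)" by (intro continuous_intros)
      then have "open ((\<lambda>c. y + para 1 c) -` {y. D y})" using oD open_vimage[of "{y. D y}"] by blast
      then show ?thesis by (simp add: S_def vimage_def)
    qed
    have "starlike S" unfolding starlike_def
    proof (intro bexI ballI subsetI)
      show "0 \<in> S" using y by (simp add: S_def)
      fix c z assume c: "c \<in> S" and z: "z \<in> closed_segment 0 c"
      then obtain t where t: "0 \<le> t" "t \<le> 1" "z = of_real t * c"
        by (auto simp: in_segment scaleR_conv_of_real)
      show "z \<in> S"
      proof (cases "of_real (1 - t) * c = 0")
        case True then have "t = 1 \<or> c = 0" by (auto simp: of_real_eq_1_iff)
        then show ?thesis using c t by auto
      next
        case False
        have "para 1 (of_real t * c) + para 1 (of_real (1 - t) * c) = para 1 c"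
          using para_add_ray[of 1 t "1 - t" c] t by simp
        then show ?thesis using dD[OF False, of "y + para 1 z"] c t by (simp add: S_def add.assoc)
      qed
    qed
    then have "connected S" by (rule starlike_imp_connected)
    then have "connected (S - {0})" using \<open>open S\<close> by (intro connected_open_delete) auto
    moreover have "?K = S - {0}" using Up_0_para[OF True] by (auto simp: S_def)
    moreover have "S \<noteq> {0}" using \<open>open S\<close> not_open_singleton by metis
    then have "S - {0} \<noteq> {}" using y by (auto simp: S_def)
    ultimately show ?thesis by simp
  next
    case False
    note r = not_Up_0_Re[OF y(1) False]
    have "connected {c. Re (be y * cnj c) - Im (al y) * cmod c \<in> {1 - Re (al y)<..}}"
      using r by (intro connected_conic) auto
    then have cH: "connected H" by (simp add: H_def gain_def greaterThan_def)
    have H0: "c \<noteq> 0" if "c \<in> H" for c using that r by (auto simp: H_def gain_def)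
    have H_iff: "Up 0 (y + para 1 c) \<and> Dn 0 (y + para 1 c) \<longleftrightarrow> c \<in> H" if "c \<noteq> 0" for c
      using Hyp_0_iff[OF y(1) False that] by (simp add: H_def)
    have neH: "H \<noteq> {}" if y0: "y \<noteq> 0"
    proof -
      obtain c where "Re (be y * cnj c) - Im (al y) * cmod c = 2 - Re (al y)"
        using conic_nonempty[OF not_Up_0_be[OF y(1) False y0], where r = "2 - Re (al y)"] r by auto
      then have "c \<in> H" unfolding H_def gain_def by simp
      then show ?thesis by blast
    qed
    from D(2) show ?thesis
    proof
      assume [simp]: "D = Dn 0"
      have "?K = H" using H0 H_iff by auto
      moreover have "y \<noteq> 0" using y(2) by (auto simp: Dn_def)
      ultimately show ?thesis using cH neH by simp
    next
      assume D: "\<forall>y. - pi / 2 < th y \<and> th y < pi / 2 \<and> Re (al y) \<ge> 1 \<longrightarrow> D y"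
      have "D z" if "Up 0 z" "Dn 0 z" for z
        using that D[rule_format, of z] by (auto simp: Up_def Dn_def)
      then have HK: "H \<subseteq> ?K" using H0 H_iff by blast
      show ?thesis
      proof (cases "y = 0")
        case True
        have "?K = - {0}" using D[rule_format, of "para 1 _"] arctan_bounded True
          by (auto simp: Up_def th_para)
        moreover have "connected (- {0 :: complex})" by (rule connected_punctured_universe) simp
        moreover have "1 \<in> - {0 :: complex}" by simp
        ultimately show ?thesis by (metis empty_iff)
      next
        case y0: False
        show ?thesis
        proof (cases "Re (al y) = 1")
          case True
          \<comment> \<open>A set between a connected set and its closure is connected.\<close>
          then have "?K \<subseteq> closure H"
            using closure_gain_pos[OF True not_Up_0_be[OF y(1) False y0]] by (auto simp: H_def)
          then have "connected ?K" using connected_intermediate_closure[OF cH HK] by simp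
          then show ?thesis using HK neH[OF y0] by blast
        next
          case Re: False
          \<comment> \<open>Otherwise \<open>th\<close> is positive at c with half-trace at most 1.
            The crossing of \<open>th = 0\<close> needs half-trace at least 1, so it happens no
            earlier than at c itself, where \<open>th\<close> is not 0.\<close>
          have "c \<in> H" if c: "c \<in> ?K" for c
          proof (rule ccontr)
            assume "c \<notin> H"
            then have g: "gain y c \<le> 1 - Re (al y)" by (simp add: H_def)
            then have "\<not> Re (al (y + para 1 c)) > 1" by (simp add: Re_para_gain)
            then have thc: "th (y + para 1 c) > 0" using c by (simp add: Up_def)
            obtain t where t: "0 \<le> t" "t \<le> 1" "th (y + para 1 (of_real t * c)) = 0"
               "Re (al y) + t * gain y c \<ge> 1"
              using ray_cross[of 0 1 y c 0] r thc by auto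
            have "t * gain y c > 0" using t(4) r Re by linarith
            then have g0: "gain y c > 0" using t(1) by (simp add: zero_less_mult_iff)
            have "t * gain y c \<ge> 1 * gain y c" using t(4) g by simp
            then have "1 \<le> t" using g0 by (rule mult_right_le_imp_le)
            then have "t = 1" using t(2) by simp
            then show False using t(3) thc by simp
          qed
          then have "?K = H" using HK by blast
          then show ?thesis using cH neH[OF y0] by simp
        qed
      qed
    qed
  qed
  have nec: "Up (- 1) y \<and> D y" if "?K \<noteq> {}"
    using that Up_minus_1_if dD by blast
  show "(\<exists>c. c \<noteq> 0 \<and> Up 0 (y + para 1 c) \<and> D (y + para 1 c)) \<longleftrightarrow> Up (- 1) y \<and> D y"
    using conc nec by blast
  show "connected ?K"
  proof (cases "?K = {}")
    case True
    then show ?thesis by (simp only: connected_empty)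
  next
    case False
    then show ?thesis using conc nec by blast
  qed
qed

lemma para_step_lower:
  assumes D: "lower_set D"
    "D = Dn a \<or> (\<forall>y. - pi / 2 < th y - of_int a * pi \<and> th y - of_int a * pi < pi / 2 \<and> sg a * Re (al y) \<ge> 1 \<longrightarrow> D y)"
  shows "connected {c. c \<noteq> 0 \<and> Up a (y + para 1 c) \<and> D (y + para 1 c)}"
    and "(\<exists>c. c \<noteq> 0 \<and> Up a (y + para 1 c) \<and> D (y + para 1 c)) \<longleftrightarrow> Up (a - 1) y \<and> D y"
proof -
  define D' where "D' z = D (cz a + z)" for z
  define y' where "y' = cz (- a) + y"
  have y: "y = cz a + y'" by (simp add: y'_def add.assoc[symmetric] cz_add cz_0)
  have "lower_set D'" unfolding lower_set_def
  proof (intro conjI allI impI)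
    have "continuous_on UNIV (\<lambda>c. cz a + c)" by (intro continuous_intros)
    then have "open ((\<lambda>c. cz a + c) -` {y. D y})" using D(1) open_vimage[of "{y. D y}"] unfolding lower_set_def by blast
    then show "open {y. D' y}" by (simp add: D'_def vimage_def)
    show "D' z" if "c \<noteq> 0" "D' (z + para 1 c)" for z c
      using that D(1) by (auto simp: D'_def lower_set_def add.assoc[symmetric])
  qed
  moreover have "D' = Dn 0 \<or> (\<forall>y. - pi / 2 < th y \<and> th y < pi / 2 \<and> Re (al y) \<ge> 1 \<longrightarrow> D' y)"
    using D(2)
  proof (elim disjE)
    assume "D = Dn a" then have "D' = Dn 0" by (auto simp: D'_def fun_eq_iff Dn_shift)
    then show ?thesis ..
  next
    assume "\<forall>y. - pi / 2 < th y - of_int a * pi \<and> th y - of_int a * pi < pi / 2 \<and> sg a * Re (al y) \<ge> 1 \<longrightarrow> D y"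
    then have "\<forall>y. - pi / 2 < th y \<and> th y < pi / 2 \<and> Re (al y) \<ge> 1 \<longrightarrow> D' y"
      by (auto simp: D'_def mult.assoc[symmetric])
    then show ?thesis ..
  qed
  moreover have "Up a (y + para 1 c) = Up 0 (y' + para 1 c)" "D (y + para 1 c) = D' (y' + para 1 c)" for c
    by (simp_all add: y D'_def add.assoc Up_shift)
  moreover have "Up (a - 1) y = Up (- 1) y'" "D y = D' y'" by (simp_all add: y D'_def Up_shift)
  ultimately show "connected {c. c \<noteq> 0 \<and> Up a (y + para 1 c) \<and> D (y + para 1 c)}"
    and "(\<exists>c. c \<noteq> 0 \<and> Up a (y + para 1 c) \<and> D (y + para 1 c)) \<longleftrightarrow> Up (a - 1) y \<and> D y"
    using para_step_0[of D' y'] by simp_all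
qed

section \<open>Regions under multiplication by parabolics of either sign\<close>

lemma Up_para: "Up a y \<Longrightarrow> Up a (y + para 1 c)"
  using Up_0_para[of "cz (- a) + y" c] by (cases "c = 0") (auto simp: Up_shift add.assoc)

lemma Up_para_minus_1: "Up a (y + para 1 c) \<Longrightarrow> Up (a - 1) y"
  using Up_minus_1_if[of "cz (- a) + y" c] Up_mono_index[of a y "a - 1"]
  by (cases "c = 0") (auto simp: Up_shift add.assoc)

lemma Up_para_neg: "Up a y \<Longrightarrow> Up (a - 1) (y + para (- 1) c)"
  using Up_para_minus_1[of a "y + para (- 1) c" "- c"] uminus_para[of "-1" c]
  by (metis add.assoc add.right_neutral minus_minus right_minus)

lemma Dn_para_neg: "Dn b y \<Longrightarrow> Dn b (y + para (- 1) c)"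
  by (simp add: Dn_mir mir_plus mir_para Up_para)

lemma Dn_para: "Dn b y \<Longrightarrow> Dn (b + 1) (y + para 1 c)"
  using Up_para_neg[of "- b" "mir y" "cnj c"] by (simp add: Dn_mir mir_plus mir_para)

lemma Dn_para_down: "Dn b (y + para 1 c) \<Longrightarrow> Dn b y"
  using Dn_para_neg[of b "y + para 1 c" "- c"] uminus_para[of 1 c] by (metis add.assoc add.right_neutral right_minus)

lemma lower_set_Dn: "lower_set (Dn b)"
  using open_Dn Dn_para_down by (auto simp: lower_set_def)

text \<open>The step of the induction over the factors: undoing a positive parabolic lowers the
  lower level by one and keeps the upper one, so the regions \<open>between a b\<close> are closed
  under it.\<close>

lemma para_step_pos:
  assumes "a \<le> b"
  shows "connected {c. c \<noteq> 0 \<and> Up a (y + para 1 c) \<and> Dn b (y + para 1 c)}"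
    and "(\<exists>c. c \<noteq> 0 \<and> Up a (y + para 1 c) \<and> Dn b (y + para 1 c)) \<longleftrightarrow> Up (a - 1) y \<and> Dn b y"
proof -
  have "Dn b = Dn a \<or> (\<forall>y. - pi / 2 < th y - of_int a * pi \<and> th y - of_int a * pi < pi / 2 \<and> sg a * Re (al y) \<ge> 1 \<longrightarrow> Dn b y)"
  proof (cases "a = b")
    case False
    then have "real_of_int a \<le> of_int b - 1" using assms by linarith
    then have "real_of_int a * pi \<le> (of_int b - 1) * pi" by (intro mult_right_mono) auto
    then have "real_of_int a * pi \<le> of_int b * pi - pi" by (simp only: left_diff_distrib mult_1)
    then have "real_of_int a * pi < of_int b * pi - pi / 2" using pi_gt_zero by linarith
    then show ?thesis unfolding Dn_def by auto
  qed simp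
  then show "connected {c. c \<noteq> 0 \<and> Up a (y + para 1 c) \<and> Dn b (y + para 1 c)}"
    and "(\<exists>c. c \<noteq> 0 \<and> Up a (y + para 1 c) \<and> Dn b (y + para 1 c)) \<longleftrightarrow> Up (a - 1) y \<and> Dn b y"
    using para_step_lower[OF lower_set_Dn, of b a y] by auto
qed

text \<open>Mirror image of the positive case; now the upper level is the one that moves.\<close>

lemma para_step_neg:
  assumes "a \<le> b"
  shows "connected {c. c \<noteq> 0 \<and> Up a (y + para (- 1) c) \<and> Dn b (y + para (- 1) c)}"
    and "(\<exists>c. c \<noteq> 0 \<and> Up a (y + para (- 1) c) \<and> Dn b (y + para (- 1) c)) \<longleftrightarrow> Up a y \<and> Dn (b + 1) y"
proof -
  have e: "c \<noteq> 0 \<and> Up a (y + para (- 1) c) \<and> Dn b (y + para (- 1) c) \<longleftrightarrow>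
     cnj c \<noteq> 0 \<and> Up (- b) (mir y + para 1 (cnj c)) \<and> Dn (- a) (mir y + para 1 (cnj c))" for c
    by (simp add: Up_mir[of a] Dn_mir[of b] mir_plus mir_para conj_commute)
  have "connected (cnj ` {c. c \<noteq> 0 \<and> Up (- b) (mir y + para 1 c) \<and> Dn (- a) (mir y + para 1 c)})"
    using assms by (intro connected_continuous_image para_step_pos continuous_intros) auto
  also have "cnj ` {c. c \<noteq> 0 \<and> Up (- b) (mir y + para 1 c) \<and> Dn (- a) (mir y + para 1 c)} =
      {c. c \<noteq> 0 \<and> Up a (y + para (- 1) c) \<and> Dn b (y + para (- 1) c)}"
    unfolding e by (auto simp: image_iff) (metis complex_cnj_cnj complex_cnj_zero_iff)
  finally show "connected {c. c \<noteq> 0 \<and> Up a (y + para (- 1) c) \<and> Dn b (y + para (- 1) c)}" .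
  have "(\<exists>c. c \<noteq> 0 \<and> Up a (y + para (- 1) c) \<and> Dn b (y + para (- 1) c)) \<longleftrightarrow>
     (\<exists>c. c \<noteq> 0 \<and> Up (- b) (mir y + para 1 c) \<and> Dn (- a) (mir y + para 1 c))"
    unfolding e by (metis complex_cnj_cnj)
  also have "\<dots> \<longleftrightarrow> Up (- b - 1) (mir y) \<and> Dn (- a) (mir y)"
    using para_step_pos(2)[of "- b" "- a" "mir y"] assms by simp
  also have "\<dots> \<longleftrightarrow> Up a y \<and> Dn (b + 1) y" by (auto simp: Up_mir[of a] Dn_mir[of "b + 1"])
  finally show "(\<exists>c. c \<noteq> 0 \<and> Up a (y + para (- 1) c) \<and> Dn b (y + para (- 1) c)) \<longleftrightarrow> Up a y \<and> Dn (b + 1) y" .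
qed

section \<open>Connectedness through fibrations\<close>

text \<open>Constancy on fibres turns f into a function on the base, and local sections make that
  function locally constant. The fibres may be disconnected as long as f does not separate their
  points.\<close>

lemma locally_constant_fibration:
  fixes f :: "'a::topological_space \<times> 'b::topological_space \<Rightarrow> bool"
  assumes B: "connected B"
    and slice: "\<And>x e e'. x \<in> B \<Longrightarrow> (x, e) \<in> E \<Longrightarrow> (x, e') \<in> E \<Longrightarrow> f (x, e) = f (x, e')"
    and sect: "\<And>x. x \<in> B \<Longrightarrow> \<exists>U s. open U \<and> x \<in> U \<and> continuous_on (U \<inter> B) s \<and> (\<forall>x'\<in>U \<inter> B. (x', s x') \<in> E)"
    and f: "continuous_on E f"
    and x: "x \<in> B" "(x, e) \<in> E" "x' \<in> B" "(x', e') \<in> E"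
  shows "f (x, e) = f (x', e')"
proof -
  define g where "g x = f (x, SOME e. (x, e) \<in> E)" for x
  have g: "g x = f (x, e)" if "x \<in> B" "(x, e) \<in> E" for x e
    unfolding g_def by (rule slice[OF that(1) someI that(2)]) (rule that(2))
  have "\<forall>a\<in>B. eventually (\<lambda>b. g a = g b) (at a within B)"
  proof
    fix a assume a: "a \<in> B"
    obtain U s where U: "open U" "a \<in> U" "continuous_on (U \<inter> B) s" "\<forall>x'\<in>U \<inter> B. (x', s x') \<in> E"
      using sect[OF a] by blast
    have "continuous_on (U \<inter> B) (\<lambda>x. f (x, s x))"
      by (rule continuous_on_compose2[OF f]) (use U in \<open>auto intro!: continuous_intros\<close>)
    then have "((\<lambda>x. f (x, s x)) \<longlongrightarrow> f (a, s a)) (at a within U \<inter> B)"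
      using U a by (simp add: continuous_on_def)
    then have "eventually (\<lambda>b. f (b, s b) = f (a, s a)) (at a within U \<inter> B)"
      by (simp add: tendsto_discrete)
    moreover have "at a within U \<inter> B = at a within B"
      by (rule at_within_nhd[OF U(2,1)]) auto
    ultimately have "eventually (\<lambda>b. f (b, s b) = f (a, s a)) (at a within B)" by simp
    moreover have "eventually (\<lambda>b. b \<in> U \<inter> B) (at a within B)"
      using eventually_at_in_open'[OF U(1,2)] by (auto simp: eventually_at_filter elim: eventually_mono)
    ultimately show "eventually (\<lambda>b. g a = g b) (at a within B)"
      by eventually_elim (use U a g in auto)
  qed
  then have "g x = g x'" using connected_local_const[OF B x(1,3)] by blast
  then show ?thesis using g x by simp
qed

lemma connected_fibration:
  fixes E :: "('a::topological_space \<times> 'b::topological_space) set"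
  assumes B: "connected B"
    and slice: "\<And>x. x \<in> B \<Longrightarrow> connected {e. (x, e) \<in> E}"
    and sect: "\<And>x. x \<in> B \<Longrightarrow> \<exists>U s. open U \<and> x \<in> U \<and> continuous_on (U \<inter> B) s \<and> (\<forall>x'\<in>U \<inter> B. (x', s x') \<in> E)"
    and base: "\<And>x e. (x, e) \<in> E \<Longrightarrow> x \<in> B"
  shows "connected E"
  unfolding connected_iff_const
proof (intro allI impI)
  fix P :: "'a \<times> 'b \<Rightarrow> bool" assume P: "continuous_on E P"
  have sl: "P (x, e) = P (x, e')" if "x \<in> B" "(x, e) \<in> E" "(x, e') \<in> E" for x e e'
  proof -
    have "continuous_on {e. (x, e) \<in> E} (\<lambda>e. P (x, e))"
      by (rule continuous_on_compose2[OF P]) (auto intro!: continuous_intros)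
    then show ?thesis using connectedD_const[OF slice[OF that(1)]] that by blast
  qed
  have "P z = P z'" if "z \<in> E" "z' \<in> E" for z z'
  proof -
    have "P (fst z, snd z) = P (fst z', snd z')"
      by (rule locally_constant_fibration[OF B sl sect P])
        (use that base[of "fst z" "snd z"] base[of "fst z'" "snd z'"] in auto)
    then show ?thesis by simp
  qed
  then show "\<exists>c. \<forall>s\<in>E. P s = c" by metis
qed

section \<open>Products of parabolic elements\<close>

primrec pp :: "(nat \<Rightarrow> real) \<Rightarrow> (nat \<Rightarrow> complex) \<Rightarrow> nat \<Rightarrow> nat \<Rightarrow> cov" where
  "pp e x i 0 = 0"
| "pp e x i (Suc n) = pp e x i n + para (e (i + n)) (x (i + n))"

lemma pp_cong: "(\<And>k. i \<le> k \<Longrightarrow> k < i + n \<Longrightarrow> x k = y k) \<Longrightarrow> pp e x i n = pp e y i n"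
  by (induction n) auto

lemma pp_cong_sign: "(\<And>k. i \<le> k \<Longrightarrow> k < i + n \<Longrightarrow> e k = e' k \<and> x k = y k) \<Longrightarrow> pp e x i n = pp e' y i n"
  by (induction n) auto

lemma pp_shift: "pp e x (i + m) n = pp (\<lambda>k. e (k + m)) (\<lambda>k. x (k + m)) i n"
  by (induction n) (auto simp: add_ac)

lemma pp_add: "pp e x i (m + n) = pp e x i m + pp e x (i + m) n"
  by (induction n) (auto simp: add.assoc)

lemma pp_Suc_left: "pp e x i (Suc n) = para (e i) (x i) + pp e x (Suc i) n"
  using pp_add[of e x i 1 n] by simp

lemma mir_pp: "mir (pp e x i n) = pp (\<lambda>k. - e k) (\<lambda>k. cnj (x k)) i n"
  by (induction n) (auto simp: mir_plus mir_para)

lemma continuous_on_coord: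
  fixes f :: "'a::topological_space \<Rightarrow> 'i \<Rightarrow> 'b::topological_space"
  shows "continuous_on S f \<Longrightarrow> continuous_on S (\<lambda>x. f x i)"
  by (rule continuous_on_product_then_coordinatewise)

lemma continuous_on_pp:
  "continuous_on S f \<Longrightarrow> continuous_on S (\<lambda>x. pp e (f x) i n)"
proof (induction n)
  case (Suc n)
  have "continuous_on S (\<lambda>x. f x (i + n))" by (rule continuous_on_coord[OF Suc.prems])
  then show ?case using Suc by (auto intro!: continuous_intros)
qed auto

text \<open>Configurations of \<open>N\<close> parabolic elements with product in \<open>R\<close>. In each of the first \<open>h\<close> blocks of four
  elements the product is required to be non-trivial. The entries with index \<open>\<ge> N\<close> play no role.\<close>

definition Conf :: "(nat \<Rightarrow> real) \<Rightarrow> nat \<Rightarrow> nat \<Rightarrow> (cov \<Rightarrow> bool) \<Rightarrow> (nat \<Rightarrow> complex) set" where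
  "Conf e h N R = {x. (\<forall>i. x i \<noteq> 0) \<and> R (pp e x 0 N) \<and> (\<forall>j<h. 4 * j + 4 \<le> N \<longrightarrow> pp e x (4 * j) 4 \<noteq> 0)}"

lemma connected_nonzero_seqs: "connected {x :: nat \<Rightarrow> complex. \<forall>i. x i \<noteq> 0}"
  unfolding connected_iff_const
proof (intro allI impI)
  fix P :: "(nat \<Rightarrow> complex) \<Rightarrow> bool" assume P: "continuous_on {x. \<forall>i. x i \<noteq> 0} P"
  have "P x = P (\<lambda>_. 1)" if x: "\<forall>i. x i \<noteq> 0" for x
  proof -
    define g where "g t = (\<lambda>i. exp (of_real t * Ln (x i)))" for t :: real
    have "continuous_on {0..1} g" unfolding g_def
      by (intro continuous_on_coordinatewise_then_product continuous_intros)
    then have "continuous_on {0..1} (\<lambda>t. P (g t))"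
      by (rule continuous_on_compose2[OF P]) (auto simp: g_def)
    then obtain c where "\<forall>t\<in>{0..1}. P (g t) = c" using connectedD_const[of "{0..1::real}"] by auto
    then have "P (g 0) = P (g 1)" by simp
    moreover have "g 0 = (\<lambda>_. 1)" "g 1 = x" using x by (auto simp: g_def)
    ultimately show ?thesis by simp
  qed
  then show "\<exists>c. \<forall>s\<in>{x. \<forall>i. x i \<noteq> 0}. P s = c" by blast
qed

text \<open>Appending a parabolic is a fibration over the shorter configurations. The fibre is an
  open connected planar set, less at most the one point at which a block of four would become
  trivial; an open connected set of the plane survives the loss of a point.\<close>

lemma Conf_step:
  assumes e: "\<bar>e N\<bar> = 1" and R: "open {y. R y}"
    and K: "\<And>y. connected {c. c \<noteq> 0 \<and> R (y + para (e N) c)}"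
      "\<And>y. (\<exists>c. c \<noteq> 0 \<and> R (y + para (e N) c)) \<longleftrightarrow> R' y"
    and C: "connected (Conf e h N R')"
  shows "connected (Conf e h (Suc N) R)"
    and "\<And>x. x \<in> Conf e h N R' \<Longrightarrow> \<exists>c. x(N := c) \<in> Conf e h (Suc N) R"
    and "\<And>x. x \<in> Conf e h (Suc N) R \<Longrightarrow> x \<in> Conf e h N R'"
proof -
  \<comment> \<open>A condition on c arises only if position N is the last of a block.\<close>
  define ok where "ok x c \<longleftrightarrow> (\<forall>j<h. 4 * j + 4 = Suc N \<longrightarrow> pp e x (4 * j) 3 + para (e N) c \<noteq> 0)" for x c
  define E where "E = {(x, c). x \<in> Conf e h N R' \<and> c \<noteq> 0 \<and> R (pp e x 0 N + para (e N) c) \<and> ok x c}"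
  have four: "pp e y (4 * j) 4 = pp e y (4 * j) 3 + para (e N) (y N)" if "4 * j + 4 = Suc N" for j y
    using that pp.simps(2)[of e y "4 * j" 3] by (auto simp: numeral_eq_Suc)
  have upd: "x(N := c) \<in> Conf e h (Suc N) R \<longleftrightarrow> (x, c) \<in> E" if x: "x \<in> Conf e h N R'" for x c
  proof -
    have 0: "pp e (x(N := c)) 0 (Suc N) = pp e x 0 N + para (e N) c"
      using pp_cong[of 0 N "x(N := c)" x e] by simp
    have 1: "pp e (x(N := c)) (4 * j) 4 = pp e x (4 * j) 4" if "4 * j + 4 \<le> N" for j
      using that by (intro pp_cong) auto
    have 2: "pp e (x(N := c)) (4 * j) 4 = pp e x (4 * j) 3 + para (e N) c" if "4 * j + 4 = Suc N" for j
      using that pp_cong[of "4 * j" 3 "x(N := c)" x e] four[OF that, of "x(N := c)"] by simp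
    have "(\<forall>j<h. 4 * j + 4 \<le> Suc N \<longrightarrow> pp e (x(N := c)) (4 * j) 4 \<noteq> 0) \<longleftrightarrow> ok x c"
    proof
      assume "ok x c"
      then show "\<forall>j<h. 4 * j + 4 \<le> Suc N \<longrightarrow> pp e (x(N := c)) (4 * j) 4 \<noteq> 0"
        using 1 2 x unfolding ok_def Conf_def le_Suc_eq by auto
    next
      assume a: "\<forall>j<h. 4 * j + 4 \<le> Suc N \<longrightarrow> pp e (x(N := c)) (4 * j) 4 \<noteq> 0"
      show "ok x c" unfolding ok_def using a 2 by (metis order_refl)
    qed
    then show ?thesis using x 0 by (auto simp: E_def Conf_def)
  qed
  have bk: "x \<in> Conf e h N R'" if "x \<in> Conf e h (Suc N) R" for x
    using that K(2)[of "pp e x 0 N"] by (auto simp: Conf_def)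
  then show "\<And>x. x \<in> Conf e h (Suc N) R \<Longrightarrow> x \<in> Conf e h N R'" .
  define S where "S x = {c. c \<noteq> 0 \<and> R (pp e x 0 N + para (e N) c)}" for x
  have openS: "open (S x)" for x
  proof -
    have "open ((\<lambda>c. pp e x 0 N + para (e N) c) -` {y. R y})"
      by (intro open_vimage R continuous_on_cov_plus continuous_on_para continuous_on_const continuous_on_id)
    then have "open (- {0} \<inter> ((\<lambda>c. pp e x 0 N + para (e N) c) -` {y. R y}))" by (intro open_Int) auto
    also have "\<dots> = S x" by (auto simp: S_def)
    finally show ?thesis .
  qed
  have E_slice: "\<exists>c0. {c. (x, c) \<in> E} = S x \<or> {c. (x, c) \<in> E} = S x - {c0}" if "x \<in> Conf e h N R'" for x
  proof (cases "\<exists>j<h. 4 * j + 4 = Suc N")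
    case True
    then obtain j where j: "j < h" "4 * j + 4 = Suc N" by blast
    then have "ok x c \<longleftrightarrow> pp e x (4 * j) 3 + para (e N) c \<noteq> 0" for c
      by (auto simp: ok_def j(2)[symmetric])
    then have "ok x c \<longleftrightarrow> para (e N) c \<noteq> - pp e x (4 * j) 3" for c
      by (simp add: add_eq_0_iff)
    then have E: "(x, c) \<in> E \<longleftrightarrow> c \<in> S x \<and> para (e N) c \<noteq> - pp e x (4 * j) 3" for c
      using that unfolding E_def S_def by blast
    show ?thesis
    proof (cases "\<exists>c. para (e N) c = - pp e x (4 * j) 3")
      case True
      then obtain c0 where c0: "para (e N) c0 = - pp e x (4 * j) 3" by blast
      then have "para (e N) c = - pp e x (4 * j) 3 \<longleftrightarrow> c = c0" for c by (metis be_para)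
      then have "{c. (x, c) \<in> E} = S x - {c0}" unfolding E by blast
      then show ?thesis by blast
    next
      case False
      then have "{c. (x, c) \<in> E} = S x" unfolding E by blast
      then show ?thesis by blast
    qed
  next
    case False
    then show ?thesis using that by (auto simp: E_def S_def ok_def)
  qed
  have ne: "\<exists>c. (x, c) \<in> E" if x: "x \<in> Conf e h N R'" for x
  proof -
    have "S x \<noteq> {}" using x K(2)[of "pp e x 0 N"] by (auto simp: Conf_def S_def)
    moreover have "S x \<noteq> {c0}" for c0 using openS[of x] not_open_singleton by metis
    ultimately show ?thesis using E_slice[OF x] by blast
  qed
  show "\<exists>c. x(N := c) \<in> Conf e h (Suc N) R" if "x \<in> Conf e h N R'" for x
    using ne[OF that] upd[OF that] by blast
  have "connected E"
  proof (rule connected_fibration[OF C])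
    fix x assume x: "x \<in> Conf e h N R'"
    have "connected (S x)" using K(1) by (simp add: S_def)
    then show "connected {c. (x, c) \<in> E}"
      using E_slice[OF x] openS[of x] connected_open_delete[of "S x"] by auto
    obtain c where xc: "(x, c) \<in> E" using ne[OF x] by blast
    \<comment> \<open>All conditions are open, so the same c serves for all nearby
      configurations.\<close>
    define U where "U = (\<lambda>x. pp e x 0 N + para (e N) c) -` {y. R y} \<inter>
       {x. \<forall>j\<in>{..<h}. 4 * j + 4 = Suc N \<longrightarrow> pp e x (4 * j) 3 + para (e N) c \<noteq> 0}"
    have "open {x. pp e x (4 * j) 3 + para (e N) c \<noteq> 0}" for j
      by (intro open_Collect_neq continuous_on_cov_plus continuous_on_pp continuous_on_const continuous_on_id)
    then have "open {x. 4 * j + 4 = Suc N \<longrightarrow> pp e x (4 * j) 3 + para (e N) c \<noteq> 0}" for j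
      by (cases "4 * j + 4 = Suc N") simp_all
    then have "open (\<Inter>j\<in>{..<h}. {x. 4 * j + 4 = Suc N \<longrightarrow> pp e x (4 * j) 3 + para (e N) c \<noteq> 0})"
      by (intro open_INT) auto
    moreover have "(\<Inter>j\<in>{..<h}. {x. 4 * j + 4 = Suc N \<longrightarrow> pp e x (4 * j) 3 + para (e N) c \<noteq> 0}) =
      {x. \<forall>j\<in>{..<h}. 4 * j + 4 = Suc N \<longrightarrow> pp e x (4 * j) 3 + para (e N) c \<noteq> 0}" by blast
    moreover have "open ((\<lambda>x. pp e x 0 N + para (e N) c) -` {y. R y})"
      by (intro open_vimage R continuous_on_cov_plus continuous_on_pp continuous_on_const continuous_on_id)
    ultimately have "open U" unfolding U_def by (intro open_Int) simp_all
    moreover have "x \<in> U" using xc by (auto simp: U_def E_def ok_def)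
    moreover have "\<forall>x'\<in>U \<inter> Conf e h N R'. (x', c) \<in> E" using xc by (auto simp: U_def E_def ok_def)
    ultimately show "\<exists>U s. open U \<and> x \<in> U \<and> continuous_on (U \<inter> Conf e h N R') s \<and>
        (\<forall>x'\<in>U \<inter> Conf e h N R'. (x', s x') \<in> E)"
      by (intro exI[of _ U] exI[of _ "\<lambda>_. c"]) simp
  next
    fix x c assume "(x, c) \<in> E"
    then show "x \<in> Conf e h N R'" by (simp add: E_def)
  qed
  moreover have "continuous_on E (\<lambda>(x, c). x(N := c))"
    unfolding case_prod_unfold
  proof (rule continuous_on_coordinatewise_then_product)
    fix i
    have "continuous_on E (\<lambda>z. fst z i)" by (rule continuous_on_coord[OF continuous_on_fst[OF continuous_on_id]])
    moreover have "continuous_on E (\<lambda>z. snd z)" by (intro continuous_intros)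
    ultimately show "continuous_on E (\<lambda>z. ((fst z)(N := snd z)) i)" by (cases "i = N") simp_all
  qed
  ultimately have "connected ((\<lambda>(x, c). x(N := c)) ` E)" by (rule connected_continuous_image[rotated])
  also have "(\<lambda>(x, c). x(N := c)) ` E = Conf e h (Suc N) R"
  proof (intro equalityI subsetI)
    fix y assume "y \<in> (\<lambda>(x, c). x(N := c)) ` E"
    then show "y \<in> Conf e h (Suc N) R" using upd by (auto simp: E_def)
  next
    fix y assume y: "y \<in> Conf e h (Suc N) R"
    then have "(y, y N) \<in> E" using upd[OF bk[OF y], of "y N"] by simp
    then show "y \<in> (\<lambda>(x, c). x(N := c)) ` E" by (metis (no_types, lifting) case_prod_conv fun_upd_triv image_eqI)
  qed
  finally show "connected (Conf e h (Suc N) R)" .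
qed

lemma Conf_step_nonempty:
  assumes "\<And>x. x \<in> Conf e h N R' \<Longrightarrow> \<exists>c. x(N := c) \<in> Conf e h (Suc N) R"
    and "\<And>x. x \<in> Conf e h (Suc N) R \<Longrightarrow> x \<in> Conf e h N R'"
  shows "Conf e h (Suc N) R = {} \<longleftrightarrow> Conf e h N R' = {}"
  using assms by blast

lemma Conf_0: "Conf e h 0 R = (if R 0 then {x. \<forall>i. x i \<noteq> 0} else {})"
  by (auto simp: Conf_def)

lemma Conf_cong: "(\<And>y. R y \<longleftrightarrow> R' y) \<Longrightarrow> Conf e h N R = Conf e h N R'"
  by (simp add: Conf_def)

definition signs :: "(nat \<Rightarrow> real) \<Rightarrow> nat \<Rightarrow> bool" where
  "signs e N \<longleftrightarrow> (\<forall>i<N. e i = 1 \<or> e i = -1)"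

definition cnt :: "(nat \<Rightarrow> real) \<Rightarrow> nat \<Rightarrow> real \<Rightarrow> int" where
  "cnt e N s = int (card {i. i < N \<and> e i = s})"

lemma cnt_0 [simp]: "cnt e 0 s = 0"
  by (simp add: cnt_def)

lemma cnt_Suc: "cnt e (Suc N) s = cnt e N s + (if e N = s then 1 else 0)"
proof -
  have "{i. i < Suc N \<and> e i = s} = (if e N = s then insert N {i. i < N \<and> e i = s} else {i. i < N \<and> e i = s})"
    by (auto simp: less_Suc_eq)
  then show ?thesis by (auto simp: cnt_def)
qed

abbreviation between :: "int \<Rightarrow> int \<Rightarrow> cov \<Rightarrow> bool" where
  "between a b y \<equiv> Up a y \<and> Dn b y"

lemma open_between: "open {y. between a b y}"
  using open_Up[of a] open_Dn[of b] by (simp add: open_Collect_conj)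

text \<open>Each removal of the last factor widens the region by one level, below for a positive and
  above for a negative factor. In the end the question is whether the identity lies in
  \<open>between (a - cnt e N 1) (b + cnt e N (-1))\<close>.\<close>

theorem Conf_between:
  assumes "signs e N" "a \<le> b"
  shows "connected (Conf e h N (between a b))"
    and "Conf e h N (between a b) \<noteq> {} \<longleftrightarrow> a < cnt e N 1 \<and> - cnt e N (-1) < b"
proof -
  have "\<forall>a b. a \<le> b \<longrightarrow> connected (Conf e h N (between a b)) \<and>
    (Conf e h N (between a b) \<noteq> {} \<longleftrightarrow> a < cnt e N 1 \<and> - cnt e N (-1) < b)"
    using assms(1)
  proof (induction N)
    case 0
    have "between a b 0 \<longleftrightarrow> a < 0 \<and> 0 < b" for a b
      using sg_cases[of a] sg_cases[of b] by (auto simp: Up_def Dn_def mult_less_0_iff zero_less_mult_iff)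
    moreover have "(\<lambda>_. 1) \<in> {x :: nat \<Rightarrow> complex. \<forall>i. x i \<noteq> 0}" by simp
    ultimately show ?case unfolding Conf_0 using connected_nonzero_seqs by (auto split: if_splits)
  next
    case (Suc N)
    then have IH: "connected (Conf e h N (between a b))"
       "Conf e h N (between a b) \<noteq> {} \<longleftrightarrow> a < cnt e N 1 \<and> - cnt e N (-1) < b" if "a \<le> b" for a b
      using that by (auto simp: signs_def)
    have "e N = 1 \<or> e N = -1" using Suc by (auto simp: signs_def)
    then show ?case
    proof
      assume e: "e N = 1"
      show ?thesis
      proof (intro allI impI)
        fix a b :: int assume ab: "a \<le> b"
        have e1: "\<bar>e N\<bar> = 1" using e by simp
        note K = para_step_pos[OF ab, folded e]
        have IH1: "connected (Conf e h N (between (a - 1) b))" using ab by (intro IH(1)) simp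
        note st = Conf_step[where R = "between a b" and R' = "between (a - 1) b", OF e1 open_between K IH1]
        have c: "connected (Conf e h (Suc N) (between a b))" by (rule st(1))
        have n: "Conf e h (Suc N) (between a b) = {} \<longleftrightarrow> Conf e h N (between (a - 1) b) = {}"
          by (rule Conf_step_nonempty[OF st(2,3)])
        show "connected (Conf e h (Suc N) (between a b)) \<and>
          (Conf e h (Suc N) (between a b) \<noteq> {} \<longleftrightarrow> a < cnt e (Suc N) 1 \<and> - cnt e (Suc N) (-1) < b)"
          unfolding n
          using IH(2)[of "a - 1" b] ab e c by (simp add: cnt_Suc) linarith
      qed
    next
      assume e: "e N = -1"
      show ?thesis
      proof (intro allI impI)
        fix a b :: int assume ab: "a \<le> b"
        have e1: "\<bar>e N\<bar> = 1" using e by simp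
        note K = para_step_neg[OF ab, folded e]
        have IH1: "connected (Conf e h N (between a (b + 1)))" using ab by (intro IH(1)) simp
        note st = Conf_step[where R = "between a b" and R' = "between a (b + 1)", OF e1 open_between K IH1]
        have c: "connected (Conf e h (Suc N) (between a b))" by (rule st(1))
        have n: "Conf e h (Suc N) (between a b) = {} \<longleftrightarrow> Conf e h N (between a (b + 1)) = {}"
          by (rule Conf_step_nonempty[OF st(2,3)])
        show "connected (Conf e h (Suc N) (between a b)) \<and>
          (Conf e h (Suc N) (between a b) \<noteq> {} \<longleftrightarrow> a < cnt e (Suc N) 1 \<and> - cnt e (Suc N) (-1) < b)"
          unfolding n
          using IH(2)[of a "b + 1"] ab e c by (simp add: cnt_Suc) linarith
      qed
    qed
  qed
  then show "connected (Conf e h N (between a b))"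
    and "Conf e h N (between a b) \<noteq> {} \<longleftrightarrow> a < cnt e N 1 \<and> - cnt e N (-1) < b"
    using assms(2) by auto
qed

text \<open>The elements below the closed hyperbolic region of level \<open>n\<close>: \<open>Up (n - 1) \<and> Below n\<close> reaches from the
  hyperbolic elements of level \<open>n - 1\<close> to the elliptic ones with \<open>(n - 1) pi < th < n pi\<close>.\<close>

definition Below :: "int \<Rightarrow> cov \<Rightarrow> bool" where
  "Below n y \<longleftrightarrow> th y < of_int n * pi \<and> (sg n * Re (al y) < 1 \<or> th y < of_int n * pi - pi / 2)"

lemma Below_shift: "Below n (cz m + y) \<longleftrightarrow> Below (n - m) y"
  by (simp add: Below_def algebra_simps)

text \<open>The argument for \<open>Up_0_para\<close> on the closed side: half the trace at least 1
  at a later crossing contradicts its decrease.\<close>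

lemma Below_0_para:
  assumes "\<not> Below 0 y" "c \<noteq> 0" shows "\<not> Below 0 (y + para 1 c)"
proof
  let ?y = "y + para 1 c"
  assume n: "Below 0 ?y"
  have th: "th y < th ?y" "th ?y < th y + pi" using th_plus_para[OF assms(2)] by auto
  have *: "- pi / 2 \<le> th y" "Re (al y) \<ge> 1" "th ?y < 0" "Re (al ?y) < 1"
    using n assms(1) th by (auto simp: Below_def)
  have g: "gain y c < 0" using * by (simp add: Re_para_gain)
  define T where "T = 1 - Re (al y) / gain y c"
  have T: "T > 1" "Re (al y) + T * gain y c < 0" using g *(2)
    by (simp_all add: T_def field_simps)
  let ?z = "y + para 1 (of_real T * c)"
  have "Re (al ?z) < 0" using T by (simp add: Re_para_gain gain_scale)
  moreover have "th y < th ?z" "th ?z < th y + pi" using th_plus_para[of "of_real T * c" y] assms(2) T by auto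
  ultimately have "th ?z \<ge> 0"
    using *(1) cos_gt_zero_pi[of "th ?z"] Re_al_pos_cos[of ?z] by (cases "th ?z < pi / 2") auto
  then obtain t where t: "1 \<le> t" "Re (al y) + t * gain y c \<ge> 1"
    using ray_cross[of 1 T y c 0] T *(3) by auto
  have "t * gain y c \<le> 1 * gain y c" using g t(1) by (intro mult_right_mono_neg) auto
  then show False using t(2) *(4) by (simp add: Re_para_gain)
qed

lemma lower_set_Below: "lower_set (Below n)"
  unfolding lower_set_def
proof (intro conjI allI impI)
  show "open {y. Below n y}" unfolding Below_def
    by (intro open_Collect_disj open_Collect_conj open_Collect_less continuous_intros)
  fix y c assume "c \<noteq> 0" "Below n (y + para 1 c)"
  then have "Below 0 (cz (- n) + y + para 1 c)" by (simp add: Below_shift add.assoc)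
  then have "Below 0 (cz (- n) + y)" using Below_0_para \<open>c \<noteq> 0\<close> by blast
  then show "Below n y" by (simp add: Below_shift)
qed

text \<open>Undoing a positive parabolic lowers a and leaves \<open>Below n\<close> as it is; with
  all signs positive the upper end never moves.\<close>

theorem Conf_below:
  assumes "\<And>i. i < N \<Longrightarrow> e i = 1" "a < n"
  shows "connected (Conf e h N (\<lambda>y. Up a y \<and> Below n y))"
    and "Conf e h N (\<lambda>y. Up a y \<and> Below n y) \<noteq> {} \<longleftrightarrow> a < int N \<and> n \<ge> 1"
proof -
  have "\<forall>a<n. connected (Conf e h N (\<lambda>y. Up a y \<and> Below n y)) \<and>
    (Conf e h N (\<lambda>y. Up a y \<and> Below n y) \<noteq> {} \<longleftrightarrow> a < int N \<and> n \<ge> 1)"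
    using assms(1)
  proof (induction N)
    case 0
    have "Below n 0 \<longleftrightarrow> n \<ge> 1"
    proof
      assume "n \<ge> 1"
      then have "1 * pi \<le> real_of_int n * pi" by (intro mult_right_mono) auto
      then show "Below n 0" using pi_gt_zero unfolding Below_def by simp
    qed (auto simp: Below_def zero_less_mult_iff)
    moreover have "Up a 0 \<longleftrightarrow> a < 0" for a
      using sg_cases[of a] by (auto simp: Up_def mult_less_0_iff)
    moreover have "(\<lambda>_. 1) \<in> {x :: nat \<Rightarrow> complex. \<forall>i. x i \<noteq> 0}" by simp
    ultimately show ?case unfolding Conf_0 using connected_nonzero_seqs by (auto split: if_splits)
  next
    case (Suc N)
    then have IH: "connected (Conf e h N (\<lambda>y. Up a y \<and> Below n y))"
       "Conf e h N (\<lambda>y. Up a y \<and> Below n y) \<noteq> {} \<longleftrightarrow> a < int N \<and> n \<ge> 1" if "a < n" for a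
      using that by auto
    have e: "e N = 1" using Suc by auto
    have e1: "\<bar>e N\<bar> = 1" using e by simp
    show ?case
    proof (intro allI impI)
      fix a assume a: "a < n"
      have "\<forall>y. - pi / 2 < th y - of_int a * pi \<and> th y - of_int a * pi < pi / 2 \<and> sg a * Re (al y) \<ge> 1 \<longrightarrow> Below n y"
      proof (intro allI impI)
        fix y assume y: "- pi / 2 < th y - of_int a * pi \<and> th y - of_int a * pi < pi / 2 \<and> sg a * Re (al y) \<ge> 1"
        have "real_of_int a \<le> of_int n - 1" using a by linarith
        then have "real_of_int a * pi \<le> (of_int n - 1) * pi" by (intro mult_right_mono) auto
        then have "real_of_int a * pi \<le> of_int n * pi - pi" by (simp only: left_diff_distrib mult_1)
        then show "Below n y" using y pi_gt_zero unfolding Below_def by linarith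
      qed
      note K = para_step_lower[OF lower_set_Below disjI2[OF this], folded e]
      have "open {y. Up a y \<and> Below n y}"
        using open_Up lower_set_Below by (simp add: open_Collect_conj lower_set_def)
      note st = Conf_step[where R = "\<lambda>y. Up a y \<and> Below n y" and R' = "\<lambda>y. Up (a - 1) y \<and> Below n y",
          OF e1 this K IH(1)]
      have a1: "a - 1 < n" using a by simp
      have "connected (Conf e h (Suc N) (\<lambda>y. Up a y \<and> Below n y))" by (rule st(1)[OF a1])
      moreover have "Conf e h (Suc N) (\<lambda>y. Up a y \<and> Below n y) = {} \<longleftrightarrow> Conf e h N (\<lambda>y. Up (a - 1) y \<and> Below n y) = {}"
        by (rule Conf_step_nonempty[OF st(2,3)[OF a1]])
      ultimately show "connected (Conf e h (Suc N) (\<lambda>y. Up a y \<and> Below n y)) \<and>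
        (Conf e h (Suc N) (\<lambda>y. Up a y \<and> Below n y) \<noteq> {} \<longleftrightarrow> a < int (Suc N) \<and> n \<ge> 1)"
        using IH(2)[OF a1] by auto
    qed
  qed
  then show "connected (Conf e h N (\<lambda>y. Up a y \<and> Below n y))"
    and "Conf e h N (\<lambda>y. Up a y \<and> Below n y) \<noteq> {} \<longleftrightarrow> a < int N \<and> n \<ge> 1"
    using assms(2) by auto
qed

section \<open>Conjugation and commutation\<close>

lemma abs_arctan_less: "\<bar>arctan x\<bar> < pi / 2"
  using arctan_bounded[of x] by auto

text \<open>The whole one-parameter group of parabolics with a given fixed point, which the unit
  vector u encodes; it contains \<open>para e c\<close> at the time \<open>e * cmod c\<close>, with
  u the direction of \<open>of_real e * c\<close>.\<close>

definition unip :: "real \<Rightarrow> complex \<Rightarrow> cov" where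
  "unip t u = Cov (arctan t) (of_real t * u)"

lemma be_unip [simp]: "be (unip t u) = of_real t * u"
  and th_unip: "th (unip t u) = arctan t"
  by (simp_all add: unip_def)

lemma al_unip [simp]: "cmod u = 1 \<Longrightarrow> al (unip t u) = Complex 1 t"
  by (simp add: al_def norm_mult complex_eq_iff cos_arctan sin_arctan th_unip add_nonneg_eq_0_iff)

lemma unip_0 [simp]: "unip 0 u = 0"
  by (rule cov_eqI) (simp_all add: th_unip)

lemma cnj_unit: "cmod u = 1 \<Longrightarrow> u * cnj u = 1"
  by (metis complex_norm_square of_real_1 power_one)

lemma unip_add:
  assumes "cmod u = 1" shows "unip s u + unip t u = unip (s + t) u"
proof (rule cov_eqI_near)
  have "of_real s * u * cnj (of_real t * u) = of_real (s * t)"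
    using cnj_unit[OF assms] by (simp add: mult_ac)
  then show "al (unip s u + unip t u) = al (unip (s + t) u)"
    using assms by (simp add: al_plus complex_eq_iff)
  show "be (unip s u + unip t u) = be (unip (s + t) u)"
    using assms by (simp add: be_plus complex_eq_iff algebra_simps)
  show "\<bar>th (unip s u + unip t u) - th (unip (s + t) u)\<bar> < 2 * pi"
    using th_plus_bound[of "unip s u" "unip t u"] abs_arctan_less[of s] abs_arctan_less[of t] abs_arctan_less[of "s + t"]
    unfolding th_unip by linarith
qed

lemma unip_para:
  assumes "e = 1 \<or> e = -1" "cmod u = 1" "r \<ge> 0"
  shows "unip (e * r) u = para e (of_real (e * r) * u)"
  using assms by (intro cov_eqI) (auto simp: th_para th_unip norm_mult arctan_minus)

text \<open>The element of the covering group over the normalisation of a matrix with positive determinant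
  \<open>\<bar>a\<bar>\<^sup>2 - \<bar>b\<bar>\<^sup>2\<close>.\<close>

definition nrm :: "complex \<Rightarrow> complex \<Rightarrow> cov" where
  "nrm a b = Cov (Arg a) (b / of_real (sqrt ((cmod a)\<^sup>2 - (cmod b)\<^sup>2)))"

lemma be_nrm [simp]: "be (nrm a b) = b / of_real (sqrt ((cmod a)\<^sup>2 - (cmod b)\<^sup>2))"
  and th_nrm: "th (nrm a b) = Arg a"
  by (simp_all add: nrm_def)

lemma al_nrm [simp]:
  assumes "cmod b < cmod a" shows "al (nrm a b) = a / of_real (sqrt ((cmod a)\<^sup>2 - (cmod b)\<^sup>2))"
proof -
  define D where "D = (cmod a)\<^sup>2 - (cmod b)\<^sup>2"
  have D: "D > 0" using assms by (simp add: D_def power2_strict_mono)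
  then have s: "(sqrt D)\<^sup>2 = D" "sqrt D > 0" by simp_all
  have "cmod (be (nrm a b)) = cmod b / sqrt D"
    using s by (simp add: nrm_def norm_divide flip: D_def)
  then have "(cmod (be (nrm a b)))\<^sup>2 = (cmod b)\<^sup>2 / D" by (simp only: power_divide s)
  moreover have "1 = D / D" using D by simp
  ultimately have "1 + (cmod (be (nrm a b)))\<^sup>2 = (D + (cmod b)\<^sup>2) / D"
    by (simp only: add_divide_distrib)
  then have "1 + (cmod (be (nrm a b)))\<^sup>2 = (cmod a)\<^sup>2 / D"
    by (simp add: D_def)
  then have "sqrt (1 + (cmod (be (nrm a b)))\<^sup>2) = cmod a / sqrt D"
    by (simp add: real_sqrt_divide)
  moreover have "a \<noteq> 0" using assms by auto
  ultimately show ?thesis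
    using cis_Arg_pos[OF \<open>a \<noteq> 0\<close>] unfolding al_def th_nrm D_def by simp
qed

lemma continuous_on_nrm [continuous_intros]:
  assumes "continuous_on S f" "continuous_on S g" "\<And>x. x \<in> S \<Longrightarrow> f x \<notin> \<real>\<^sub>\<le>\<^sub>0" "\<And>x. x \<in> S \<Longrightarrow> cmod (g x) < cmod (f x)"
  shows "continuous_on S (\<lambda>x. nrm (f x) (g x))"
  unfolding nrm_def using assms
  by (auto intro!: continuous_intros simp: power2_eq_iff_nonneg)
    (metis norm_ge_zero order_less_irrefl power2_eq_iff_nonneg)+

lemma cov_commute:
  assumes "al (x + y) = al (y + x)" "be (x + y) = be (y + x)" shows "x + y = y + x"
  using th_plus_bound[of x y] th_plus_bound[of y x] pi_gt_zero
  by (intro cov_eqI_near assms) linarith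

section \<open>Conjugation in the covering group\<close>

definition cjg :: "cov \<Rightarrow> cov \<Rightarrow> cov" where
  "cjg g y = g + y - g"

lemma cjg_plus: "cjg g (x + y) = cjg g x + cjg g y"
  and cjg_uminus: "cjg g (- x) = - cjg g x"
  and cjg_zero [simp]: "cjg g 0 = 0" "cjg 0 y = y"
  and cjg_cjg: "cjg g (cjg h y) = cjg (g + h) y"
  and cjg_cz [simp]: "cjg g (cz n) = cz n"
  by (simp_all add: cjg_def diff_conv_add_uminus add.assoc minus_add del: add_uminus_conv_diff)
     (metis add.assoc add.right_neutral cz_commute right_minus)

lemma cjg_minus: "cjg g (x - y) = cjg g x - cjg g y"
  using cjg_plus[of g x "- y"] by (simp add: cjg_uminus)

lemma cjg_cz_left: "cjg (cz n + g) y = cjg g y"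
proof -
  have "cjg (cz n) z = z" for z by (simp add: cjg_def flip: cz_commute)
  then show ?thesis by (simp flip: cjg_cjg)
qed

lemma cjg_eq_iff: "cjg g y = y \<longleftrightarrow> g + y = y + g"
  by (simp add: cjg_def diff_eq_eq)

lemma al_cjg: "al (cjg g y) = of_real ((cmod (al g))\<^sup>2) * al y - of_real ((cmod (be g))\<^sup>2) * cnj (al y)
    + (be g * cnj (al g) * cnj (be y) - cnj (be g) * al g * be y)"
proof -
  have "al (cjg g y) = (al g * al y + be g * cnj (be y)) * cnj (al g) - (al g * be y + be g * cnj (al y)) * cnj (be g)"
    by (simp add: cjg_def al_plus be_plus diff_conv_add_uminus del: add_uminus_conv_diff)
  then show ?thesis unfolding complex_norm_square by algebra
qed

lemma be_cjg: "be (cjg g y) = al g * al g * be y - be g * be g * cnj (be y) + al g * be g * (cnj (al y) - al y)"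
proof -
  have "be (cjg g y) = (al g * al y + be g * cnj (be y)) * - be g + (al g * be y + be g * cnj (al y)) * al g"
    by (simp add: cjg_def al_plus be_plus diff_conv_add_uminus del: add_uminus_conv_diff)
  then show ?thesis by algebra
qed

lemma Re_al_cjg: "Re (al (cjg g y)) = Re (al y)"
proof -
  have "Re (al (cjg g y)) = ((cmod (al g))\<^sup>2 - (cmod (be g))\<^sup>2) * Re (al y)"
    by (simp add: al_cjg algebra_simps)
  then show ?thesis by (simp add: cmod_al_sq)
qed

lemma th_cjg_bound: "\<bar>th (cjg g y) - th y\<bar> < pi"
  using th_plus_bound[of "g + y" "- g"] th_plus_bound[of g y]
  unfolding cjg_def diff_conv_add_uminus th_uminus by linarith

lemma continuous_on_cjg [continuous_intros]:
  "continuous_on S f \<Longrightarrow> continuous_on S g \<Longrightarrow> continuous_on S (\<lambda>x. cjg (f x) (g x))"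
  unfolding cjg_def by (intro continuous_intros)

lemma mir_cjg: "mir (cjg g y) = cjg (mir g) (mir y)"
  by (simp add: cjg_def mir_plus mir_uminus diff_conv_add_uminus del: add_uminus_conv_diff)

lemma para_char_pos:
  assumes "Re (al y) = 1" "0 < th y" "th y < pi / 2"
  shows "y = para 1 (be y)"
proof (rule cov_eqI_near)
  have "sin (th y) > 0" using assms by (intro sin_gt_zero) auto
  then have "Im (al y) > 0" using al_nz[of y] by (simp add: Im_al del: al_nz)
  moreover have "(Im (al y))\<^sup>2 = (cmod (be y))\<^sup>2" using SU_sq[of y] assms(1) by simp
  ultimately have "Im (al y) = cmod (be y)" by (simp add: power2_eq_iff_nonneg)
  then show "al y = al (para 1 (be y))" using assms(1) by (simp add: complex_eq_iff)
  show "\<bar>th y - th (para 1 (be y))\<bar> < 2 * pi"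
    using arctan_bounded[of "cmod (be y)"] assms by (simp add: th_para abs_less_iff)
qed simp

lemma para_char_neg:
  assumes "Re (al y) = 1" "- pi / 2 < th y" "th y < 0"
  shows "y = para (- 1) (be y)"
  using para_char_pos[of "mir y"] assms mir_para[of 1 "cnj (be y)"] mir_mir[of y] by simp

text \<open>Half the trace stays 1, so only the sign of the imaginary part of \<open>al\<close> is
  at stake, and it is at least \<open>cmod c\<close> times the square of
  \<open>cmod (al g) - cmod (be g)\<close>.\<close>

lemma cjg_para_pos:
  assumes "c \<noteq> 0" shows "cjg g (para 1 c) = para 1 (be (cjg g (para 1 c)))"
proof (rule para_char_pos)
  let ?z = "cjg g (para 1 c)"
  have th: "\<bar>th ?z - arctan (cmod c)\<bar> < pi" using th_cjg_bound[of g "para 1 c"] by (simp add: th_para)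
  moreover have ar: "0 < arctan (cmod c)" "arctan (cmod c) < pi / 2" using assms arctan_bounded[of "cmod c"] by auto
  show Re: "Re (al ?z) = 1" by (simp add: Re_al_cjg)
  then have "cos (th ?z) > 0" using Re_al_pos_cos[of ?z] by simp
  moreover have "- 3 * pi / 2 < th ?z" "th ?z < 3 * pi / 2" using th ar by linarith+
  ultimately have r: "- pi / 2 < th ?z" "th ?z < pi / 2" using cos_pos_range[of "th ?z"] by auto
  then show "th ?z < pi / 2" by simp
  let ?x = "be g * cnj (al g) * cnj c"
  have im: "Im (al ?z) = ((cmod (al g))\<^sup>2 + (cmod (be g))\<^sup>2) * cmod c + 2 * Im ?x"
    by (simp add: al_cjg algebra_simps)
  have "\<bar>Im ?x\<bar> \<le> cmod (be g) * cmod (al g) * cmod c"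
    using abs_Im_le_cmod[of ?x] by (simp add: norm_mult)
  then have "Im (al ?z) \<ge> ((cmod (al g))\<^sup>2 + (cmod (be g))\<^sup>2) * cmod c - 2 * (cmod (be g) * cmod (al g) * cmod c)"
    unfolding im by linarith
  also have "((cmod (al g))\<^sup>2 + (cmod (be g))\<^sup>2) * cmod c - 2 * (cmod (be g) * cmod (al g) * cmod c) =
      (cmod (al g) - cmod (be g))\<^sup>2 * cmod c"
    by (simp add: power2_eq_square algebra_simps)
  finally have "Im (al ?z) \<ge> (cmod (al g) - cmod (be g))\<^sup>2 * cmod c" .
  moreover have "(cmod (al g) - cmod (be g))\<^sup>2 * cmod c > 0"
    using cmod_be_less[of g] assms by simp
  ultimately have i: "Im (al ?z) > 0" by linarith
  show "0 < th ?z"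
  proof (rule ccontr)
    assume "\<not> 0 < th ?z"
    then have "sin (- th ?z) \<ge> 0" using r by (intro sin_ge_zero) auto
    then have "Im (al ?z) \<le> 0" by (simp add: Im_al mult_nonneg_nonpos)
    then show False using i by simp
  qed
qed

lemma cjg_para:
  assumes "e = 1 \<or> e = -1" "c \<noteq> 0" shows "cjg g (para e c) = para e (be (cjg g (para e c)))"
  using assms(1)
proof
  assume "e = -1"
  have "mir (cjg g (para (- 1) c)) = para 1 (be (mir (cjg g (para (- 1) c))))"
    using cjg_para_pos[of "cnj c" "mir g"] assms(2) by (simp only: mir_cjg mir_para) simp
  then have "mir (mir (cjg g (para (- 1) c))) = para (- 1) (cnj (be (mir (cjg g (para (- 1) c)))))"
    by (metis mir_para)
  then show ?thesis using \<open>e = -1\<close> by simp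
qed (use cjg_para_pos assms in simp)

lemma be_cjg_para_nz:
  assumes "e = 1 \<or> e = -1" "c \<noteq> 0" shows "be (cjg g (para e c)) \<noteq> 0"
proof
  assume "be (cjg g (para e c)) = 0"
  then have "cjg g (para e c) = 0" using cjg_para[OF assms, of g] by simp
  then have "cjg (- g) (cjg g (para e c)) = 0" by simp
  then have "para e c = 0" by (simp add: cjg_cjg)
  then have "be (para e c) = 0" by simp
  then show False using assms by simp
qed

text \<open>Half the trace of the product of the traceless parts of two matrices.\<close>

definition jform :: "cov \<Rightarrow> cov \<Rightarrow> real" where
  "jform x y = Re (be x * cnj (be y)) - Im (al x) * Im (al y)"

lemma jform_para: "\<bar>e\<bar> = 1 \<Longrightarrow> \<bar>e'\<bar> = 1 \<Longrightarrow> jform (para e c) (para e' c') = Re (c * cnj c') - e * e' * cmod c * cmod c'"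
  by (simp add: jform_def)

lemma div_comb: "a / s * p + b / s * q = (a * p + b * q) / (s :: complex)"
  and div_comb': "p * (b / s) + q * (a / s) = (p * b + q * a) / (s :: complex)"
  by (simp_all add: add_divide_distrib)

text \<open>The path is 1 + t H with H the traceless part of h, normalised to determinant 1. The
  bound T keeps \<open>cmod (of_real t * be h)\<close> below 1, so the determinant stays
  positive.\<close>

lemma centralizer_path:
  obtains T where "T > 0" "continuous_on {0..T} (\<lambda>t. nrm (1 + of_real t * (\<i> * of_real (Im (al h)))) (of_real t * be h))"
    "\<And>t. t \<in> {0..T} \<Longrightarrow> cmod (of_real t * be h) < cmod (1 + of_real t * (\<i> * of_real (Im (al h))))"
    "\<And>t. t \<in> {0..T} \<Longrightarrow> cjg (nrm (1 + of_real t * (\<i> * of_real (Im (al h)))) (of_real t * be h)) h = h"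
proof -
  define T where "T = 1 / (2 * (cmod (be h) + 1))"
  have T: "T > 0" by (simp add: T_def add_nonneg_pos)
  let ?a = "\<lambda>t. 1 + of_real t * (\<i> * of_real (Im (al h)))" and ?b = "\<lambda>t. of_real t * be h"
  have lt: "cmod (?b t) < cmod (?a t)" if "t \<in> {0..T}" for t
  proof -
    have "cmod (?b t) = t * cmod (be h)" using that by (simp add: norm_mult)
    also have "\<dots> \<le> T * cmod (be h)" using that by (intro mult_right_mono) auto
    also have "\<dots> < 1" using norm_ge_zero[of "be h"] by (simp add: T_def field_simps add_nonneg_pos del: norm_ge_zero)
    also have "1 \<le> cmod (?a t)" using complex_Re_le_cmod[of "?a t"] by simp
    finally show ?thesis .
  qed
  have "continuous_on {0..T} (\<lambda>t. nrm (?a t) (?b t))"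
    by (intro continuous_intros lt) (auto simp: complex_nonpos_Reals_iff)
  moreover have "cjg (nrm (?a t) (?b t)) h = h" if "t \<in> {0..T}" for t
    unfolding cjg_eq_iff
  proof (rule cov_commute)
    define s where "s = sqrt ((cmod (?a t))\<^sup>2 - (cmod (?b t))\<^sup>2)"
    have "al (nrm (?a t) (?b t)) = ?a t / of_real s" "be (nrm (?a t) (?b t)) = ?b t / of_real s"
      using lt[OF that] by (simp_all add: s_def)
    note X = this
    have key: "?a t * be h + ?b t * cnj (al h) = al h * ?b t + be h * cnj (?a t)"
      by (simp add: complex_eq_iff algebra_simps)
    show "al (nrm (?a t) (?b t) + h) = al (h + nrm (?a t) (?b t))"
      by (simp only: al_plus X complex_cnj_divide complex_cnj_complex_of_real) (simp add: mult_ac)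
    have "be (nrm (?a t) (?b t) + h) = (?a t * be h + ?b t * cnj (al h)) / of_real s"
      unfolding be_plus X by (rule div_comb)
    also have "\<dots> = be (h + nrm (?a t) (?b t))"
      unfolding be_plus X key complex_cnj_divide complex_cnj_complex_of_real by (rule div_comb'[symmetric])
    finally show "be (nrm (?a t) (?b t) + h) = be (h + nrm (?a t) (?b t))" .
  qed
  ultimately show ?thesis using that[OF T] lt by blast
qed

text \<open>Conjugating by the centraliser of \<open>h\<close> moves the axis of a parabolic element unless \<open>h\<close> fixes it.\<close>

lemma jform_twist:
  assumes "cmod b < cmod a" "a = 1 + of_real t * (\<i> * of_real (Im (al h)))" "b = of_real t * be h"
    and y: "Re (al y) = 1"
  shows "((cmod a)\<^sup>2 - (cmod b)\<^sup>2) * jform (cjg (nrm a b) y) y = - 2 * t\<^sup>2 * (jform h y)\<^sup>2"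
proof -
  define s where "s = sqrt ((cmod a)\<^sup>2 - (cmod b)\<^sup>2)"
  have s2: "s\<^sup>2 = (cmod a)\<^sup>2 - (cmod b)\<^sup>2" and s: "s > 0"
    using assms(1) by (simp_all add: s_def power2_strict_mono less_imp_le)
  define n where "n = Im (al y)" define m where "m = Im (al h)"
  define p q where "p = Re (be y)" and "q = Im (be y)"
  define k l where "k = Re (be h)" and "l = Im (be h)"
  \<comment> \<open>The traceless part of y is isotropic; this relation collapses the expression
    below to a square.\<close>
  have e1: "p\<^sup>2 + q\<^sup>2 = n\<^sup>2" using SU_sq[of y] y by (simp add: p_def q_def n_def cmod_power2)
  have a: "al (nrm a b) = a / of_real s" "be (nrm a b) = b / of_real s" using assms(1) by (simp_all add: s_def)
  have ab: "a = Complex 1 (t * m)" "b = Complex (t * k) (t * l)"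
    by (simp_all add: assms complex_eq_iff m_def k_def l_def)
  have y': "al y = Complex 1 n" "be y = Complex p q" using y by (simp_all add: complex_eq_iff n_def p_def q_def)
  have "s\<^sup>2 * Im (al (cjg (nrm a b) y)) = Im (of_real ((cmod a)\<^sup>2) * al y - of_real ((cmod b)\<^sup>2) * cnj (al y)
    + (b * cnj a * cnj (be y) - cnj b * a * be y))"
    using s unfolding al_cjg a by (simp add: norm_divide power_divide power2_eq_square field_simps)
  then have A: "s\<^sup>2 * Im (al (cjg (nrm a b) y)) = ((1 + (t * m)\<^sup>2) + (t * k)\<^sup>2 + (t * l)\<^sup>2) * n
     + 2 * ((t * l * 1 - t * k * (t * m)) * p - (t * k + t * l * (t * m)) * q)"
    by (simp add: ab y' cmod_power2 algebra_simps)
  have "of_real (s\<^sup>2) * be (cjg (nrm a b) y) = a * a * be y - b * b * cnj (be y) + a * b * (cnj (al y) - al y)"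
    using s unfolding be_cjg a by (simp add: power2_eq_square field_simps)
  then have B: "s\<^sup>2 * Re (be (cjg (nrm a b) y)) = Re (a * a * be y - b * b * cnj (be y) + a * b * (cnj (al y) - al y))"
    "s\<^sup>2 * Im (be (cjg (nrm a b) y)) = Im (a * a * be y - b * b * cnj (be y) + a * b * (cnj (al y) - al y))"
    by (metis Re_complex_of_real Im_complex_of_real Re_divide_of_real times_complex.sel mult_zero_left diff_0_right add_0_right mult.commute)+
  have "s\<^sup>2 * jform (cjg (nrm a b) y) y = (s\<^sup>2 * Re (be (cjg (nrm a b) y))) * p + (s\<^sup>2 * Im (be (cjg (nrm a b) y))) * q
     - (s\<^sup>2 * Im (al (cjg (nrm a b) y))) * n"
    by (simp add: jform_def y' algebra_simps)
  also have "\<dots> = - 2 * t\<^sup>2 * (k * p + l * q - m * n)\<^sup>2"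
    unfolding A B unfolding ab y' using e1 by (simp add: power2_eq_square) algebra
  also have "k * p + l * q - m * n = jform h y" by (simp add: jform_def k_def l_def m_def y')
  finally show ?thesis by (simp add: s2)
qed

section \<open>Genus zero\<close>

definition Sph :: "(nat \<Rightarrow> real) \<Rightarrow> nat \<Rightarrow> int \<Rightarrow> (nat \<Rightarrow> complex) set" where
  "Sph e p n = {x. (\<forall>i. x i \<noteq> 0) \<and> pp e x 0 p = cz n}"

text \<open>Non-vanishing of \<open>jform\<close> on the two parabolics, which means that they have
  distinct fixed points.\<close>

definition ncomm :: "(nat \<Rightarrow> real) \<Rightarrow> (nat \<Rightarrow> complex) \<Rightarrow> nat \<Rightarrow> nat \<Rightarrow> bool" where
  "ncomm e x i j \<longleftrightarrow> Re (x i * cnj (x j)) \<noteq> e i * e j * cmod (x i) * cmod (x j)"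

lemma cz_cancel: "cz n + (cz (- n) + w) = w" and cz_cancel': "cz (- n) + (cz n + w) = w"
  by (simp_all add: cz_add cz_0 flip: add.assoc)

lemma para_cancel: "para (- a) b + para a (- b) = 0"
  using uminus_para[of "- a" b] by (metis minus_minus right_minus)

lemma Re_al_para2:
  "\<bar>a\<bar> = 1 \<Longrightarrow> Re (al (para a d + para (- 1) c)) = 1 + a * cmod d * cmod c + Re (d * cnj c)"
  by (simp add: al_plus)

lemma pp_upd: "k < i \<or> k \<ge> i + n \<Longrightarrow> pp e (x(k := c)) i n = pp e x i n"
  by (rule pp_cong) auto

lemma continuous_on_fun_upd:
  fixes f :: "'a::topological_space \<Rightarrow> nat \<Rightarrow> 'b::topological_space"
  assumes "continuous_on S f" "continuous_on S g"
  shows "continuous_on S (\<lambda>z. (f z)(N := g z))"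
proof (rule continuous_on_coordinatewise_then_product)
  fix i
  show "continuous_on S (\<lambda>z. ((f z)(N := g z)) i)"
    using assms continuous_on_coord[OF assms(1)] by (cases "i = N") simp_all
qed

lemma continuous_on_gain [continuous_intros]:
  "continuous_on S f \<Longrightarrow> continuous_on S g \<Longrightarrow> continuous_on S (\<lambda>x. gain (f x) (g x))"
  unfolding gain_def by (intro continuous_intros)

text \<open>The fibres of the map that forgets the last two punctures are conics.\<close>

lemma connected_ncomm_end:
  assumes eN: "e N = 1" and e': "e (Suc N) = 1 \<or> e (Suc N) = -1"
    and B: "connected (Conf e 0 N (\<lambda>y. R (cz (- n) + y)))"
    and R: "\<And>y. R y \<Longrightarrow> Re (al y) \<noteq> 1 \<and> connected {c. Re (al (y + para 1 c)) = 1} \<and> (\<exists>c. Re (al (y + para 1 c)) = 1)"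
    and R': "\<And>y c. R y \<Longrightarrow> Re (al (y + para 1 c)) = 1 \<Longrightarrow> y + para 1 c = para (- e (Suc N)) (be (y + para 1 c))"
    and R'': "\<And>c d. c \<noteq> 0 \<Longrightarrow> d \<noteq> 0 \<Longrightarrow> Re (al (para (- e (Suc N)) d + para (- 1) c)) \<noteq> 1 \<Longrightarrow> R (para (- e (Suc N)) d + para (- 1) c)"
  shows "connected {x \<in> Sph e (N + 2) n. ncomm e x N (Suc N)}"
    and "{x \<in> Sph e (N + 2) n. ncomm e x N (Suc N)} = {} \<longleftrightarrow> Conf e 0 N (\<lambda>y. R (cz (- n) + y)) = {}"
proof -
  let ?B = "Conf e 0 N (\<lambda>y. R (cz (- n) + y))" and ?S = "{x \<in> Sph e (N + 2) n. ncomm e x N (Suc N)}"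
  define Y where "Y x = cz (- n) + pp e x 0 N" for x
  have Bdef: "x \<in> ?B \<longleftrightarrow> (\<forall>i. x i \<noteq> 0) \<and> R (Y x)" for x by (simp add: Conf_def Y_def)
  have contY: "continuous_on A Y" for A
    unfolding Y_def by (intro continuous_on_cov_plus continuous_on_const continuous_on_pp continuous_on_id)
  \<comment> \<open>Only the entry at N is recorded: half-trace 1 after it guarantees that the last
    parabolic exists, and the product then determines it.\<close>
  define E where "E = {(x, c). x \<in> ?B \<and> Re (al (Y x + para 1 c)) = 1}"
  have "connected E"
  proof (rule connected_fibration[OF B])
    fix x assume x: "x \<in> ?B"
    then have Rx: "R (Y x)" by (simp add: Bdef)
    show "connected {c. (x, c) \<in> E}" using R[OF Rx] x by (simp add: E_def)
    obtain c where c: "Re (al (Y x + para 1 c)) = 1" using R[OF Rx] by blast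
    \<comment> \<open>The gain is homogeneous, so rescaling the solution c at x by m / g solves the
      equation at nearby points, as long as m and g have the same sign.\<close>
    define m g where "m x = 1 - Re (al (Y x))" and "g x = gain (Y x) c" for x
    have cont: "continuous_on A m" "continuous_on A g" for A
      unfolding m_def g_def by (intro continuous_intros contY)+
    have mg: "g x = m x" "m x \<noteq> 0" using c R[OF Rx] by (auto simp: Re_para_gain m_def g_def)
    define U where "U = {x. m x * g x > 0}"
    have "open U" unfolding U_def by (intro open_Collect_less continuous_intros cont)
    moreover have "x \<in> U" using mg not_real_square_gt_zero[of "m x"] unfolding U_def by (metis mem_Collect_eq)
    moreover have "continuous_on (U \<inter> ?B) (\<lambda>x. of_real (m x / g x) * c)"
      by (intro continuous_intros cont) (auto simp: U_def)
    moreover have "(x', of_real (m x' / g x') * c) \<in> E" if "x' \<in> U \<inter> ?B" for x'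
    proof -
      have p: "m x' * g x' > 0" using that by (simp add: U_def)
      then have "m x' / g x' \<ge> 0" by (simp add: zero_less_mult_iff zero_le_divide_iff) linarith
      then have "gain (Y x') (of_real (m x' / g x') * c) = m x' / g x' * g x'"
        by (simp only: gain_scale g_def)
      also have "\<dots> = m x'" using p by auto
      finally show ?thesis using that by (simp add: E_def Re_para_gain m_def)
    qed
    ultimately show "\<exists>U s. open U \<and> x \<in> U \<and> continuous_on (U \<inter> ?B) s \<and> (\<forall>x'\<in>U \<inter> ?B. (x', s x') \<in> E)"
      by (intro exI[of _ U] exI[of _ "\<lambda>x. of_real (m x / g x) * c"]) blast
  qed (auto simp: E_def)
  define F where "F = (\<lambda>(x, c). (x(N := c))(Suc N := - be (Y x + para 1 c)))"
  have "continuous_on E F" unfolding F_def case_prod_unfold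
  proof (intro continuous_on_fun_upd)
    show "continuous_on E (\<lambda>z. - be (Y (fst z) + para 1 (snd z)))"
      by (intro continuous_intros continuous_on_compose2[OF contY]) auto
  qed (intro continuous_intros)+
  then have "connected (F ` E)" using \<open>connected E\<close> by (rule connected_continuous_image)
  also have FE: "F ` E = ?S"
  proof (intro equalityI subsetI)
    fix z assume "z \<in> F ` E"
    then obtain x c where xc: "x \<in> ?B" "Re (al (Y x + para 1 c)) = 1" "z = F (x, c)" by (auto simp: E_def)
    have Rx: "R (Y x)" using xc by (simp add: Bdef)
    let ?d = "be (Y x + para 1 c)"
    have eq: "Y x + para 1 c = para (- e (Suc N)) ?d" by (rule R'[OF Rx xc(2)])
    have c0: "c \<noteq> 0" using R[OF Rx] xc(2) by auto
    have "?d \<noteq> 0"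
    proof
      assume "?d = 0"
      then have "Y x + para 1 c = 0" using eq by simp
      then have "Y x = - para 1 c" by (simp add: eq_neg_iff_add_eq_0)
      then show False using R[OF Rx] by simp
    qed
    have z: "z = (x(N := c))(Suc N := - ?d)" using xc by (simp add: F_def)
    have pz: "pp e z 0 N = pp e x 0 N" by (simp add: z pp_upd)
    have "cz (- n) + pp e z 0 (N + 2) = Y x + para 1 c + para (e (Suc N)) (- ?d)"
    proof -
      have "z N = c" "z (Suc N) = - ?d" by (simp_all add: z)
      then have "pp e z 0 (N + 2) = pp e x 0 N + para 1 c + para (e (Suc N)) (- ?d)"
        using eN by (simp add: pz)
      then show ?thesis by (simp only: Y_def add.assoc)
    qed
    also have "\<dots> = 0" by (subst eq) (rule para_cancel)
    finally have "cz n + (cz (- n) + pp e z 0 (N + 2)) = cz n" by simp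
    then have "pp e z 0 (N + 2) = cz n" unfolding cz_cancel .
    moreover have "z i \<noteq> 0" for i using xc(1) c0 \<open>?d \<noteq> 0\<close> by (simp add: z Bdef)
    ultimately have zS: "z \<in> Sph e (N + 2) n" by (simp add: Sph_def)
    have "Y x = para (- e (Suc N)) ?d + para (- 1) (- c)"
      using eq by (metis add.assoc add.right_neutral right_minus uminus_para)
    then have "Re (al (Y x)) = Re (al (para (- e (Suc N)) ?d + para (- 1) (- c)))" by (rule arg_cong)
    then have "Re (al (Y x)) = 1 - e (Suc N) * cmod ?d * cmod c - Re (?d * cnj c)"
      using Re_al_para2[of "- e (Suc N)" ?d "- c"] e' by auto
    moreover have "Re (al (Y x)) \<noteq> 1" using R[OF Rx] by blast
    moreover have "z N = c" "z (Suc N) = - ?d" by (simp_all add: z)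
    ultimately have "ncomm e z N (Suc N)" using eN unfolding ncomm_def by (simp add: algebra_simps)
    then show "z \<in> ?S" using zS by simp
  next
    fix z assume z: "z \<in> ?S"
    then have "Y z + (para 1 (z N) + para (e (Suc N)) (z (Suc N))) = 0"
      using eN by (auto simp: Sph_def Y_def add.assoc cz_add cz_0)
    then have "Y z = - (para 1 (z N) + para (e (Suc N)) (z (Suc N)))" by (simp add: eq_neg_iff_add_eq_0)
    also have "\<dots> = para (- e (Suc N)) (- z (Suc N)) + para (- 1) (- z N)"
      by (simp add: minus_add uminus_para)
    finally have Yz: "Y z = para (- e (Suc N)) (- z (Suc N)) + para (- 1) (- z N)" .
    then have "Re (al (Y z)) = 1 - e (Suc N) * cmod (z (Suc N)) * cmod (z N) + Re (z (Suc N) * cnj (z N))"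
      using Re_al_para2[of "- e (Suc N)" "- z (Suc N)" "- z N"] e' by auto
    then have "Re (al (Y z)) \<noteq> 1" using z eN by (auto simp: ncomm_def algebra_simps)
    then have "R (Y z)" using R''[of "- z N" "- z (Suc N)"] z unfolding Yz by (auto simp: Sph_def)
    then have "z \<in> ?B" using z by (auto simp: Bdef Sph_def)
    have eq: "Y z + para 1 (z N) = para (- e (Suc N)) (- z (Suc N))"
      unfolding Yz using uminus_para[of "1" "z N"] by (simp add: add.assoc flip: uminus_para)
    then have "(z, z N) \<in> E" using \<open>z \<in> ?B\<close> e' by (auto simp: E_def)
    moreover have "F (z, z N) = z" by (auto simp: F_def eq)
    ultimately show "z \<in> F ` E" by (metis image_eqI)
  qed
  finally show "connected ?S" .
  show "?S = {} \<longleftrightarrow> ?B = {}"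
  proof -
    have "\<exists>c. (x, c) \<in> E" if "x \<in> ?B" for x
      using R[of "Y x"] that by (simp add: E_def Bdef)
    then have "E = {} \<longleftrightarrow> ?B = {}" unfolding E_def by blast
    then show ?thesis using FE by blast
  qed
qed

text \<open>The solutions form the conic \<open>gain y c = 1 - Re (al y)\<close>. A positive level
  is wanted, so for half-trace above 1 both sides change sign.\<close>

lemma connected_slice_level:
  assumes "Re (al y) \<noteq> 1" "Re (al y) > 1 \<Longrightarrow> - Im (al y) < cmod (be y)" "Re (al y) < 1 \<Longrightarrow> Im (al y) < cmod (be y)"
  shows "connected {c. Re (al (y + para 1 c)) = 1} \<and> (\<exists>c. Re (al (y + para 1 c)) = 1)"
proof (cases "Re (al y) > 1")
  case True
  have e: "Re (al (y + para 1 c)) = 1 \<longleftrightarrow> Re (- be y * cnj c) - (- Im (al y)) * cmod c \<in> {Re (al y) - 1}" for c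
    by (auto simp: Re_para_gain gain_def)
  have "connected {c. Re (al (y + para 1 c)) = 1}"
    unfolding e using True by (intro connected_conic) auto
  moreover obtain c where "Re (- be y * cnj c) - (- Im (al y)) * cmod c = Re (al y) - 1"
    using conic_nonempty[of "- Im (al y)" "- be y" "Re (al y) - 1"] assms(2) True by auto
  ultimately show ?thesis unfolding e by blast
next
  case False
  then have lt: "Re (al y) < 1" using assms(1) by simp
  have e: "Re (al (y + para 1 c)) = 1 \<longleftrightarrow> Re (be y * cnj c) - Im (al y) * cmod c \<in> {1 - Re (al y)}" for c
    by (auto simp: Re_para_gain gain_def)
  have "connected {c. Re (al (y + para 1 c)) = 1}"
    unfolding e using lt by (intro connected_conic) auto
  moreover obtain c where "Re (be y * cnj c) - Im (al y) * cmod c = 1 - Re (al y)"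
    using conic_nonempty[of "Im (al y)" "be y" "1 - Re (al y)"] assms(3) lt by auto
  ultimately show ?thesis unfolding e by blast
qed

lemma hyp_be_Im: "Re (al y) > 1 \<Longrightarrow> \<bar>Im (al y)\<bar> < cmod (be y)"
proof -
  assume "Re (al y) > 1"
  then have "(Re (al y))\<^sup>2 > 1"
    using mult_strict_mono[of 1 "Re (al y)" 1 "Re (al y)"] by (simp add: power2_eq_square)
  then have "\<bar>Im (al y)\<bar>\<^sup>2 < (cmod (be y))\<^sup>2" using SU_sq[of y] by simp
  then show ?thesis by (rule power2_less_imp_less) simp
qed

lemma th_para_bounds: "c \<noteq> 0 \<Longrightarrow> 0 < th (para 1 c) \<and> th (para 1 c) < pi / 2"
  "c \<noteq> 0 \<Longrightarrow> - pi / 2 < th (para (- 1) c) \<and> th (para (- 1) c) < 0"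
  using abs_arctan_less[of "cmod c"] by (auto simp: th_para)

lemma th_plus_para_neg:
  assumes "c \<noteq> 0" shows "th y - pi < th (y + para (- 1) c)" "th (y + para (- 1) c) < th y"
proof -
  have "mir (y + para (- 1) c) = mir y + para 1 (cnj c)" by (simp add: mir_plus mir_para)
  then have "th (mir y + para 1 (cnj c)) = - th (y + para (- 1) c)" by (metis mir_simps(1))
  then show "th y - pi < th (y + para (- 1) c)" "th (y + para (- 1) c) < th y"
    using th_plus_para[of "cnj c" "mir y"] assms by simp_all
qed

text \<open>The inverse of a product of a positive and a negative parabolic with distinct fixed
  points is hyperbolic of level 0, so the first N factors multiply into
  \<open>between n n\<close>.\<close>

lemma connected_ncomm_pm:
  assumes "signs e N" "e N = 1" "e (Suc N) = -1"
  shows "connected {x \<in> Sph e (N + 2) n. ncomm e x N (Suc N)}"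
    and "{x \<in> Sph e (N + 2) n. ncomm e x N (Suc N)} \<noteq> {} \<longleftrightarrow> n < cnt e N 1 \<and> - cnt e N (-1) < n"
proof -
  have e: "Conf e 0 N (\<lambda>y. between 0 0 (cz (- n) + y)) = Conf e 0 N (between n n)"
    by (rule Conf_cong) (simp add: Up_shift Dn_shift)
  note cc = connected_ncomm_end[of e N "between 0 0" n]
  have 1: "Re (al y) > 1" "\<bar>th y\<bar> < pi / 2" if "between 0 0 y" for y
    using that by (auto simp: Up_def Dn_def)
  have A: "Re (al y) \<noteq> 1 \<and> connected {c. Re (al (y + para 1 c)) = 1} \<and> (\<exists>c. Re (al (y + para 1 c)) = 1)"
    if "between 0 0 y" for y
    using connected_slice_level[of y] 1[OF that] hyp_be_Im[of y] by auto
  have B: "y + para 1 c = para (- e (Suc N)) (be (y + para 1 c))" if y: "between 0 0 y" "Re (al (y + para 1 c)) = 1" for y c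
  proof -
    have c: "c \<noteq> 0" using 1[OF y(1)] y(2) by auto
    have "th (y + para 1 c) > 0" using Up_para[of 0 y c] y by (simp add: Up_def)
    moreover have "th (y + para 1 c) < 3 * pi / 2" using th_plus_para[OF c, of y] 1[OF y(1)] by linarith
    moreover have "cos (th (y + para 1 c)) > 0" using Re_al_pos_cos[of "y + para 1 c"] y(2) by simp
    ultimately have "y + para 1 c = para 1 (be (y + para 1 c))"
      using cos_pos_range[of "th (y + para 1 c)"] pi_gt_zero by (intro para_char_pos y) linarith+
    then show ?thesis using assms by simp
  qed
  have C: "between 0 0 (para (- e (Suc N)) d + para (- 1) c)"
    if cd: "c \<noteq> 0" "d \<noteq> 0" "Re (al (para (- e (Suc N)) d + para (- 1) c)) \<noteq> 1" for c d
  proof -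
    let ?y = "para 1 d + para (- 1) c"
    have re: "Re (al ?y) = 1 + cmod d * cmod c + Re (d * cnj c)" by (simp add: Re_al_para2)
    have "\<bar>Re (d * cnj c)\<bar> \<le> cmod d * cmod c" using abs_Re_le_cmod[of "d * cnj c"] by (simp add: norm_mult)
    then have r: "Re (al ?y) > 1" using re cd(3) assms(3) by simp
    have "th ?y < pi / 2" "th ?y > - pi"
      using th_plus_para_neg[OF cd(1), of "para 1 d"] th_para_bounds(1)[OF cd(2)] by linarith+
    moreover have "cos (th ?y) > 0" using Re_al_pos_cos[of ?y] r by simp
    ultimately have "\<bar>th ?y\<bar> < pi / 2" using cos_pos_range[of "th ?y"] pi_gt_zero by (simp add: abs_less_iff)
    then show ?thesis using r assms(3) by (auto simp: Up_def Dn_def abs_less_iff)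
  qed
  have D: "connected (Conf e 0 N (\<lambda>y. between 0 0 (cz (- n) + y)))"
    unfolding e by (rule Conf_between(1)[OF assms(1)]) simp
  show "connected {x \<in> Sph e (N + 2) n. ncomm e x N (Suc N)}"
    by (rule cc(1)[OF assms(2) disjI2[OF assms(3)] D A B C])
  show "{x \<in> Sph e (N + 2) n. ncomm e x N (Suc N)} \<noteq> {} \<longleftrightarrow> n < cnt e N 1 \<and> - cnt e N (-1) < n"
    using cc(2)[OF assms(2) disjI2[OF assms(3)] D A B C] Conf_between(2)[OF assms(1), of n n 0]
    unfolding e by blast
qed

text \<open>The inverse of a product of two positive parabolics with distinct fixed points has
  half-trace below 1 and may be elliptic. It ranges in a region with a hyperbolic level only at its
  lower end, which is the reason for \<open>Below\<close>.\<close>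

lemma connected_ncomm_pp:
  assumes "\<And>i. i < N + 2 \<Longrightarrow> e i = 1"
  shows "connected {x \<in> Sph e (N + 2) n. ncomm e x N (Suc N)}"
    and "{x \<in> Sph e (N + 2) n. ncomm e x N (Suc N)} \<noteq> {} \<longleftrightarrow> n - 1 < int N \<and> n \<ge> 1"
proof -
  let ?R = "\<lambda>y. Up (- 1) y \<and> Below 0 y"
  have e: "Conf e 0 N (\<lambda>y. ?R (cz (- n) + y)) = Conf e 0 N (\<lambda>y. Up (n - 1) y \<and> Below n y)"
    by (rule Conf_cong) (simp add: Up_shift Below_shift)
  have eN: "e N = 1" "e (Suc N) = 1" using assms by auto
  note cc = connected_ncomm_end[of e N ?R n]
  have 1: "Re (al y) < 1 \<and> th y < 0 \<and> th y > - 3 * pi / 2 \<and> \<not> Up 0 y" if y: "?R y" for y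
  proof -
    have th: "th y < 0" "th y > - 3 * pi / 2" using y by (auto simp: Up_def Below_def)
    have "Re (al y) < 1"
    proof (cases "th y < - pi / 2")
      case True
      then have "\<not> Re (al y) > 0" using Re_al_pos_cos[of y] cos_pos_range[of "th y"] th pi_gt_zero by auto
      then show ?thesis by simp
    qed (use y in \<open>auto simp: Below_def\<close>)
    then show ?thesis using th by (auto simp: Up_def)
  qed
  have A: "Re (al y) \<noteq> 1 \<and> connected {c. Re (al (y + para 1 c)) = 1} \<and> (\<exists>c. Re (al (y + para 1 c)) = 1)"
    if y: "?R y" for y
  proof -
    have "y \<noteq> 0" using 1[OF y] by auto
    then have "Im (al y) < cmod (be y)" using not_Up_0_be[of y] 1[OF y] y by blast
    then show ?thesis using connected_slice_level[of y] 1[OF y] by auto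
  qed
  have B: "y + para 1 c = para (- e (Suc N)) (be (y + para 1 c))" if y: "?R y" "Re (al (y + para 1 c)) = 1" for y c
  proof -
    note 1 = 1[OF y(1)]
    have c: "c \<noteq> 0" using 1 y(2) by auto
    have g: "gain y c = 1 - Re (al y)" using y(2) by (simp add: Re_para_gain)
    \<comment> \<open>Reaching \<open>th = 0\<close> with half-trace 1 means reaching the identity,
      and then y would be parabolic, against its half-trace below 1.\<close>
    have t0: "th (y + para 1 c) < 0"
    proof (rule ccontr)
      assume "\<not> th (y + para 1 c) < 0"
      then obtain t where t: "0 \<le> t" "t \<le> 1" "th (y + para 1 (of_real t * c)) = 0" "Re (al y) + t * gain y c \<ge> 1"
        using ray_cross[of 0 1 y c 0] 1 by auto
      have "t * gain y c \<ge> 1 * gain y c" using t(4) g by simp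
      then have "1 \<le> t" by (rule mult_right_le_imp_le) (use 1 g in simp)
      then have th0: "th (y + para 1 c) = 0" using t by simp
      then have "cmod (al (y + para 1 c)) = 1" using th_eq_int_pi[of "y + para 1 c" 0] y(2) by simp
      then have "be (y + para 1 c) = 0" by (simp add: cmod_al)
      then have "y + para 1 c = 0" using th0 by (intro cov_eqI) auto
      then have "y = - para 1 c" by (simp add: eq_neg_iff_add_eq_0)
      then show False using 1 by simp
    qed
    moreover have "th (y + para 1 c) > - 3 * pi / 2" using th_plus_para[OF c, of y] 1 by linarith
    moreover have "cos (th (y + para 1 c)) > 0" using Re_al_pos_cos[of "y + para 1 c"] y(2) by simp
    ultimately have "y + para 1 c = para (- 1) (be (y + para 1 c))"
      using cos_pos_range[of "th (y + para 1 c)"] pi_gt_zero by (intro para_char_neg y) linarith+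
    then show ?thesis using eN by simp
  qed
  have C: "?R (para (- e (Suc N)) d + para (- 1) c)"
    if cd: "c \<noteq> 0" "d \<noteq> 0" "Re (al (para (- e (Suc N)) d + para (- 1) c)) \<noteq> 1" for c d
  proof -
    let ?y = "para (- 1) d + para (- 1) c"
    have re: "Re (al ?y) = 1 - cmod d * cmod c + Re (d * cnj c)" by (simp add: Re_al_para2)
    have "\<bar>Re (d * cnj c)\<bar> \<le> cmod d * cmod c" using abs_Re_le_cmod[of "d * cnj c"] by (simp add: norm_mult)
    then have r: "Re (al ?y) < 1" using re cd(3) eN by simp
    have th: "th ?y < 0" "th ?y > - 3 * pi / 2"
      using th_plus_para_neg[OF cd(1), of "para (- 1) d"] th_para_bounds(2)[OF cd(2)] by linarith+
    have "Re (al (?y + para 1 (- c))) = 1"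
    proof -
      have "?y + para 1 (- c) = para (- 1) d" using uminus_para[of "-1" c]
        by (metis add.assoc add.right_neutral minus_minus right_minus)
      then show ?thesis by simp
    qed
    then have "Up (- 1) ?y" using not_Up_minus_1_gain[of ?y "- c"] th by auto
    then show ?thesis using r th eN by (auto simp: Below_def)
  qed
  have D: "connected (Conf e 0 N (\<lambda>y. ?R (cz (- n) + y)))"
    unfolding e by (rule Conf_below(1)) (use assms in auto)
  show "connected {x \<in> Sph e (N + 2) n. ncomm e x N (Suc N)}"
    by (rule cc(1)[OF eN(1) disjI1[OF eN(2)] D A B C])
  show "{x \<in> Sph e (N + 2) n. ncomm e x N (Suc N)} \<noteq> {} \<longleftrightarrow> n - 1 < int N \<and> n \<ge> 1"
  proof -
    have "Conf e 0 N (\<lambda>y. Up (n - 1) y \<and> Below n y) \<noteq> {} \<longleftrightarrow> n - 1 < int N \<and> n \<ge> 1"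
      by (rule Conf_below(2)) (use assms in auto)
    then show ?thesis using cc(2)[OF eN(1) disjI1[OF eN(2)] D A B C] unfolding e by blast
  qed
qed

text \<open>The equality case of the Cauchy-Schwarz inequality in the plane.\<close>

lemma parallel_complex:
  assumes "Re (a * cnj b) = s * cmod a * cmod b" "s = 1 \<or> s = -1"
  shows "b * of_real (cmod a) = of_real (s * cmod b) * a"
proof -
  have *: "(cmod (p - q))\<^sup>2 = (cmod p)\<^sup>2 + (cmod q)\<^sup>2 - 2 * Re (p * cnj q)" for p q
    by (simp add: cmod_power2) (simp add: power2_eq_square algebra_simps)
  have "Re (b * of_real (cmod a) * cnj (of_real (s * cmod b) * a)) = s * cmod a * cmod b * Re (a * cnj b)"
    by (simp add: algebra_simps)
  also have "\<dots> = (cmod a * cmod b)\<^sup>2"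
    unfolding assms(1) using assms(2) by (auto simp: power2_eq_square)
  finally have "(cmod (b * of_real (cmod a) - of_real (s * cmod b) * a))\<^sup>2 = 0"
    unfolding * using assms(2) by (auto simp: norm_mult power_mult_distrib)
  then show ?thesis by simp
qed

lemma unit_sign_iff: "s = 1 \<or> s = -1 \<Longrightarrow> X = of_real (s * m) * u \<longleftrightarrow> of_real s * X = of_real m * (u :: complex)"
  by (auto simp: neg_equal_iff_equal) (metis minus_minus)+

lemma pp_split2:
  assumes "Suc i < p"
  shows "pp e y 0 p = pp e y 0 i + (para (e i) (y i) + para (e (Suc i)) (y (Suc i))) + pp e y (i + 2) (p - (i + 2))"
proof -
  have "p = i + (2 + (p - (i + 2)))" using assms by simp
  then have "pp e y 0 p = pp e y 0 i + (pp e y i 2 + pp e y (i + 2) (p - (i + 2)))"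
    by (metis add_0 pp_add)
  moreover have "pp e y i 2 = para (e i) (y i) + para (e (Suc i)) (y (Suc i))" by (simp add: numeral_2_eq_2)
  ultimately show ?thesis by (simp add: add.assoc)
qed

section \<open>Twisting two neighbouring punctures\<close>

lemma Sph_pair_path:
  assumes x: "x \<in> Sph e p n" "Suc i < p"
    and g: "continuous_on {0..T} g1" "continuous_on {0..T} g2"
      "\<And>t. t \<in> {0..T} \<Longrightarrow> g1 t \<noteq> 0 \<and> g2 t \<noteq> 0"
      "\<And>t. t \<in> {0..T} \<Longrightarrow> para (e i) (g1 t) + para (e (Suc i)) (g2 t) = para (e i) (x i) + para (e (Suc i)) (x (Suc i))"
    and P: "continuous_on (Sph e p n) P" and st: "s \<in> {0..T::real}" "t \<in> {0..T}"
  shows "P (x(i := g1 s, Suc i := g2 s)) = (P (x(i := g1 t, Suc i := g2 t)) :: bool)"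
    and "x(i := g1 t, Suc i := g2 t) \<in> Sph e p n"
proof -
  have S: "x(i := g1 t, Suc i := g2 t) \<in> Sph e p n" if t: "t \<in> {0..T}" for t
  proof -
    let ?y = "x(i := g1 t, Suc i := g2 t)"
    have "pp e ?y 0 p = pp e x 0 p"
      unfolding pp_split2[OF x(2)] using g(4)[OF t] by (simp add: pp_upd)
    then show ?thesis using x(1) g(3)[OF t] by (simp add: Sph_def)
  qed
  then show "x(i := g1 t, Suc i := g2 t) \<in> Sph e p n" using st by blast
  have "continuous_on {0..T} (\<lambda>t. P (x(i := g1 t, Suc i := g2 t)))"
    by (rule continuous_on_compose2[OF P]) (use S in \<open>auto intro!: continuous_on_fun_upd g continuous_on_const\<close>)
  then obtain c where "\<forall>t\<in>{0..T}. P (x(i := g1 t, Suc i := g2 t)) = c"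
    using connectedD_const[OF connected_Icc] by blast
  then show "P (x(i := g1 s, Suc i := g2 s)) = P (x(i := g1 t, Suc i := g2 t))"
    using st by blast
qed

lemma jform_plus_para:
  assumes "\<bar>e1\<bar> = 1" "\<bar>e2\<bar> = 1"
  shows "jform (para e1 c + para e2 d) (para e2 d) = jform (para e1 c) (para e2 d)"
proof -
  have e2: "e2 * e2 = 1" using assms(2) by (metis abs_mult_self_eq mult_1)
  have d: "Re d * Re d + Im d * Im d = cmod d * cmod d" by (metis cmod_power2 power2_eq_square)
  have "jform (para e1 c + para e2 d) (para e2 d) = (Re d * Re d + Im d * Im d) - e2 * e2 * (cmod d * cmod d)
     + (Re (c * cnj d) - e1 * e2 * cmod c * cmod d)"
    using assms by (simp add: jform_def al_plus be_plus algebra_simps)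
  then show ?thesis using assms by (simp add: d e2 jform_para)
qed

text \<open>Conjugating \<open>C\<^sub>i, C\<^sub>i\<^sub>+\<^sub>1\<close> by the centraliser of their product makes \<open>C\<^sub>i\<^sub>+\<^sub>1\<close> and \<open>C\<^sub>i\<^sub>+\<^sub>2\<close> non-commuting.\<close>

lemma twist_step:
  assumes e: "signs e p" and x: "x \<in> Sph e p n" "Suc (Suc i) < p" "ncomm e x i (Suc i)"
    and P: "continuous_on (Sph e p n) (P :: _ \<Rightarrow> bool)"
  obtains x' where "x' \<in> Sph e p n" "P x' = P x" "ncomm e x' (Suc i) (Suc (Suc i))"
proof (cases "ncomm e x (Suc i) (Suc (Suc i))")
  case True then show ?thesis using that x by blast
next
  case False
  let ?i = "Suc i" and ?k = "Suc (Suc i)"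
  have ei: "e j = 1 \<or> e j = -1" if "j \<le> ?k" for j using e that x(2) by (auto simp: signs_def)
  have e1: "\<bar>e j\<bar> = 1" if "j \<le> ?k" for j using ei[OF that] by auto
  have xn: "x j \<noteq> 0" for j using x(1) by (simp add: Sph_def)
  define y1 y2 where "y1 = para (e i) (x i)" and "y2 = para (e ?i) (x ?i)"
  obtain T where T: "T > 0" "continuous_on {0..T} (\<lambda>t. nrm (1 + of_real t * (\<i> * of_real (Im (al (y1 + y2))))) (of_real t * be (y1 + y2)))"
    "\<And>t. t \<in> {0..T} \<Longrightarrow> cmod (of_real t * be (y1 + y2)) < cmod (1 + of_real t * (\<i> * of_real (Im (al (y1 + y2)))))"
    "\<And>t. t \<in> {0..T} \<Longrightarrow> cjg (nrm (1 + of_real t * (\<i> * of_real (Im (al (y1 + y2))))) (of_real t * be (y1 + y2))) (y1 + y2) = y1 + y2"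
    by (rule centralizer_path[where h = "y1 + y2"]) (rule that)
  define G where "G t = nrm (1 + of_real t * (\<i> * of_real (Im (al (y1 + y2))))) (of_real t * be (y1 + y2))" for t :: real
  define g1 g2 where "g1 t = be (cjg (G t) y1)" and "g2 t = be (cjg (G t) y2)" for t
  have Gc: "continuous_on {0..T} G" using T(2) by (simp add: G_def)
  have cp: "cjg (G t) y1 = para (e i) (g1 t)" "cjg (G t) y2 = para (e ?i) (g2 t)" for t
    unfolding g1_def g2_def y1_def y2_def by (intro cjg_para ei xn; simp)+
  have nz: "g1 t \<noteq> 0 \<and> g2 t \<noteq> 0" for t
    unfolding g1_def g2_def y1_def y2_def using be_cjg_para_nz[OF ei xn] by simp
  have sum: "para (e i) (g1 t) + para (e ?i) (g2 t) = para (e i) (x i) + para (e ?i) (x ?i)" if "t \<in> {0..T}" for t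
    using T(4)[OF that] by (simp add: G_def[symmetric] cjg_plus cp) (simp add: y1_def y2_def)
  have c: "continuous_on {0..T} g1" "continuous_on {0..T} g2"
    unfolding g1_def g2_def by (intro continuous_intros Gc)+
  have i: "Suc i < p" using x(2) by simp
  note path = Sph_pair_path[OF x(1) i c nz sum P]
  have "G 0 = 0" by (rule cov_eqI) (simp_all add: G_def th_nrm)
  then have "g1 0 = x i" "g2 0 = x ?i" by (simp_all add: g1_def g2_def y1_def y2_def)
  then have x0: "x(i := g1 0, ?i := g2 0) = x" by simp
  define x' where "x' = x(i := g1 T, ?i := g2 T)"
  have "x' \<in> Sph e p n" unfolding x'_def by (rule path(2)[of 0 T]) (use T in auto)
  moreover have "P x' = P x" using path(1)[of 0 T] T x0 by (simp add: x'_def)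
  moreover have "ncomm e x' ?i ?k"
  proof (rule ccontr)
    \<comment> \<open>Before the twist \<open>x ?k\<close> was a real multiple of
      \<open>x ?i\<close>. If the pair still commuted afterwards, \<open>y2\<close> and its
      conjugate would share the fixed point, and \<open>jform_twist\<close> would make
      \<open>y1\<close> and \<open>y2\<close> commute.\<close>
    assume "\<not> ncomm e x' ?i ?k"
    then have *: "Re (x' ?i * cnj (x' ?k)) = e ?i * e ?k * cmod (x' ?i) * cmod (x' ?k)"
      by (simp add: ncomm_def)
    have x'v: "x' ?i = g2 T" "x' ?k = x ?k" by (simp_all add: x'_def)
    have J: "jform (cjg (G T) y2) (para (e ?k) (x ?k)) = 0"
      unfolding cp using * e1 by (simp add: jform_para x'v)
    have "Re (x ?i * cnj (x ?k)) = (e ?i * e ?k) * cmod (x ?i) * cmod (x ?k)"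
      using False by (simp add: ncomm_def)
    moreover have "e ?i * e ?k = 1 \<or> e ?i * e ?k = -1" using ei[of ?i] ei[of ?k] by auto
    ultimately have par: "x ?k * of_real (cmod (x ?i)) = of_real (e ?i * e ?k * cmod (x ?k)) * x ?i"
      by (rule parallel_complex)
    define k where "k = e ?i * e ?k * cmod (x ?k) / cmod (x ?i)"
    have xk: "x ?k = of_real k * x ?i" using par xn[of ?i] by (simp add: k_def field_simps)
    have k0: "k \<noteq> 0" using xk xn[of ?k] by auto
    have "e ?k * cmod (x ?k) = k * (e ?i * cmod (x ?i))"
      using xn[of ?i] ei[of ?i] by (auto simp: k_def)
    then have "jform w (para (e ?k) (x ?k)) = k * jform w y2" for w
      using e1 by (simp add: jform_def y2_def xk[symmetric]) (simp add: xk algebra_simps)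
    then have "jform (cjg (G T) y2) y2 = 0" using J k0 by simp
    moreover have "Re (al y2) = 1" using e1 by (simp add: y2_def)
    ultimately have "0 = - 2 * T\<^sup>2 * (jform (y1 + y2) y2)\<^sup>2"
      using jform_twist[OF T(3) HOL.refl HOL.refl, of T y2] T(1) by (simp add: G_def)
    then have "jform y1 y2 = 0" using T(1) jform_plus_para[of "e i" "e ?i"] e1 by (simp add: y1_def y2_def)
    then show False using x(3) e1 by (simp add: y1_def y2_def jform_para ncomm_def)
  qed
  ultimately show ?thesis by (rule that)
qed

lemma twist_to_end:
  assumes e: "signs e p" and P: "continuous_on (Sph e p n) (P :: _ \<Rightarrow> bool)"
  shows "x \<in> Sph e p n \<Longrightarrow> Suc i < p \<Longrightarrow> ncomm e x i (Suc i) \<Longrightarrow>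
    \<exists>x'\<in>Sph e p n. P x' = P x \<and> ncomm e x' (p - 2) (Suc (p - 2))"
proof (induction "p - 2 - i" arbitrary: i x)
  case 0
  then have "i = p - 2" by simp
  then show ?case using 0 by blast
next
  case (Suc k)
  then have i: "Suc (Suc i) < p" by simp
  obtain x' where x': "x' \<in> Sph e p n" "P x' = P x" "ncomm e x' (Suc i) (Suc (Suc i))"
    using twist_step[OF e Suc.prems(1) i Suc.prems(3) P] by blast
  have "k = p - 2 - Suc i" using Suc(2) by simp
  then show ?case using Suc.hyps(1)[OF _ x'(1) i x'(3)] x'(2) by auto
qed

section \<open>Configurations with a common fixed point\<close>

definition comm_all :: "(nat \<Rightarrow> real) \<Rightarrow> nat \<Rightarrow> (nat \<Rightarrow> complex) \<Rightarrow> bool" where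
  "comm_all e p x \<longleftrightarrow> (\<forall>i. Suc i < p \<longrightarrow> \<not> ncomm e x i (Suc i))"

text \<open>Commuting is transitive among non-trivial parabolics, so conditions on neighbours
  already give a common axis.\<close>

lemma comm_all_axis:
  assumes e: "signs e p" and x: "\<And>i. x i \<noteq> 0" "comm_all e p x"
  obtains u where "cmod u = 1" "\<And>i. i < p \<Longrightarrow> x i = of_real (e i * cmod (x i)) * u"
proof -
  define u where "u = of_real (e 0) * x 0 / of_real (cmod (x 0))"
  have *: "x i = of_real (e i * cmod (x i)) * u" if "i < p" for i
    using that
  proof (induction i)
    case 0
    then have "e 0 * e 0 = 1" using e by (auto simp: signs_def)
    then show ?case using x(1)[of 0] by (simp add: u_def field_simps flip: of_real_mult)
  next
    case (Suc i)
    have ei: "e i = 1 \<or> e i = -1" "e (Suc i) = 1 \<or> e (Suc i) = -1" using e Suc by (auto simp: signs_def)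
    have "Re (x i * cnj (x (Suc i))) = (e i * e (Suc i)) * cmod (x i) * cmod (x (Suc i))"
      using x(2) Suc by (simp add: comm_all_def ncomm_def)
    then have par: "x (Suc i) * of_real (cmod (x i)) = of_real (e i * e (Suc i) * cmod (x (Suc i))) * x i"
      by (rule parallel_complex) (use ei in auto)
    moreover have "of_real (e i) * x i = of_real (cmod (x i)) * u"
      using Suc unit_sign_iff[OF ei(1)] by simp
    then have "of_real (e i * e (Suc i) * cmod (x (Suc i))) * x i = of_real (e (Suc i) * cmod (x (Suc i))) * u * of_real (cmod (x i))"
      by (simp add: mult_ac)
    ultimately have "x (Suc i) * of_real (cmod (x i)) = of_real (e (Suc i) * cmod (x (Suc i))) * u * of_real (cmod (x i))"
      by simp
    then show ?case using x(1)[of i] by simp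
  qed
  show ?thesis
  proof (cases "p = 0")
    case True then show ?thesis using that[of 1] by simp
  next
    case False
    then have "\<bar>e 0\<bar> = 1" using e by (auto simp: signs_def)
    then have "cmod u = 1" using x(1)[of 0] by (simp add: u_def norm_mult norm_divide)
    then show ?thesis using that * by blast
  qed
qed

lemma pp_axis:
  assumes "cmod u = 1" "\<And>j. i \<le> j \<Longrightarrow> j < i + k \<Longrightarrow> (e j = 1 \<or> e j = -1) \<and> r j \<ge> 0 \<and> x j = of_real (e j * r j) * u"
  shows "pp e x i k = unip (\<Sum>j=i..<i+k. e j * r j) u"
  using assms(2)
proof (induction k)
  case (Suc k)
  have "para (e (i + k)) (x (i + k)) = unip (e (i + k) * r (i + k)) u"
    using Suc.prems[of "i + k"] assms(1) by (simp add: unip_para)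
  then show ?case using Suc assms(1) by (simp add: unip_add)
qed simp

lemma unip_eq_cz: "cmod u = 1 \<Longrightarrow> unip t u = cz n \<longleftrightarrow> t = 0 \<and> n = 0"
proof
  assume u: "cmod u = 1" and "unip t u = cz n"
  then have "be (unip t u) = be (cz n)" by simp
  then have t: "t = 0" using u by auto
  then have "cz n = cz 0" using \<open>unip t u = cz n\<close> by (simp add: cz_0)
  then show "t = 0 \<and> n = 0" using t by (simp add: cz_inj)
qed (simp add: cz_0)

text \<open>On a common axis the product is the unipotent element of the signed sum of the lengths,
  which is central only if it is trivial.\<close>

lemma comm_all_sum:
  assumes e: "signs e p" and x: "x \<in> Sph e p n" "comm_all e p x"
  shows "n = 0 \<and> (\<Sum>j<p. e j * cmod (x j)) = 0"
proof -
  have x0: "\<And>i. x i \<noteq> 0" using x by (simp add: Sph_def)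
  obtain u where u: "cmod u = 1" "\<And>i. i < p \<Longrightarrow> x i = of_real (e i * cmod (x i)) * u"
    using comm_all_axis[OF e x0 x(2)] by blast
  have "pp e x 0 p = unip (\<Sum>j=0..<0+p. e j * cmod (x j)) u"
    by (rule pp_axis) (use u e in \<open>auto simp: signs_def\<close>)
  then have "unip (\<Sum>j=0..<p. e j * cmod (x j)) u = cz n" using x by (simp add: Sph_def)
  then show ?thesis using unip_eq_cz[OF u(1)] by (simp add: lessThan_atLeast0)
qed

lemma axis_Sph:
  assumes e: "signs e p" and u: "cmod u = 1" and r: "\<And>i. i < p \<Longrightarrow> r i > 0" "(\<Sum>j<p. e j * r j) = 0"
    and x: "\<And>i. i < p \<Longrightarrow> x i = of_real (e i * r i) * u" "\<And>i. i \<ge> p \<Longrightarrow> x i \<noteq> 0"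
  shows "x \<in> Sph e p 0"
proof -
  have "pp e x 0 p = unip (\<Sum>j=0..<0+p. e j * r j) u"
    by (rule pp_axis) (use u e r x in \<open>auto simp: signs_def less_imp_le\<close>)
  then have "pp e x 0 p = cz 0" using r by (simp add: lessThan_atLeast0 cz_0)
  moreover have "x i \<noteq> 0" for i
    using x(1)[of i] x(2)[of i] r(1)[of i] u e by (cases "i < p") (auto simp: signs_def)
  ultimately show ?thesis by (simp add: Sph_def)
qed

lemma axis_comm_all:
  assumes e: "signs e p" and u: "cmod u = 1" and r: "\<And>i. i < p \<Longrightarrow> r i > 0"
    and x: "\<And>i. i < p \<Longrightarrow> x i = of_real (e i * r i) * u"
  shows "comm_all e p x"
  unfolding comm_all_def
proof (intro allI impI)
  fix i assume i: "Suc i < p"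
  have s: "\<bar>e j\<bar> = 1" if "j < p" for j using e that by (auto simp: signs_def)
  have "x i * cnj (x (Suc i)) = of_real (e i * r i * (e (Suc i) * r (Suc i)))"
    using x[of i] x[of "Suc i"] i cnj_unit[OF u] by (simp add: mult_ac)
  moreover have "cmod (x i) = r i" "cmod (x (Suc i)) = r (Suc i)"
    using x[of i] x[of "Suc i"] r[of i] r[of "Suc i"] i s[of i] s[of "Suc i"] u by (simp_all add: norm_mult)
  ultimately show "\<not> ncomm e x i (Suc i)" by (simp add: ncomm_def)
qed

text \<open>Commuting configurations are given by an angle of the axis and by positive lengths in a
  hyperplane, hence by a connected set.\<close>

lemma comm_all_const:
  assumes e: "signs e p" and P: "continuous_on (Sph e p n) (P :: _ \<Rightarrow> bool)"
    and x: "x \<in> Sph e p n" "comm_all e p x" and y: "y \<in> Sph e p n" "comm_all e p y"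
  shows "P x = P y"
proof -
  have x0: "\<And>i. x i \<noteq> 0" and y0: "\<And>i. y i \<noteq> 0" using x y by (simp_all add: Sph_def)
  obtain u where u: "cmod u = 1" "\<And>i. i < p \<Longrightarrow> x i = of_real (e i * cmod (x i)) * u"
    using comm_all_axis[OF e x0 x(2)] by blast
  obtain v where v: "cmod v = 1" "\<And>i. i < p \<Longrightarrow> y i = of_real (e i * cmod (y i)) * v"
    using comm_all_axis[OF e y0 y(2)] by blast
  have n: "n = 0" and sx: "(\<Sum>j<p. e j * cmod (x j)) = 0" and sy: "(\<Sum>j<p. e j * cmod (y j)) = 0"
    using comm_all_sum[OF e x] comm_all_sum[OF e y] by auto
  define r where "r t i = (1 - t) * cmod (x i) + t * cmod (y i)" for t i
  define w where "w t = cis ((1 - t) * Arg u + t * Arg v)" for t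
  \<comment> \<open>The first p entries interpolate axis and lengths; the remaining entries have
    only to avoid 0, which a path in logarithms does.\<close>
  define g where "g t = (\<lambda>i. if i < p then of_real (e i * r t i) * w t
     else exp (of_real (1 - t) * Ln (x i) + of_real t * Ln (y i)))" for t
  have S: "g t \<in> Sph e p n" if t: "t \<in> {0..1}" for t
    unfolding n
  proof (rule axis_Sph[OF e, of "w t" "r t"])
    show "r t i > 0" for i
    proof (cases "t = 1")
      case False
      then have "(1 - t) * cmod (x i) > 0" "t * cmod (y i) \<ge> 0" using t x0 by auto
      then show ?thesis unfolding r_def by linarith
    qed (simp add: r_def y0)
    have "(\<Sum>j<p. e j * r t j) = (1 - t) * (\<Sum>j<p. e j * cmod (x j)) + t * (\<Sum>j<p. e j * cmod (y j))"
      by (simp add: r_def sum_distrib_left sum.distrib[symmetric] algebra_simps)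
    then show "(\<Sum>j<p. e j * r t j) = 0" by (simp add: sx sy)
  qed (auto simp: g_def w_def)
  have "continuous_on {0..1} (\<lambda>t. g t i)" for i
  proof (cases "i < p")
    case True
    then show ?thesis unfolding g_def r_def w_def cis_conv_exp by (simp, intro continuous_intros)
  next
    case False
    then show ?thesis unfolding g_def by (simp, intro continuous_intros)
  qed
  then have "continuous_on {0..1} g" by (rule continuous_on_coordinatewise_then_product)
  then have "continuous_on {0..1} (\<lambda>t. P (g t))"
    by (rule continuous_on_compose2[OF P]) (use S in auto)
  then have "P (g 0) = P (g 1)" using connectedD_const[of "{0..1::real}"] by fastforce
  moreover have "u \<noteq> 0" "v \<noteq> 0" using u(1) v(1) by auto
  then have w: "w 0 = u" "w 1 = v"
    using cis_Arg_pos[of u] cis_Arg_pos[of v] u(1) v(1) by (auto simp: w_def)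
  have "g 0 = x"
  proof
    fix i show "g 0 i = x i"
    proof (cases "i < p")
      case True
      then have "g 0 i = of_real (e i * cmod (x i)) * u" by (simp add: g_def r_def w)
      also have "\<dots> = x i" by (rule u(2)[OF True, symmetric])
      finally show ?thesis .
    qed (use x0 in \<open>simp add: g_def exp_Ln\<close>)
  qed
  moreover have "g 1 = y"
  proof
    fix i show "g 1 i = y i"
    proof (cases "i < p")
      case True
      then have "g 1 i = of_real (e i * cmod (y i)) * v" by (simp add: g_def r_def w)
      also have "\<dots> = y i" by (rule v(2)[OF True, symmetric])
      finally show ?thesis .
    qed (use y0 in \<open>simp add: g_def exp_Ln\<close>)
  qed
  ultimately show ?thesis by simp
qed

lemma sum_sign_weights:
  "signs e p \<Longrightarrow> (\<Sum>j<p. e j * (if e j = 1 then a else b)) = real_of_int (cnt e p 1) * a - real_of_int (cnt e p (-1)) * b"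
  by (induction p) (auto simp: cnt_Suc signs_def less_Suc_eq algebra_simps)

text \<open>A commuting configuration is deformed by rotating the axis of a pair of mutually inverse neighbours.\<close>

lemma comm_all_attach:
  assumes e: "signs e p" and i: "Suc i < p" "e i \<noteq> e (Suc i)" and two: "cnt e p 1 \<ge> 2" "cnt e p (-1) \<ge> 2"
    and P: "continuous_on (Sph e p 0) (P :: _ \<Rightarrow> bool)"
  obtains x y where "x \<in> Sph e p 0" "y \<in> Sph e p 0" "P x = P y" "comm_all e p x" "\<not> comm_all e p y"
proof -
  \<comment> \<open>The weights balance all entries other than the pair at i and i + 1, which
    contains one entry of each sign. They are positive because each sign occurs at least
    twice.\<close>
  define a b where "a = real_of_int (cnt e p (-1)) - 1" and "b = real_of_int (cnt e p 1) - 1"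
  have ab: "a > 0" "b > 0" using two unfolding a_def b_def by linarith+
  define r where "r j = (if e j = 1 then a else b)" for j
  have r0: "r j > 0" for j using ab by (simp add: r_def)
  \<comment> \<open>The pair consists of mutually inverse parabolics on the axis at angle t and
    cancels for every t; all other entries keep the axis 1.\<close>
  define X where "X t = (\<lambda>j. if j = i \<or> j = Suc i then of_real (e j) * cis t else if j < p then of_real (e j * r j) else 1)" for t
  have sg: "e j = 1 \<or> e j = -1" if "j < p" for j using e that by (simp add: signs_def)
  have tot: "(\<Sum>j<p. e j * r j) = a - b"
    unfolding r_def sum_sign_weights[OF e] a_def b_def by (simp add: algebra_simps)
  have "{..<p} = {0..<i} \<union> {i, Suc i} \<union> {i + 2..<p}" using i(1) by auto
  then have "(\<Sum>j<p. e j * r j) = (\<Sum>j\<in>{0..<i} \<union> {i, Suc i} \<union> {i + 2..<p}. e j * r j)" by simp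
  also have "\<dots> = (\<Sum>j=0..<i. e j * r j) + (e i * r i + e (Suc i) * r (Suc i)) + (\<Sum>j=i+2..<p. e j * r j)"
    by (subst sum.union_disjoint, auto)+
  also have "e i * r i + e (Suc i) * r (Suc i) = a - b"
    using i sg[of i] sg[of "Suc i"] by (auto simp: r_def)
  finally have rest: "(\<Sum>j=0..<i. e j * r j) + (\<Sum>j=i+2..<p. e j * r j) = 0" using tot by simp
  have S: "X t \<in> Sph e p 0" for t
  proof -
    have "pp e (X t) 0 i = unip (\<Sum>j=0..<0+i. e j * r j) 1"
      by (rule pp_axis) (use i sg r0 in \<open>auto simp: X_def less_imp_le\<close>)
    moreover have "pp e (X t) (i + 2) (p - (i + 2)) = unip (\<Sum>j=i+2..<i+2+(p-(i+2)). e j * r j) 1"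
      by (rule pp_axis) (use i sg r0 in \<open>auto simp: X_def less_imp_le\<close>)
    moreover have "i + 2 + (p - (i + 2)) = p" using i(1) by simp
    moreover have "para (e i) (X t i) + para (e (Suc i)) (X t (Suc i)) = 0"
    proof -
      have "e (Suc i) = - e i" using i sg[of i] sg[of "Suc i"] by auto
      then show ?thesis using para_cancel[of "e (Suc i)" "of_real (e i) * cis t"] by (simp add: X_def)
    qed
    ultimately have "pp e (X t) 0 p = unip (\<Sum>j=0..<i. e j * r j) 1 + unip (\<Sum>j=i+2..<p. e j * r j) 1"
      unfolding pp_split2[OF i(1)] by (simp only: add_0 add_0_right)
    also have "\<dots> = cz 0" using rest by (simp add: unip_add cz_0)
    finally have "pp e (X t) 0 p = cz 0" .
    moreover have "X t j \<noteq> 0" for j using sg[of j] i(1) r0[of j] by (auto simp: X_def)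
    ultimately show ?thesis by (simp add: Sph_def)
  qed
  have "continuous_on {0..1} (\<lambda>t. X t j)" for j
    unfolding X_def cis_conv_exp by (cases "j = i \<or> j = Suc i"; simp; intro continuous_intros)
  then have "continuous_on {0..1} X" by (rule continuous_on_coordinatewise_then_product)
  then have "continuous_on {0..1} (\<lambda>t. P (X t))"
    by (rule continuous_on_compose2[OF P]) (use S in auto)
  then obtain c where "\<forall>t\<in>{0..1}. P (X t) = c" using connectedD_const[OF connected_Icc] by blast
  then have "P (X 0) = P (X 1)" by simp
  moreover have "comm_all e p (X 0)"
    by (rule axis_comm_all[OF e, of 1 "\<lambda>j. if j = i \<or> j = Suc i then 1 else r j"]) (use r0 in \<open>auto simp: X_def\<close>)
  moreover have "\<not> comm_all e p (X 1)"
  proof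
    assume "comm_all e p (X 1)"
    moreover have "\<And>j. X 1 j \<noteq> 0" using S by (simp add: Sph_def)
    ultimately obtain u where u: "\<And>j. j < p \<Longrightarrow> X 1 j = of_real (e j * cmod (X 1 j)) * u"
      using comm_all_axis[OF e] by blast
    \<comment> \<open>A third entry fixes the common axis at 1, whereas the pair has been rotated by
      the angle 1.\<close>
    have "\<exists>j<p. j \<noteq> i \<and> j \<noteq> Suc i"
    proof (rule ccontr)
      assume "\<not> (\<exists>j<p. j \<noteq> i \<and> j \<noteq> Suc i)"
      then have "{j. j < p \<and> e j = 1} \<subseteq> {if e i = 1 then i else Suc i}"
        using i sg[of i] sg[of "Suc i"] by auto
      then have "card {j. j < p \<and> e j = 1} \<le> 1" using card_mono[of "{if e i = 1 then i else Suc i}"] by simp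
      then show False using two by (simp add: cnt_def)
    qed
    then obtain j where j: "j < p" "j \<noteq> i" "j \<noteq> Suc i" by blast
    have "of_real (e j * r j) = of_real (e j * r j) * u"
      using u[OF j(1)] j sg[OF j(1)] r0[of j] by (auto simp: X_def norm_mult)
    then have "u = 1" using sg[OF j(1)] r0[of j] by auto
    moreover have "of_real (e i) * cis 1 = of_real (e i) * u"
      using u[of i] i(1) sg[of i] by (auto simp: X_def norm_mult)
    ultimately have "cis 1 = 1" using sg[of i] i(1) by auto
    then have "cos (1 :: real) = 1" by (simp add: complex_eq_iff)
    then show False using cos_monotone_0_pi[of 0 1] pi_gt3 by simp
  qed
  ultimately show ?thesis using that S by blast
qed

text \<open>Twisting joins every non-commuting configuration to one that does not commute at the
  end, and the commuting ones form a single piece. When both kinds occur, \<open>attach\<close>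
  supplies what is required to rotate a pair out of the common axis.\<close>

lemma Sph_connected_from_end:
  assumes e: "signs e p"
    and NE: "connected {x \<in> Sph e p n. ncomm e x (p - 2) (Suc (p - 2))}"
    and attach: "\<And>x. x \<in> Sph e p n \<Longrightarrow> comm_all e p x \<Longrightarrow> {x \<in> Sph e p n. ncomm e x (p - 2) (Suc (p - 2))} \<noteq> {} \<Longrightarrow>
      cnt e p 1 \<ge> 2 \<and> cnt e p (-1) \<ge> 2 \<and> (\<exists>i. Suc i < p \<and> e i \<noteq> e (Suc i))"
  shows "connected (Sph e p n)"
  unfolding connected_iff_const
proof (intro allI impI)
  fix P :: "(nat \<Rightarrow> complex) \<Rightarrow> bool" assume P: "continuous_on (Sph e p n) P"
  let ?NE = "{x \<in> Sph e p n. ncomm e x (p - 2) (Suc (p - 2))}"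
  have end1: "\<exists>x'\<in>?NE. P x' = P x" if "x \<in> Sph e p n" "\<not> comm_all e p x" for x
    using that twist_to_end[OF e P that(1)] by (auto simp: comm_all_def)
  have "continuous_on ?NE P" using P by (rule continuous_on_subset) auto
  then obtain c where c: "\<forall>x\<in>?NE. P x = c" using connectedD_const[OF NE] by blast
  have A: "P x = c" if "x \<in> Sph e p n" "\<not> comm_all e p x" for x using end1[OF that] c by metis
  show "\<exists>c. \<forall>s\<in>Sph e p n. P s = c"
  proof (cases "\<exists>x\<in>Sph e p n. comm_all e p x")
    case False
    then have "\<forall>s\<in>Sph e p n. P s = c" using A by simp
    then show ?thesis by (rule exI)
  next
    case True
    then obtain x where x: "x \<in> Sph e p n" "comm_all e p x" by blast
    have B: "P y = P x" if "y \<in> Sph e p n" "comm_all e p y" for y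
      by (rule comm_all_const[OF e P that x])
    show ?thesis
    proof (cases "?NE = {}")
      case True
      then have "comm_all e p y" if "y \<in> Sph e p n" for y using end1[OF that] by blast
      then have "\<forall>s\<in>Sph e p n. P s = P x" using B by simp
      then show ?thesis by (rule exI)
    next
      case False
      have n: "n = 0" using comm_all_sum[OF e x] by simp
      obtain i where i: "cnt e p 1 \<ge> 2" "cnt e p (-1) \<ge> 2" "Suc i < p" "e i \<noteq> e (Suc i)"
        using attach[OF x False] by blast
      obtain y z where "y \<in> Sph e p 0" "z \<in> Sph e p 0" "P y = P z" "comm_all e p y" "\<not> comm_all e p z"
        using comm_all_attach[OF e i(3,4,1,2)] P unfolding n by blast
      then have "P x = c" using A[of z] B[of y] n by simp
      then have "\<forall>s\<in>Sph e p n. P s = c" using A B by metis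
      then show ?thesis by (rule exI)
    qed
  qed
qed

lemma Sph_nonempty_from_end:
  assumes e: "signs e p"
  shows "Sph e p n \<noteq> {} \<longleftrightarrow> {x \<in> Sph e p n. ncomm e x (p - 2) (Suc (p - 2))} \<noteq> {} \<or> (\<exists>x\<in>Sph e p n. comm_all e p x)"
proof -
  have "continuous_on (Sph e p n) (\<lambda>_. True)" by simp
  from twist_to_end[OF e this] show ?thesis unfolding comm_all_def by blast
qed

lemma cnt_pos_iff: "cnt e p s \<ge> 1 \<longleftrightarrow> (\<exists>i<p. e i = s)"
proof -
  have "cnt e p s \<ge> 1 \<longleftrightarrow> card {i. i < p \<and> e i = s} > 0" by (simp add: cnt_def) linarith
  also have "\<dots> \<longleftrightarrow> (\<exists>i<p. e i = s)" by (auto simp: card_gt_0_iff)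
  finally show ?thesis .
qed

lemma comm_all_mixed:
  assumes e: "signs e p" and x: "x \<in> Sph e p n" "comm_all e p x" "p > 0"
  shows "n = 0 \<and> cnt e p 1 \<ge> 1 \<and> cnt e p (-1) \<ge> 1"
proof -
  have n: "n = 0" and s: "(\<Sum>j<p. e j * cmod (x j)) = 0" using comm_all_sum[OF e x(1,2)] by auto
  have xn: "cmod (x j) > 0" for j using x(1) by (simp add: Sph_def)
  have sg: "e j = 1 \<or> e j = -1" if "j < p" for j using e that by (simp add: signs_def)
  have "\<exists>i<p. e i = 1"
  proof (rule ccontr)
    assume "\<not> ?thesis"
    then have "(\<Sum>j<p. - (e j * cmod (x j))) > 0"
      using sg xn x(3) by (intro sum_pos) force+
    then show False using s by (simp add: sum_negf)
  qed
  moreover have "\<exists>i<p. e i = -1"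
  proof (rule ccontr)
    assume "\<not> ?thesis"
    then have "(\<Sum>j<p. e j * cmod (x j)) > 0"
      using sg xn x(3) by (intro sum_pos) force+
    then show False using s by simp
  qed
  ultimately show ?thesis using n cnt_pos_iff by blast
qed

lemma comm_all_exists:
  assumes e: "signs e p" and pm: "cnt e p 1 \<ge> 1" "cnt e p (-1) \<ge> 1"
  shows "\<exists>x\<in>Sph e p 0. comm_all e p x"
proof -
  define r where "r j = (if e j = 1 then real_of_int (cnt e p (-1)) else real_of_int (cnt e p 1))" for j
  have r: "r j > 0" for j using pm by (simp add: r_def)
  have s: "(\<Sum>j<p. e j * r j) = 0" unfolding r_def sum_sign_weights[OF e] by simp
  define x where "x j = (if j < p then of_real (e j * r j) * 1 else 1 :: complex)" for j
  have "x \<in> Sph e p 0" by (rule axis_Sph[OF e _ r s, of 1]) (simp_all add: x_def)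
  moreover have "comm_all e p x" by (rule axis_comm_all[OF e, of 1 r]) (simp_all add: x_def r)
  ultimately show ?thesis by blast
qed

text \<open>If both kinds of configurations exist, then n = 0 and both signs occur among the first N
  entries, so each occurs twice in all. If a sign does not occur among them, the fibre for n = 0
  consists of commuting configurations only.\<close>

lemma Sph_pm:
  assumes e: "signs e (N + 2)" "e N = 1" "e (Suc N) = -1"
  shows "connected (Sph e (N + 2) n)"
    and "Sph e (N + 2) n \<noteq> {} \<longleftrightarrow> n < cnt e N 1 \<and> - cnt e N (-1) < n \<or> n = 0"
proof -
  have eN: "signs e N" using e(1) by (simp add: signs_def)
  note NE = connected_ncomm_pm[OF eN e(2,3), of n]
  have cn: "cnt e (N + 2) 1 = cnt e N 1 + 1" "cnt e (N + 2) (-1) = cnt e N (-1) + 1"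
    using e by (simp_all add: cnt_Suc)
  show "connected (Sph e (N + 2) n)"
  proof (rule Sph_connected_from_end[OF e(1)])
    show "connected {x \<in> Sph e (N + 2) n. ncomm e x (N + 2 - 2) (Suc (N + 2 - 2))}" using NE(1) by simp
    fix x assume "x \<in> Sph e (N + 2) n" "comm_all e (N + 2) x"
      "{x \<in> Sph e (N + 2) n. ncomm e x (N + 2 - 2) (Suc (N + 2 - 2))} \<noteq> {}"
    then have "n = 0" "n < cnt e N 1" "- cnt e N (-1) < n" using comm_all_mixed[OF e(1)] NE(2) by auto
    then show "cnt e (N + 2) 1 \<ge> 2 \<and> cnt e (N + 2) (-1) \<ge> 2 \<and> (\<exists>i. Suc i < N + 2 \<and> e i \<noteq> e (Suc i))"
      using e cn by (intro conjI exI[of _ N]) auto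
  qed
  have "cnt e (N + 2) 1 \<ge> 1" "cnt e (N + 2) (-1) \<ge> 1" unfolding cn by (simp_all add: cnt_def)
  then have "(\<exists>x\<in>Sph e (N + 2) n. comm_all e (N + 2) x) \<longleftrightarrow> n = 0"
    using comm_all_mixed[OF e(1)] comm_all_exists[OF e(1)] by auto
  then show "Sph e (N + 2) n \<noteq> {} \<longleftrightarrow> n < cnt e N 1 \<and> - cnt e N (-1) < n \<or> n = 0"
    using Sph_nonempty_from_end[OF e(1), of n] NE(2) by simp
qed

lemma Sph_pp:
  assumes e: "\<And>i. i < N + 2 \<Longrightarrow> e i = 1"
  shows "connected (Sph e (N + 2) n)"
    and "Sph e (N + 2) n \<noteq> {} \<longleftrightarrow> n - 1 < int N \<and> n \<ge> 1"
proof -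
  have s: "signs e (N + 2)" using e by (simp add: signs_def)
  have nc: "\<not> comm_all e (N + 2) x" if "x \<in> Sph e (N + 2) n" for x
  proof
    assume "comm_all e (N + 2) x"
    then have "\<exists>i<N + 2. e i = -1" using comm_all_mixed[OF s that] cnt_pos_iff by simp
    then show False using e by force
  qed
  show "connected (Sph e (N + 2) n)"
    by (rule Sph_connected_from_end[OF s]) (use connected_ncomm_pp(1)[of N e n] e nc in auto)
  show "Sph e (N + 2) n \<noteq> {} \<longleftrightarrow> n - 1 < int N \<and> n \<ge> 1"
    using Sph_nonempty_from_end[OF s, of n] connected_ncomm_pp(2)[of N e n] e nc by auto
qed

section \<open>Cyclic shifts and reflection of the punctures\<close>

definition rot :: "nat \<Rightarrow> (nat \<Rightarrow> 'a) \<Rightarrow> nat \<Rightarrow> 'a" where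
  "rot p e i = (if Suc i < p then e (Suc i) else if Suc i = p then e 0 else e i)"

definition rot_inv :: "nat \<Rightarrow> (nat \<Rightarrow> 'a) \<Rightarrow> nat \<Rightarrow> 'a" where
  "rot_inv p e i = (if i = 0 then e (p - 1) else if i < p then e (i - 1) else e i)"

lemma rot_rot_inv: "p > 0 \<Longrightarrow> rot p (rot_inv p e) = e" "p > 0 \<Longrightarrow> rot_inv p (rot p e) = e"
  by (auto simp: rot_def rot_inv_def fun_eq_iff)

text \<open>A cyclic shift conjugates the product by its first factor, and a central value does not
  notice.\<close>

lemma rot_in_Sph:
  assumes "p > 0" shows "rot p x \<in> Sph (rot p e) p n \<longleftrightarrow> x \<in> Sph e p n"
proof -
  obtain q where p: "p = Suc q" using assms gr0_implies_Suc by blast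
  have "pp (rot p e) (rot p x) 0 q = pp (\<lambda>k. e (k + 1)) (\<lambda>k. x (k + 1)) 0 q"
    by (rule pp_cong_sign) (simp add: rot_def p)
  also have "\<dots> = pp e x 1 q" using pp_shift[of e x 0 1 q] by simp
  finally have "pp (rot p e) (rot p x) 0 p = pp e x 1 q + para (e 0) (x 0)"
    by (simp add: p) (simp add: rot_def)
  moreover have "pp e x 0 p = para (e 0) (x 0) + pp e x 1 q" unfolding p by (simp only: pp_Suc_left One_nat_def)
  moreover have "a + b = cz n \<longleftrightarrow> b + a = cz n" for a b
    by (metis add.assoc add_left_cancel cz_commute)
  ultimately have "pp (rot p e) (rot p x) 0 p = cz n \<longleftrightarrow> pp e x 0 p = cz n" by simp
  moreover have "(\<forall>i. rot p x i \<noteq> 0) \<longleftrightarrow> (\<forall>i. x i \<noteq> 0)"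
  proof
    assume a: "\<forall>i. rot p x i \<noteq> 0"
    show "\<forall>i. x i \<noteq> 0"
    proof
      fix i show "x i \<noteq> 0" using a[rule_format, of i] a[rule_format, of "i - 1"] a[rule_format, of q]
        by (cases "i = 0"; cases "i < p") (auto simp: rot_def p split: if_splits)
    qed
  qed (auto simp: rot_def)
  ultimately show ?thesis by (simp add: Sph_def)
qed

lemma cnt_cong: "(\<And>i. i < N \<Longrightarrow> e i = e' i) \<Longrightarrow> cnt e N s = cnt e' N s"
  unfolding cnt_def by (rule arg_cong[where f = "\<lambda>A. int (card A)"]) auto

lemma cnt_Suc_left: "cnt e (Suc N) s = (if e 0 = s then 1 else 0) + cnt (\<lambda>i. e (Suc i)) N s"
  by (induction N) (auto simp: cnt_Suc)

lemma cnt_rot: assumes "p > 0" shows "cnt (rot p e) p s = cnt e p s"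
proof -
  obtain q where p: "p = Suc q" using assms gr0_implies_Suc by blast
  have "cnt (rot p e) q s = cnt (\<lambda>i. e (Suc i)) q s" by (rule cnt_cong) (simp add: rot_def p)
  then have "cnt (rot p e) p s = cnt (\<lambda>i. e (Suc i)) q s + (if e 0 = s then 1 else 0)"
    unfolding p cnt_Suc by (simp add: rot_def)
  then show ?thesis unfolding p cnt_Suc_left by simp
qed

lemma rot_funpow:
  assumes "p > 0" shows "i < p \<Longrightarrow> (rot p ^^ k) e i = e ((i + k) mod p)"
proof (induction k arbitrary: i)
  case (Suc k)
  show ?case
  proof (cases "Suc i < p")
    case True then show ?thesis using Suc.IH[of "Suc i"] by (simp add: rot_def)
  next
    case False
    then have "Suc i = p" using Suc.prems by simp
    moreover from this have "(i + Suc k) mod p = k mod p" by (metis add_Suc_shift mod_add_self1)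
    ultimately show ?thesis using Suc.IH[of 0] assms by (simp add: rot_def)
  qed
qed simp

lemma Sph_rot_image:
  assumes "p > 0" shows "Sph e p n = rot_inv p ` Sph (rot p e) p n"
proof (intro equalityI subsetI)
  fix x assume "x \<in> Sph e p n"
  then have "rot p x \<in> Sph (rot p e) p n" using rot_in_Sph[OF assms] by blast
  moreover have "x = rot_inv p (rot p x)" by (simp add: rot_rot_inv[OF assms])
  ultimately show "x \<in> rot_inv p ` Sph (rot p e) p n" by blast
next
  fix x assume "x \<in> rot_inv p ` Sph (rot p e) p n"
  then obtain y where y: "y \<in> Sph (rot p e) p n" "x = rot_inv p y" by blast
  then have "rot p x \<in> Sph (rot p e) p n" by (simp add: rot_rot_inv[OF assms])
  then show "x \<in> Sph e p n" using rot_in_Sph[OF assms] by blast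
qed

lemma connected_Sph_rot:
  assumes "p > 0" "connected (Sph (rot p e) p n)" shows "connected (Sph e p n)"
proof -
  have "continuous_on A (\<lambda>x. x i :: complex)" for A and i :: nat
    by (rule continuous_on_coord[OF continuous_on_id])
  then have "continuous_on (Sph (rot p e) p n) (rot_inv p)"
  proof (intro continuous_on_coordinatewise_then_product)
    fix i show "continuous_on (Sph (rot p e) p n) (\<lambda>x. rot_inv p x i)"
      using \<open>\<And>A i. continuous_on A (\<lambda>x. x i)\<close> by (cases "i = 0"; cases "i < p"; simp add: rot_inv_def)
  qed
  then show ?thesis unfolding Sph_rot_image[OF assms(1), of e] using assms(2) by (rule connected_continuous_image)
qed

lemma Sph_mir: "Sph e p n = (\<lambda>x i. cnj (x i)) ` Sph (\<lambda>i. - e i) p (- n)"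
proof -
  have *: "(\<lambda>i. cnj (x i)) \<in> Sph (\<lambda>i. - e i) p (- n) \<longleftrightarrow> x \<in> Sph e p n" for e x n
    unfolding Sph_def by (simp add: mir_pp[symmetric] mir_cz[symmetric] mir_inj del: mir_cz)
  show ?thesis
  proof (intro equalityI subsetI)
    fix x assume "x \<in> Sph e p n"
    then have "(\<lambda>i. cnj (x i)) \<in> Sph (\<lambda>i. - e i) p (- n)" using * by blast
    then show "x \<in> (\<lambda>x i. cnj (x i)) ` Sph (\<lambda>i. - e i) p (- n)" by (rule rev_image_eqI) simp
  qed (use *[of _ "\<lambda>i. - e i" "- n"] in auto)
qed

lemma connected_Sph_mir: "connected (Sph (\<lambda>i. - e i) p (- n)) \<Longrightarrow> connected (Sph e p n)"
  unfolding Sph_mir[of e p n]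
  by (intro connected_continuous_image continuous_on_coordinatewise_then_product continuous_intros
      continuous_on_coord[OF continuous_on_id])

text \<open>With both signs present, a cyclic shift puts a positive and a negative entry at the end;
  otherwise all signs agree, and a reflection makes them positive.\<close>

theorem Sph_connected_nonempty:
  assumes e: "signs e p" and p: "p \<ge> 3"
  defines "a \<equiv> cnt e p 1" and "b \<equiv> cnt e p (-1)"
  shows "connected (Sph e p n)"
    and "Sph e p n \<noteq> {} \<longleftrightarrow> 2 - b \<le> n \<and> n \<le> a - 2 \<or> n = 0 \<and> (a = 1 \<or> b = 1) \<or> n = 1 \<and> b = 0 \<or> n = -1 \<and> a = 0"
proof -
  define N where "N = p - 2"
  have pN: "p = N + 2" "N \<ge> 1" using p by (simp_all add: N_def)
  have sg: "e i = 1 \<or> e i = -1" if "i < p" for i using e that by (simp add: signs_def)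
  have ab: "a + b = int p"
  proof -
    have "signs e q \<Longrightarrow> cnt e q 1 + cnt e q (-1) = int q" for q
      by (induction q) (auto simp: cnt_Suc signs_def less_Suc_eq)
    then show ?thesis using e by (simp add: a_def b_def)
  qed
  have nn: "a \<ge> 0" "b \<ge> 0" by (simp_all add: a_def b_def cnt_def)
  consider "b = 0" | "a = 0" | "a \<ge> 1" "b \<ge> 1" using nn by linarith
  then have "connected (Sph e p n) \<and> (Sph e p n \<noteq> {} \<longleftrightarrow>
    2 - b \<le> n \<and> n \<le> a - 2 \<or> n = 0 \<and> (a = 1 \<or> b = 1) \<or> n = 1 \<and> b = 0 \<or> n = -1 \<and> a = 0)"
  proof cases
    case 1
    then have "e i = 1" if "i < N + 2" for i using sg[of i] that cnt_pos_iff[of e p "-1"] unfolding b_def pN by auto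
    with Sph_pp[of N e n] show ?thesis using 1 ab pN by auto
  next
    case 2
    then have "- e i = 1" if "i < N + 2" for i using sg[of i] that cnt_pos_iff[of e p 1] unfolding a_def pN by auto
    with Sph_pp[of N "\<lambda>i. - e i" "- n"] have "connected (Sph e p n)" "Sph e p n \<noteq> {} \<longleftrightarrow> - n - 1 < int N \<and> - n \<ge> 1"
      using connected_Sph_mir[of e p n] Sph_mir[of e p n] unfolding pN by auto
    then show ?thesis using 2 ab pN by auto
  next
    case 3
    \<comment> \<open>Otherwise positivity would propagate once round the cycle and leave no
      negative entry.\<close>
    have "\<exists>i<p. e i = 1 \<and> e (Suc i mod p) = -1"
    proof (rule ccontr)
      assume no: "\<not> ?thesis"
      obtain i0 where i0: "i0 < p" "e i0 = 1" using 3 cnt_pos_iff[of e p 1] unfolding a_def by blast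
      have all1: "e ((i0 + k) mod p) = 1" for k
      proof (induction k)
        case (Suc k)
        have "(i0 + k) mod p < p" using p by simp
        then have "e (Suc ((i0 + k) mod p) mod p) \<noteq> -1" using no Suc by blast
        then show ?case using sg[of "(i0 + Suc k) mod p"] p by (simp add: mod_Suc_eq)
      qed (use i0 in simp)
      obtain j where j: "j < p" "e j = -1" using 3 cnt_pos_iff[of e p "-1"] unfolding b_def by blast
      have "(i0 + (p - i0 + j)) mod p = j" using i0 j by simp
      then show False using all1[of "p - i0 + j"] j by simp
    qed
    then obtain i where i: "i < p" "e i = 1" "e (Suc i mod p) = -1" by blast
    \<comment> \<open>After i + 2 shifts the entries i and i + 1 stand at p - 2 and p - 1.\<close>
    define e' where "e' = (rot p ^^ (i + 2)) e"
    have p0: "p > 0" using p by simp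
    have e'v: "e' j = e ((j + (i + 2)) mod p)" if "j < p" for j
      unfolding e'_def by (rule rot_funpow[OF p0 that])
    have s': "signs e' (N + 2)" unfolding signs_def pN(1)[symmetric] using e'v sg p0 by simp
    have k: "N + (i + 2) = i + p" "Suc N + (i + 2) = Suc i + p" by (simp_all add: pN)
    have "N < p" "Suc N < p" by (simp_all add: pN)
    have e'N: "e' N = 1" "e' (Suc N) = -1"
      unfolding e'v[OF \<open>N < p\<close>] e'v[OF \<open>Suc N < p\<close>] k mod_add_self2 using i by simp_all
    have inv: "(connected (Sph ((rot p ^^ k) e) p n) \<longrightarrow> connected (Sph e p n)) \<and>
      (Sph ((rot p ^^ k) e) p n = {} \<longleftrightarrow> Sph e p n = {}) \<and> cnt ((rot p ^^ k) e) p s = cnt e p s" for k s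
    proof (induction k)
      case (Suc k)
      show ?case using Suc connected_Sph_rot[OF p0, of "(rot p ^^ k) e" n] Sph_rot_image[OF p0, of "(rot p ^^ k) e" n]
         cnt_rot[OF p0, of "(rot p ^^ k) e" s] by auto
    qed simp
    have c: "connected (Sph e p n)" using inv Sph_pm(1)[OF s' e'N, of n] unfolding e'_def pN(1)[symmetric] by blast
    have ne: "Sph e p n \<noteq> {} \<longleftrightarrow> n < cnt e' N 1 \<and> - cnt e' N (-1) < n \<or> n = 0"
      using inv Sph_pm(2)[OF s' e'N, of n] unfolding e'_def pN(1)[symmetric] by blast
    have cs: "cnt e' (N + 2) s = cnt e p s" for s using inv[of "i + 2" s] unfolding e'_def pN(1)[symmetric] by blast
    have "cnt e' (N + 2) 1 = cnt e' N 1 + 1" "cnt e' (N + 2) (-1) = cnt e' N (-1) + 1"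
      using e'N by (simp_all add: cnt_Suc)
    then have "cnt e' N 1 = a - 1" "cnt e' N (-1) = b - 1"
      unfolding a_def b_def cs by linarith+
    then show ?thesis using c ne 3 by auto
  qed
  then show "connected (Sph e p n)"
    and "Sph e p n \<noteq> {} \<longleftrightarrow> 2 - b \<le> n \<and> n \<le> a - 2 \<or> n = 0 \<and> (a = 1 \<or> b = 1) \<or> n = 1 \<and> b = 0 \<or> n = -1 \<and> a = 0"
    by blast+
qed

section \<open>Commutators\<close>

lemma SU_det: "al y * cnj (al y) - be y * cnj (be y) = 1"
proof -
  have "al y * cnj (al y) - be y * cnj (be y) = of_real ((cmod (al y))\<^sup>2 - (cmod (be y))\<^sup>2)"
    by (simp only: complex_norm_square of_real_diff)
  then show ?thesis by (simp add: cmod_al_sq)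
qed

definition cmt :: "cov \<Rightarrow> cov \<Rightarrow> cov" where
  "cmt a b = a + b - a - b"

lemma cmt_cjg: "cmt a b = a + cjg b (- a)"
  by (simp add: cmt_def cjg_def diff_conv_add_uminus add.assoc del: add_uminus_conv_diff)

lemma cmt_cz [simp]: "cmt (cz m + a) b = cmt a b" "cmt a (cz m + b) = cmt a b"
proof -
  have "cmt (cz m + a) b = (cz m + (a + cjg b (- a))) + cz (- m)"
    by (simp add: cmt_cjg minus_add cjg_plus cz_uminus add.assoc)
  also have "\<dots> = cz (- m) + (cz m + (a + cjg b (- a)))" by (rule cz_commute)
  also have "\<dots> = cmt a b" by (simp only: cz_cancel' cmt_cjg)
  finally show "cmt (cz m + a) b = cmt a b" .
  show "cmt a (cz m + b) = cmt a b" by (simp add: cmt_cjg cjg_cz_left)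
qed

lemma cmt_eq_0_iff: "cmt a b = 0 \<longleftrightarrow> a + b = b + a"
  by (simp add: cmt_def diff_eq_eq)

lemma cjg_cmt: "cjg g (cmt a b) = cmt (cjg g a) (cjg g b)"
  by (simp add: cmt_def cjg_plus cjg_minus)

lemma mir_cmt: "mir (cmt a b) = cmt (mir a) (mir b)"
  by (simp add: cmt_def mir_plus mir_uminus diff_conv_add_uminus del: add_uminus_conv_diff)

text \<open>Prescribing the commutator means that b conjugates a to \<open>- k + a\<close>; the
  obstruction to finding b is an equality of traces that is linear in a.\<close>

lemma cmt_eq_iff: "cmt a b = k \<longleftrightarrow> cjg b a = - k + a"
proof -
  have "cmt a b = k \<longleftrightarrow> cjg b (- a) = - a + k" unfolding cmt_cjg by (metis add.assoc add_0 left_minus right_minus)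
  also have "\<dots> \<longleftrightarrow> - cjg b (- a) = - (- a + k)" by (metis minus_minus)
  also have "\<dots> \<longleftrightarrow> cjg b a = - k + a" by (simp add: minus_add flip: cjg_uminus)
  finally show ?thesis .
qed

lemma cmt_add_left:
  assumes "d + b = b + d" shows "cmt (a + d) b = cmt a b"
proof -
  have "a + d + b - (a + d) - b = a + (d + b - d) - a - b"
    by (simp add: diff_conv_add_uminus minus_add add.assoc del: add_uminus_conv_diff)
  also have "d + b - d = b" by (simp add: assms)
  finally show ?thesis by (simp add: cmt_def)
qed

lemma cmt_add_right:
  assumes "d + a = a + d" shows "cmt a (b + d) = cmt a b"
proof -
  have "a + (b + d) - a - (b + d) = a + b + (d - a - d) - b"
    by (simp add: diff_conv_add_uminus minus_add add.assoc del: add_uminus_conv_diff)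
  also have "d - a - d = - a" using assms
    by (metis add.assoc diff_conv_add_uminus minus_add right_minus add_0_right minus_minus)
  finally show ?thesis by (simp add: cmt_def)
qed

lemma continuous_on_cmt [continuous_intros]:
  "continuous_on S f \<Longrightarrow> continuous_on S g \<Longrightarrow> continuous_on S (\<lambda>x. cmt (f x) (g x))"
  unfolding cmt_def by (intro continuous_intros)

section \<open>Paths in centralisers\<close>

lemma commute_lin:
  assumes "d + y = y + d" and s: "s \<noteq> 0"
    and x: "al x = (of_real p + of_real q * al d) / of_real s" "be x = of_real q * be d / of_real s"
  shows "x + y = y + x"
proof (rule cov_commute)
  have A: "be d * cnj (be y) = be y * cnj (be d)"
    using arg_cong[OF assms(1), of al] by (simp add: al_plus)
  have B: "al d * be y + be d * cnj (al y) = al y * be d + be y * cnj (al d)"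
    using arg_cong[OF assms(1), of be] by (simp add: be_plus)
  show "al (x + y) = al (y + x)"
    using A by (simp add: al_plus x mult_ac)
  have "be (x + y) = (of_real p * be y + of_real q * (al d * be y + be d * cnj (al y))) / of_real s"
    by (simp add: be_plus x add_divide_distrib distrib_left distrib_right mult_ac)
  also have "\<dots> = be (y + x)" unfolding B
    by (simp add: be_plus x add_divide_distrib distrib_left distrib_right mult_ac)
  finally show "be (x + y) = be (y + x)" .
qed

lemma nrm_1_0: "nrm 1 0 = 0"
  by (rule cov_eqI) (simp_all add: th_nrm)

text \<open>The segment from the identity to the matrix of d or of its negative consists of
  combinations of 1 and d, so it commutes with whatever d commutes with. The sign with non-negative
  trace keeps the determinant positive on the segment.\<close>

lemma centralizer_connected:
  obtains m g where "continuous_on {0..1} g" "g 0 = 0" "g 1 = cz m + d"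
    "\<And>y t. t \<in> {0..1::real} \<Longrightarrow> d + y = y + d \<Longrightarrow> g t + y = y + g t"
proof -
  define m0 :: int where "m0 = (if Re (al d) \<ge> 0 then 0 else 1)"
  define d' where "d' = cz m0 + d"
  have d': "Re (al d') \<ge> 0" by (simp add: d'_def m0_def sg_def)
  let ?a = "\<lambda>t :: real. of_real (1 - t) + of_real t * al d'" and ?b = "\<lambda>t :: real. of_real t * be d'"
  have det: "(cmod (?a t))\<^sup>2 - (cmod (?b t))\<^sup>2 = (1 - t)\<^sup>2 + t\<^sup>2 + 2 * t * (1 - t) * Re (al d')" for t
  proof -
    have "(cmod (?a t))\<^sup>2 - (cmod (?b t))\<^sup>2 = (1 - t)\<^sup>2 + 2 * t * (1 - t) * Re (al d') + t\<^sup>2 * ((cmod (al d'))\<^sup>2 - (cmod (be d'))\<^sup>2)"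
      by (simp add: cmod_power2) (simp add: power2_eq_square algebra_simps)
    then show ?thesis by (simp add: cmod_al_sq)
  qed
  have pos: "(cmod (?a t))\<^sup>2 - (cmod (?b t))\<^sup>2 > 0" if "t \<in> {0..1}" for t
  proof -
    have "(1 - t)\<^sup>2 + t\<^sup>2 > 0" by (simp add: sum_power2_gt_zero_iff)
    moreover have "2 * t * (1 - t) * Re (al d') \<ge> 0" using that d' by simp
    ultimately show ?thesis unfolding det by linarith
  qed
  have lt: "cmod (?b t) < cmod (?a t)" if "t \<in> {0..1}" for t
  proof (rule power2_less_imp_less)
    show "(cmod (?b t))\<^sup>2 < (cmod (?a t))\<^sup>2" using pos[OF that] by (simp only: diff_gt_0_iff_gt)
  qed (rule norm_ge_zero)
  define g where "g t = nrm (?a t) (?b t)" for t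
  have "continuous_on {0..1} g" unfolding g_def
  proof (intro continuous_intros lt)
    fix t :: real assume t: "t \<in> {0..1}"
    show "?a t \<notin> \<real>\<^sub>\<le>\<^sub>0"
    proof
      assume n: "?a t \<in> \<real>\<^sub>\<le>\<^sub>0"
      have "Re (?a t) = (1 - t) + t * Re (al d')" by simp
      moreover have "t * Re (al d') \<ge> 0" using t d' by simp
      moreover have "Re (?a t) \<le> 0" using n by (simp only: complex_nonpos_Reals_iff)
      ultimately have "t = 1" "Re (?a t) = 0" using t by auto
      then have "?a t = 0" using n by (simp add: complex_nonpos_Reals_iff complex_eq_iff)
      then show False using lt[OF t] by (metis norm_ge_zero norm_zero not_le)
    qed
  qed auto
  moreover have "g 0 = 0" by (simp add: g_def nrm_1_0)
  moreover obtain n where "g 1 = cz n + d'"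
    using cov_lifts[of "g 1" 0 d'] lt[of 1] by (auto simp: g_def cmod_al_sq)
  then have "g 1 = cz (n + m0) + d" by (simp add: d'_def cz_add flip: add.assoc)
  moreover have "g t + y = y + g t" if "t \<in> {0..1}" "d + y = y + d" for y t
  proof (rule commute_lin)
    show "d' + y = y + d'" unfolding d'_def using that(2) by (metis add.assoc cz_commute)
    show "sqrt ((cmod (?a t))\<^sup>2 - (cmod (?b t))\<^sup>2) \<noteq> 0"
      using pos[OF that(1)] by (metis real_sqrt_gt_0_iff less_irrefl)
    show "al (g t) = ?a t / of_real (sqrt ((cmod (?a t))\<^sup>2 - (cmod (?b t))\<^sup>2))"
      using lt[OF that(1)] by (simp add: g_def)
    show "be (g t) = ?b t / of_real (sqrt ((cmod (?a t))\<^sup>2 - (cmod (?b t))\<^sup>2))" by (simp add: g_def)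
  qed
  ultimately show ?thesis using that by blast
qed

lemma const_on_path:
  assumes "continuous_on F H" "continuous_on {0..1::real} g" "\<And>t. t \<in> {0..1} \<Longrightarrow> g t \<in> F"
  shows "H (g 0) = (H (g 1) :: bool)"
proof -
  have "continuous_on {0..1} (\<lambda>t. H (g t))"
    by (rule continuous_on_compose2[OF assms(1,2)]) (use assms(3) in auto)
  then obtain c where "\<forall>t\<in>{0..1}. H (g t) = c" using connectedD_const[OF connected_Icc] by blast
  then show ?thesis by simp
qed

section \<open>Local sections of the conjugation action\<close>

text \<open>Intertwiners of two matrices with equal traces solve a linear system. A solution
  depending continuously on the data and starting at \<open>g0\<close> can be normalised to
  determinant 1 nearby.\<close>

lemma intertwiner_section:
  fixes q0 :: "'a::topological_space"
  assumes q0: "q0 \<in> B" and cont: "continuous_on B kap" "continuous_on B lam"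
    and tr: "\<And>q. q \<in> B \<Longrightarrow> Re (al (kap q)) = Re (al (lam q))"
    and g0: "cjg g0 (kap q0) = lam q0" and nc: "Im (al (kap q0)) \<noteq> 0 \<or> be (kap q0) \<noteq> 0"
  obtains U g where "open U" "q0 \<in> U" "continuous_on (U \<inter> B) g" "g q0 = g0"
    "\<And>q. q \<in> U \<inter> B \<Longrightarrow> cjg (g q) (kap q) = lam q"
proof -
  define n b where "n = Im (al (kap q0))" and "b = be (kap q0)"
  define N where "N = 2 * (n\<^sup>2 + (cmod b)\<^sup>2)"
  have "n\<^sup>2 + (cmod b)\<^sup>2 > 0" using nc by (auto simp: n_def b_def sum_power2_gt_zero_iff)
  then have N: "N > 0" by (simp add: N_def)
  \<comment> \<open>\<open>W = g0 X\<close> with \<open>X\<close> traceless and \<open>tr(H X) = 1\<close> for the traceless part \<open>H\<close> of \<open>kap q0\<close>; then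
    \<open>lam W - W kap\<^sup>-\<^sup>1\<close> intertwines \<open>kap\<close> and \<open>lam\<close> and equals \<open>g0\<close> at \<open>q0\<close>.\<close>
  define W1 W2 where "W1 = (al g0 * (- \<i> * of_real n) + be g0 * cnj b) / of_real N"
    and "W2 = (al g0 * b + be g0 * (\<i> * of_real n)) / of_real N"
  define P S where "P q = (al (lam q) * W1 + be (lam q) * cnj W2) - (W1 * cnj (al (kap q)) - W2 * cnj (be (kap q)))"
    and "S q = (al (lam q) * W2 + be (lam q) * cnj W1) - (W2 * al (kap q) - W1 * be (kap q))" for q
  have twine: "P q * al (kap q) + S q * cnj (be (kap q)) = al (lam q) * P q + be (lam q) * cnj (S q)"
    "P q * be (kap q) + S q * cnj (al (kap q)) = al (lam q) * S q + be (lam q) * cnj (P q)" if q: "q \<in> B" for q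
  proof -
    have t: "al (kap q) + cnj (al (kap q)) = al (lam q) + cnj (al (lam q))"
      using tr[OF q] by (simp add: complex_eq_iff)
    have d: "al (kap q) * cnj (al (kap q)) - be (kap q) * cnj (be (kap q)) = 1"
      "al (lam q) * cnj (al (lam q)) - be (lam q) * cnj (be (lam q)) = 1"
      by (rule SU_det)+
    have c: "cnj (P q) = (cnj (al (lam q)) * cnj W1 + cnj (be (lam q)) * W2) - (cnj W1 * al (kap q) - cnj W2 * be (kap q))"
      "cnj (S q) = (cnj (al (lam q)) * cnj W2 + cnj (be (lam q)) * W1) - (cnj W2 * cnj (al (kap q)) - cnj W1 * cnj (be (kap q)))"
      by (simp_all add: P_def S_def)
    show "P q * al (kap q) + S q * cnj (be (kap q)) = al (lam q) * P q + be (lam q) * cnj (S q)"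
      unfolding c unfolding P_def S_def using t d by algebra
    show "P q * be (kap q) + S q * cnj (al (kap q)) = al (lam q) * S q + be (lam q) * cnj (P q)"
      unfolding c unfolding P_def S_def using t d by algebra
  qed
  have l0: "al (lam q0) * al g0 + be (lam q0) * cnj (be g0) = al g0 * al (kap q0) + be g0 * cnj (be (kap q0))"
    "al (lam q0) * be g0 + be (lam q0) * cnj (al g0) = al g0 * be (kap q0) + be g0 * cnj (al (kap q0))"
  proof -
    have "lam q0 + g0 = g0 + kap q0" using g0 diff_eq_eq[of "g0 + kap q0" g0 "lam q0"] by (simp add: cjg_def)
    then show "al (lam q0) * al g0 + be (lam q0) * cnj (be g0) = al g0 * al (kap q0) + be g0 * cnj (be (kap q0))"
      "al (lam q0) * be g0 + be (lam q0) * cnj (al g0) = al g0 * be (kap q0) + be g0 * cnj (al (kap q0))"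
      by (metis al_plus, metis be_plus)
  qed
  have at0: "P q0 = al g0" "S q0 = be g0"
  proof -
    have k: "al (kap q0) = of_real (Re (al (kap q0))) + \<i> * of_real n" by (simp add: n_def complex_eq_iff)
    define r where "r = complex_of_real (Re (al (kap q0)))"
    define m where "m = \<i> * complex_of_real n"
    have ak: "al (kap q0) = r + m" "cnj (al (kap q0)) = r - m" using k by (simp_all add: r_def m_def complex_eq_iff)
    have cm: "cnj m = - m" by (simp add: m_def)
    have Nc: "of_real N = 2 * (- m * m + b * cnj b)"
      by (simp add: N_def m_def complex_norm_square[symmetric] power2_eq_square algebra_simps)
    have W: "of_real N * W1 = - al g0 * m + be g0 * cnj b" "of_real N * W2 = al g0 * b + be g0 * m"
      "of_real N * cnj W1 = cnj (al g0) * m + cnj (be g0) * b" "of_real N * cnj W2 = cnj (al g0) * cnj b - cnj (be g0) * m"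
      using N by (simp_all add: W1_def W2_def m_def)
    note L = l0[unfolded ak(2), unfolded ak(1) b_def[symmetric]]
    have "of_real N * P q0 = (al (lam q0) * (of_real N * W1) + be (lam q0) * (of_real N * cnj W2))
       - ((of_real N * W1) * (r - m) - (of_real N * W2) * cnj b)"
      unfolding P_def ak(2) unfolding ak(1) b_def[symmetric] by (simp add: algebra_simps)
    also have "\<dots> = of_real N * al g0" unfolding W unfolding Nc using L by algebra
    finally show "P q0 = al g0" using N by simp
    have "of_real N * S q0 = (al (lam q0) * (of_real N * W2) + be (lam q0) * (of_real N * cnj W1))
       - ((of_real N * W2) * (r + m) - (of_real N * W1) * b)"
      unfolding S_def ak(2) unfolding ak(1) b_def[symmetric] by (simp add: algebra_simps)
    also have "\<dots> = of_real N * be g0" unfolding W unfolding Nc using L by algebra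
    finally show "S q0 = be g0" using N by simp
  qed
  \<comment> \<open>The inverse of \<open>g0\<close> times the intertwiner: it is the identity at
    \<open>q0\<close>, so near \<open>q0\<close> the principal argument in \<open>nrm\<close> picks
    the right lift.\<close>
  define P' S' where "P' q = cnj (al g0) * P q - be g0 * cnj (S q)"
    and "S' q = cnj (al g0) * S q - be g0 * cnj (P q)" for q
  have PS: "P q = al g0 * P' q + be g0 * cnj (S' q)" "S q = al g0 * S' q + be g0 * cnj (P' q)" for q
  proof -
    have d: "al g0 * cnj (al g0) - be g0 * cnj (be g0) = 1"
      by (rule SU_det)
    have c: "cnj (P' q) = al g0 * cnj (P q) - cnj (be g0) * S q" "cnj (S' q) = al g0 * cnj (S q) - cnj (be g0) * P q"
      by (simp_all add: P'_def S'_def)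
    show "P q = al g0 * P' q + be g0 * cnj (S' q)" "S q = al g0 * S' q + be g0 * cnj (P' q)"
      unfolding c unfolding P'_def S'_def using d by algebra+
  qed
  have P0: "P' q0 = 1" "S' q0 = 0"
    unfolding P'_def S'_def at0
    using SU_det by (simp_all add: mult.commute)
  have contP: "continuous_on B P'" "continuous_on B S'"
    unfolding P'_def S'_def P_def S_def by (intro continuous_intros cont)+
  define g where "g q = g0 + nrm (P' q) (S' q)" for q
  define U1 where "U1 = {q \<in> B. Re (P' q) > 0 \<and> cmod (S' q) < cmod (P' q)}"
  have "openin (top_of_set B) U1"
  proof -
    have "openin (top_of_set B) (B \<inter> (\<lambda>q. (P' q, S' q)) -` {z. Re (fst z) > 0 \<and> cmod (snd z) < cmod (fst z)})"
      by (intro continuous_openin_preimage_gen continuous_intros contP open_Collect_conj open_Collect_less)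
    moreover have "B \<inter> (\<lambda>q. (P' q, S' q)) -` {z. Re (fst z) > 0 \<and> cmod (snd z) < cmod (fst z)} = U1"
      by (auto simp: U1_def)
    ultimately show ?thesis by simp
  qed
  have gU1: "continuous_on U1 g" unfolding g_def
    by (intro continuous_intros continuous_on_subset[OF contP(1)] continuous_on_subset[OF contP(2)])
      (auto simp: U1_def complex_nonpos_Reals_iff)
  \<comment> \<open>The matrices agree on U1 already; a difference of \<open>th\<close> below pi
    rules out a central translation between the two sides.\<close>
  define U2 where "U2 = U1 \<inter> (\<lambda>q. th (cjg (g q) (kap q)) - th (lam q)) -` {-pi<..<pi}"
  have "continuous_on U1 kap" "continuous_on U1 lam"
    using cont by (auto intro: continuous_on_subset simp: U1_def)
  then have "openin (top_of_set U1) U2" unfolding U2_def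
    by (intro continuous_openin_preimage_gen continuous_intros gU1) auto
  then have "openin (top_of_set B) U2" using \<open>openin (top_of_set B) U1\<close> openin_trans by blast
  then obtain U where U: "open U" "U2 = B \<inter> U" by (auto simp: openin_open)
  have g0': "g q0 = g0" by (simp add: g_def P0 nrm_1_0)
  have "q0 \<in> U2" using q0 by (simp add: U2_def U1_def P0 g0' g0)
  moreover have "cjg (g q) (kap q) = lam q" if q: "q \<in> U2" for q
  proof -
    have qB: "q \<in> B" and lt: "cmod (S' q) < cmod (P' q)" using q by (auto simp: U2_def U1_def)
    define s where "s = complex_of_real (sqrt ((cmod (P' q))\<^sup>2 - (cmod (S' q))\<^sup>2))"
    have "(cmod (S' q))\<^sup>2 < (cmod (P' q))\<^sup>2" using lt by (intro power_strict_mono) auto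
    then have "sqrt ((cmod (P' q))\<^sup>2 - (cmod (S' q))\<^sup>2) > 0" by (simp only: real_sqrt_gt_0_iff diff_gt_0_iff_gt)
    then have "s \<noteq> 0" unfolding s_def of_real_eq_0_iff by (metis less_irrefl)
    moreover have "cnj s = s" by (simp add: s_def)
    ultimately have s: "s \<noteq> 0" "cnj s = s" by blast+
    have ag: "al (g q) = P q / s" "be (g q) = S q / s"
      using lt s unfolding g_def PS al_plus be_plus by (simp_all add: s_def[symmetric] add_divide_distrib)
    have "al (g q + kap q) = al (lam q + g q)"
      using twine(1)[OF qB] s unfolding al_plus ag by (simp add: div_comb) (simp add: add_divide_distrib[symmetric])
    moreover have "be (g q + kap q) = be (lam q + g q)"
      using twine(2)[OF qB] s unfolding be_plus ag by (simp add: div_comb) (simp add: add_divide_distrib[symmetric])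
    ultimately obtain n where n: "g q + kap q = cz n + (lam q + g q)" using cov_eq_SU by blast
    then have "cjg (g q) (kap q) = cz n + lam q" by (simp add: cjg_def add.assoc diff_eq_eq)
    moreover from this have "\<bar>of_int n * pi\<bar> < 1 * pi" using q by (auto simp: U2_def abs_less_iff)
    then have "n = 0" by (simp add: abs_mult)
    ultimately show ?thesis by (simp add: cz_0)
  qed
  moreover have "continuous_on U2 g" using gU1 by (rule continuous_on_subset) (auto simp: U2_def)
  ultimately show ?thesis using that[of U g] U g0' by (simp add: Int_commute)
qed

text \<open>First a is corrected so that it keeps the trace of \<open>- kap q + a\<close>, a linear
  condition; then b comes from the local section of the conjugation action.\<close>

lemma cmt_section:
  fixes q0 :: "'a::topological_space"
  assumes q0: "q0 \<in> B" and kap: "continuous_on B kap" and ab: "cmt a0 b0 = kap q0" and nc: "kap q0 \<noteq> 0"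
  obtains U a b where "open U" "q0 \<in> U" "continuous_on (U \<inter> B) a" "continuous_on (U \<inter> B) b"
    "a q0 = a0" "b q0 = b0" "\<And>q. q \<in> U \<inter> B \<Longrightarrow> cmt (a q) (b q) = kap q"
proof -
  define k0 where "k0 = kap q0"
  have a0c: "a0 + b0 \<noteq> b0 + a0" using nc ab cmt_eq_0_iff by metis
  define l where "l q P Q = Re ((cnj (al (kap q)) - 1) * P - be (kap q) * cnj Q)" for q P Q
  have l0: "l q0 (al a0) (be a0) = 0"
  proof -
    have "Re (al (- k0 + a0)) = Re (al a0)" using ab cmt_eq_iff Re_al_cjg unfolding k0_def by metis
    then show ?thesis by (simp add: l_def k0_def al_plus algebra_simps)
  qed
  \<comment> \<open>The vector that represents the functional \<open>l q0\<close>, so that its value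
    there is a sum of squares.\<close>
  define W1 W2 where "W1 = al k0 - 1" and "W2 = - be k0"
  have lW: "l q0 W1 W2 > 0"
  proof -
    have "l q0 W1 W2 = (cmod (al k0 - 1))\<^sup>2 + (cmod (be k0))\<^sup>2"
      by (simp add: l_def W1_def W2_def k0_def[symmetric] cmod_power2) (simp add: power2_eq_square algebra_simps)
    \<comment> \<open>A non-trivial commutator does not lie over the identity matrix, because its
      \<open>th\<close> is below 2 pi in absolute value.\<close>
    moreover have "al k0 \<noteq> 1 \<or> be k0 \<noteq> 0"
    proof (rule ccontr)
      assume "\<not> ?thesis"
      then obtain n where "k0 = cz n + 0" "sg n = 1" using cov_eq_SU[of k0 0] by auto
      then have k: "k0 = cz n" by simp
      have "\<bar>th (cmt a0 b0)\<bar> < 2 * pi"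
        using th_plus_bound[of a0 "cjg b0 (- a0)"] th_cjg_bound[of b0 "- a0"] unfolding cmt_cjg th_uminus by linarith
      then have "\<bar>real_of_int n\<bar> < 2" using k ab by (simp add: k0_def abs_mult)
      then have "n = 0" using \<open>sg n = 1\<close> by (auto simp: sg_def split: if_splits elim!: evenE)
      then show False using k nc by (simp add: k0_def cz_0)
    qed
    ultimately show ?thesis by (auto simp: sum_power2_gt_zero_iff)
  qed
  define c where "c q = l q (al a0) (be a0) / l q W1 W2" for q
  define P S where "P q = al a0 - of_real (c q) * W1" and "S q = be a0 - of_real (c q) * W2" for q
  define P' S' where "P' q = cnj (al a0) * P q - be a0 * cnj (S q)"
    and "S' q = cnj (al a0) * S q - be a0 * cnj (P q)" for q
  have PS: "P q = al a0 * P' q + be a0 * cnj (S' q)" "S q = al a0 * S' q + be a0 * cnj (P' q)" for q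
  proof -
    have d: "al a0 * cnj (al a0) - be a0 * cnj (be a0) = 1"
      by (rule SU_det)
    have c: "cnj (P' q) = al a0 * cnj (P q) - cnj (be a0) * S q" "cnj (S' q) = al a0 * cnj (S q) - cnj (be a0) * P q"
      by (simp_all add: P'_def S'_def)
    show "P q = al a0 * P' q + be a0 * cnj (S' q)" "S q = al a0 * S' q + be a0 * cnj (P' q)"
      unfolding c unfolding P'_def S'_def using d by algebra+
  qed
  have at0: "P q0 = al a0" "S q0 = be a0" by (simp_all add: P_def S_def c_def l0)
  have P0: "P' q0 = 1" "S' q0 = 0"
    unfolding P'_def S'_def at0
    using SU_det by (simp_all add: mult.commute)
  define U0 where "U0 = {q \<in> B. l q W1 W2 > 0}"
  have contl: "continuous_on B (\<lambda>q. l q X Y)" for X Y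
    unfolding l_def by (intro continuous_intros kap)
  have oU0: "openin (top_of_set B) U0"
  proof -
    have "openin (top_of_set B) (B \<inter> (\<lambda>q. l q W1 W2) -` {0<..})"
      by (intro continuous_openin_preimage_gen contl) auto
    moreover have "B \<inter> (\<lambda>q. l q W1 W2) -` {0<..} = U0" by (auto simp: U0_def)
    ultimately show ?thesis by simp
  qed
  have "U0 \<subseteq> B" by (auto simp: U0_def)
  have contc: "continuous_on U0 c" unfolding c_def
    by (intro continuous_intros continuous_on_subset[OF contl \<open>U0 \<subseteq> B\<close>]) (auto simp: U0_def)
  have contP: "continuous_on U0 P'" "continuous_on U0 S'"
    unfolding P'_def S'_def P_def S_def by (intro continuous_intros contc)+
  define U1 where "U1 = {q \<in> U0. Re (P' q) > 0 \<and> cmod (S' q) < cmod (P' q)}"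
  have "openin (top_of_set U0) U1"
  proof -
    have "openin (top_of_set U0) (U0 \<inter> (\<lambda>q. (P' q, S' q)) -` {z. Re (fst z) > 0 \<and> cmod (snd z) < cmod (fst z)})"
      by (intro continuous_openin_preimage_gen continuous_intros contP open_Collect_conj open_Collect_less)
    moreover have "U0 \<inter> (\<lambda>q. (P' q, S' q)) -` {z. Re (fst z) > 0 \<and> cmod (snd z) < cmod (fst z)} = U1"
      by (auto simp: U1_def)
    ultimately show ?thesis by simp
  qed
  then have oU1: "openin (top_of_set B) U1" using oU0 openin_trans by blast
  define a where "a q = a0 + nrm (P' q) (S' q)" for q
  have conta: "continuous_on U1 a" unfolding a_def
    by (intro continuous_intros continuous_on_subset[OF contP(1)] continuous_on_subset[OF contP(2)])
      (auto simp: U1_def complex_nonpos_Reals_iff)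
  have a_q0: "a q0 = a0" by (simp add: a_def P0 nrm_1_0)
  have contk: "continuous_on U1 kap" using kap by (rule continuous_on_subset) (auto simp: U1_def U0_def)
  have q01: "q0 \<in> U1" using q0 lW by (simp add: U1_def U0_def P0)
  have tr: "Re (al (a q)) = Re (al (- kap q + a q))" if q: "q \<in> U1" for q
  proof -
    have lt: "cmod (S' q) < cmod (P' q)" and lq: "l q W1 W2 > 0" using q by (auto simp: U1_def U0_def)
    define s where "s = sqrt ((cmod (P' q))\<^sup>2 - (cmod (S' q))\<^sup>2)"
    have ag: "al (a q) = P q / of_real s" "be (a q) = S q / of_real s"
      using lt unfolding a_def PS al_plus be_plus by (simp_all add: s_def[symmetric] add_divide_distrib)
    have "l q (P q) (S q) = l q (al a0) (be a0) - c q * l q W1 W2"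
      by (simp add: l_def P_def S_def algebra_simps)
    also have "\<dots> = 0" using lq by (simp add: c_def)
    finally have "l q (P q) (S q) = 0" .
    moreover have "Re (al (- kap q + a q)) - Re (al (a q)) = l q (P q) (S q) / s"
      by (simp add: al_plus ag l_def diff_divide_distrib add_divide_distrib algebra_simps)
    ultimately show ?thesis by simp
  qed
  have nca: "Im (al (a q0)) \<noteq> 0 \<or> be (a q0) \<noteq> 0"
  proof (rule ccontr)
    assume "\<not> ?thesis"
    then have "be a0 = 0" "Im (al a0) = 0" by (simp_all add: a_q0)
    then have "a0 + b0 = b0 + a0" by (intro cov_commute) (simp_all add: al_plus be_plus complex_eq_iff)
    then show False using a0c by simp
  qed
  have c0: "cjg b0 (a q0) = - kap q0 + a q0" using ab by (simp add: cmt_eq_iff a_q0)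
  have contl: "continuous_on U1 (\<lambda>q. - kap q + a q)" by (intro continuous_intros contk conta)
  obtain U b where U: "open U" "q0 \<in> U" "continuous_on (U \<inter> U1) b" "b q0 = b0"
    "\<And>q. q \<in> U \<inter> U1 \<Longrightarrow> cjg (b q) (a q) = - kap q + a q"
    by (rule intertwiner_section[OF q01 conta contl tr c0 nca]) blast+
  obtain V where V: "open V" "U1 = B \<inter> V" using oU1 by (auto simp: openin_open)
  have e: "(U \<inter> V) \<inter> B = U \<inter> U1" using V by blast
  show ?thesis
  proof (rule that[of "U \<inter> V" a b])
    show "open (U \<inter> V)" "q0 \<in> U \<inter> V" using U V q01 by auto
    show "continuous_on (U \<inter> V \<inter> B) a" unfolding e using conta by (rule continuous_on_subset) auto
    show "continuous_on (U \<inter> V \<inter> B) b" unfolding e by (rule U(3))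
    show "cmt (a q) (b q) = kap q" if "q \<in> U \<inter> V \<inter> B" for q
      using U(5)[of q] that unfolding e cmt_eq_iff by blast
  qed (rule a_q0, rule U(4))
qed

section \<open>The fibres of the commutator map\<close>

text \<open>The functions on a fibre of the commutator map that descend to pairs in \<open>PSL(2,\<real>)\<close>.\<close>

definition fibfun :: "cov \<Rightarrow> (cov \<times> cov \<Rightarrow> bool) \<Rightarrow> bool" where
  "fibfun k H \<longleftrightarrow> continuous_on {z. cmt (fst z) (snd z) = k} H \<and>
     (\<forall>m a b. cmt a b = k \<longrightarrow> H (cz m + a, b) = H (a, b) \<and> H (a, cz m + b) = H (a, b))"

lemma fibfun_path:
  assumes "fibfun k H" "continuous_on {0..1::real} g1" "continuous_on {0..1} g2"
    "\<And>t. t \<in> {0..1} \<Longrightarrow> cmt (g1 t) (g2 t) = k"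
  shows "H (g1 0, g2 0) = H (g1 1, g2 1)"
  using const_on_path[of "{z. cmt (fst z) (snd z) = k}" H "\<lambda>t. (g1 t, g2 t)"] assms
  by (auto simp: fibfun_def intro: continuous_on_Pair)

text \<open>Multiplying a by the centraliser of b does not change the commutator. The centraliser is
  connected up to central translations, which H does not see.\<close>

lemma fibfun_add_left:
  assumes H: "fibfun k H" and k: "cmt a b = k" and d: "d + b = b + d"
  shows "H (a + d, b) = H (a, b)"
proof -
  obtain m g where g: "continuous_on {0..1} g" "g 0 = 0" "g 1 = cz m + d"
    "\<And>y t. t \<in> {0..1::real} \<Longrightarrow> d + y = y + d \<Longrightarrow> g t + y = y + g t"
    by (rule centralizer_connected[of d]) (rule that)
  have "H (a + g 0, b) = H (a + g 1, b)"
    by (rule fibfun_path[OF H]) (use g d k in \<open>auto intro!: continuous_intros simp: cmt_add_left\<close>)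
  moreover have "a + g 1 = cz m + (a + d)" using cz_commute[of a m] by (simp add: g(3) flip: add.assoc)
  ultimately show ?thesis using H k d by (auto simp: fibfun_def g(2) cmt_add_left)
qed

lemma fibfun_add_right:
  assumes H: "fibfun k H" and k: "cmt a b = k" and d: "d + a = a + d"
  shows "H (a, b + d) = H (a, b)"
proof -
  obtain m g where g: "continuous_on {0..1} g" "g 0 = 0" "g 1 = cz m + d"
    "\<And>y t. t \<in> {0..1::real} \<Longrightarrow> d + y = y + d \<Longrightarrow> g t + y = y + g t"
    by (rule centralizer_connected[of d]) (rule that)
  have "H (a, b + g 0) = H (a, b + g 1)"
    by (rule fibfun_path[OF H]) (use g d k in \<open>auto intro!: continuous_intros simp: cmt_add_right\<close>)
  moreover have "b + g 1 = cz m + (b + d)" using cz_commute[of b m] by (simp add: g(3) flip: add.assoc)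
  ultimately show ?thesis using H k d by (auto simp: fibfun_def g(2) cmt_add_right)
qed

lemma fibfun_cjg:
  assumes H: "fibfun k H" and k: "cmt a b = k" and d: "d + k = k + d"
  shows "H (cjg d a, cjg d b) = H (a, b)"
proof -
  obtain m g where g: "continuous_on {0..1} g" "g 0 = 0" "g 1 = cz m + d"
    "\<And>y t. t \<in> {0..1::real} \<Longrightarrow> d + y = y + d \<Longrightarrow> g t + y = y + g t"
    by (rule centralizer_connected[of d]) (rule that)
  have "H (cjg (g 0) a, cjg (g 0) b) = H (cjg (g 1) a, cjg (g 1) b)"
  proof (rule fibfun_path[OF H])
    fix t :: real assume "t \<in> {0..1}"
    then show "cmt (cjg (g t) a) (cjg (g t) b) = k"
      using g(4)[OF _ d, of t] by (simp add: k cjg_eq_iff flip: cjg_cmt)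
  qed (intro continuous_intros g)+
  then show ?thesis by (simp add: g cjg_cz_left)
qed

text \<open>Along a path of conjugates \<open>th\<close> cannot vanish, since at 0 the half-trace
  would be at least 1.\<close>

lemma th_sign_cjg:
  assumes "Re (al y) < 1" shows "th (cjg g y) > 0 \<longleftrightarrow> th y > 0"
proof -
  obtain m h where h: "continuous_on {0..1} h" "h 0 = 0" "h 1 = cz m + g"
      "\<And>y t. t \<in> {0..1::real} \<Longrightarrow> g + y = y + g \<Longrightarrow> h t + y = y + h t"
    by (rule centralizer_connected[of g]) (rule that)
  have nz: "th (cjg (h t) y) \<noteq> 0" for t
  proof
    assume "th (cjg (h t) y) = 0"
    then have "Re (al (cjg (h t) y)) \<ge> 1" using th_eq_int_pi[of "cjg (h t) y" 0] cmod_al_ge_1 by simp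
    then show False using assms by (simp add: Re_al_cjg)
  qed
  have c: "continuous_on {0..1} (\<lambda>t. th (cjg (h t) y))" by (intro continuous_intros h)
  have "th (cjg (h 0) y) > 0 \<longleftrightarrow> th (cjg (h 1) y) > 0"
  proof (rule ccontr)
    assume n: "\<not> ?thesis"
    have "\<exists>t\<ge>0. t \<le> 1 \<and> th (cjg (h t) y) = 0"
    proof (cases "th (cjg (h 0) y) > 0")
      case True
      with n show ?thesis by (intro IVT2'[OF _ _ _ c]) auto
    next
      case False
      with n show ?thesis by (intro IVT'[OF _ _ _ c]) auto
    qed
    then show False using nz by blast
  qed
  then show ?thesis by (simp add: h cjg_cz_left)
qed

subsection \<open>Making the first element hyperbolic\<close>

text \<open>The element d is the normalisation of x + y B with B the traceless part of b. The first
  hypothesis is the positivity of its determinant, the second that the product with a is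
  hyperbolic.\<close>

lemma centralizer_trace:
  assumes "x\<^sup>2 - y\<^sup>2 * ((Re (al b))\<^sup>2 - 1) > 0"
    and "(x * Re (al a) + y * jform a b)\<^sup>2 > x\<^sup>2 - y\<^sup>2 * ((Re (al b))\<^sup>2 - 1)"
  shows "\<exists>d. d + b = b + d \<and> \<bar>Re (al (a + d))\<bar> > 1"
proof -
  let ?P = "of_real x + of_real y * (\<i> * of_real (Im (al b)))" and ?Q = "of_real y * be b"
  have det: "(cmod ?P)\<^sup>2 - (cmod ?Q)\<^sup>2 = x\<^sup>2 - y\<^sup>2 * ((Re (al b))\<^sup>2 - 1)"
  proof -
    have "(cmod ?P)\<^sup>2 - (cmod ?Q)\<^sup>2 = x\<^sup>2 + y\<^sup>2 * ((Im (al b))\<^sup>2 - (cmod (be b))\<^sup>2)"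
      by (simp add: cmod_power2) (simp add: power2_eq_square algebra_simps)
    also have "(Im (al b))\<^sup>2 - (cmod (be b))\<^sup>2 = 1 - (Re (al b))\<^sup>2" using SU_sq[of b] by simp
    finally show ?thesis by (simp add: algebra_simps)
  qed
  define D where "D = x\<^sup>2 - y\<^sup>2 * ((Re (al b))\<^sup>2 - 1)"
  define s where "s = sqrt D"
  have s: "s > 0" "s\<^sup>2 = D" using assms(1) by (simp_all add: s_def D_def)
  have "(cmod ?Q)\<^sup>2 < (cmod ?P)\<^sup>2" using det assms(1) by linarith
  then have lt: "cmod ?Q < cmod ?P" by (rule power2_less_imp_less) (rule norm_ge_zero)
  define d where "d = nrm ?P ?Q"
  have ds: "sqrt ((cmod ?P)\<^sup>2 - (cmod ?Q)\<^sup>2) = s" by (simp only: det s_def D_def)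
  have d: "al d = ?P / of_real s" "be d = ?Q / of_real s"
    unfolding d_def al_nrm[OF lt] be_nrm ds by simp_all
  have "d + b = b + d"
  proof (rule commute_lin[OF HOL.refl])
    show "s \<noteq> 0" using s by simp
    show "al d = (of_real (x - y * Re (al b)) + of_real y * al b) / of_real s"
      unfolding d by (simp add: complex_eq_iff)
    show "be d = of_real y * be b / of_real s" by (rule d)
  qed
  moreover have "Re (al (a + d)) = (x * Re (al a) + y * jform a b) / s"
    unfolding al_plus d by (simp add: jform_def add_divide_distrib diff_divide_distrib algebra_simps)
  moreover have "\<bar>x * Re (al a) + y * jform a b\<bar> > s"
  proof (rule power2_less_imp_less)
    show "s\<^sup>2 < \<bar>x * Re (al a) + y * jform a b\<bar>\<^sup>2" using assms(2) by (simp add: s(2) D_def)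
  qed simp
  ultimately show ?thesis using s(1) by (intro exI[of _ d]) (simp add: abs_divide)
qed

text \<open>The right side is the vanishing of the cross product of the traceless parts, seen as
  vectors in R^3.\<close>

lemma commute_iff_parallel:
  "a + b = b + a \<longleftrightarrow> of_real (Im (al b)) * be a = of_real (Im (al a)) * be b \<and> Im (be a * cnj (be b)) = 0"
proof
  assume c: "a + b = b + a"
  have A: "be a * cnj (be b) = be b * cnj (be a)" using arg_cong[OF c, of al] by (simp add: al_plus)
  have B: "al a * be b + be a * cnj (al b) = al b * be a + be b * cnj (al a)"
    using arg_cong[OF c, of be] by (simp add: be_plus)
  have "Im (be a * cnj (be b)) = 0" using arg_cong[OF A, of Im] by simp
  moreover have "2 * \<i> * (of_real (Im (al b)) * be a) = 2 * \<i> * (of_real (Im (al a)) * be b)"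
  proof -
    have t: "2 * \<i> * of_real (Im (al x)) = al x - cnj (al x)" for x by (simp add: complex_eq_iff)
    have "2 * \<i> * (of_real (Im (al b)) * be a) = (al b - cnj (al b)) * be a" by (simp flip: t)
    also have "\<dots> = (al a - cnj (al a)) * be b" using B by algebra
    finally show ?thesis by (simp flip: t)
  qed
  ultimately show "of_real (Im (al b)) * be a = of_real (Im (al a)) * be b \<and> Im (be a * cnj (be b)) = 0" by simp
next
  assume c: "of_real (Im (al b)) * be a = of_real (Im (al a)) * be b \<and> Im (be a * cnj (be b)) = 0"
  show "a + b = b + a"
  proof (rule cov_commute)
    show "al (a + b) = al (b + a)" using c by (simp add: al_plus complex_eq_iff algebra_simps)
    have "al a * be b + be a * cnj (al b) - (al b * be a + be b * cnj (al a)) =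
      2 * \<i> * (of_real (Im (al a)) * be b - of_real (Im (al b)) * be a)"
      by (simp add: complex_eq_iff algebra_simps)
    then show "be (a + b) = be (b + a)" using c by (simp add: be_plus)
  qed
qed

text \<open>The Lagrange identity for the form \<open>jform\<close> of signature (2, 1), since the
  square of the half-trace minus 1 is \<open>jform\<close> of y with itself.\<close>

lemma jform_identity:
  "(jform a b)\<^sup>2 - ((Re (al a))\<^sup>2 - 1) * ((Re (al b))\<^sup>2 - 1) =
     (cmod (of_real (Im (al b)) * be a - of_real (Im (al a)) * be b))\<^sup>2 - (Im (be a * cnj (be b)))\<^sup>2"
proof -
  have e: "(Re (al y))\<^sup>2 - 1 = (Re (be y))\<^sup>2 + (Im (be y))\<^sup>2 - (Im (al y))\<^sup>2" for y
    using SU_sq[of y] by (simp add: cmod_power2)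
  show ?thesis unfolding e jform_def cmod_power2
    by (simp add: power2_eq_square algebra_simps)
qed

text \<open>The reversed Cauchy-Schwarz inequality: an elliptic b is timelike.\<close>

lemma jform_noncommuting:
  assumes nc: "a + b \<noteq> b + a" and a: "\<bar>Re (al a)\<bar> \<le> 1" and b: "\<bar>Re (al b)\<bar> < 1"
  shows "(jform a b)\<^sup>2 > ((Re (al a))\<^sup>2 - 1) * ((Re (al b))\<^sup>2 - 1)"
proof -
  let ?v = "of_real (Im (al b)) * be a - of_real (Im (al a)) * be b" and ?i = "Im (be a * cnj (be b))"
  have "(Re (al b))\<^sup>2 < 1" using b by (simp add: abs_square_less_1)
  then have bb: "(cmod (be b))\<^sup>2 < (Im (al b))\<^sup>2" using SU_sq[of b] by simp
  have iv: "?i * Im (al b) = Im (?v * cnj (be b))" by (simp add: algebra_simps)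
  have "?v \<noteq> 0"
  proof
    assume v: "?v = 0"
    then have "?i * Im (al b) = 0" using iv by simp
    moreover have "Im (al b) \<noteq> 0" using bb by auto
    ultimately show False using nc v commute_iff_parallel[of a b] by simp
  qed
  then have v0: "(cmod ?v)\<^sup>2 > 0" by simp
  have "\<bar>?i * Im (al b)\<bar> \<le> cmod ?v * cmod (be b)"
    unfolding iv using abs_Im_le_cmod[of "?v * cnj (be b)"] by (simp add: norm_mult)
  then have "\<bar>?i * Im (al b)\<bar>\<^sup>2 \<le> (cmod ?v * cmod (be b))\<^sup>2" by (intro power_mono) auto
  then have "?i\<^sup>2 * (Im (al b))\<^sup>2 \<le> (cmod ?v)\<^sup>2 * (cmod (be b))\<^sup>2" by (simp add: power_mult_distrib)
  also have "\<dots> < (cmod ?v)\<^sup>2 * (Im (al b))\<^sup>2" using v0 bb by (intro mult_strict_left_mono)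
  finally have "?i\<^sup>2 < (cmod ?v)\<^sup>2" by (rule mult_right_less_imp_less) simp
  then show ?thesis using jform_identity[of a b] by linarith
qed

text \<open>A lightlike vector is not orthogonal to any timelike or lightlike vector that is
  independent of it.\<close>

lemma jform_par_nz:
  assumes nc: "a + b \<noteq> b + a" and a: "\<bar>Re (al a)\<bar> \<le> 1" and b: "\<bar>Re (al b)\<bar> = 1"
  shows "jform a b \<noteq> 0"
proof
  assume J: "jform a b = 0"
  have "(Re (al b))\<^sup>2 = 1" using b by (metis abs_1 power2_abs power_one)
  then have "(cmod (be b))\<^sup>2 = (Im (al b))\<^sup>2" using SU_sq[of b] by simp
  then have bb: "cmod (be b) = \<bar>Im (al b)\<bar>" by (metis abs_norm_cancel power2_eq_iff_nonneg power2_abs abs_ge_zero norm_ge_zero)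
  have "(Re (al a))\<^sup>2 \<le> 1" using a by (simp add: abs_square_le_1)
  then have "(cmod (be a))\<^sup>2 \<le> \<bar>Im (al a)\<bar>\<^sup>2" using SU_sq[of a] by simp
  then have aa: "cmod (be a) \<le> \<bar>Im (al a)\<bar>" by (rule power2_le_imp_le) simp
  let ?z = "be a * cnj (be b)"
  have r: "Re ?z = Im (al a) * Im (al b)" using J by (simp add: jform_def)
  have "cmod ?z \<le> \<bar>Im (al a) * Im (al b)\<bar>"
    using mult_right_mono[OF aa, of "cmod (be b)"] by (simp add: norm_mult bb abs_mult)
  then have "(cmod ?z)\<^sup>2 \<le> (Re ?z)\<^sup>2" unfolding r using power_mono[of "cmod ?z" _ 2] by fastforce
  then have i: "Im ?z = 0" by (simp add: cmod_power2 del: complex_mod_cnj)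
  have "of_real (Im (al b)) * be a * cnj (be b) = of_real (Im (al a)) * be b * cnj (be b)"
  proof -
    have "?z = of_real (Im (al a) * Im (al b))" using r i by (simp add: complex_eq_iff)
    moreover have "be b * cnj (be b) = of_real ((Im (al b))\<^sup>2)"
      using bb by (simp flip: complex_norm_square)
    ultimately show ?thesis by (simp add: mult.assoc power2_eq_square)
  qed
  moreover have "be b \<noteq> 0"
  proof
    assume "be b = 0"
    then have "a + b = b + a" using bb commute_iff_parallel[of a b] by simp
    then show False using nc by simp
  qed
  ultimately have "of_real (Im (al b)) * be a = of_real (Im (al a)) * be b" by simp
  then show False using nc i commute_iff_parallel[of a b] by blast
qed

lemma hyperbolize_step:
  assumes nc: "a + b \<noteq> b + a" and a: "\<bar>Re (al a)\<bar> \<le> 1" and ne: "\<bar>Re (al b)\<bar> > 1 \<Longrightarrow> Re (al a) \<noteq> 0 \<or> jform a b \<noteq> 0"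
  shows "\<exists>d. d + b = b + d \<and> \<bar>Re (al (a + d))\<bar> > 1"
proof (cases "\<bar>Re (al b)\<bar> < 1")
  case True
  define A J E where "A = Re (al a)" and "J = jform a b" and "E = 1 - (Re (al b))\<^sup>2"
  have E: "E > 0" using True by (simp add: E_def abs_square_less_1)
  have J: "J\<^sup>2 > (1 - A\<^sup>2) * E" using jform_noncommuting[OF nc a True] by (simp add: A_def J_def E_def algebra_simps)
  \<comment> \<open>The centraliser is a circle. The squared linear form divided by the determinant
    is largest in the direction \<open>(A * E, J)\<close>, where its value is m / E.\<close>
  define m where "m = A\<^sup>2 * E + J\<^sup>2"
  have m: "m > E" using J by (simp add: m_def algebra_simps)
  have 1: "(A * E)\<^sup>2 - J\<^sup>2 * ((Re (al b))\<^sup>2 - 1) = E * m"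
    by (simp add: E_def m_def power2_eq_square algebra_simps)
  have 2: "A * E * Re (al a) + J * jform a b = m" by (simp add: m_def A_def J_def power2_eq_square algebra_simps)
  show ?thesis
    by (rule centralizer_trace[of "A * E" J]) (use 1 2 E m in \<open>simp_all add: power2_eq_square\<close>)
next
  case False
  define A J D where "A = Re (al a)" and "J = jform a b" and "D = (Re (al b))\<^sup>2 - 1"
  have D: "D \<ge> 0" using False abs_le_square_iff[of 1 "Re (al b)"] by (simp add: D_def)
  \<comment> \<open>The determinant vanishes for x = sqrt D and y = 1 or y = -1. Close to such a
    point at which the linear form does not vanish, the normalised half-trace exceeds 1.\<close>
  have "sqrt D * A + J \<noteq> 0 \<or> sqrt D * A - J \<noteq> 0"
  proof (rule ccontr)
    assume "\<not> ?thesis"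
    then have z: "J = 0" "sqrt D * A = 0" by auto
    show False
    proof (cases "\<bar>Re (al b)\<bar> = 1")
      case True then show ?thesis using jform_par_nz[OF nc a] z by (simp add: J_def)
    next
      case F: False
      then have "\<bar>Re (al b)\<bar> > 1" using False by linarith
      moreover from this have "D > 0" using abs_le_square_iff[of "Re (al b)" 1] by (simp add: D_def)
      ultimately show ?thesis using ne z by (simp add: A_def J_def)
    qed
  qed
  then obtain y :: real where y: "y\<^sup>2 = 1" "sqrt D * A + y * J \<noteq> 0"
    by (metis mult_1 mult_minus1 power2_minus power_one add_uminus_conv_diff)
  define F where "F x = (x * A + y * J)\<^sup>2 - (x\<^sup>2 - D)" for x
  have "F (sqrt D) > 0" using y D by (simp add: F_def)
  moreover have "(F \<longlongrightarrow> F (sqrt D)) (at_right (sqrt D))" unfolding F_def by (intro tendsto_intros)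
  ultimately have "eventually (\<lambda>x. F x > 0) (at_right (sqrt D))" by (intro order_tendstoD(1))
  then have "eventually (\<lambda>x. F x > 0 \<and> x > sqrt D) (at_right (sqrt D))"
    using eventually_at_right_less by (rule eventually_conj)
  then obtain x where x: "F x > 0" "x > sqrt D"
    using eventually_happens[of _ "at_right (sqrt D)"] trivial_limit_at_right_real by blast
  have "x\<^sup>2 > D" using x(2) D real_sqrt_ge_zero[OF D] power_strict_mono[of "sqrt D" x 2] by simp
  then show ?thesis
    using centralizer_trace[of x y b a] x y by (simp add: F_def A_def J_def D_def)
qed

lemma jform_shift: "Re (al a) = 0 \<Longrightarrow> jform a (b + a) = - Re (al b)"
proof -
  assume a: "Re (al a) = 0"
  have "(Re (be a))\<^sup>2 + (Im (be a))\<^sup>2 = (Im (al a))\<^sup>2 - 1" using SU_sq[of a] a by (simp add: cmod_power2)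
  moreover have "jform a (b + a) = Re (al b) * ((Re (be a))\<^sup>2 + (Im (be a))\<^sup>2 - (Im (al a))\<^sup>2)"
    using a by (simp add: jform_def al_plus be_plus power2_eq_square algebra_simps)
  ultimately show ?thesis by simp
qed

text \<open>The one obstructed case is a of trace 0 with \<open>jform a b = 0\<close> and b
  hyperbolic: the centraliser of b then never changes the trace of a. Replacing b by
  \<open>b + a\<close> turns the pairing into minus the half-trace of b.\<close>

lemma hyperbolize:
  assumes nc: "cmt a b = k" "k \<noteq> 0"
  shows "\<exists>a' b'. cmt a' b' = k \<and> \<bar>Re (al a')\<bar> > 1 \<and> (\<forall>H. fibfun k H \<longrightarrow> H (a', b') = H (a, b))"
proof (cases "\<bar>Re (al a)\<bar> > 1")
  case True then show ?thesis using nc by blast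
next
  case False
  have nc': "a + b \<noteq> b + a" using nc cmt_eq_0_iff by metis
  define b' where "b' = (if Re (al a) = 0 \<and> jform a b = 0 \<and> \<bar>Re (al b)\<bar> > 1 then b + a else b)"
  have b': "cmt a b' = k" "fibfun k H \<longrightarrow> H (a, b') = H (a, b)" for H
    using nc fibfun_add_right[of k H a b a] cmt_add_right[of a a b] by (auto simp: b'_def)
  have "\<bar>Re (al b')\<bar> > 1 \<Longrightarrow> Re (al a) \<noteq> 0 \<or> jform a b' \<noteq> 0"
    using jform_shift[of a b] by (auto simp: b'_def)
  moreover have "a + b' \<noteq> b' + a" using b'(1) nc(2) cmt_eq_0_iff by metis
  ultimately obtain d where d: "d + b' = b' + d" "\<bar>Re (al (a + d))\<bar> > 1"
    using hyperbolize_step[of a b'] False by auto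
  have "cmt (a + d) b' = k" using cmt_add_left[OF d(1)] b' by simp
  moreover have "\<forall>H. fibfun k H \<longrightarrow> H (a + d, b') = H (a, b)"
    using fibfun_add_left[OF _ b'(1) d(1)] b'(2) by metis
  ultimately show ?thesis using d(2) by blast
qed

subsection \<open>Conjugacy classes\<close>

lemma central_iff: "Im (al y) = 0 \<and> be y = 0 \<longleftrightarrow> (\<exists>m. y = cz m)"
proof
  assume y: "Im (al y) = 0 \<and> be y = 0"
  then have "sin (th y) = 0" using al_nz[of y] by (simp add: Im_al)
  then obtain m :: int where "th y = of_int m * pi" by (auto simp: sin_zero_iff_int2)
  then show "\<exists>m. y = cz m" using y by (intro exI[of _ m] cov_eqI) simp_all
qed auto

lemma cjg_inverse: "cjg g x = y \<Longrightarrow> cjg (- g) y = x"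
  by (auto simp: cjg_cjg)

text \<open>Local sections of the conjugation action make every class open in S.\<close>

lemma conjugate_connected:
  assumes S: "connected S" "x \<in> S" "y \<in> S"
    and tr: "\<And>y. y \<in> S \<Longrightarrow> Re (al y) = c" and nc: "\<And>y m. y \<in> S \<Longrightarrow> y \<noteq> cz m"
  shows "\<exists>g. cjg g x = y"
proof (rule connected_equivalence_relation[OF S])
  fix q assume q: "q \<in> S"
  obtain U g where U: "open U" "q \<in> U" "\<And>r. r \<in> U \<inter> S \<Longrightarrow> cjg (g r) q = r"
  proof (rule intertwiner_section[of q S "\<lambda>_. q" "\<lambda>r. r" 0, OF q])
    show "Im (al q) \<noteq> 0 \<or> be q \<noteq> 0" using central_iff[of q] nc[OF q] by blast
  qed (use tr q in \<open>auto intro: continuous_on_const continuous_on_id\<close>)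
  then show "\<exists>T. openin (top_of_set S) T \<and> q \<in> T \<and> (\<forall>r\<in>T. \<exists>g. cjg g q = r)"
    using q by (intro exI[of _ "S \<inter> U"]) (auto intro: openin_open_Int)
next
  fix x y assume "\<exists>g. cjg g x = y" then show "\<exists>g. cjg g y = x" using cjg_inverse by blast
next
  fix x y z assume "\<exists>g. cjg g x = y" "\<exists>g. cjg g y = z"
  then show "\<exists>g. cjg g x = z" by (metis cjg_cjg)
qed

lemma between_not_cz: "between 0 1 y \<Longrightarrow> y \<noteq> cz m"
proof
  assume b: "between 0 1 y" and m: "y = cz m"
  have "\<not> \<bar>Re (al y)\<bar> > 1" by (simp add: m)
  then have "0 < th y" "th y < pi" using b by (auto simp: Up_def Dn_def)
  then show False by (simp add: m zero_less_mult_iff)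
qed

lemma between_hyp_iff:
  "Re (al y) > 1 \<Longrightarrow> between 0 1 y \<longleftrightarrow> \<bar>th y\<bar> < pi / 2"
  using cos_pos_range[of "th y"] Re_al_pos_cos[of y] pi_gt_zero by (auto simp: Up_def Dn_def)

lemma th_arctan: "\<bar>th y\<bar> < pi / 2 \<Longrightarrow> th y = arctan (Im (al y) / Re (al y))"
proof -
  assume t: "\<bar>th y\<bar> < pi / 2"
  have "Im (al y) / Re (al y) = tan (th y)" by (simp add: Im_al Re_al tan_def)
  then show ?thesis using t arctan_tan[of "th y"] by (simp add: abs_less_iff)
qed

lemma connected_class_hyp:
  assumes c: "c > 1" shows "connected {y. between 0 1 y \<and> Re (al y) = c}"
proof -
  define F where "F v = Cov (arctan (fst v / c)) (of_real (sqrt (c\<^sup>2 - 1 + (fst v)\<^sup>2)) * cis (snd v))" for v :: "real \<times> real"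
  have c2: "c\<^sup>2 > 1" using c by (simp add: one_less_power)
  have F: "Re (al (F v)) = c" "th (F v) = arctan (fst v / c)" for v
  proof -
    have "(cmod (be (F v)))\<^sup>2 = c\<^sup>2 - 1 + (fst v)\<^sup>2" using c2 by (simp add: F_def norm_mult)
    moreover have "c\<^sup>2 + (fst v)\<^sup>2 = c\<^sup>2 * (1 + (fst v / c)\<^sup>2)" using c by (simp add: field_simps)
    ultimately have "cmod (al (F v)) = c * sqrt (1 + (fst v / c)\<^sup>2)"
      using c by (simp add: cmod_al real_sqrt_mult)
    then show "Re (al (F v)) = c" "th (F v) = arctan (fst v / c)"
      using c by (auto simp: Re_al F_def cos_arctan real_sqrt_eq_zero_cancel_iff add_nonneg_eq_0_iff)
  qed
  have "{y. between 0 1 y \<and> Re (al y) = c} = range F"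
  proof (intro equalityI subsetI)
    fix y assume y: "y \<in> {y. between 0 1 y \<and> Re (al y) = c}"
    then have t: "\<bar>th y\<bar> < pi / 2" using between_hyp_iff[of y] c by simp
    have "be y = of_real (sqrt (c\<^sup>2 - 1 + (Im (al y))\<^sup>2)) * cis (Arg (be y))"
    proof -
      have "c\<^sup>2 - 1 + (Im (al y))\<^sup>2 = (cmod (be y))\<^sup>2" using SU_sq[of y] y by simp
      then have "sqrt (c\<^sup>2 - 1 + (Im (al y))\<^sup>2) = cmod (be y)" by simp
      then show ?thesis by (cases "be y = 0") (simp_all add: cis_Arg_pos)
    qed
    then have "y = F (Im (al y), Arg (be y))"
      using th_arctan[OF t] y by (intro cov_eqI) (simp_all add: F_def)
    then show "y \<in> range F" by blast
  next
    fix y assume "y \<in> range F"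
    then obtain v where "y = F v" by blast
    then show "y \<in> {y. between 0 1 y \<and> Re (al y) = c}"
      using F[of v] c between_hyp_iff[of y] abs_arctan_less[of "fst v / c"] by simp
  qed
  moreover have "continuous_on UNIV F" unfolding F_def using c by (intro continuous_intros) auto
  ultimately show ?thesis using connected_continuous_image[of UNIV F] convex_connected[OF convex_UNIV] by metis
qed

lemma connected_class_par: "connected {y. between 0 1 y \<and> Re (al y) = 1}"
proof -
  have "{y. between 0 1 y \<and> Re (al y) = 1} = para 1 ` (- {0})"
  proof (intro equalityI subsetI)
    fix y assume y: "y \<in> {y. between 0 1 y \<and> Re (al y) = 1}"
    then have "0 < th y" "th y < pi" by (auto simp: Up_def Dn_def)
    moreover have "th y < pi / 2" using cos_pos_range[of "th y"] Re_al_pos_cos[of y] y calculation by auto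
    ultimately have p: "y = para 1 (be y)" using y para_char_pos by simp
    then have "be y \<noteq> 0" using \<open>0 < th y\<close> by auto
    then show "y \<in> para 1 ` (- {0})" using p by blast
  next
    fix y assume "y \<in> para 1 ` (- {0::complex})"
    then show "y \<in> {y. between 0 1 y \<and> Re (al y) = 1}"
      using th_para_bounds(1) pi_gt_zero by (fastforce simp: Up_def Dn_def)
  qed
  then show ?thesis
    by (auto intro!: connected_continuous_image continuous_intros connected_punctured_universe)
qed

lemma connected_class_ell:
  assumes c: "\<bar>c\<bar> < 1" shows "connected {y. between 0 1 y \<and> Re (al y) = c}"
proof -
  define F where "F v = Cov (arccos (c / sqrt (1 + (cmod v)\<^sup>2))) v" for v
  have b: "\<bar>c / sqrt (1 + (cmod v)\<^sup>2)\<bar> < 1" for v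
  proof -
    have "1 \<le> sqrt (1 + (cmod v)\<^sup>2)" by (rule real_sqrt_ge_one) simp
    then have "\<bar>c\<bar> < sqrt (1 + (cmod v)\<^sup>2)" using c by linarith
    moreover from this have "sqrt (1 + (cmod v)\<^sup>2) > 0" by linarith
    ultimately show ?thesis by (simp add: abs_divide divide_less_eq_1_pos del: real_sqrt_gt_0_iff)
  qed
  have p: "1 + (cmod v)\<^sup>2 > 0" for v :: complex by (simp add: add_pos_nonneg)
  have F: "Re (al (F v)) = c" "0 < th (F v)" "th (F v) < pi" for v
  proof -
    define w where "w = c / sqrt (1 + (cmod v)\<^sup>2)"
    have w: "- 1 < w" "w < 1" using b[of v] unfolding w_def by linarith+
    then show "0 < th (F v)" "th (F v) < pi" using arccos_lt_bounded[of w] by (simp_all add: F_def w_def)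
    have "cos (th (F v)) = w" using w by (simp add: F_def flip: w_def)
    then show "Re (al (F v)) = c" using p[of v] by (simp add: Re_al cmod_al F_def w_def)
  qed
  have "{y. between 0 1 y \<and> Re (al y) = c} = range F"
  proof (intro equalityI subsetI)
    fix y assume y: "y \<in> {y. between 0 1 y \<and> Re (al y) = c}"
    then have t: "0 < th y" "th y < pi" using c by (auto simp: Up_def Dn_def)
    have "c / sqrt (1 + (cmod (be y))\<^sup>2) = cos (th y)"
      using y cmod_al[of y] al_nz[of y] by (auto simp: Re_al)
    then have "y = F (be y)" using t by (intro cov_eqI) (simp_all add: F_def arccos_cos)
    then show "y \<in> range F" by blast
  next
    fix y assume "y \<in> range F"
    then show "y \<in> {y. between 0 1 y \<and> Re (al y) = c}" using F by (auto simp: Up_def Dn_def)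
  qed
  moreover have "- 1 \<le> c / sqrt (1 + (cmod v)\<^sup>2) \<and> c / sqrt (1 + (cmod v)\<^sup>2) \<le> 1" for v
    using b[of v] by linarith
  then have "continuous_on UNIV F" unfolding F_def
    using p by (intro continuous_intros) (auto simp: less_imp_neq[symmetric])
  ultimately show ?thesis using connected_continuous_image[of UNIV F] convex_connected[OF convex_UNIV] by metis
qed

text \<open>A reflection of the region in its middle, which exchanges the levels 0 and 1 and negates
  half the trace.\<close>

lemma between_flip: "between 0 1 (cz 1 + mir y) \<longleftrightarrow> between 0 1 y"
  using Up_mir[of "-1" "mir y"] Dn_mir[of 0 "mir y"] by (auto simp: Up_shift Dn_shift)

lemma connected_class: "connected {y. between 0 1 y \<and> Re (al y) = c}"
proof (cases "c \<le> -1")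
  case True
  let ?F = "\<lambda>y. cz 1 + mir y"
  have inv: "?F (?F y) = y" for y by (intro cov_eqI) simp_all
  have "{y. between 0 1 y \<and> Re (al y) = c} = ?F ` {y. between 0 1 y \<and> Re (al y) = - c}"
  proof (intro equalityI subsetI)
    fix y assume "y \<in> {y. between 0 1 y \<and> Re (al y) = c}"
    then have "?F y \<in> {y. between 0 1 y \<and> Re (al y) = - c}" by (simp add: between_flip)
    then show "y \<in> ?F ` {y. between 0 1 y \<and> Re (al y) = - c}" by (rule image_eqI[of _ ?F "?F y", OF inv[symmetric]])
  next
    fix y assume "y \<in> ?F ` {y. between 0 1 y \<and> Re (al y) = - c}"
    then show "y \<in> {y. between 0 1 y \<and> Re (al y) = c}" using between_flip by auto
  qed
  moreover have "connected {y. between 0 1 y \<and> Re (al y) = - c}"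
    using True connected_class_hyp[of "- c"] connected_class_par by (cases "c = -1") simp_all
  moreover have "continuous_on UNIV mir" unfolding mir_def by (intro continuous_intros)
  then have "continuous_on S ?F" for S by (intro continuous_intros) (rule continuous_on_subset, auto)
  ultimately show ?thesis by (simp only: connected_continuous_image)
next
  case False
  then show ?thesis using connected_class_hyp[of c] connected_class_par connected_class_ell[of c]
    by (cases "c = 1"; cases "c > 1") auto
qed

text \<open>In this region half the trace is a complete invariant of conjugacy: its level sets are
  connected and free of central elements.\<close>

lemma conjugate_between:
  assumes "between 0 1 x" "between 0 1 y" "Re (al x) = Re (al y)"
  shows "\<exists>g. cjg g x = y"
  by (rule conjugate_connected[OF connected_class[of "Re (al y)"]]) (use assms between_not_cz in blast)+

subsection \<open>Values of the commutator map\<close>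

lemma hyp_decompose:
  assumes "between 0 0 y" "Re (al y) > 1"
  obtains c d where "y = para 1 c + para (-1) d"
proof -
  have "- Im (al y) < cmod (be y)" using hyp_be_Im[OF assms(2)] by linarith
  then obtain c where c: "Re (al (y + para 1 c)) = 1" using connected_slice_level[of y] assms(2) by auto
  let ?w = "y + para 1 c"
  have "Up 0 ?w" "Dn 1 ?w" using assms(1) Up_para[of 0 y c] Dn_para[of 0 y c] by auto
  then have t: "0 < th ?w" "th ?w < pi" using c by (auto simp: Up_def Dn_def)
  then have "th ?w < pi / 2" using cos_pos_range[of "th ?w"] Re_al_pos_cos[of ?w] c by auto
  then have "?w = para 1 (be ?w)" using t c by (intro para_char_pos)
  then have "y = para 1 (be ?w) + para (-1) (- c)"
    using uminus_para[of 1 c] by (metis add_diff_cancel diff_conv_add_uminus)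
  then show ?thesis by (rule that)
qed

lemma shift_Re_pos:
  assumes "Re (al a) \<noteq> 0"
  obtains m where "Re (al (cz m + a)) = \<bar>Re (al a)\<bar>" "\<bar>th (cz m + a)\<bar> < pi / 2"
proof -
  define m where "m = - round (th a / pi)"
  have "\<bar>th a / pi + of_int m\<bar> \<le> 1 / 2"
    using of_int_round_abs_le[of "th a / pi"] by (simp add: m_def abs_minus_commute)
  then have "\<bar>(th a / pi + of_int m) * pi\<bar> \<le> 1 / 2 * pi" by (simp add: abs_mult)
  then have t: "\<bar>th (cz m + a)\<bar> \<le> pi / 2" by (simp add: algebra_simps)
  have r: "\<bar>Re (al (cz m + a))\<bar> = \<bar>Re (al a)\<bar>" by (simp add: abs_mult)
  have "\<bar>th (cz m + a)\<bar> \<noteq> pi / 2"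
  proof
    assume "\<bar>th (cz m + a)\<bar> = pi / 2"
    then have "cos \<bar>th (cz m + a)\<bar> = 0" by (simp only: cos_pi_half)
    then show False using r assms by (simp add: Re_al del: cz_plus_simps)
  qed
  then have t': "\<bar>th (cz m + a)\<bar> < pi / 2" using t by linarith
  then have "Re (al (cz m + a)) > 0" using cos_gt_zero_pi[of "th (cz m + a)"] Re_al_pos_cos[of "cz m + a"] by (simp add: abs_less_iff del: cz_plus_simps)
  then show ?thesis using that[of m] r t' by simp
qed

text \<open>For a non-trivial commutator, a may be taken hyperbolic of level 0; so is then the
  conjugate of \<open>- a\<close>. Written as a positive times a negative parabolic, the latter
  moves a by at most one level in either direction.\<close>

theorem cmt_between: "between (-1) 1 (cmt a b)"
proof (cases "cmt a b = 0")
  case True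
  then show ?thesis by (simp add: Up_def Dn_def)
next
  case False
  then obtain a1 b1 where 1: "cmt a1 b1 = cmt a b" "\<bar>Re (al a1)\<bar> > 1" using hyperbolize by metis
  obtain m where m: "Re (al (cz m + a1)) > 1" "\<bar>th (cz m + a1)\<bar> < pi / 2"
    by (rule shift_Re_pos[of a1], use 1(2) in force, rule that) (use 1(2) in auto)
  define x where "x = cz m + a1"
  let ?y = "cjg b1 (- x)"
  have x: "Re (al x) > 1" "\<bar>th x\<bar> < pi / 2" using m by (simp_all only: x_def)
  have eq: "cmt a b = x + ?y" using 1(1) by (simp add: x_def flip: cmt_cjg)
  have yr: "Re (al ?y) > 1" using x by (simp add: Re_al_cjg)
  have "\<bar>th ?y\<bar> < 3 * pi / 2" using th_cjg_bound[of b1 "- x"] x by (simp add: abs_if split: if_splits)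
  then have yt: "\<bar>th ?y\<bar> < pi / 2" using yr Re_al_pos_cos[of ?y] cos_pos_range[of "th ?y"] by linarith
  obtain c d where y: "?y = para 1 c + para (-1) d"
    by (rule hyp_decompose[of ?y]) (use yr yt in \<open>auto simp: Up_def Dn_def abs_less_iff\<close>)
  have x0: "Up 0 x" "Dn 0 x" using x by (auto simp: Up_def Dn_def abs_less_iff)
  have "Up (-1) (x + para 1 c + para (-1) d)" "Dn 1 (x + para 1 c + para (-1) d)"
    using Up_para_neg[OF Up_para[OF x0(1)]] Dn_para_neg[OF Dn_para[OF x0(2)]] by auto
  then show ?thesis by (simp add: eq y add.assoc)
qed

lemma between_halves: "between (-1) 1 k \<Longrightarrow> k \<noteq> 0 \<Longrightarrow> between 0 1 k \<or> between (-1) 0 k"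
proof -
  assume k: "between (-1) 1 k" "k \<noteq> 0"
  consider "th k > 0" | "th k < 0" | "th k = 0" by linarith
  then show ?thesis
  proof cases
    case 3
    then have "Re (al k) = cmod (al k)" by (simp add: Re_al)
    moreover have "be k \<noteq> 0" using 3 k(2) cov_eqI[of k 0] by auto
    ultimately have "Re (al k) > 1" by (simp add: cmod_al)
    then show ?thesis using 3 k by (simp add: Up_def)
  qed (use k in \<open>auto simp: Up_def Dn_def\<close>)
qed

text \<open>With a diagonal first element, the trace sees b only through the Lorentz norm of
  \<open>Im (al b)\<close> and \<open>Im (be b)\<close>. Half-trace above, below and equal to 1 mean
  a timelike, spacelike and lightlike vector.\<close>

lemma trace_cmt:
  "Re (al (cmt (Cov 0 s) b)) = 1 + 2 * s\<^sup>2 * ((Im (al b))\<^sup>2 - (Im (be b))\<^sup>2)"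
proof -
  define A where "A = sqrt (1 + s\<^sup>2)"
  have A: "al (Cov 0 s) = of_real A" "be (Cov 0 s) = of_real s" "A\<^sup>2 = 1 + s\<^sup>2"
    by (simp_all add: al_def A_def)
  have "Re (al (cmt (Cov 0 s) b)) = A\<^sup>2 * ((cmod (al b))\<^sup>2 - (cmod (be b))\<^sup>2) + s\<^sup>2 * Re (be b * be b - al b * al b)"
    unfolding cmt_cjg al_plus al_cjg be_cjg al_uminus be_uminus A(1,2)
    by (simp add: algebra_simps power2_eq_square)
  also have "\<dots> = 1 + s\<^sup>2 * (1 + ((Re (be b))\<^sup>2 - (Im (be b))\<^sup>2 - (Re (al b))\<^sup>2 + (Im (al b))\<^sup>2))"
    using cmod_al_sq[of b] unfolding A(3) by (simp add: power2_eq_square) (simp add: algebra_simps)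
  also have "(Re (be b))\<^sup>2 - (Im (be b))\<^sup>2 - (Re (al b))\<^sup>2 + (Im (al b))\<^sup>2 = 2 * (Im (al b))\<^sup>2 - 2 * (Im (be b))\<^sup>2 - 1"
    using SU_sq[of b] by (simp add: cmod_power2)
  finally show ?thesis by (simp add: algebra_simps)
qed

subsection \<open>Upper triangular elements\<close>

text \<open>The matrix of \<open>tri p b\<close> has rows \<open>(p, b)\<close> and \<open>(0, 1 / p)\<close>.\<close>

definition tri :: "real \<Rightarrow> real \<Rightarrow> cov" where
  "tri p b = Cov (arctan (b / (p + 1 / p))) (Complex ((p - 1 / p) / 2) (- b / 2))"

lemma be_tri [simp]: "be (tri p b) = Complex ((p - 1 / p) / 2) (- b / 2)"
  and th_tri: "th (tri p b) = arctan (b / (p + 1 / p))"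
  by (simp_all add: tri_def)

lemma al_tri [simp]:
  assumes "p > 0" shows "al (tri p b) = Complex ((p + 1 / p) / 2) (b / 2)"
proof -
  define P where "P = p + 1 / p"
  have P: "P > 0" "((p - 1 / p) / 2)\<^sup>2 = P\<^sup>2 / 4 - 1"
    using assms by (simp_all add: P_def power2_eq_square add_pos_pos field_simps)
  have "1 + (cmod (be (tri p b)))\<^sup>2 = (P / 2)\<^sup>2 * (1 + (b / P)\<^sup>2)"
    unfolding be_tri cmod_power2 complex.sel P(2) using P(1) by (simp add: field_simps power2_eq_square)
  then have "sqrt (1 + (cmod (be (tri p b)))\<^sup>2) = P / 2 * sqrt (1 + (b / P)\<^sup>2)"
    using P(1) by (simp add: real_sqrt_mult)
  then have r: "cmod (al (tri p b)) = P / 2 * sqrt (1 + (b / P)\<^sup>2)" by (simp only: cmod_al)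
  have "sqrt (1 + (b / P)\<^sup>2) > 0" by (simp add: add_pos_nonneg)
  then show ?thesis unfolding complex_eq_iff Re_al Im_al r th_tri P_def[symmetric]
    using P(1) by (simp add: cos_arctan sin_arctan)
qed

lemma tri_unique: "\<bar>th y\<bar> < 3 * pi / 2 \<Longrightarrow> p > 0 \<Longrightarrow> al y = al (tri p b) \<Longrightarrow> be y = be (tri p b) \<Longrightarrow> y = tri p b"
  using abs_arctan_less[of "b / (p + 1 / p)"] by (intro cov_eqI_near) (auto simp: th_tri simp del: be_tri al_tri)

lemma tri_add:
  assumes "p > 0" "e > 0" shows "tri p b + tri e h = tri (p * e) (p * h + b / e)"
proof (rule tri_unique)
  show "\<bar>th (tri p b + tri e h)\<bar> < 3 * pi / 2"
    using th_plus_bound[of "tri p b" "tri e h"] abs_arctan_less[of "b / (p + 1 / p)"] abs_arctan_less[of "h / (e + 1 / e)"]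
    unfolding th_tri by linarith
qed (use assms in \<open>simp_all add: al_plus be_plus complex_eq_iff field_simps\<close>)

lemma uminus_tri: "p > 0 \<Longrightarrow> - tri p b = tri (1 / p) (- b)"
proof (rule tri_unique)
  show "\<bar>th (- tri p b)\<bar> < 3 * pi / 2" using abs_arctan_less[of "b / (p + 1 / p)"] pi_gt_zero by (simp add: th_tri)
qed (simp_all add: complex_eq_iff field_simps)

lemma cmt_tri:
  assumes "p > 0" "e > 0"
  shows "cmt (tri p b) (tri e h) = tri 1 (e * h * (p\<^sup>2 - 1) - p * b * (e\<^sup>2 - 1))"
proof -
  have "cmt (tri p b) (tri e h) = tri p b + tri e h + tri (1 / p) (- b) + tri (1 / e) (- h)"
    using assms by (simp add: cmt_def diff_conv_add_uminus uminus_tri del: add_uminus_conv_diff)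
  also have "\<dots> = tri (p * e * (1 / p) * (1 / e)) (p * e * (1 / p) * (- h) + (p * e * (- b) + (p * h + b / e) / (1 / p)) / (1 / e))"
    using assms by (simp only: tri_add mult_pos_pos zero_less_divide_1_iff)
  also have "\<dots> = tri 1 (e * h * (p\<^sup>2 - 1) - p * b * (e\<^sup>2 - 1))"
    using assms by (intro arg_cong2[of _ _ _ _ tri]) (simp_all add: field_simps power2_eq_square)
  finally show ?thesis .
qed

lemma continuous_on_tri [continuous_intros]:
  assumes "continuous_on S f" "continuous_on S g" "\<And>x. x \<in> S \<Longrightarrow> f x > 0"
  shows "continuous_on S (\<lambda>x. tri (f x) (g x))"
proof -
  have "f x \<noteq> 0" "f x + 1 / f x \<noteq> 0" if "x \<in> S" for x
    using assms(3)[OF that] by (auto simp: add_pos_pos less_imp_neq[symmetric])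
  then show ?thesis unfolding tri_def Complex_eq using assms(1,2) by (intro continuous_intros) auto
qed

lemma Cov_0_tri:
  assumes "s > 0" obtains p where "p > 1" "Cov 0 (of_real s) = tri p 0" "- Cov 0 (of_real s) = tri (1 / p) 0"
proof -
  define p where "p = s + sqrt (1 + s\<^sup>2)"
  have p: "p > 1" using assms by (simp add: p_def add_pos_nonneg less_add_same_cancel2 real_less_rsqrt add_strict_increasing)
  have "(p - s)\<^sup>2 = 1 + s\<^sup>2" by (simp add: p_def)
  then have "p * p - 1 = 2 * s * p" by (simp add: power2_eq_square algebra_simps)
  then have e: "Cov 0 (of_real s) = tri p 0" using p by (intro cov_eqI) (simp_all add: th_tri complex_eq_iff field_simps)
  then show ?thesis using that p uminus_tri[of p 0] by simp
qed

subsection \<open>Normal forms of pairs with a given commutator\<close>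

lemma cmt_not_cz: "cmt a b \<noteq> 0 \<Longrightarrow> cmt a b \<noteq> cz m"
  using cmt_between[of a b] between_halves[of "cmt a b"] between_not_cz[of "cmt a b" m]
    between_not_cz[of "mir (cmt a b)" "- m"] Up_mir[of "-1" "cmt a b"] Dn_mir[of 0 "cmt a b"]
  by (auto simp: mir_cz)

text \<open>The pairs of a parameter q and a conjugator to k form a fibration over B, whose fibres
  are cosets of the centraliser of k. On these H is constant, so all normal forms of the family give
  the same value.\<close>

lemma fib_normal:
  fixes B :: "'a::topological_space set"
  assumes B: "connected B" "continuous_on B a0" "continuous_on B b0"
    and nz: "\<And>q. q \<in> B \<Longrightarrow> cmt (a0 q) (b0 q) \<noteq> 0"
    and tr: "\<And>q. q \<in> B \<Longrightarrow> Re (al (cmt (a0 q) (b0 q))) = c"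
    and q: "q \<in> B" "q' \<in> B" "cjg g (cmt (a0 q) (b0 q)) = k" "cjg g' (cmt (a0 q') (b0 q')) = k"
    and H: "fibfun k H"
  shows "H (cjg g (a0 q), cjg g (b0 q)) = H (cjg g' (a0 q'), cjg g' (b0 q'))"
proof -
  let ?kap = "\<lambda>q. cmt (a0 q) (b0 q)"
  have kap: "continuous_on B ?kap" by (intro continuous_intros B)
  define E where "E = {(q, g). q \<in> B \<and> cjg g (?kap q) = k}"
  define f where "f z = H (cjg (snd z) (a0 (fst z)), cjg (snd z) (b0 (fst z)))" for z
  have "f (q, g) = f (q', g')"
  proof (rule locally_constant_fibration[OF B(1), of E])
    fix x e e' assume x: "(x, e) \<in> E" "(x, e') \<in> E"
    define d where "d = e' - e"
    have e': "e' = d + e" by (simp add: d_def)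
    have "cjg d k = k" using x by (simp add: E_def e' flip: cjg_cjg)
    then have "H (cjg d (cjg e (a0 x)), cjg d (cjg e (b0 x))) = H (cjg e (a0 x), cjg e (b0 x))"
      using fibfun_cjg[OF H] x by (simp add: E_def cjg_cmt cjg_eq_iff)
    then show "f (x, e) = f (x, e')" by (simp add: f_def e' cjg_cjg)
  next
    fix x assume x: "x \<in> B"
    have "\<exists>h. cjg h (?kap x) = ?kap q"
    proof (rule conjugate_connected)
      show "connected (?kap ` B)" by (rule connected_continuous_image[OF kap B(1)])
    qed (use x q tr nz cmt_not_cz in auto)
    then obtain h where "cjg h (?kap x) = ?kap q" by blast
    then have h: "cjg (g + h) (?kap x) = k" using q cjg_cjg[of g h "?kap x"] by simp
    obtain U s where U: "open U" "x \<in> U" "continuous_on (U \<inter> B) s" "\<And>r. r \<in> U \<inter> B \<Longrightarrow> cjg (s r) (?kap r) = k"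
    proof (rule intertwiner_section[OF x kap, of "\<lambda>_. k"])
      show "cjg (g + h) (?kap x) = k" by (rule h)
      show "Re (al (?kap q)) = Re (al k)" if "q \<in> B" for q
        using that tr h x by (metis Re_al_cjg)
      show "Im (al (?kap x)) \<noteq> 0 \<or> be (?kap x) \<noteq> 0"
        using central_iff[of "?kap x"] cmt_not_cz[OF nz[OF x]] by blast
    qed (auto intro: continuous_on_const)
    then show "\<exists>U s. open U \<and> x \<in> U \<and> continuous_on (U \<inter> B) s \<and> (\<forall>x'\<in>U \<inter> B. (x', s x') \<in> E)"
      by (intro exI[of _ U] exI[of _ s]) (auto simp: E_def)
  next
    have "continuous_on E (\<lambda>z. (cjg (snd z) (a0 (fst z)), cjg (snd z) (b0 (fst z))))"
      by (intro continuous_intros continuous_on_compose2[OF B(2)] continuous_on_compose2[OF B(3)]) (auto simp: E_def)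
    then show "continuous_on E f" unfolding f_def
    proof (rule continuous_on_compose2[rotated])
      show "continuous_on {z. cmt (fst z) (snd z) = k} H" using H by (simp add: fibfun_def)
      show "(\<lambda>z. (cjg (snd z) (a0 (fst z)), cjg (snd z) (b0 (fst z)))) ` E \<subseteq> {z. cmt (fst z) (snd z) = k}"
        unfolding E_def by (force simp flip: cjg_cmt)
    qed
  qed (use q in \<open>auto simp: E_def\<close>)
  then show ?thesis by (simp add: f_def)
qed

lemma hyp_normal:
  assumes "cmt a b = k" "k \<noteq> 0"
  obtains g s b' where "s > 0" "cjg g (cmt (Cov 0 (of_real s)) b') = k"
    "\<And>H. fibfun k H \<Longrightarrow> H (cjg g (Cov 0 (of_real s)), cjg g b') = H (a, b)"
proof -
  obtain a1 b1 where 1: "cmt a1 b1 = k" "\<bar>Re (al a1)\<bar> > 1" "\<And>H. fibfun k H \<Longrightarrow> H (a1, b1) = H (a, b)"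
    using hyperbolize[OF assms] by metis
  obtain m where m: "Re (al (cz m + a1)) > 1" "\<bar>th (cz m + a1)\<bar> < pi / 2"
    by (rule shift_Re_pos[of a1], use 1(2) in force, rule that) (use 1(2) in auto)
  define x where "x = cz m + a1"
  have x: "between 0 1 x" "Re (al x) > 1" using m between_hyp_iff[of x] by (simp_all only: x_def)
  define s where "s = sqrt ((Re (al x))\<^sup>2 - 1)"
  have r: "(Re (al x))\<^sup>2 > 1" using x(2) by (simp add: one_less_power)
  then have s: "s > 0" "s\<^sup>2 = (Re (al x))\<^sup>2 - 1" by (simp_all add: s_def)
  let ?a = "Cov 0 (of_real s)"
  have "Re (al ?a) = Re (al x)" using s x(2) by (simp add: al_def)
  moreover from this have "between 0 1 ?a" using x(2) by (intro between_hyp_iff[THEN iffD2]) simp_all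
  ultimately obtain g where g: "cjg g ?a = x" using conjugate_between x(1) by metis
  define b' where "b' = cjg (- g) b1"
  have b': "cjg g b' = b1" by (simp add: b'_def cjg_cjg)
  show ?thesis
  proof (rule that[OF s(1)])
    show "cjg g (cmt ?a b') = k" using 1(1) by (simp add: cjg_cmt g b' x_def)
    show "H (cjg g ?a, cjg g b') = H (a, b)" if "fibfun k H" for H
      using 1 that by (simp add: g b' x_def fibfun_def)
  qed
qed

lemma fibfun_cz:
  assumes "fibfun k H" "cmt a b = k" shows "H (cz m + a, b) = H (a, b)" "H (a, cz m + b) = H (a, b)"
  using assms by (auto simp: fibfun_def)

section \<open>Boosts by diagonal elements\<close>

lemma al_Cov_0 [simp]: "al (Cov 0 (of_real s)) = of_real (sqrt (1 + s\<^sup>2))"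
  by (simp add: al_def)

lemma cjg_tri_0:
  assumes "L > 0"
  shows "Im (al (cjg (tri L 0) b)) = ((L\<^sup>2 + 1 / L\<^sup>2) * Im (al b) - (L\<^sup>2 - 1 / L\<^sup>2) * Im (be b)) / 2"
    and "Im (be (cjg (tri L 0) b)) = ((L\<^sup>2 + 1 / L\<^sup>2) * Im (be b) - (L\<^sup>2 - 1 / L\<^sup>2) * Im (al b)) / 2"
proof -
  define C S where "C = (L + 1 / L) / 2" and "S = (L - 1 / L) / 2"
  have "al (tri L 0) = of_real C" "be (tri L 0) = of_real S"
    using assms by (simp_all add: C_def S_def complex_eq_iff)
  then have "Im (al (cjg (tri L 0) b)) = (C\<^sup>2 + S\<^sup>2) * Im (al b) - 2 * C * S * Im (be b)"
    "Im (be (cjg (tri L 0) b)) = (C\<^sup>2 + S\<^sup>2) * Im (be b) - 2 * C * S * Im (al b)"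
    by (simp_all add: al_cjg be_cjg power2_eq_square algebra_simps)
  moreover have "C\<^sup>2 + S\<^sup>2 = (L\<^sup>2 + 1 / L\<^sup>2) / 2" "2 * C * S = (L\<^sup>2 - 1 / L\<^sup>2) / 2"
    using assms by (simp_all add: C_def S_def power2_eq_square field_simps)
  ultimately show "Im (al (cjg (tri L 0) b)) = ((L\<^sup>2 + 1 / L\<^sup>2) * Im (al b) - (L\<^sup>2 - 1 / L\<^sup>2) * Im (be b)) / 2"
    "Im (be (cjg (tri L 0) b)) = ((L\<^sup>2 + 1 / L\<^sup>2) * Im (be b) - (L\<^sup>2 - 1 / L\<^sup>2) * Im (al b)) / 2"
    by (simp_all only: times_divide_eq_left flip: diff_divide_distrib)
qed

lemma boost_exists:
  assumes "\<bar>X\<bar> < \<bar>Y\<bar>" obtains L :: real where "L > 0" "(L\<^sup>2 + 1 / L\<^sup>2) * X = (L\<^sup>2 - 1 / L\<^sup>2) * Y"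
proof -
  define r where "r = (Y + X) / (Y - X)"
  have n: "Y - X \<noteq> 0" using assms by auto
  have r: "r > 0" using assms by (cases "Y > 0") (auto simp: r_def zero_less_divide_iff abs_if split: if_splits)
  define L where "L = root 4 r"
  have L: "L > 0" "L ^ 4 = r" using r by (simp_all add: L_def)
  have "L ^ 4 * (Y - X) = Y + X" using n by (simp add: L(2) r_def)
  then have "(L\<^sup>2 * L\<^sup>2 + 1) * X = (L\<^sup>2 * L\<^sup>2 - 1) * Y" by (simp add: algebra_simps flip: power_add)
  then have "(L\<^sup>2 + 1 / L\<^sup>2) * X = (L\<^sup>2 - 1 / L\<^sup>2) * Y" using L(1) by (simp add: field_simps)
  then show ?thesis using that L(1) by blast
qed

lemma cjg_tri_0_Cov: assumes "L > 0" shows "cjg (tri L 0) (Cov 0 (of_real s)) = Cov 0 (of_real s)"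
proof -
  have "tri L 0 + Cov 0 (of_real s) = Cov 0 (of_real s) + tri L 0"
    by (rule cov_commute) (use assms in \<open>simp_all add: al_plus be_plus complex_eq_iff mult.commute\<close>)
  then show ?thesis by (simp add: cjg_eq_iff)
qed

text \<open>The centralizer of \<open>Cov 0 s\<close> acts on \<open>(Im (al b), Im (be b))\<close> by Lorentz boosts.\<close>

lemma boost_normal:
  assumes "\<bar>X b\<bar> < \<bar>Y b\<bar>" and XY: "(X, Y) = (\<lambda>b. Im (al b), \<lambda>b. Im (be b)) \<or> (X, Y) = (\<lambda>b. Im (be b), \<lambda>b. Im (al b))"
    and k: "cjg g (cmt (Cov 0 (of_real s)) b) = k"
  obtains g' b' where "X b' = 0" "cjg g' (cmt (Cov 0 (of_real s)) b') = k"
    "cjg g' (Cov 0 (of_real s)) = cjg g (Cov 0 (of_real s))" "cjg g' b' = cjg g b"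
proof -
  obtain L where L: "L > 0" "(L\<^sup>2 + 1 / L\<^sup>2) * X b = (L\<^sup>2 - 1 / L\<^sup>2) * Y b" using boost_exists[OF assms(1)] .
  let ?b = "cjg (tri L 0) b" and ?g = "g - tri L 0" and ?a = "Cov 0 (of_real s)"
  have a: "cjg ?g ?a = cjg g ?a"
    using cjg_inverse[OF cjg_tri_0_Cov[OF L(1), of s]] cjg_cjg[of g "- tri L 0" ?a] by simp
  have b: "cjg ?g ?b = cjg g b" by (simp add: cjg_cjg)
  have "X ?b = 0" using XY L cjg_tri_0[OF L(1), of b] by auto
  moreover have "cjg ?g (cmt ?a ?b) = k" using k a b by (simp add: cjg_cmt)
  ultimately show ?thesis using that a b by blast
qed

text \<open>The vector is timelike, so a boost makes \<open>be b\<close> real. A central translation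
  brings \<open>th b\<close> into (0, pi), and the trace determines the diagonal element: the normal
  forms are parametrised by a strip.\<close>

lemma fib_case_gt:
  assumes ab: "cmt a b = k" "cmt a' b' = k" and H: "fibfun k H" and t: "Re (al k) > 1"
  shows "H (a, b) = H (a', b')"
proof -
  define c where "c = Re (al k)"
  define B where "B = {q :: real \<times> real. 0 < fst q \<and> fst q < pi}"
  define s where "s q = sqrt ((c - 1) / 2) / Im (al (Cov (fst q) (of_real (snd q))))" for q :: "real \<times> real"
  define a0 where "a0 q = Cov 0 (of_real (s q))" for q
  define b0 where "b0 q = Cov (fst q) (of_real (snd q))" for q :: "real \<times> real"
  have pos: "Im (al (b0 q)) > 0" if "q \<in> B" for q
    using that al_nz[of "b0 q"] by (simp add: B_def b0_def Im_al sin_gt_zero)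
  have tr: "Re (al (cmt (a0 q) (b0 q))) = c" if "q \<in> B" for q
    using pos[OF that] t unfolding a0_def trace_cmt s_def by (simp add: b0_def c_def power_divide field_simps)
  have form: "\<exists>g q. q \<in> B \<and> cjg g (cmt (a0 q) (b0 q)) = k \<and> H (cjg g (a0 q), cjg g (b0 q)) = H (a, b)"
    if ab: "cmt a b = k" for a b
  proof -
    have k: "k \<noteq> 0" using t by auto
    obtain g r b1 where 1: "r > 0" "cjg g (cmt (Cov 0 (of_real r)) b1) = k"
      "H (cjg g (Cov 0 (of_real r)), cjg g b1) = H (a, b)"
      using hyp_normal[OF ab k] H by metis
    have "Re (al (cmt (Cov 0 (of_real r)) b1)) > 1" using t 1(2) by (metis Re_al_cjg)
    then have "2 * r\<^sup>2 * ((Im (al b1))\<^sup>2 - (Im (be b1))\<^sup>2) > 0" by (simp add: trace_cmt)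
    then have "(Im (be b1))\<^sup>2 < (Im (al b1))\<^sup>2" using 1(1) by (simp add: zero_less_mult_iff)
    then have "\<bar>Im (be b1)\<bar> < \<bar>Im (al b1)\<bar>" by (simp add: abs_le_square_iff not_le[symmetric])
    then obtain g2 b2 where 2: "Im (be b2) = 0" "cjg g2 (cmt (Cov 0 (of_real r)) b2) = k"
      "H (cjg g2 (Cov 0 (of_real r)), cjg g2 b2) = H (a, b)"
      using boost_normal[of "\<lambda>b. Im (be b)" b1 "\<lambda>b. Im (al b)" g r k] 1 by metis
    have c2: "c = 1 + 2 * r\<^sup>2 * (Im (al b2))\<^sup>2" using 2(1,2) trace_cmt[of r b2] unfolding c_def by (metis Re_al_cjg diff_zero power_zero_numeral)
    then have i: "Im (al b2) \<noteq> 0" using t by (auto simp: c_def)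
    \<comment> \<open>The floor leaves pi times the fractional part, which is not 0 because
      \<open>Im (al b2)\<close> is not.\<close>
    define m where "m = - \<lfloor>th b2 / pi\<rfloor>"
    define b3 where "b3 = cz m + b2"
    have "th b3 = pi * frac (th b2 / pi)" by (simp add: b3_def m_def frac_def algebra_simps)
    moreover have "frac (th b2 / pi) \<noteq> 0"
    proof
      assume "frac (th b2 / pi) = 0"
      then have "th b2 = of_int \<lfloor>th b2 / pi\<rfloor> * pi" by (simp add: frac_def field_simps)
      then have "sin (th b2) = 0" using sin_int_pi by metis
      then show False using i by (simp add: Im_al)
    qed
    then have "frac (th b2 / pi) > 0" using frac_ge_0[of "th b2 / pi"] by simp
    ultimately have b3: "0 < th b3" "th b3 < pi" using frac_lt_1[of "th b2 / pi"] by simp_all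
    define q where "q = (th b3, Re (be b3))"
    have q: "q \<in> B" "b0 q = b3" using b3 2(1) by (auto simp: q_def B_def b0_def b3_def complex_eq_iff intro!: cov_eqI)
    have "(Im (al b3))\<^sup>2 = (Im (al b2))\<^sup>2" using sg_cases[of m] by (auto simp: b3_def)
    then have "s q = sqrt (r\<^sup>2 * (Im (al b3))\<^sup>2) / Im (al b3)" using c2 q(2) by (simp add: s_def b0_def)
    then have "s q = r" using 1(1) pos[OF q(1)] by (simp add: q real_sqrt_mult)
    then have a0: "a0 q = Cov 0 (of_real r)" by (simp add: a0_def)
    have g3: "cjg g2 b3 = cz m + cjg g2 b2" by (simp add: b3_def cjg_plus)
    have "cjg g2 (cmt (a0 q) (b0 q)) = k" using 2(2) by (simp add: a0 q cjg_cmt g3)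
    moreover have "H (cjg g2 (a0 q), cjg g2 (b0 q)) = H (a, b)"
      using 2 fibfun_cz[OF H, of "cjg g2 (a0 q)" "cjg g2 b2"] by (simp add: a0 q g3 cjg_cmt)
    ultimately show ?thesis using q by blast
  qed
  obtain g q where 1: "q \<in> B" "cjg g (cmt (a0 q) (b0 q)) = k" "H (cjg g (a0 q), cjg g (b0 q)) = H (a, b)"
    using form[OF ab(1)] by blast
  obtain g' q' where 2: "q' \<in> B" "cjg g' (cmt (a0 q') (b0 q')) = k" "H (cjg g' (a0 q'), cjg g' (b0 q')) = H (a', b')"
    using form[OF ab(2)] by blast
  have B: "connected B"
  proof -
    have "B = {0<..<pi} \<times> UNIV" by (auto simp: B_def)
    then show ?thesis by (simp add: connected_Times convex_connected)
  qed
  have b0: "continuous_on B b0" unfolding b0_def by (intro continuous_intros)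
  have a0: "continuous_on B a0" unfolding a0_def s_def
    using pos[unfolded b0_def] by (intro continuous_intros ballI) (simp_all add: less_imp_neq[symmetric])
  have "cmt (a0 q) (b0 q) \<noteq> 0" if "q \<in> B" for q using tr[OF that] t by (auto simp: c_def)
  then show ?thesis using fib_normal[OF B a0 b0 _ tr, of q q' g k g' H] 1 2 H by simp
qed

text \<open>The vector is spacelike, so a boost makes \<open>al b\<close> real, and a central
  translation gives \<open>th b = 0\<close>. The sign of \<open>Im (be b)\<close> separates two
  families exchanged by \<open>mir\<close>; the sign of \<open>th k\<close> is invariant under
  conjugation and admits only one of them.\<close>

lemma fib_case_lt:
  assumes ab: "cmt a b = k" "cmt a' b' = k" and H: "fibfun k H" and t: "Re (al k) < 1"
  shows "H (a, b) = H (a', b')"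
proof -
  define c where "c = Re (al k)"
  define B where "B = {q :: real \<times> real. 0 < snd q}"
  define a0 where "a0 q = Cov 0 (of_real (sqrt ((1 - c) / 2) / snd q))" for q :: "real \<times> real"
  define b0 where "b0 e q = Cov 0 (Complex (fst q) (e * snd q))" for e :: real and q :: "real \<times> real"
  define kap where "kap e q = cmt (a0 q) (b0 e q)" for e q
  have tr: "Re (al (kap e q)) = c" if "q \<in> B" "e\<^sup>2 = 1" for e q
    using that t unfolding kap_def a0_def trace_cmt
    by (simp add: b0_def B_def c_def power_divide power_mult_distrib al_def field_simps)
  have nz: "kap e q \<noteq> 0" if "q \<in> B" "e\<^sup>2 = 1" for e q using tr[OF that] t by (auto simp: c_def)
  have form: "\<exists>g q e. q \<in> B \<and> e\<^sup>2 = 1 \<and> cjg g (kap e q) = k \<and> H (cjg g (a0 q), cjg g (b0 e q)) = H (a, b)"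
    if ab: "cmt a b = k" for a b
  proof -
    have k: "k \<noteq> 0" using t by auto
    obtain g r b1 where 1: "r > 0" "cjg g (cmt (Cov 0 (of_real r)) b1) = k"
      "H (cjg g (Cov 0 (of_real r)), cjg g b1) = H (a, b)"
      using hyp_normal[OF ab k] H by metis
    have "Re (al (cmt (Cov 0 (of_real r)) b1)) < 1" using t 1(2) by (metis Re_al_cjg)
    then have "2 * r\<^sup>2 * ((Im (al b1))\<^sup>2 - (Im (be b1))\<^sup>2) < 0" by (simp add: trace_cmt)
    then have "(Im (al b1))\<^sup>2 < (Im (be b1))\<^sup>2" using 1(1) by (simp add: mult_less_0_iff)
    then have "\<bar>Im (al b1)\<bar> < \<bar>Im (be b1)\<bar>" by (simp add: abs_le_square_iff not_le[symmetric])
    then obtain g2 b2 where 2: "Im (al b2) = 0" "cjg g2 (cmt (Cov 0 (of_real r)) b2) = k"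
      "H (cjg g2 (Cov 0 (of_real r)), cjg g2 b2) = H (a, b)"
      using boost_normal[of "\<lambda>b. Im (al b)" b1 "\<lambda>b. Im (be b)" g r k] 1 by metis
    have c2: "c = 1 - 2 * r\<^sup>2 * (Im (be b2))\<^sup>2"
      using 2(1,2) trace_cmt[of r b2] Re_al_cjg[of g2 "cmt (Cov 0 (of_real r)) b2"] unfolding c_def by simp
    then have i: "Im (be b2) \<noteq> 0" using t by (auto simp: c_def)
    have "sin (th b2) = 0" using 2(1) by (simp add: Im_al)
    then obtain m :: int where m: "th b2 = of_int m * pi" by (auto simp: sin_zero_iff_int2)
    define b3 where "b3 = cz (- m) + b2"
    define q where "q = (Re (be b3), \<bar>Im (be b3)\<bar>)"
    have i3: "\<bar>Im (be b3)\<bar> = \<bar>Im (be b2)\<bar>" by (simp add: b3_def abs_mult)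
    have "b0 (sgn (Im (be b3))) q = Cov 0 (be b3)"
      unfolding b0_def q_def fst_conv snd_conv sgn_mult_abs by (simp add: complex_eq_iff)
    also have "\<dots> = b3" by (intro cov_eqI) (simp_all add: b3_def m)
    finally have q: "q \<in> B" "b0 (sgn (Im (be b3))) q = b3" using i i3 by (auto simp: q_def B_def)
    have "sqrt ((1 - c) / 2) = sqrt ((r * \<bar>Im (be b2)\<bar>)\<^sup>2)" using c2 by (simp add: power_mult_distrib)
    then have a0: "a0 q = Cov 0 (of_real r)" using 1(1) i by (simp add: a0_def q_def i3)
    have g3: "cjg g2 b3 = cz (- m) + cjg g2 b2" by (simp add: b3_def cjg_plus)
    have "cjg g2 (cmt (a0 q) b3) = k" using 2(2) by (simp add: a0 cjg_cmt g3)
    moreover have "H (cjg g2 (a0 q), cjg g2 b3) = H (a, b)"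
      using 2 fibfun_cz[OF H, of "cjg g2 (a0 q)" "cjg g2 b2"] by (simp add: a0 g3 cjg_cmt)
    moreover have "(sgn (Im (be b3)))\<^sup>2 = 1" using i i3 by (auto simp: sgn_if)
    ultimately show ?thesis using q unfolding kap_def by metis
  qed
  have B: "connected B"
  proof -
    have "B = UNIV \<times> {0<..}" by (auto simp: B_def)
    then show ?thesis by (simp add: connected_Times convex_connected)
  qed
  have cont: "continuous_on B (b0 e)" "continuous_on B a0" for e
    unfolding b0_def a0_def Complex_eq by (intro continuous_intros; simp add: B_def)+
  have sgn: "e = e'" if q: "q \<in> B" "q' \<in> B" "e\<^sup>2 = 1" "e'\<^sup>2 = 1" "cjg g (kap e q) = k" "cjg g' (kap e' q') = k" for q q' e e' g g'
  proof -
    have "mir (a0 q) = a0 q" "mir (b0 e q) = b0 (- e) q" for e q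
      by (intro cov_eqI; simp add: a0_def b0_def complex_eq_iff)+
    then have m: "kap (- e) q = mir (kap e q)" for e q by (simp add: kap_def mir_cmt)
    have lt: "Re (al (kap e q)) < 1" if "q \<in> B" "e\<^sup>2 = 1" for e q using tr[OF that] t by (simp add: c_def)
    have "\<exists>h. cjg h (kap e q) = kap e q'"
    proof (rule conjugate_connected)
      show "connected (kap e ` B)"
        unfolding kap_def by (intro connected_continuous_image B continuous_intros cont)
    qed (use q tr nz cmt_not_cz in \<open>auto simp: kap_def\<close>)
    then have s1: "th (kap e q) > 0 \<longleftrightarrow> th (kap e q') > 0" using th_sign_cjg[OF lt] q by metis
    have s2: "th (kap e q) > 0 \<longleftrightarrow> th k > 0" "th (kap e' q') > 0 \<longleftrightarrow> th k > 0"
      using th_sign_cjg[OF lt] q by metis+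
    have "th (kap e q') \<noteq> 0"
    proof
      assume "th (kap e q') = 0"
      then have "Re (al (kap e q')) \<ge> 1" using th_eq_int_pi[of _ 0] cmod_al_ge_1 by simp
      then show False using lt[of q' e] q by simp
    qed
    then have "e' \<noteq> - e" using s1 s2 by (auto simp: m)
    then show ?thesis using q(3,4) power2_eq_iff[of e e'] by auto
  qed
  obtain g q e where 1: "q \<in> B" "e\<^sup>2 = 1" "cjg g (kap e q) = k" "H (cjg g (a0 q), cjg g (b0 e q)) = H (a, b)"
    using form[OF ab(1)] by blast
  obtain g' q' e' where 2: "q' \<in> B" "e'\<^sup>2 = 1" "cjg g' (kap e' q') = k" "H (cjg g' (a0 q'), cjg g' (b0 e' q')) = H (a', b')"
    using form[OF ab(2)] by blast
  have "e' = e" using sgn 1 2 by metis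
  then show ?thesis
    using fib_normal[OF B cont(2) cont(1)[of e] _ tr[unfolded kap_def], of q q' g k g' H] 1 2 H nz by (simp add: kap_def)
qed

lemma tri_1_para: "y \<noteq> 0 \<Longrightarrow> tri 1 y = para (sgn y) (be (tri 1 y))"
proof -
  assume y: "y \<noteq> 0"
  have "al (tri 1 y) = Complex 1 (y / 2)" "\<bar>th (tri 1 y)\<bar> < pi / 2" using abs_arctan_less by (simp_all add: th_tri)
  then show ?thesis using y para_char_pos[of "tri 1 y"] para_char_neg[of "tri 1 y"]
    by (cases "y > 0") (simp_all add: th_tri abs_less_iff sgn_if del: be_tri)
qed

lemma tri_1_sign:
  assumes "cjg g (tri 1 y) = k" "y \<noteq> 0" shows "th k > 0 \<longleftrightarrow> y > 0"
proof -
  have y: "be (tri 1 y) \<noteq> 0" using assms(2) by (simp add: complex_eq_iff)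
  have "k = para (sgn y) (be k)" "be k \<noteq> 0"
    using cjg_para[OF _ y, of "sgn y" g] be_cjg_para_nz[OF _ y, of "sgn y" g] assms tri_1_para[OF assms(2)]
    by (auto simp: sgn_if split: if_splits)
  then show ?thesis using th_para_bounds[of "be k"] assms(2) by (cases "y > 0") (auto simp: sgn_if)
qed

lemma cjg_quarter:
  shows "al (cjg (Cov (pi / 2) 0) y) = al y" "be (cjg (Cov (pi / 2) 0) y) = - be y"
  by (simp_all add: al_cjg be_cjg al_def[of "Cov (pi / 2) 0"])

text \<open>Put X = p^2 - 1 and Y = r^2 - 1. For fixed (p, r) the condition places (p b, r h) on one
  side of the line through (X, Y). This is a half-plane unless p = r = 1, where nothing is left; the
  base is a punctured plane in the logarithms of p and r.\<close>

lemma connected_tri_pairs: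
  assumes "e\<^sup>2 = (1 :: real)"
  shows "connected {((p, b), (r, h)) | p b r h. p > 0 \<and> r > 0 \<and> e * (r * h * (p\<^sup>2 - 1) - p * b * (r\<^sup>2 - 1)) > (0 :: real)}" (is "connected ?B")
proof -
  define p r where "p v = exp (fst (fst v))" and "r v = exp (snd (fst v))" for v :: "(real \<times> real) \<times> (real \<times> real)"
  define X Y where "X v = (p v)\<^sup>2 - 1" and "Y v = (r v)\<^sup>2 - 1" for v
  define F where "F v = ((p v, (snd (snd v) * X v - e * exp (fst (snd v)) * Y v) / p v), (r v, (e * exp (fst (snd v)) * X v + snd (snd v) * Y v) / r v))" for v
  let ?D = "(- {0 :: real \<times> real}) \<times> (UNIV :: (real \<times> real) set)"
  have XY: "X v * X v + Y v * Y v > 0" if "fst v \<noteq> 0" for v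
  proof -
    have "p v \<noteq> 1 \<or> r v \<noteq> 1" using that by (auto simp: p_def r_def prod_eq_iff)
    then have "X v \<noteq> 0 \<or> Y v \<noteq> 0" by (auto simp: X_def Y_def p_def r_def power2_eq_1_iff) (metis exp_gt_zero neg_0_less_iff_less not_one_less_zero zero_less_one less_asym)+
    then show ?thesis by (simp add: sum_squares_gt_zero_iff)
  qed
  have pr: "p v > 0" "r v > 0" for v by (simp_all add: p_def r_def)
  have "?B = F ` ?D"
  proof (intro equalityI subsetI)
    fix q assume "q \<in> ?B"
    then obtain p' b r' h where q: "q = ((p', b), (r', h))" "p' > 0" "r' > 0" "e * (r' * h * (p'\<^sup>2 - 1) - p' * b * (r'\<^sup>2 - 1)) > 0" by blast
    define x y N where "x = p'\<^sup>2 - 1" and "y = r'\<^sup>2 - 1" and "N = x * x + y * y"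
    have nz: "x \<noteq> 0 \<or> y \<noteq> 0" using q(4) by (auto simp: x_def y_def)
    then have N: "N > 0" by (simp add: N_def sum_squares_gt_zero_iff)
    define w where "w = e * (r' * h * x - p' * b * y) / N"
    have w: "w > 0" using q(4) N by (simp add: w_def x_def y_def)
    define v where "v = ((ln p', ln r'), (ln w, (x * p' * b + y * r' * h) / N))"
    have v: "p v = p'" "r v = r'" "X v = x" "Y v = y" "exp (fst (snd v)) = w" "snd (snd v) = (x * p' * b + y * r' * h) / N"
      using q w by (simp_all add: v_def p_def r_def X_def Y_def x_def y_def)
    have "e * e = 1" using assms by (simp add: power2_eq_square)
    then have ew: "e * w = (r' * h * x - p' * b * y) / N" by (simp add: w_def flip: mult.assoc)
    have "F v = q" using N q(2,3) unfolding F_def v ew q(1) by (simp add: field_simps) (simp add: N_def field_simps)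
    moreover have "ln p' \<noteq> 0 \<or> ln r' \<noteq> 0" using nz q(2,3) by (auto simp: x_def y_def)
    then have "v \<in> ?D" by (auto simp: v_def zero_prod_def)
    ultimately show "q \<in> F ` ?D" by blast
  next
    fix q assume "q \<in> F ` ?D"
    then obtain v where "v \<in> ?D" and q: "q = F v" by (rule imageE)
    then have v: "fst v \<noteq> 0" by (simp add: mem_Times_iff)
    define x y w where "x = X v" and "y = Y v" and "w = exp (fst (snd v))"
    have "e * (r v * ((e * w * x + snd (snd v) * y) / r v) * x - p v * ((snd (snd v) * x - e * w * y) / p v) * y) = e\<^sup>2 * (w * (x * x + y * y))"
    proof -
      have c: "z * (u / z) = u" if "z > 0" for z u :: real using that by simp
      show ?thesis unfolding c[OF pr(1)] c[OF pr(2)] by (simp add: power2_eq_square algebra_simps)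
    qed
    also have "\<dots> > 0" using assms XY[OF v] by (simp add: x_def y_def w_def)
    finally show "q \<in> ?B" using pr[of v] unfolding q F_def x_def[symmetric] y_def[symmetric] w_def[symmetric]
      by (simp add: x_def X_def y_def Y_def)
  qed
  moreover have "connected ?D"
    using connected_punctured_universe[where 'N="real \<times> real" and a=0] by (simp add: connected_Times convex_connected)
  moreover have "continuous_on ?D F" unfolding F_def p_def r_def X_def Y_def
    by (intro continuous_intros) auto
  ultimately show ?thesis using connected_continuous_image by metis
qed

text \<open>The vector is lightlike, so b is upper or lower triangular. A quarter turn makes a lower
  triangular b upper triangular and inverts the diagonal element. The sign of \<open>th k\<close>
  fixes the sign of the off-diagonal entry of the commutator.\<close>

lemma fib_case_eq:
  assumes ab: "cmt a b = k" "cmt a' b' = k" and H: "fibfun k H" and t: "Re (al k) = 1" and k: "k \<noteq> 0"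
  shows "H (a, b) = H (a', b')"
proof -
  define e :: real where "e = (if th k > 0 then 1 else -1)"
  define B where "B = {((p, b), (r, h)) | p b r h. p > 0 \<and> r > 0 \<and> e * (r * h * (p\<^sup>2 - 1) - p * b * (r\<^sup>2 - 1)) > (0 :: real)}"
  define a0 b0 where "a0 q = tri (fst (fst q)) (snd (fst q))" and "b0 q = tri (fst (snd q)) (snd (snd q))" for q :: "(real \<times> real) \<times> (real \<times> real)"
  have form: "\<exists>g q. q \<in> B \<and> cjg g (cmt (a0 q) (b0 q)) = k \<and> H (cjg g (a0 q), cjg g (b0 q)) = H (a, b)"
    if ab: "cmt a b = k" for a b
  proof -
    obtain g s b1 where 1: "s > 0" "cjg g (cmt (Cov 0 (of_real s)) b1) = k"
      "H (cjg g (Cov 0 (of_real s)), cjg g b1) = H (a, b)"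
      using hyp_normal[OF ab k] H by metis
    have "Re (al (cmt (Cov 0 (of_real s)) b1)) = 1" using t 1(2) by (metis Re_al_cjg)
    then have i: "(Im (al b1))\<^sup>2 = (Im (be b1))\<^sup>2" using 1(1) by (simp add: trace_cmt)
    have r: "(Re (al b1))\<^sup>2 = 1 + (Re (be b1))\<^sup>2" using SU_sq[of b1] i by (simp add: cmod_power2)
    have r0: "Re (al b1) \<noteq> 0"
    proof
      assume "Re (al b1) = 0"
      then show False using r zero_le_power2[of "Re (be b1)"] by simp
    qed
    then obtain m where m: "Re (al (cz m + b1)) = \<bar>Re (al b1)\<bar>" "\<bar>th (cz m + b1)\<bar> < pi / 2" by (rule shift_Re_pos)
    define b2 where "b2 = cz m + b1"
    have b2: "Re (al b2) = \<bar>Re (al b1)\<bar>" "\<bar>th b2\<bar> < pi / 2" using m by (simp_all only: b2_def)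
    have i2: "(Im (al b2))\<^sup>2 = (Im (be b2))\<^sup>2" "(Re (be b2))\<^sup>2 = (Re (be b1))\<^sup>2"
      using i sg_cases[of m] by (auto simp: b2_def)
    have g2: "cjg g b2 = cz m + cjg g b1" by (simp add: b2_def cjg_plus)
    have 2: "cjg g (cmt (Cov 0 (of_real s)) b2) = k" "H (cjg g (Cov 0 (of_real s)), cjg g b2) = H (a, b)"
      using 1 fibfun_cz[OF H, of "cjg g (Cov 0 (of_real s))" "cjg g b1"] by (simp_all add: g2 cjg_cmt)
    obtain p where p: "p > 1" "Cov 0 (of_real s) = tri p 0" "- Cov 0 (of_real s) = tri (1 / p) 0" using Cov_0_tri[OF 1(1)] .
    have up: "y = tri (Re (al b2) + Re (be y)) (2 * Im (al y)) \<and> Re (al b2) + Re (be y) > 0"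
      if y: "Im (be y) = - Im (al y)" "Re (al y) = Re (al b2)" "(Re (be y))\<^sup>2 = (Re (be b2))\<^sup>2" "\<bar>th y\<bar> < 3 * pi / 2" for y
    proof -
      let ?P = "Re (al b2) + Re (be y)" and ?N = "Re (al b2) - Re (be y)"
      have "(Re (al b2))\<^sup>2 = 1 + (Re (be y))\<^sup>2" using r b2 i2 y by simp
      then have PN: "?P * ?N = 1" by (simp add: algebra_simps power2_eq_square)
      have "?P + ?N > 0" using b2 r0 by simp
      then have P: "?P > 0" using PN by (smt (verit, best) zero_less_mult_iff)
      have "1 / ?P = ?N" using PN P by (simp add: field_simps)
      then have "y = tri ?P (2 * Im (al y))"
        by (intro tri_unique) (use y P in \<open>simp_all add: complex_eq_iff\<close>)
      then show ?thesis using P by simp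
    qed
    have "\<exists>g p r h. p > 0 \<and> r > 0 \<and> cjg g (cmt (tri p 0) (tri r h)) = k \<and> H (cjg g (tri p 0), cjg g (tri r h)) = H (a, b)"
    proof (cases "Im (be b2) = - Im (al b2)")
      case True
      then have "b2 = tri (Re (al b2) + Re (be b2)) (2 * Im (al b2)) \<and> Re (al b2) + Re (be b2) > 0"
        using b2(2) pi_gt_zero by (intro up) auto
      then obtain r h where "b2 = tri r h" "r > 0" by blast
      moreover have "p > 0" using p(1) by simp
      ultimately show ?thesis using 2 unfolding p(2) by blast
    next
      case False
      let ?R = "Cov (pi / 2) 0"
      let ?y = "cjg ?R b2"
      have y: "?y = tri (Re (al b2) + Re (be ?y)) (2 * Im (al ?y)) \<and> Re (al b2) + Re (be ?y) > 0"
      proof (rule up)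
        show "Im (be ?y) = - Im (al ?y)" using False i2(1) by (auto simp: cjg_quarter power2_eq_iff)
        show "\<bar>th ?y\<bar> < 3 * pi / 2" using b2(2) th_cjg_bound[of ?R b2] by linarith
      qed (simp_all add: cjg_quarter)
      then obtain r h where rh: "?y = tri r h" "r > 0" by blast
      have "cjg ?R (Cov 0 (of_real s)) = - Cov 0 (of_real s)"
        using th_cjg_bound[of ?R "Cov 0 (of_real s)"] pi_gt_zero by (intro cov_eqI_near) (simp_all add: cjg_quarter)
      then have x: "cjg ?R (Cov 0 (of_real s)) = tri (1 / p) 0" by (simp only: p(3))
      have c: "cjg (g - ?R) (cjg ?R z) = cjg g z" for z by (simp add: cjg_cjg)
      have "cjg (g - ?R) (cmt (cjg ?R (Cov 0 (of_real s))) ?y) = k"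
        unfolding cjg_cmt[of ?R, symmetric] c by (rule 2(1))
      moreover have "H (cjg (g - ?R) (cjg ?R (Cov 0 (of_real s))), cjg (g - ?R) ?y) = H (a, b)"
        unfolding c by (rule 2(2))
      moreover have "1 / p > 0" using p(1) by simp
      ultimately show ?thesis using rh(2) unfolding x rh(1) by blast
    qed
    then obtain g p r h where 3: "p > 0" "r > 0" "cjg g (cmt (tri p 0) (tri r h)) = k" "H (cjg g (tri p 0), cjg g (tri r h)) = H (a, b)"
      by blast
    define y where "y = r * h * (p\<^sup>2 - 1) - p * 0 * (r\<^sup>2 - 1)"
    have ky: "cjg g (tri 1 y) = k" using 3 cmt_tri[of p r 0 h] by (simp add: y_def)
    have "tri 1 0 = 0" by (intro cov_eqI) (simp_all add: th_tri complex_eq_iff)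
    then have "y \<noteq> 0" using ky k by auto
    then have "e * y > 0" using tri_1_sign[OF ky] by (auto simp: e_def)
    then have "((p, 0), (r, h)) \<in> B" using 3 by (auto simp: B_def y_def)
    then show ?thesis using 3 by (intro exI[of _ g] exI[of _ "((p, 0), (r, h))"]) (simp add: a0_def b0_def)
  qed
  obtain g q where 1: "q \<in> B" "cjg g (cmt (a0 q) (b0 q)) = k" "H (cjg g (a0 q), cjg g (b0 q)) = H (a, b)"
    using form[OF ab(1)] by blast
  obtain g' q' where 2: "q' \<in> B" "cjg g' (cmt (a0 q') (b0 q')) = k" "H (cjg g' (a0 q'), cjg g' (b0 q')) = H (a', b')"
    using form[OF ab(2)] by blast
  have B: "connected B" unfolding B_def by (rule connected_tri_pairs) (simp add: e_def)
  have pos: "fst (fst q) > 0" "fst (snd q) > 0" if "q \<in> B" for q using that by (auto simp: B_def)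
  have cont: "continuous_on B a0" "continuous_on B b0"
    unfolding a0_def b0_def using pos by (auto intro!: continuous_on_tri continuous_on_fst continuous_on_snd continuous_on_id)
  have kap: "\<exists>y. y \<noteq> 0 \<and> cmt (a0 q) (b0 q) = tri 1 y" if q: "q \<in> B" for q
  proof -
    obtain p b r h where "q = ((p, b), (r, h))" "p > 0" "r > 0" "e * (r * h * (p\<^sup>2 - 1) - p * b * (r\<^sup>2 - 1)) > 0"
      using q unfolding B_def by blast
    then show ?thesis
      by (intro exI[of _ "r * h * (p\<^sup>2 - 1) - p * b * (r\<^sup>2 - 1)"]) (auto simp: a0_def b0_def cmt_tri)
  qed
  have nz: "cmt (a0 q) (b0 q) \<noteq> 0" "Re (al (cmt (a0 q) (b0 q))) = 1" if q: "q \<in> B" for q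
  proof -
    obtain y where y: "y \<noteq> 0" "cmt (a0 q) (b0 q) = tri 1 y" using kap[OF q] by blast
    have "be (tri 1 y) \<noteq> 0" using y(1) by (simp add: complex_eq_iff)
    then show "cmt (a0 q) (b0 q) \<noteq> 0" unfolding y(2) by (metis be_zero)
    show "Re (al (cmt (a0 q) (b0 q))) = 1" unfolding y(2) by simp
  qed
  show ?thesis
    using fib_normal[OF B cont nz 1(1) 2(1) 1(2) 2(2) H] 1(3) 2(3) by simp
qed

theorem commutator_fibre:
  assumes "cmt a b = k" "cmt a' b' = k" "k \<noteq> 0" "fibfun k H"
  shows "H (a, b) = H (a', b')"
  using fib_case_lt[OF assms(1,2,4)] fib_case_eq[OF assms(1,2,4)] fib_case_gt[OF assms(1,2,4)] assms(3) by linarith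

section \<open>Surjectivity of the commutator map\<close>

lemma trace_cmt_surj: "\<exists>a b. cmt a b \<noteq> 0 \<and> Re (al (cmt a b)) = c"
proof -
  consider "c > 1" | "c = 1" | "c < 1" by linarith
  then show ?thesis
  proof cases
    case 1
    then have "Re (al (cmt (Cov 0 (of_real (sqrt ((c - 1) / 2)))) (Cov (pi / 2) 0))) = c"
      unfolding trace_cmt by (simp add: al_def field_simps)
    then show ?thesis using 1 by (metis al_zero less_irrefl one_complex.sel(1))
  next
    case 2
    have "cmt (tri 2 0) (tri 1 1) = tri 1 3" by (simp add: cmt_tri)
    moreover have "be (tri 1 3) \<noteq> 0" by (simp add: complex_eq_iff)
    then have "tri 1 3 \<noteq> 0" by (metis be_zero)
    moreover have "Re (al (tri 1 3)) = 1" by simp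
    ultimately show ?thesis using 2 by metis
  next
    case 3
    then have "Re (al (cmt (Cov 0 (of_real (sqrt ((1 - c) / 2)))) (Cov 0 \<i>))) = c"
      unfolding trace_cmt by (simp add: al_def field_simps)
    then show ?thesis using 3 by (metis al_zero less_irrefl one_complex.sel(1))
  qed
qed

text \<open>Every half-trace is attained by a non-trivial commutator. A reflection moves that
  commutator to the required half of the region, where half the trace determines the conjugacy
  class.\<close>

theorem cmt_surj:
  assumes "between (-1) 1 k" "k \<noteq> 0" shows "\<exists>a b. cmt a b = k"
proof -
  have half: "\<exists>a b. cmt a b = k" if k: "between 0 1 k" for k
  proof -
    obtain a b where ab: "cmt a b \<noteq> 0" "Re (al (cmt a b)) = Re (al k)" using trace_cmt_surj by blast
    have "\<exists>a b. between 0 1 (cmt a b) \<and> Re (al (cmt a b)) = Re (al k)"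
    proof (cases "between 0 1 (cmt a b)")
      case False
      then have "between (-1) 0 (cmt a b)" using between_halves cmt_between ab(1) by blast
      then have "between 0 1 (cmt (mir a) (mir b))"
        using Up_mir[of "-1" "cmt a b"] Dn_mir[of 0 "cmt a b"] by (simp add: mir_cmt)
      moreover have "Re (al (cmt (mir a) (mir b))) = Re (al k)" using ab(2) by (simp flip: mir_cmt)
      ultimately show ?thesis by blast
    qed (use ab in blast)
    then obtain a b g where "cjg g (cmt a b) = k" using conjugate_between k by metis
    then show ?thesis by (metis cjg_cmt)
  qed
  show ?thesis
  proof (cases "between 0 1 k")
    case False
    then have "between (-1) 0 k" using between_halves assms by blast
    then have "between 0 1 (mir k)" using Up_mir[of "-1" k] Dn_mir[of 0 k] by simp
    then obtain a b where "cmt a b = mir k" using half by blast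
    then have "cmt (mir a) (mir b) = k" using mir_cmt[of a b] by simp
    then show ?thesis by blast
  qed (use half in blast)
qed

section \<open>Lifted representations\<close>

primrec cp :: "(nat \<Rightarrow> cov \<times> cov) \<Rightarrow> nat \<Rightarrow> nat \<Rightarrow> cov" where
  "cp u i 0 = 0"
| "cp u i (Suc m) = cp u i m + cmt (fst (u (i + m))) (snd (u (i + m)))"

lemma cp_cong: "(\<And>k. i \<le> k \<Longrightarrow> k < i + m \<Longrightarrow> cmt (fst (u k)) (snd (u k)) = cmt (fst (u' k)) (snd (u' k))) \<Longrightarrow> cp u i m = cp u' i m"
  by (induction m) auto

lemma cp_add: "cp u i (m + n) = cp u i m + cp u (i + m) n"
  by (induction n) (simp_all add: add.assoc)

definition Om :: "nat \<Rightarrow> nat \<Rightarrow> (nat \<Rightarrow> real) \<Rightarrow> int \<Rightarrow> ((nat \<Rightarrow> cov \<times> cov) \<times> (nat \<Rightarrow> complex)) set" where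
  "Om g p s n = {z. (\<forall>i. snd z i \<noteq> 0) \<and> cp (fst z) 0 g + pp s (snd z) 0 p = cz n}"

text \<open>The functions on \<open>Om\<close> that descend to representations in \<open>PSL(2,\<real>)\<close>.\<close>

definition Omfun :: "nat \<Rightarrow> nat \<Rightarrow> (nat \<Rightarrow> real) \<Rightarrow> int \<Rightarrow> ((nat \<Rightarrow> cov \<times> cov) \<times> (nat \<Rightarrow> complex) \<Rightarrow> bool) \<Rightarrow> bool" where
  "Omfun g p s n f \<longleftrightarrow> continuous_on (Om g p s n) f \<and>
     (\<forall>u c u' c'. (u, c) \<in> Om g p s n \<longrightarrow> (u', c') \<in> Om g p s n \<longrightarrow>
        (\<forall>j<g. \<exists>l m. u' j = (cz l + fst (u j), cz m + snd (u j))) \<longrightarrow> (\<forall>i<p. c' i = c i) \<longrightarrow> f (u', c') = f (u, c))"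

lemma Om_cong:
  assumes "(u, c) \<in> Om g p s n" "\<And>j. j < g \<Longrightarrow> cmt (fst (u' j)) (snd (u' j)) = cmt (fst (u j)) (snd (u j))"
  shows "(u', c) \<in> Om g p s n"
  using assms cp_cong[of 0 g u' u] by (simp add: Om_def)

lemma handle_fibfun:
  assumes f: "Omfun g p s n f" and z: "(u, c) \<in> Om g p s n" "cmt (fst (u j)) (snd (u j)) = k"
  shows "fibfun k (\<lambda>v. f (u(j := v), c))"
proof -
  have mem: "(u(j := v), c) \<in> Om g p s n" if "cmt (fst v) (snd v) = k" for v
    by (rule Om_cong[OF z(1)]) (use that z in auto)
  have "f (u(j := (cz m + a, b)), c) = f (u(j := (a, b)), c)" "f (u(j := (a, cz m + b)), c) = f (u(j := (a, b)), c)"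
    if "cmt a b = k" for m a b
  proof -
    have id: "\<exists>l m. (a', b') = (cz l + a', cz m + b')" for a' b'
      by (rule exI[of _ 0], rule exI[of _ 0]) (simp add: cz_0)
    have 1: "(u(j := (a, b)), c) \<in> Om g p s n" "(u(j := (cz m + a, b)), c) \<in> Om g p s n" "(u(j := (a, cz m + b)), c) \<in> Om g p s n"
      by (rule mem, simp add: that)+
    have e: "\<exists>l m. (u(j := (a', b'))) i = (cz l + fst ((u(j := (a, b))) i), cz m + snd ((u(j := (a, b))) i))"
      if "\<exists>l m. (a', b') = (cz l + a, cz m + b)" for a' b' i
      using that id[of "fst (u i)" "snd (u i)"] by (cases "i = j") auto
    have "\<exists>l m'. (cz m + a, b) = (cz l + a, cz m' + b)" "\<exists>l m'. (a, cz m + b) = (cz l + a, cz m' + b)"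
      by (rule exI[of _ m], rule exI[of _ 0], simp add: cz_0) (rule exI[of _ 0], rule exI[of _ m], simp add: cz_0)
    then show "f (u(j := (cz m + a, b)), c) = f (u(j := (a, b)), c)" "f (u(j := (a, cz m + b)), c) = f (u(j := (a, b)), c)"
      using f 1 e unfolding Omfun_def by blast+
  qed
  moreover have "continuous_on {v. cmt (fst v) (snd v) = k} (\<lambda>v. f (u(j := v), c))"
  proof (rule continuous_on_compose2[of "Om g p s n" f])
    show "continuous_on {v. cmt (fst v) (snd v) = k} (\<lambda>v. (u(j := v), c))"
      by (intro continuous_on_Pair continuous_on_fun_upd continuous_on_const continuous_on_id)
  qed (use f mem in \<open>auto simp: Omfun_def\<close>)
  ultimately show ?thesis by (simp add: fibfun_def)
qed

subsection \<open>Removing commuting handles\<close>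

text \<open>The second entry is moved to \<open>b + - b\<close> by the centraliser of a; once it is
  trivial, the first entry can be moved freely.\<close>

lemma commuting_handle:
  assumes "fibfun 0 H" "cmt a b = 0" shows "H (A, 0) = H (a, b)"
proof -
  have c: "a + b = b + a" using assms(2) cmt_eq_0_iff by simp
  have "H (a, b + - b) = H (a, b)"
  proof (rule fibfun_add_right[OF assms])
    have "- b + a = - b + (a + b) + - b" by (simp only: add.assoc right_minus add_0_right)
    also have "\<dots> = a + - b" by (simp only: c minus_add_cancel)
    finally show "- b + a = a + - b" .
  qed
  then have 1: "H (a, 0) = H (a, b)" by simp
  have "H (0 + d, 0) = H (0, 0)" for d
    by (rule fibfun_add_left[OF assms(1)]) (simp_all add: cmt_def)
  from this[of a] this[of A] show ?thesis using 1 by simp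
qed

text \<open>A conjugation that doubles the parabolics of a ray satisfies A + P - A = P + P, that is,
  the commutator of A and P is P itself.\<close>

lemma axis_dilation:
  assumes e: "e = 1 \<or> e = -1" and c: "c \<noteq> 0"
  obtains A where "\<And>t. t \<ge> 0 \<Longrightarrow> cmt A (para e (of_real t * c)) = para e (of_real t * c)"
proof -
  have pos: "\<exists>A. cjg A (para 1 c) = para 1 (of_real 2 * c)" if "c \<noteq> 0" for c
    using that th_para_bounds(1)[of c] th_para_bounds(1)[of "of_real 2 * c"]
    by (intro conjugate_between) (auto simp: Up_def Dn_def)
  have "\<exists>A. cjg A (para e c) = para e (of_real 2 * c)"
  proof (cases "e = 1")
    case False
    then have e: "e = -1" using e by simp
    obtain A where "cjg A (para 1 (cnj c)) = para 1 (of_real 2 * cnj c)" using pos[of "cnj c"] c by auto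
    then have "mir (cjg A (para 1 (cnj c))) = mir (para 1 (of_real 2 * cnj c))" by simp
    then show ?thesis by (auto simp: mir_cjg mir_para e)
  qed (use pos c in simp)
  then obtain A where A: "cjg A (para e c) = para e (of_real 2 * c)" by blast
  have ae: "\<bar>e\<bar> = 1" using e by auto
  show ?thesis
  proof (rule that)
    fix t :: real assume t: "t \<ge> 0"
    show "cmt A (para e (of_real t * c)) = para e (of_real t * c)"
    proof (cases "t = 0")
      case False
      have "be (cjg A (para e (of_real t * c))) = of_real t * be (cjg A (para e c))"
        using t by (simp add: be_cjg ae norm_mult complex_eq_iff algebra_simps)
      also have "\<dots> = of_real (t + t) * c" by (simp add: A)
      finally have "cjg A (para e (of_real t * c)) = para e (of_real (t + t) * c)"
        using cjg_para[OF e, of "of_real t * c" A] c False by simp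
      also have "\<dots> = para e (of_real t * c) + para e (of_real t * c)" using para_add_ray[OF ae t t] by simp
      finally show ?thesis by (simp add: cmt_def cjg_def)
    qed (simp add: cmt_def)
  qed
qed

text \<open>The first parabolic is split on its ray, and the share t is realised as the commutator
  of the handle. At t = 0 the handle still commutes and is reached by
  \<open>commuting_handle\<close>; at t = 1/2 it does not commute.\<close>

lemma remove_commuting_handle:
  assumes s: "signs s p" "p \<ge> 1" and z: "(u, c) \<in> Om g p s n" and j: "j < g" "cmt (fst (u j)) (snd (u j)) = 0"
  obtains v c' where "(u(j := v), c') \<in> Om g p s n" "cmt (fst v) (snd v) \<noteq> 0"
    "\<And>f. Omfun g p s n f \<Longrightarrow> f (u(j := v), c') = f (u, c)"
proof -
  have c0: "c 0 \<noteq> 0" and s0: "s 0 = 1 \<or> s 0 = -1" using z s by (auto simp: Om_def signs_def)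
  have as: "\<bar>s 0\<bar> = 1" using s0 by auto
  obtain A where A: "\<And>t. t \<ge> 0 \<Longrightarrow> cmt A (para (s 0) (of_real t * c 0)) = para (s 0) (of_real t * c 0)"
    using axis_dilation[OF s0 c0] by blast
  obtain m where m: "g = j + Suc m" using j(1) less_iff_Suc_add by auto
  obtain q where q: "p = Suc q" using s(2) by (cases p) auto
  \<comment> \<open>The product of the later handles, past which the share has to be conjugated to
    reach handle j.\<close>
  define w where "w = cp u (Suc j) m"
  define v where "v t = (cjg w A, cjg w (para (s 0) (of_real t * c 0)))" for t :: real
  define d where "d t = c(0 := of_real (1 - t) * c 0)" for t :: real
  have split: "cp u' 0 g = cp u' 0 j + (cmt (fst (u' j)) (snd (u' j)) + cp u' (Suc j) m)" for u'
    using cp_add[of u' 0 j "Suc m"] cp_add[of u' j 1 m] by (simp add: m add.assoc)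
  have pps: "pp s c' 0 p = para (s 0) (c' 0) + pp s c' (Suc 0) q" for c'
    unfolding q pp_Suc_left ..
  have base: "cp u 0 j + (w + (para (s 0) (c 0) + pp s c (Suc 0) q)) = cz n"
    using z j(2) by (simp add: Om_def split pps w_def add.assoc)
  have mem: "(u(j := v t), d t) \<in> Om g p s n" if t: "t \<ge> 0" "t < 1" for t
  proof -
    have "cmt (fst (v t)) (snd (v t)) = cjg w (para (s 0) (of_real t * c 0))"
      unfolding v_def fst_conv snd_conv cjg_cmt[symmetric] A[OF t(1)] ..
    moreover have "cp (u(j := v t)) (Suc j) m = w" "cp (u(j := v t)) 0 j = cp u 0 j"
      unfolding w_def by (rule cp_cong; simp)+
    moreover have "pp s (d t) (Suc 0) q = pp s c (Suc 0) q" by (rule pp_cong) (simp add: d_def)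
    moreover have "para (s 0) (of_real t * c 0) + para (s 0) (of_real (1 - t) * c 0) = para (s 0) (c 0)"
      using para_add_ray[OF as t(1), of "1 - t" "c 0"] t by simp
    then have "cjg w (para (s 0) (of_real t * c 0)) + w + para (s 0) (of_real (1 - t) * c 0) = w + para (s 0) (c 0)"
      by (simp add: cjg_def add.assoc del: of_real_diff)
    then have "cp u 0 j + (cjg w (para (s 0) (of_real t * c 0)) + w + para (s 0) (of_real (1 - t) * c 0) + pp s c (Suc 0) q) = cz n"
      using base by (simp add: add.assoc)
    ultimately have "cp (u(j := v t)) 0 g + pp s (d t) 0 p = cz n"
      unfolding split pps by (simp add: d_def add.assoc)
    moreover have "complex_of_real (1 - t) \<noteq> 0" unfolding of_real_eq_0_iff using t by simp
    then have "\<forall>i. d t i \<noteq> 0" using z c0 by (simp add: d_def Om_def del: of_real_diff)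
    ultimately show ?thesis by (simp add: Om_def)
  qed
  show ?thesis
  proof (rule that)
    show "(u(j := v (1/2)), d (1/2)) \<in> Om g p s n" by (rule mem) auto
    have "cmt (fst (v (1/2))) (snd (v (1/2))) = cjg w (para (s 0) (of_real (1/2) * c 0))"
      unfolding v_def fst_conv snd_conv cjg_cmt[symmetric] by (subst A) simp_all
    moreover have "be (cjg w (para (s 0) (of_real (1/2) * c 0))) \<noteq> 0"
      by (rule be_cjg_para_nz[OF s0]) (use c0 in simp)
    ultimately show "cmt (fst (v (1/2))) (snd (v (1/2))) \<noteq> 0" by (metis be_zero)
    fix f assume f: "Omfun g p s n f"
    have "f (u(j := (cjg w A, 0)), c) = f (u(j := (fst (u j), snd (u j))), c)"
      by (rule commuting_handle[OF handle_fibfun[OF f z j(2)] j(2)])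
    then have 0: "f (u(j := v 0), d 0) = f (u, c)" by (simp add: v_def d_def)
    have "f (u(j := v (1/2 * 0)), d (1/2 * 0)) = f (u(j := v (1/2 * 1)), d (1/2 * 1))"
    proof (rule const_on_path[of "Om g p s n" f "\<lambda>t. (u(j := v (1/2 * t)), d (1/2 * t))"])
      show "continuous_on {0..1} (\<lambda>t. (u(j := v (1/2 * t)), d (1/2 * t)))"
        unfolding v_def d_def
        by (intro continuous_on_Pair continuous_on_fun_upd continuous_on_const continuous_on_cjg continuous_on_para continuous_intros)
    qed (use f mem in \<open>auto simp: Omfun_def\<close>)
    then show "f (u(j := v (1/2)), d (1/2)) = f (u, c)" using 0 by simp
  qed
qed

definition ncmt :: "nat \<Rightarrow> (nat \<Rightarrow> cov \<times> cov) \<Rightarrow> bool" where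
  "ncmt g u \<longleftrightarrow> (\<forall>j<g. cmt (fst (u j)) (snd (u j)) \<noteq> 0)"

lemma remove_commuting_handles:
  assumes s: "signs s p" "p \<ge> 1" and z: "(u, c) \<in> Om g p s n"
  shows "\<exists>u' c'. (u', c') \<in> Om g p s n \<and> ncmt g u' \<and> (\<forall>f. Omfun g p s n f \<longrightarrow> f (u', c') = f (u, c))"
  using z
proof (induction "card {j. j < g \<and> cmt (fst (u j)) (snd (u j)) = 0}" arbitrary: u c rule: less_induct)
  case less
  show ?case
  proof (cases "ncmt g u")
    case False
    then obtain j where j: "j < g" "cmt (fst (u j)) (snd (u j)) = 0" by (auto simp: ncmt_def)
    obtain v c' where v: "(u(j := v), c') \<in> Om g p s n" "cmt (fst v) (snd v) \<noteq> 0"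
      "\<And>f. Omfun g p s n f \<Longrightarrow> f (u(j := v), c') = f (u, c)"
      using remove_commuting_handle[OF s less.prems j] by blast
    have "card {i. i < g \<and> cmt (fst ((u(j := v)) i)) (snd ((u(j := v)) i)) = 0} < card {i. i < g \<and> cmt (fst (u i)) (snd (u i)) = 0}"
      by (rule psubset_card_mono) (use j v(2) in \<open>auto split: if_splits\<close>)
    then show ?thesis using less.hyps[OF _ v(1)] v(3) by metis
  qed (use less.prems in blast)
qed

subsection \<open>Handles as words in parabolics\<close>

text \<open>Two positive parabolics carry k to a hyperbolic element of level 1, which is itself a
  product of two positive parabolics; undoing the first two contributes the negative ones.\<close>

lemma para_block_decompose:
  assumes k: "between (-1) 1 k"
  obtains x where "\<And>i. x i \<noteq> (0 :: complex)" "k = para 1 (x 0) + para 1 (x 1) + para (-1) (x 2) + para (-1) (x (3 :: nat))"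
proof -
  obtain c where c: "c \<noteq> 0" "Up 0 (k + para 1 c)" "Dn 1 (k + para 1 c)"
    using para_step_pos(2)[of 0 1 k] k by auto
  obtain d where d: "d \<noteq> 0" "Up 1 (k + para 1 c + para 1 d)" "Dn 1 (k + para 1 c + para 1 d)"
    using para_step_pos(2)[of 1 1 "k + para 1 c"] c by auto
  define y where "y = k + para 1 c + para 1 d"
  have y: "Up 1 y" "Dn 1 y" using d by (simp_all add: y_def)
  have "Re (al y) < -1" using y by (auto simp: Up_def Dn_def)
  moreover from this have "Re (al (cz 1 + mir y)) > 1" by simp
  then have "\<bar>Im (al y)\<bar> < cmod (be y)" using hyp_be_Im[of "cz 1 + mir y"] by simp
  ultimately obtain r where r: "Re (al (mir y + para 1 r)) = 1"
    using connected_slice_level[of "mir y"] by (auto simp: abs_less_iff)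
  define v where "v = y + para (-1) (cnj r)"
  have "mir (mir y + para 1 r) = v" by (simp add: v_def mir_plus mir_para)
  then have v1: "Re (al v) = 1" using r by (metis mir_simps(3) complex_cnj(1) cnj.simps(1))
  have r0: "r \<noteq> 0" using r \<open>Re (al y) < -1\<close> by auto
  have "Up 0 v" "Dn 1 v" using Up_para_neg[OF y(1)] Dn_para_neg[OF y(2)] by (simp_all add: v_def)
  then have t: "0 < th v" "th v < pi" using v1 by (auto simp: Up_def Dn_def)
  then have "th v < pi / 2" using cos_pos_range[of "th v"] Re_al_pos_cos[of v] v1 by auto
  then have v: "v = para 1 (be v)" using t v1 by (intro para_char_pos)
  then have v0: "be v \<noteq> 0" using t by auto
  have "y = v + para 1 (- cnj r)" using para_cancel[of 1 "cnj r"] by (simp add: v_def add.assoc)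
  also note v
  finally have "para 1 (be v) + para 1 (- cnj r) = k + para 1 c + para 1 d" by (simp add: y_def)
  then have "para 1 (be v) + para 1 (- cnj r) + para (-1) (- d) + para (-1) (- c) = k"
    using para_cancel[of "-1" c] para_cancel[of "-1" d] by (simp add: add.assoc)
  from this[symmetric] show ?thesis
    using that[of "\<lambda>i. if i = 0 then be v else if i = 1 then - cnj r else if i = 2 then - d else - c"] v0 r0 c(1) d(1) by simp
qed

lemma Dn_uminus: "Dn b (- y) \<longleftrightarrow> Up (- b) y" and Up_uminus: "Up b (- y) \<longleftrightarrow> Dn (- b) y"
  by (auto simp: Up_def Dn_def)

text \<open>If \<open>th\<close> reaches pi, then the imaginary part of \<open>al\<close> is at most
  0, and the arithmetic-geometric mean inequality pushes the half-trace below -1: the product is at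
  most hyperbolic of level 1.\<close>

lemma Dn_para2:
  assumes "a \<noteq> 0" "b \<noteq> 0" shows "Dn 1 (para 1 a + para 1 b)"
proof (cases "th (para 1 a + para 1 b) < pi")
  case False
  define y where "y = para 1 a + para 1 b"
  have t: "pi \<le> th y" "th y < 3 * pi / 2"
    using False th_plus_para(2)[OF assms(2), of "para 1 a"] th_para_bounds(1)[OF assms(1)] by (auto simp: y_def)
  have "sin (th y - pi) \<ge> 0" by (rule sin_ge_zero) (use t in auto)
  then have im: "Im (al y) \<le> 0" by (simp add: Im_al mult_nonneg_nonpos)
  define P X Y where "P = cmod a * cmod b" and "X = Re (a * cnj b)" and "Y = Im (a * cnj b)"
  have al: "Re (al y) = 1 - P + X" "Im (al y) = cmod a + cmod b + Y"
    by (simp_all add: y_def al_plus P_def X_def Y_def)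
  have "P\<^sup>2 = X\<^sup>2 + Y\<^sup>2" unfolding X_def Y_def P_def using cmod_power2[of "a * cnj b"] by (simp only: norm_mult complex_mod_cnj)
  moreover have P: "P > 0" using assms by (simp add: P_def)
  moreover have "4 * P \<le> (cmod a + cmod b)\<^sup>2"
    using zero_le_power2[of "cmod a - cmod b"] by (simp add: P_def power2_eq_square algebra_simps)
  moreover have "(cmod a + cmod b)\<^sup>2 \<le> Y\<^sup>2" using power_mono[of "cmod a + cmod b" "- Y" 2] im al by simp
  ultimately have X: "X\<^sup>2 \<le> P\<^sup>2 - 4 * P" by linarith
  then have "P\<^sup>2 - 4 * P \<ge> 0" using zero_le_power2[of X] by linarith
  then have "P * (P - 4) \<ge> 0" by (simp add: power2_eq_square algebra_simps)
  then have P4: "P \<ge> 4" using P by (simp add: zero_le_mult_iff)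
  have "X\<^sup>2 < (P - 2)\<^sup>2" using X by (simp add: power2_eq_square algebra_simps)
  then have "X < P - 2" by (rule power_less_imp_less_base) (use P4 in simp)
  then show ?thesis using t al(1) by (simp add: Dn_def flip: y_def)
qed (simp add: Dn_def)

lemma para_block_between:
  assumes "a \<noteq> 0" "b \<noteq> 0" "c \<noteq> 0" "d \<noteq> 0"
  shows "between (-1) 1 (para 1 a + para 1 b + para (-1) c + para (-1) d)"
proof
  show "Dn 1 (para 1 a + para 1 b + para (-1) c + para (-1) d)"
    using Dn_para2[OF assms(1,2)] by (intro Dn_para_neg)
  have "Dn 1 (para 1 (- d) + para 1 (- c) + para (-1) (- b) + para (-1) (- a))"
    by (intro Dn_para_neg Dn_para2) (use assms in auto)
  moreover have "- (para 1 a + para 1 b + para (-1) c + para (-1) d) = para 1 (- d) + para 1 (- c) + para (-1) (- b) + para (-1) (- a)"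
    by (simp add: minus_add uminus_para add.assoc)
  ultimately show "Up (-1) (para 1 a + para 1 b + para (-1) c + para (-1) d)" using Dn_uminus by metis
qed

text \<open>Each handle except the first is replaced by a word \<open>+ + - -\<close> in parabolic elements: the products of such
  words fill out exactly the range of the commutator map.\<close>

definition base_signs :: "(nat \<Rightarrow> real) \<Rightarrow> nat \<Rightarrow> nat \<Rightarrow> real" where
  "base_signs s h i = (if i < 4 * h then (if i mod 4 < 2 then 1 else -1) else s (i - 4 * h))"

lemma base_signs_block:
  assumes "j < h"
  shows "pp (base_signs s h) x (4 * j) 4 = para 1 (x (4 * j)) + para 1 (x (4 * j + 1)) + para (-1) (x (4 * j + 2)) + para (-1) (x (4 * j + 3))"
proof -
  have "4 * j + i < 4 * h" if "i < 4" for i using assms that by simp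
  then have "base_signs s h (4 * j + i) = (if i < 2 then 1 else -1)" if "i < 4" for i
    using that by (simp add: base_signs_def)
  from this[of 0] this[of 1] this[of 2] this[of 3] show ?thesis by (simp add: eval_nat_numeral)
qed

lemma base_signs_tail: "pp (base_signs s h) x (4 * h) p = pp s (\<lambda>i. x (i + 4 * h)) 0 p"
  using pp_shift[of "base_signs s h" x 0 "4 * h" p] by (simp add: base_signs_def)

lemma cnt_add: "cnt e (m + n) t = cnt e m t + cnt (\<lambda>i. e (i + m)) n t"
  by (induction n) (simp_all add: cnt_Suc add.commute)

lemma cnt_base_signs:
  assumes "t = 1 \<or> t = -1" shows "cnt (base_signs s h) (4 * h + p) t = 2 * int h + cnt s p t"
proof -
  have "cnt (base_signs s h) (4 * k) t = 2 * int k" if "k \<le> h" for k using that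
  proof (induction k)
    case (Suc k)
    have "4 * k + i < 4 * h" if "i < 4" for i using Suc.prems that by simp
    then have b: "base_signs s h (4 * k + i) = (if i < 2 then 1 else -1)" if "i < 4" for i
      using that by (simp add: base_signs_def)
    have "cnt (base_signs s h) (4 * k + 4) t = 2 * int k + 2"
      using Suc b[of 0] b[of 1] b[of 2] b[of 3] assms by (auto simp: eval_nat_numeral cnt_Suc)
    then show ?case by (simp add: add.commute)
  qed simp
  then show ?thesis by (simp add: cnt_add base_signs_def)
qed

lemma signs_base_signs: "signs s p \<Longrightarrow> signs (base_signs s h) (4 * h + p)"
  by (auto simp: signs_def base_signs_def)

text \<open>The value prescribed for the commutator of the \<open>j\<close>-th handle by a word in parabolics.\<close>

definition kap :: "nat \<Rightarrow> nat \<Rightarrow> (nat \<Rightarrow> real) \<Rightarrow> int \<Rightarrow> (nat \<Rightarrow> complex) \<Rightarrow> nat \<Rightarrow> cov" where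
  "kap h p s n x j = (if j = 0 then cz n - pp (base_signs s h) x 0 (4 * h + p) else pp (base_signs s h) x (4 * (j - 1)) 4)"

text \<open>The first handle has to realise z^n times the inverse of the product of the words, a
  commutator exactly if it lies in \<open>between (-1) 1\<close>; non-triviality excludes the
  product z^n. The remaining products form two regions that share the hyperbolic level n.\<close>

definition base_set :: "nat \<Rightarrow> nat \<Rightarrow> (nat \<Rightarrow> real) \<Rightarrow> int \<Rightarrow> (nat \<Rightarrow> complex) set" where
  "base_set h p s n = Conf (base_signs s h) h (4 * h + p) (between (n - 1) n) \<union> Conf (base_signs s h) h (4 * h + p) (between n (n + 1))"

lemma base_set_iff:
  "x \<in> base_set h p s n \<longleftrightarrow> (\<forall>i. x i \<noteq> 0) \<and> (\<forall>j<Suc h. between (-1) 1 (kap h p s n x j) \<and> kap h p s n x j \<noteq> 0)"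
proof -
  define F where "F = pp (base_signs s h) x 0 (4 * h + p)"
  have U: "Up a (cz n - F) \<longleftrightarrow> Dn (n - a) F" and D: "Dn a (cz n - F) \<longleftrightarrow> Up (n - a) F" for a
    using Up_shift[of a n "- F"] Dn_shift[of a n "- F"] by (simp_all add: Up_uminus Dn_uminus)
  have k0: "kap h p s n x 0 = cz n - F" by (simp add: kap_def F_def)
  have "\<not> between 0 1 (0 :: cov)" "\<not> between (-1) 0 (0 :: cov)" by (auto simp: Up_def Dn_def)
  then have V: "between (-1) 1 y \<and> y \<noteq> 0 \<longleftrightarrow> between 0 1 y \<or> between (-1) 0 y" for y
    using between_halves[of y] Up_mono_index[of 0 y "-1"] Dn_mir[of 0 y] Dn_mir[of 1 y] Up_mono_index[of 0 "mir y" "-1"] by auto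
  have 0: "between (-1) 1 (kap h p s n x 0) \<and> kap h p s n x 0 \<noteq> 0 \<longleftrightarrow> between (n - 1) n F \<or> between n (n + 1) F"
    unfolding k0 using V[of "cz n - F"] unfolding U D by auto
  show ?thesis
  proof (cases "\<forall>i. x i \<noteq> 0")
    case True
    have "between (-1) 1 (kap h p s n x (Suc j)) \<and> kap h p s n x (Suc j) \<noteq> 0 \<longleftrightarrow> pp (base_signs s h) x (4 * j) 4 \<noteq> 0"
      if "j < h" for j
      using para_block_between True base_signs_block[OF that, of s x] by (simp add: kap_def)
    then have "(\<forall>j<h. between (-1) 1 (kap h p s n x (Suc j)) \<and> kap h p s n x (Suc j) \<noteq> 0) \<longleftrightarrow>
       (\<forall>j<h. 4 * j + 4 \<le> 4 * h + p \<longrightarrow> pp (base_signs s h) x (4 * j) 4 \<noteq> 0)" by fastforce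
    moreover have "(P \<longleftrightarrow> Q) \<Longrightarrow> (R \<longleftrightarrow> S \<or> T) \<Longrightarrow> X \<and> S \<and> Q \<or> X \<and> T \<and> Q \<longleftrightarrow> X \<and> R \<and> P" for P Q R S T X by blast
    ultimately show ?thesis using 0
      unfolding base_set_def Conf_def All_less_Suc2 Un_iff mem_Collect_eq F_def by metis
  next
    case False
    then show ?thesis unfolding base_set_def Conf_def by blast
  qed
qed

text \<open>The two pieces meet in the configurations with product in \<open>between n n\<close>; if
  there are none, one of the pieces is empty.\<close>

lemma connected_base_set:
  assumes "signs s p" "p \<ge> 1"
  shows "connected (base_set h p s n)"
    and "base_set h p s n \<noteq> {} \<longleftrightarrow> - (2 * int h + cnt s p (-1)) \<le> n \<and> n \<le> 2 * int h + cnt s p 1"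
proof -
  let ?C = "\<lambda>a b. Conf (base_signs s h) h (4 * h + p) (between a b)"
  let ?a = "2 * int h + cnt s p 1" and ?b = "2 * int h + cnt s p (-1)"
  note C = Conf_between[OF signs_base_signs[OF assms(1)], where h=h]
  have ne: "?C a b \<noteq> {} \<longleftrightarrow> a < ?a \<and> - ?b < b" if "a \<le> b" for a b
    using C(2)[OF that] by (simp add: cnt_base_signs)
  have pos: "cnt s p 1 + cnt s p (-1) \<ge> 1"
    using assms cnt_pos_iff[of s p 1] cnt_pos_iff[of s p "-1"] by (force simp: signs_def cnt_def)
  have sub: "?C n n \<subseteq> ?C (n - 1) n \<inter> ?C n (n + 1)"
    using Up_mono_index[of n _ "n - 1"] Up_mono_index[of "- n" "mir _" "- n - 1"] by (auto simp: Conf_def Dn_mir)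
  show "connected (base_set h p s n)"
  proof (cases "?C n n = {}")
    case False
    then show ?thesis unfolding base_set_def using sub by (intro connected_Un C(1)) auto
  next
    case True
    then have "?C (n - 1) n = {} \<or> ?C n (n + 1) = {}"
      using ne[of n n] ne[of "n - 1" n] ne[of n "n + 1"] by auto
    then show ?thesis unfolding base_set_def using C(1)[of "n - 1" n] C(1)[of n "n + 1"] by auto
  qed
  show "base_set h p s n \<noteq> {} \<longleftrightarrow> - ?b \<le> n \<and> n \<le> ?a"
    unfolding base_set_def using ne[of "n - 1" n] ne[of n "n + 1"] pos by auto
qed

lemma base_sum:
  assumes "\<And>j. j < h \<Longrightarrow> cmt (fst (u (Suc j))) (snd (u (Suc j))) = kap h p s n x (Suc j)" "\<And>i. i < p \<Longrightarrow> c i = x (i + 4 * h)"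
  shows "cp u 0 (Suc h) + pp s c 0 p = cmt (fst (u 0)) (snd (u 0)) + pp (base_signs s h) x 0 (4 * h + p)"
proof -
  let ?e = "base_signs s h"
  have "cp u 1 j = pp ?e x 0 (4 * j)" if "j \<le> h" for j using that
  proof (induction j)
    case (Suc j)
    have "pp ?e x 0 (4 * j + 4) = pp ?e x 0 (4 * j) + pp ?e x (4 * j) 4" using pp_add[of ?e x 0 "4 * j" 4] by simp
    then show ?case using Suc assms(1)[of j] by (simp add: kap_def add.commute)
  qed simp
  moreover have "pp s c 0 p = pp ?e x (4 * h) p" unfolding base_signs_tail by (rule pp_cong) (use assms(2) in auto)
  moreover have "cp u 0 (Suc h) = cmt (fst (u 0)) (snd (u 0)) + cp u 1 h" using cp_add[of u 0 1 h] by simp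
  ultimately have "cp u 0 (Suc h) + pp s c 0 p = cmt (fst (u 0)) (snd (u 0)) + (pp ?e x 0 (4 * h) + pp ?e x (4 * h) p)"
    by (simp only: add.assoc order_refl)
  then show ?thesis using pp_add[of ?e x 0 "4 * h" p] by simp
qed

lemma Omfun_cong:
  assumes "Omfun g p s n f" "(u, c) \<in> Om g p s n" "(u', c') \<in> Om g p s n"
    and "\<And>j. j < g \<Longrightarrow> u' j = u j" "\<And>i. i < p \<Longrightarrow> c' i = c i"
  shows "f (u', c') = f (u, c)"
proof -
  have "\<exists>l m. u' j = (cz l + fst (u j), cz m + snd (u j))" if "j < g" for j
    by (rule exI[of _ 0], rule exI[of _ 0]) (simp add: cz_0 assms(4) that)
  then show ?thesis using assms(1,2,3,5) unfolding Omfun_def by blast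
qed

lemma base_in_Om:
  assumes "x \<in> base_set h p s n" "\<And>j. j < Suc h \<Longrightarrow> cmt (fst (u j)) (snd (u j)) = kap h p s n x j"
  shows "(u, \<lambda>i. x (i + 4 * h)) \<in> Om (Suc h) p s n"
proof -
  have "cp u 0 (Suc h) + pp s (\<lambda>i. x (i + 4 * h)) 0 p = kap h p s n x 0 + pp (base_signs s h) x 0 (4 * h + p)"
    unfolding assms(2)[of 0, OF zero_less_Suc, symmetric] by (rule base_sum) (use assms in auto)
  also have "\<dots> = cz n" by (simp add: kap_def)
  finally show ?thesis using assms(1) by (auto simp: Om_def base_set_iff)
qed

lemma Om_base:
  assumes "(u, c) \<in> Om (Suc h) p s n" "ncmt (Suc h) u"
  obtains x where "x \<in> base_set h p s n" "\<And>j. j < Suc h \<Longrightarrow> cmt (fst (u j)) (snd (u j)) = kap h p s n x j"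
    "(\<lambda>i. x (i + 4 * h)) = c"
proof -
  let ?k = "\<lambda>j. cmt (fst (u j)) (snd (u j))"
  have "\<forall>j. \<exists>x. (\<forall>i. x i \<noteq> (0 :: complex)) \<and> ?k j = para 1 (x 0) + para 1 (x 1) + para (-1) (x 2) + para (-1) (x (3 :: nat))"
    using para_block_decompose[OF cmt_between] by metis
  then obtain X where X: "\<And>j i. X j i \<noteq> (0 :: complex)"
    "\<And>j. ?k j = para 1 (X j 0) + para 1 (X j 1) + para (-1) (X j 2) + para (-1) (X j (3 :: nat))" by metis
  \<comment> \<open>Block j encodes the commutator of handle j + 1; handle 0 is recovered from the
    total product.\<close>
  define x where "x i = (if i < 4 * h then X (Suc (i div 4)) (i mod 4) else c (i - 4 * h))" for i
  have blk: "?k (Suc j) = kap h p s n x (Suc j)" if "j < h" for j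
  proof -
    have "4 * j + i < 4 * h" if "i < 4" for i using \<open>j < h\<close> that by simp
    then have "x (4 * j + i) = X (Suc j) i" if "i < 4" for i using that by (simp add: x_def)
    from this[of 0] this[of 1] this[of 2] this[of 3] show ?thesis
      by (simp add: kap_def base_signs_block[OF that] X(2))
  qed
  have "?k 0 + pp (base_signs s h) x 0 (4 * h + p) = cz n"
    using base_sum[of h u p s n x c] blk assms by (simp add: Om_def x_def)
  then have k0: "?k 0 = kap h p s n x 0" by (simp add: kap_def eq_diff_eq)
  have K: "?k j = kap h p s n x j" if "j < Suc h" for j using that k0 blk[of "j - 1"] by (cases j) auto
  have "between (-1) 1 (kap h p s n x j) \<and> kap h p s n x j \<noteq> 0" if "j < Suc h" for j
    using K[of j] cmt_between[of "fst (u j)" "snd (u j)"] assms(2) that unfolding ncmt_def by metis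
  moreover have "x i \<noteq> 0" for i using assms(1) X(1) by (simp add: x_def Om_def)
  ultimately have "x \<in> base_set h p s n" unfolding base_set_iff by blast
  then show ?thesis using K by (rule that) (auto simp: x_def)
qed

theorem Om_nonempty:
  assumes s: "signs s p" "p \<ge> 1" "g = 0 \<longrightarrow> p \<ge> 3"
  defines "a \<equiv> cnt s p 1" and "b \<equiv> cnt s p (-1)"
  shows "Om g p s n \<noteq> {} \<longleftrightarrow> 2 - 2 * int g - b \<le> n \<and> n \<le> 2 * int g - 2 + a \<or>
     g = 0 \<and> (n = 0 \<and> (a = 1 \<or> b = 1) \<or> n = 1 \<and> b = 0 \<or> n = - 1 \<and> a = 0)"
proof (cases g)
  case 0
  have "Om g p s n \<noteq> {} \<longleftrightarrow> Sph s p n \<noteq> {}" by (auto simp: Om_def Sph_def 0)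
  then show ?thesis using Sph_connected_nonempty(2)[of s p n] s 0 by (auto simp: a_def b_def)
next
  case (Suc h)
  have "Om g p s n \<noteq> {} \<longleftrightarrow> base_set h p s n \<noteq> {}"
  proof
    assume "Om g p s n \<noteq> {}"
    then obtain u c where "(u, c) \<in> Om g p s n" "ncmt g u" using remove_commuting_handles[OF s(1,2)] by fast
    then obtain x where "x \<in> base_set h p s n" using Om_base[of u c h p s n] unfolding Suc by blast
    then show "base_set h p s n \<noteq> {}" by blast
  next
    assume "base_set h p s n \<noteq> {}"
    then obtain x where x: "x \<in> base_set h p s n" by blast
    then have "\<forall>j. \<exists>v. j < Suc h \<longrightarrow> cmt (fst v) (snd v) = kap h p s n x j"
      unfolding base_set_iff using cmt_surj by (metis fst_conv snd_conv)
    then obtain u where "\<And>j. j < Suc h \<Longrightarrow> cmt (fst (u j)) (snd (u j)) = kap h p s n x j" by metis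
    from base_in_Om[OF x this] show "Om g p s n \<noteq> {}" unfolding Suc by blast
  qed
  then show ?thesis using connected_base_set(2)[OF s(1,2), of h n] by (auto simp: Suc a_def b_def)
qed

text \<open>In positive genus the non-commuting solutions fibre over \<open>base_set\<close>, and
  \<open>commutator_fibre\<close> exchanges the handles in a fibre one at a time. The fibres contain
  several central translates, so f is shown to be constant on them rather than the fibres to be
  connected.\<close>

theorem Omfun_const:
  assumes s: "signs s p" "p \<ge> 1" "g = 0 \<longrightarrow> p \<ge> 3" and f: "Omfun g p s n f"
    and z: "z \<in> Om g p s n" "z' \<in> Om g p s n"
  shows "f z = f z'"
proof (cases g)
  case 0
  have c: "f (u, c) = f (u', c)" if "(u, c) \<in> Om g p s n" "(u', c) \<in> Om g p s n" for u u' c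
    using Omfun_cong[OF f that(2,1)] 0 by simp
  define H where "H c = f (fst z, c)" for c
  have mem: "c \<in> Sph s p n \<longleftrightarrow> (u, c) \<in> Om g p s n" for c u by (simp add: Sph_def Om_def 0)
  have "continuous_on (Sph s p n) H" unfolding H_def
    by (rule continuous_on_compose2[of "Om g p s n" f])
      (use f mem in \<open>auto simp: Omfun_def intro: continuous_on_Pair continuous_on_const continuous_on_id\<close>)
  \<comment> \<open>A one-point fibre reduces the fibration lemma to locally constant functions on a
    connected set.\<close>
  then have "continuous_on (Sph s p n \<times> {0 :: real}) (\<lambda>w. H (fst w))"
    by (rule continuous_on_compose2) (auto intro: continuous_on_fst continuous_on_id)
  moreover have "connected (Sph s p n)" using Sph_connected_nonempty(1) s 0 by blast
  ultimately have "H x = H y" if "x \<in> Sph s p n" "y \<in> Sph s p n" for x y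
    using locally_constant_fibration[of "Sph s p n" "Sph s p n \<times> {0 :: real}" "\<lambda>w. H (fst w)" x 0 y 0] that
    by (force intro: continuous_on_const)
  then have "H (snd z) = H (snd z')" using z mem by (metis prod.collapse)
  then show ?thesis using c[of "fst z" "snd z'" "fst z'"] z mem by (metis H_def prod.collapse)
next
  case (Suc h)
  let ?B = "base_set h p s n" and ?K = "kap h p s n"
  define E where "E = {(x, u). x \<in> ?B \<and> (\<forall>j<g. cmt (fst (u j)) (snd (u j)) = ?K x j)}"
  define P where "P x = (\<lambda>i. x (i + 4 * h) :: complex)" for x
  have mem: "(u, P x) \<in> Om g p s n" if "(x, u) \<in> E" for x u
    using that base_in_Om[of x h p s n u] by (simp add: E_def P_def Suc)
  define F where "F w = f (snd w, P (fst w))" for w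
  have slice: "F (x, u) = F (x, u')" if u: "(x, u) \<in> E" "(x, u') \<in> E" for x u u'
  proof -
    \<comment> \<open>The hybrids take the first k handles from one point of the fibre and the
      others from the other.\<close>
    have "f (\<lambda>j. if j < k then u' j else u j, P x) = f (u, P x)" if "k \<le> g" for k using that
    proof (induction k)
      case (Suc k)
      let ?u = "\<lambda>j. if j < k then u' j else u j"
      have E: "(x, ?u) \<in> E" using u by (auto simp: E_def)
      have fb: "fibfun (?K x k) (\<lambda>v. f (?u(k := v), P x))"
        by (rule handle_fibfun[OF f mem[OF E]]) (use u Suc.prems in \<open>auto simp: E_def\<close>)
      have nz: "?K x k \<noteq> 0" using u Suc.prems by (auto simp: E_def base_set_iff \<open>g = Suc h\<close>)
      have "cmt (fst (u' k)) (snd (u' k)) = ?K x k" "cmt (fst (u k)) (snd (u k)) = ?K x k"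
        using u Suc.prems by (auto simp: E_def)
      from commutator_fibre[OF this nz fb] have "f (?u(k := (fst (u' k), snd (u' k))), P x) = f (?u(k := (fst (u k), snd (u k))), P x)"
        .
      moreover have "?u(k := (fst (u' k), snd (u' k))) = (\<lambda>j. if j < Suc k then u' j else u j)"
        "?u(k := (fst (u k), snd (u k))) = ?u" by (auto simp: less_Suc_eq)
      ultimately show ?case using Suc by simp
    qed simp
    from this[of g] have 1: "f (\<lambda>j. if j < g then u' j else u j, P x) = f (u, P x)" by simp
    have "(x, \<lambda>j. if j < g then u' j else u j) \<in> E" using u by (auto simp: E_def)
    then have "f (\<lambda>j. if j < g then u' j else u j, P x) = f (u', P x)"
      by (intro Omfun_cong[OF f] mem u(2)) simp_all
    then show ?thesis using 1 by (simp add: F_def)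
  qed
  have sect: "\<exists>U t. open U \<and> x \<in> U \<and> continuous_on (U \<inter> ?B) t \<and> (\<forall>y\<in>U \<inter> ?B. (y, t y) \<in> E)" if x: "x \<in> ?B" for x
  proof -
    have "\<forall>j<g. \<exists>U t. open U \<and> x \<in> U \<and> continuous_on (U \<inter> ?B) t \<and> (\<forall>y\<in>U \<inter> ?B. cmt (fst (t y)) (snd (t y)) = ?K y j)"
    proof (intro allI impI)
      fix j assume "j < g"
      then have j: "between (-1) 1 (?K x j)" "?K x j \<noteq> 0" using x by (auto simp: base_set_iff Suc)
      obtain a0 b0 where ab: "cmt a0 b0 = ?K x j" using cmt_surj[OF j] by blast
      have ct: "continuous_on ?B (\<lambda>x. ?K x j)" unfolding kap_def
        by (cases "j = 0") (simp_all add: continuous_on_cov_minus continuous_on_pp continuous_on_id)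
      obtain U a b where "open U" "x \<in> U" "continuous_on (U \<inter> ?B) a" "continuous_on (U \<inter> ?B) b"
        "\<And>q. q \<in> U \<inter> ?B \<Longrightarrow> cmt (a q) (b q) = ?K q j"
        by (rule cmt_section[where kap="\<lambda>x. ?K x j", OF x ct ab j(2)]) (rule that)
      then show "\<exists>U t. open U \<and> x \<in> U \<and> continuous_on (U \<inter> ?B) t \<and> (\<forall>y\<in>U \<inter> ?B. cmt (fst (t y)) (snd (t y)) = ?K y j)"
        by (intro exI[of _ U] exI[of _ "\<lambda>y. (a y, b y)"]) (auto intro: continuous_on_Pair)
    qed
    then obtain U t where Ut: "\<And>j. j < g \<Longrightarrow> open (U j) \<and> x \<in> U j \<and> continuous_on (U j \<inter> ?B) (t j) \<and> (\<forall>y\<in>U j \<inter> ?B. cmt (fst (t j y)) (snd (t j y)) = ?K y j)"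
      by metis
    let ?U = "\<Inter>j\<in>{..<g}. U j"
    have "continuous_on (?U \<inter> ?B) (\<lambda>y j. if j < g then t j y else (0, 0))"
    proof (rule continuous_on_coordinatewise_then_product)
      fix j show "continuous_on (?U \<inter> ?B) (\<lambda>y. if j < g then t j y else (0, 0))"
      proof (cases "j < g")
        case True
        then show ?thesis using Ut[OF True] by (auto intro: continuous_on_subset[of "U j \<inter> ?B"])
      qed simp
    qed
    moreover have "open ?U" "x \<in> ?U" using Ut by (auto intro: open_INT)
    moreover have "\<forall>y\<in>?U \<inter> ?B. (y, \<lambda>j. if j < g then t j y else (0, 0)) \<in> E"
      using Ut by (simp add: E_def)
    ultimately show ?thesis by blast
  qed
  have cont: "continuous_on E F" unfolding F_def P_def
  proof (rule continuous_on_compose2[of "Om g p s n" f])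
    show "continuous_on E (\<lambda>w. (snd w, \<lambda>i. fst w (i + 4 * h)))"
    proof (rule continuous_on_Pair)
      show "continuous_on E snd" by (rule continuous_on_snd[OF continuous_on_id])
      show "continuous_on E (\<lambda>w i. fst w (i + 4 * h))"
        by (rule continuous_on_coordinatewise_then_product, rule continuous_on_coord, rule continuous_on_fst[OF continuous_on_id])
    qed
  qed (use f mem in \<open>auto simp: Omfun_def P_def\<close>)
  have lift: "\<exists>x u. (x, u) \<in> E \<and> F (x, u) = f z" if z: "z \<in> Om g p s n" for z
  proof -
    obtain u c where 1: "(u, c) \<in> Om g p s n" "ncmt g u" "f (u, c) = f z"
      using remove_commuting_handles[OF s(1,2), of "fst z" "snd z" g n] z f by auto
    obtain x where "x \<in> ?B" "\<And>j. j < Suc h \<Longrightarrow> cmt (fst (u j)) (snd (u j)) = ?K x j" "P x = c"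
      using Om_base[of u c h p s n] 1 unfolding Suc P_def by blast
    then show ?thesis using 1(3) by (intro exI[of _ x] exI[of _ u]) (simp add: E_def F_def Suc)
  qed
  obtain x u x' u' where 1: "(x, u) \<in> E" "F (x, u) = f z" "(x', u') \<in> E" "F (x', u') = f z'"
    using lift z by metis
  have "F (x, u) = F (x', u')"
    by (rule locally_constant_fibration[OF connected_base_set(1)[OF s(1,2)] slice sect cont]) (use 1 in \<open>auto simp: E_def\<close>)
  then show ?thesis using 1 by simp
qed

section \<open>The group \<open>PSL(2,\<real>)\<close>\<close>

text \<open>\<open>cmat\<close> inverts the Cayley transform, which sends the matrix with rows \<open>(a, b)\<close> and \<open>(c, d)\<close> to
  \<open>al = (a + d + \<i> (b - c)) / 2\<close> and \<open>be = (a - d - \<i> (b + c)) / 2\<close>.\<close>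

definition cmat :: "cov \<Rightarrow> real^2^2" where
  "cmat y = vector [vector [Re (al y) + Re (be y), Im (al y) - Im (be y)], vector [- Im (al y) - Im (be y), Re (al y) - Re (be y)]]"

lemma cmat_entries [simp]:
  "cmat y $ 1 $ 1 = Re (al y) + Re (be y)" "cmat y $ 1 $ 2 = Im (al y) - Im (be y)"
  "cmat y $ 2 $ 1 = - Im (al y) - Im (be y)" "cmat y $ 2 $ 2 = Re (al y) - Re (be y)"
  by (simp_all add: cmat_def)

lemma mat2_eq_iff: "(A :: real^2^2) = B \<longleftrightarrow> A $ 1 $ 1 = B $ 1 $ 1 \<and> A $ 1 $ 2 = B $ 1 $ 2 \<and> A $ 2 $ 1 = B $ 2 $ 1 \<and> A $ 2 $ 2 = B $ 2 $ 2"
  by (auto simp: vec_eq_iff forall_2)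

lemma mat2_mult [simp]:
  "((A :: real^2^2) ** B) $ i $ j = A $ i $ 1 * B $ 1 $ j + A $ i $ 2 * B $ 2 $ j"
  by (simp add: matrix_matrix_mult_def sum_2)

lemma mat2_mat [simp]: "(mat k :: real^2^2) $ 1 $ 1 = k" "(mat k :: real^2^2) $ 1 $ 2 = 0" "(mat k :: real^2^2) $ 2 $ 1 = 0" "(mat k :: real^2^2) $ 2 $ 2 = k"
  by (simp_all add: mat_def)

lemma cmat_plus: "cmat (x + y) = cmat x ** cmat y"
  by (simp add: mat2_eq_iff al_plus be_plus algebra_simps)

lemma cmat_0: "cmat 0 = mat 1"
  by (simp add: mat2_eq_iff)

lemma det_cmat [simp]: "det (cmat y) = 1"
  using SU_sq[of y] unfolding cmod_power2 by (simp add: det_2 power2_eq_square algebra_simps)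

definition mal :: "real^2^2 \<Rightarrow> complex" where "mal A = Complex ((A $ 1 $ 1 + A $ 2 $ 2) / 2) ((A $ 1 $ 2 - A $ 2 $ 1) / 2)"
definition mbe :: "real^2^2 \<Rightarrow> complex" where "mbe A = Complex ((A $ 1 $ 1 - A $ 2 $ 2) / 2) (- (A $ 1 $ 2 + A $ 2 $ 1) / 2)"

lemma mal_cmat [simp]: "mal (cmat y) = al y" "mal (- A) = - mal A"
  and mbe_cmat [simp]: "mbe (cmat y) = be y" "mbe (- A) = - mbe A"
  by (simp_all add: mal_def mbe_def complex_eq_iff field_simps)

lemma cmat_surj: assumes "det A = 1" obtains y where "A = cmat y"
proof -
  have d: "(cmod (mal A))\<^sup>2 - (cmod (mbe A))\<^sup>2 = 1"
    using assms unfolding cmod_power2 mal_def mbe_def complex.sel by (simp add: det_2 power2_eq_square field_simps)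
  then have "(cmod (mbe A))\<^sup>2 < (cmod (mal A))\<^sup>2" by linarith
  then have "cmod (mbe A) < cmod (mal A)" by (rule power2_less_imp_less) simp
  then have "al (nrm (mal A) (mbe A)) = mal A" "be (nrm (mal A) (mbe A)) = mbe A" by (simp_all add: d)
  then show ?thesis by (intro that[of "nrm (mal A) (mbe A)"]) (simp add: mat2_eq_iff mal_def mbe_def field_simps)
qed

lemma carrier_SL2: "carrier SL2 = range cmat"
  by (auto simp: SL2_def elim: cmat_surj)

lemma mult_SL2 [simp]: "A \<otimes>\<^bsub>SL2\<^esub> B = A ** B" and one_SL2 [simp]: "\<one>\<^bsub>SL2\<^esub> = mat 1"
  by (simp_all add: SL2_def)

interpretation SL2: group SL2
proof (rule groupI)
  fix A assume "A \<in> carrier SL2"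
  then obtain y where "A = cmat y" by (auto simp: carrier_SL2)
  then show "\<exists>B\<in>carrier SL2. B \<otimes>\<^bsub>SL2\<^esub> A = \<one>\<^bsub>SL2\<^esub>"
    by (intro bexI[of _ "cmat (- y)"]) (simp_all add: carrier_SL2 cmat_0 flip: cmat_plus)
qed (auto simp: carrier_SL2 matrix_mul_assoc simp flip: cmat_plus cmat_0)

lemma uminus_mat_mult: "(- mat 1) ** A = - (A :: real^2^2)" "A ** (- mat 1) = - (A :: real^2^2)"
  by (simp_all add: mat2_eq_iff)

lemma cmat_uminus: "- cmat y = cmat (cz 1 + y)"
  by (simp add: mat2_eq_iff sg_def)

lemma normal_pm: "{mat 1, - mat 1} \<lhd> SL2"
proof (rule SL2.normalI)
  have m: "mat 1 \<in> carrier SL2" "- mat 1 \<in> carrier SL2"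
    using rangeI[of cmat 0] rangeI[of cmat "cz 1"] cmat_0 cmat_uminus[of 0] by (simp_all add: carrier_SL2)
  moreover have "inv\<^bsub>SL2\<^esub> (- mat 1) = - mat 1"
    by (rule SL2.inv_equality) (simp_all add: uminus_mat_mult m)
  ultimately show "subgroup {mat 1, - mat 1} SL2"
    using SL2.inv_one by (intro SL2.subgroupI) (auto simp: uminus_mat_mult)
  show "\<forall>A\<in>carrier SL2. {mat 1, - mat 1} #>\<^bsub>SL2\<^esub> A = A <#\<^bsub>SL2\<^esub> {mat 1, - mat 1}"
    by (auto simp: r_coset_def l_coset_def uminus_mat_mult)
qed

interpretation N: normal "{mat 1, - mat 1}" SL2 by (rule normal_pm)

lemma psl_eq: "psl A = {A, - A}"
  by (auto simp: psl_def r_coset_def uminus_mat_mult)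

definition ppi :: "cov \<Rightarrow> (real^2^2) set" where "ppi y = psl (cmat y)"

lemma psl_mat: "psl A = psl B \<longleftrightarrow> A = B \<or> A = - B"
  by (auto simp: psl_eq doubleton_eq_iff)

lemma ppi_eq_iff: "ppi x = ppi y \<longleftrightarrow> (\<exists>n. x = cz n + y)"
proof
  assume "ppi x = ppi y"
  then have "cmat x = cmat y \<or> cmat x = - cmat y" by (simp add: ppi_def psl_mat)
  then have "al x = al y \<and> be x = be y \<or> al x = - al y \<and> be x = - be y"
    by (metis mal_cmat mbe_cmat)
  then show "\<exists>n. x = cz n + y"
    using cov_lifts[of x 0 y] cov_lifts[of x 1 y] by (auto simp: sg_def)
next
  assume "\<exists>n. x = cz n + y"
  then obtain n where "x = cz n + y" by blast
  then have "cmat x = cmat y \<or> cmat x = - cmat y" using sg_cases[of n] by (auto simp: mat2_eq_iff)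
  then show "ppi x = ppi y" by (simp add: ppi_def psl_mat)
qed

lemma carrier_PSL2: "carrier PSL2 = range ppi"
  by (auto simp: PSL2_def FactGroup_def RCOSETS_def ppi_def psl_def carrier_SL2)

lemma ppi_mult [simp]: "ppi x \<otimes>\<^bsub>PSL2\<^esub> ppi y = ppi (x + y)"
  using N.rcos_sum[of "cmat x" "cmat y"] by (simp add: PSL2_def FactGroup_def ppi_def psl_def carrier_SL2 cmat_plus)

lemma ppi_0: "ppi 0 = \<one>\<^bsub>PSL2\<^esub>"
  by (auto simp: ppi_def psl_eq cmat_0 PSL2_def FactGroup_def)

interpretation PSL2: group PSL2
  unfolding PSL2_def by (rule N.factorgroup_is_group)

lemma ppi_closed [simp]: "ppi x \<in> carrier PSL2"
  by (simp add: carrier_PSL2)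

lemma ppi_inv [simp]: "inv\<^bsub>PSL2\<^esub> (ppi x) = ppi (- x)"
  by (rule PSL2.inv_equality) (simp_all add: ppi_0)

subsection \<open>Topology\<close>

lemma topspace_PSL2 [simp]: "topspace PSL2_top = carrier PSL2"
  by (auto simp: PSL2_top_def carrier_PSL2 carrier_SL2 ppi_def)

lemma continuous_map_from_PSL2:
  assumes "continuous_on (carrier SL2) F" "\<And>y. Q (ppi y) = F (cmat y)"
  shows "continuous_map PSL2_top euclidean Q"
  unfolding continuous_map_def
proof (intro conjI allI impI)
  fix U :: "'a set" assume "openin euclidean U"
  then have "openin (top_of_set (carrier SL2)) (carrier SL2 \<inter> F -` U)"
    using assms(1) by (simp add: continuous_openin_preimage_gen)
  moreover have "{A \<in> carrier SL2. psl A \<in> {P \<in> carrier PSL2. Q P \<in> U}} = carrier SL2 \<inter> F -` U"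
    using assms(2) by (auto simp: carrier_SL2 carrier_PSL2 simp flip: ppi_def)
  ultimately show "openin PSL2_top {P \<in> topspace PSL2_top. Q P \<in> U}"
    unfolding topspace_PSL2 by (auto simp: PSL2_top_def openin_quotient_topology carrier_PSL2 carrier_SL2 ppi_def)
qed auto

lemma continuous_on_cmat: assumes "continuous_on S f" shows "continuous_on S (\<lambda>x. cmat (f x))"
  unfolding continuous_on_def
proof
  fix x assume "x \<in> S"
  then have "((\<lambda>x. al (f x)) \<longlongrightarrow> al (f x)) (at x within S)" "((\<lambda>x. be (f x)) \<longlongrightarrow> be (f x)) (at x within S)"
    using continuous_on_al[OF assms] continuous_on_be[OF assms] by (auto simp: continuous_on_def)
  then have "\<forall>i j. ((\<lambda>x. cmat (f x) $ i $ j) \<longlongrightarrow> cmat (f x) $ i $ j) (at x within S)"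
    unfolding forall_2 cmat_entries by (intro conjI tendsto_intros)
  then show "((\<lambda>x. cmat (f x)) \<longlongrightarrow> cmat (f x)) (at x within S)" by (intro vec_tendstoI) simp
qed

lemma continuous_map_psl: "continuous_map (top_of_set (carrier SL2)) PSL2_top psl"
  by (auto simp: continuous_map_def PSL2_top_def openin_quotient_topology)

lemma continuous_map_ppi:
  assumes "continuous_on S f" shows "continuous_map (top_of_set S) PSL2_top (\<lambda>x. ppi (f x))"
proof -
  have "continuous_map (top_of_set S) (top_of_set (carrier SL2)) (\<lambda>x. cmat (f x))"
    using continuous_on_cmat[OF assms] by (auto simp: carrier_SL2)
  from continuous_map_compose[OF this continuous_map_psl] show ?thesis by (simp add: o_def ppi_def)
qed

text \<open>Two functions that do not change when the matrix changes sign. As \<open>al\<close> is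
  never 0, they determine the element of PSL(2,R), so lifting reduces to choosing a logarithm of the
  first one.\<close>

definition Qc :: "(real^2^2) set \<Rightarrow> complex \<times> complex" where
  "Qc P = (let A = (SOME A. A \<in> P) in ((mal A)\<^sup>2, mal A * mbe A))"

lemma Qc_ppi: "Qc (ppi y) = ((al y)\<^sup>2, al y * be y)"
proof -
  have "(SOME A. A \<in> ppi y) \<in> ppi y" by (rule someI) (auto simp: ppi_def psl_eq)
  then show ?thesis by (auto simp: Qc_def Let_def ppi_def psl_eq)
qed

lemma continuous_map_Qc: "continuous_map PSL2_top euclidean Qc"
proof (rule continuous_map_from_PSL2)
  show "continuous_on (carrier SL2) (\<lambda>A. ((mal A)\<^sup>2, mal A * mbe A))"
    unfolding mal_def mbe_def Complex_eq by (intro continuous_intros) simp_all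
qed (simp add: Qc_ppi)

text \<open>For L a logarithm of the square of \<open>al\<close>, exp (L / 2) is \<open>al\<close>
  up to sign, and half the imaginary part of L is the angle \<open>th\<close>.\<close>

definition from_log :: "complex \<Rightarrow> complex \<Rightarrow> cov" where
  "from_log L w = Cov (Im L / 2) (w / exp (L / 2))"

lemma ppi_from_log:
  assumes "P \<in> carrier PSL2" "exp L = fst (Qc P)" shows "ppi (from_log L (snd (Qc P))) = P"
proof -
  obtain y where y: "P = ppi y" using assms(1) by (auto simp: carrier_PSL2)
  define x where "x = from_log L (al y * be y)"
  have "(exp (L / 2))\<^sup>2 = (al y)\<^sup>2" using assms(2) by (simp add: y Qc_ppi flip: exp_double)
  then obtain k :: int where k: "exp (L / 2) = of_real (sg k) * al y"
    unfolding power2_eq_iff by (metis mult_1 mult_minus1 of_real_1 of_real_minus sg_def sg_simps(1,7))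
  have be: "be x = of_real (sg k) * be y" using sg_cases[of k] by (auto simp: x_def from_log_def k)
  then have "cmod (be x) = cmod (be y)" using sg_cases[of k] by (auto simp: norm_mult)
  then have "cmod (al x) = cmod (al y)" by (simp add: cmod_al)
  also have "\<dots> = cmod (exp (L / 2))" by (simp add: k norm_mult)
  finally have "al x = of_real (cmod (exp (L / 2))) * cis (Im L / 2)"
    by (subst al_polar) (simp add: x_def from_log_def)
  also have "\<dots> = exp (L / 2)" by (subst exp_eq_polar[of "L / 2"]) simp
  finally have "al x = of_real (sg k) * al y" using k by simp
  then show ?thesis using cov_lifts[OF _ be] by (auto simp: y Qc_ppi ppi_eq_iff simp flip: x_def)
qed

lemma lift_map:
  fixes g :: "'a::real_normed_vector \<Rightarrow> _"
  assumes S: "contractible S" and g: "continuous_map (top_of_set S) PSL2_top g"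
  obtains y where "continuous_on S y" "\<And>x. x \<in> S \<Longrightarrow> ppi (y x) = g x"
proof -
  have car: "g x \<in> carrier PSL2" if "x \<in> S" for x using g that by (auto simp: continuous_map_def)
  have Q: "continuous_on S (\<lambda>x. Qc (g x))"
    using continuous_map_compose[OF g continuous_map_Qc] by (simp add: o_def)
  have nz: "fst (Qc (g x)) \<noteq> 0" if "x \<in> S" for x using car[OF that] by (auto simp: carrier_PSL2 Qc_ppi)
  obtain L where L: "continuous_on S L" "\<And>x. x \<in> S \<Longrightarrow> fst (Qc (g x)) = exp (L x)"
    by (rule continuous_logarithm_on_contractible[OF continuous_on_fst[OF Q] S nz], assumption) (rule that)
  show ?thesis
  proof (rule that)
    show "continuous_on S (\<lambda>x. from_log (L x) (snd (Qc (g x))))"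
      unfolding from_log_def by (intro continuous_intros L Q) auto
  qed (use ppi_from_log car L(2) in auto)
qed

lemma local_section:
  obtains N sec where "openin PSL2_top N" "ppi y \<in> N" "continuous_map (subtopology PSL2_top N) euclidean sec"
    "sec (ppi y) = y" "\<And>P. P \<in> N \<Longrightarrow> ppi (sec P) = P"
proof -
  define D where "D = {z :: complex \<times> complex. Re (fst z / (al y)\<^sup>2) > 0}"
  define N where "N = {P \<in> carrier PSL2. Qc P \<in> D}"
  \<comment> \<open>The constant is the logarithm of \<open>(al y)\<^sup>2\<close> with imaginary
    part \<open>2 * th y\<close>; with it the section passes through y itself.\<close>
  define L where "L z = Ln (fst z / (al y)\<^sup>2) + (2 * of_real (ln (cmod (al y))) + 2 * \<i> * of_real (th y))" for z :: "complex \<times> complex"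
  define l where "l = of_real (ln (cmod (al y))) + \<i> * of_real (th y)"
  have l: "exp l = al y"
    unfolding l_def exp_add by (simp add: exp_of_real cis_conv_exp[symmetric] al_polar[symmetric])
  have L_def: "L z = Ln (fst z / (al y)\<^sup>2) + 2 * l" for z by (simp add: L_def l_def)
  have "open D" unfolding D_def by (intro open_Collect_less continuous_intros) auto
  then have N: "openin PSL2_top N"
    using continuous_map_Qc unfolding N_def continuous_map_def topspace_PSL2 by simp
  have hD: "continuous_on D (\<lambda>z. from_log (L z) (snd z))"
    unfolding from_log_def L_def by (intro continuous_intros) (auto simp: D_def complex_nonpos_Reals_iff)
  have Q: "continuous_map (subtopology PSL2_top N) (top_of_set D) Qc"
    using continuous_map_from_subtopology[OF continuous_map_Qc, of N] by (auto simp: continuous_map_in_subtopology N_def)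
  show ?thesis
  proof (rule that[OF N])
    show yN: "ppi y \<in> N" by (simp add: N_def D_def Qc_ppi)
    show "continuous_map (subtopology PSL2_top N) euclidean (\<lambda>P. from_log (L (Qc P)) (snd (Qc P)))"
      using continuous_map_compose[OF Q, of euclidean] hD by (simp add: o_def)
    show "from_log (L (Qc (ppi y))) (snd (Qc (ppi y))) = y"
    proof -
      have "L (Qc (ppi y)) = 2 * l" by (simp add: L_def Qc_ppi)
      then show ?thesis unfolding from_log_def by (intro cov_eqI) (simp_all add: l Qc_ppi, simp add: l_def)
    qed
    fix P assume P: "P \<in> N"
    then have "fst (Qc P) \<noteq> 0" by (auto simp: N_def D_def)
    then have "exp (L (Qc P)) = fst (Qc P)" unfolding L_def exp_add exp_double l by simp
    then show "ppi (from_log (L (Qc P)) (snd (Qc P))) = P" using P by (intro ppi_from_log) (auto simp: N_def)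
  qed
qed

section \<open>The universal cover\<close>

text \<open>Two lifts differ by central elements, whose \<open>th\<close> is spaced by pi.\<close>

lemma lift_unique:
  fixes f g :: "'a::topological_space \<Rightarrow> cov"
  assumes "connected S" "continuous_on S f" "continuous_on S g" "\<And>x. x \<in> S \<Longrightarrow> ppi (f x) = ppi (g x)"
    and x: "x0 \<in> S" "f x0 = g x0" "x \<in> S"
  shows "f x = g x"
proof -
  have d: "\<exists>n. f x - g x = cz n" if x: "x \<in> S" for x
  proof -
    obtain n where "f x = cz n + g x" using assms(4)[OF x] ppi_eq_iff by blast
    then show ?thesis by (intro exI[of _ n]) simp
  qed
  have "(\<lambda>x. th (f x - g x)) constant_on S"
  proof (rule continuous_discrete_range_constant[OF assms(1)])
    show "continuous_on S (\<lambda>x. th (f x - g x))" by (intro continuous_intros assms)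
    fix x assume x: "x \<in> S"
    have "pi \<le> norm (th (f y - g y) - th (f x - g x))" if y: "y \<in> S" "th (f y - g y) \<noteq> th (f x - g x)" for y
    proof -
      obtain m n where mn: "f y - g y = cz m" "f x - g x = cz n" using d x y by blast
      then have "m \<noteq> n" using y(2) by auto
      then have "1 * pi \<le> \<bar>of_int (m - n)\<bar> * pi" by (intro mult_right_mono) auto
      then show ?thesis by (simp add: mn abs_mult flip: left_diff_distrib)
    qed
    then show "\<exists>e>0. \<forall>y. y \<in> S \<and> th (f y - g y) \<noteq> th (f x - g x) \<longrightarrow> e \<le> norm (th (f y - g y) - th (f x - g x))"
      using pi_gt_zero by blast
  qed
  then have "th (f x - g x) = th (f x0 - g x0)" using x unfolding constant_on_def by metis
  moreover obtain n where "f x - g x = cz n" using d x by blast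
  ultimately have "f x - g x = 0" using x(2) by (simp add: cz_0)
  then show ?thesis by simp
qed

definition lifted :: "(real \<Rightarrow> (real^2^2) set) \<Rightarrow> (real \<Rightarrow> cov) \<Rightarrow> bool" where
  "lifted \<gamma> c \<longleftrightarrow> continuous_on {0..1} c \<and> c 0 = 0 \<and> (\<forall>t\<in>{0..1}. \<gamma> t = ppi (c t))"

text \<open>The isomorphism from the model to \<open>SL2_cover\<close>: a class of paths is named by
  the endpoint of the lift that starts at 0.\<close>

definition Lam :: "cov \<Rightarrow> (real \<Rightarrow> (real^2^2) set) set" where
  "Lam y = {\<gamma>. \<exists>c. lifted \<gamma> c \<and> c 1 = y}"

lemma lifted_unique:
  assumes "lifted \<gamma> c" "lifted \<gamma> c'" shows "c 1 = c' 1"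
  by (rule lift_unique[of "{0..1}" c c' 0]) (use assms in \<open>auto simp: lifted_def\<close>)

lemma lifted_pathin:
  assumes "lifted \<gamma> c" shows "pathin PSL2_top \<gamma>" "\<gamma> 0 = \<one>\<^bsub>PSL2\<^esub>"
proof -
  have "continuous_map (top_of_set {0..1}) PSL2_top (\<lambda>t. ppi (c t))"
    using assms by (intro continuous_map_ppi) (simp add: lifted_def)
  then show "pathin PSL2_top \<gamma>" unfolding pathin_def
    by (rule continuous_map_eq) (use assms in \<open>auto simp: lifted_def\<close>)
  show "\<gamma> 0 = \<one>\<^bsub>PSL2\<^esub>" using assms by (simp add: lifted_def ppi_0)
qed

lemma shift_lift: "ppi y = \<one>\<^bsub>PSL2\<^esub> \<Longrightarrow> \<exists>n. cz n + y = 0"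
  unfolding ppi_0[symmetric] ppi_eq_iff by (metis add.right_neutral add.right_inverse cz_uminus add_uminus_conv_diff cz_commute)

lemma ppi_cz: "ppi (cz n + y) = ppi y"
  unfolding ppi_eq_iff by blast

lemma lifted_exists:
  assumes "pathin PSL2_top \<gamma>" "\<gamma> 0 = \<one>\<^bsub>PSL2\<^esub>" shows "\<exists>c. lifted \<gamma> c"
proof -
  obtain y where y: "continuous_on {0..1} y" "\<And>x. x \<in> {0..1} \<Longrightarrow> ppi (y x) = \<gamma> x"
    by (rule lift_map[OF _ assms(1)[unfolded pathin_def]]) (auto intro: convex_imp_contractible)
  obtain n where "cz n + y 0 = 0" using shift_lift[of "y 0"] y(2)[of 0] assms(2) by auto
  then have "lifted \<gamma> (\<lambda>t. cz n + y t)" using y by (auto simp: lifted_def ppi_cz intro!: continuous_intros)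
  then show ?thesis by blast
qed

text \<open>A homotopy lifts over the square, and its fixed endpoints lift to constants. Conversely
  the model is homeomorphic to a vector space, so lifts with the same ends are homotopic.\<close>

lemma path_homotopic_lifted:
  assumes c: "lifted \<gamma> c" shows "path_homotopic PSL2_top \<gamma> \<delta> \<longleftrightarrow> (\<exists>c'. lifted \<delta> c' \<and> c' 1 = c 1)"
proof
  assume "path_homotopic PSL2_top \<gamma> \<delta>"
  then obtain h :: "real \<times> real \<Rightarrow> _" where h: "continuous_map (prod_topology (top_of_set {0..1}) (top_of_set {0..1})) PSL2_top h"
    "\<forall>x. h (0, x) = \<gamma> x" "\<forall>x. h (1, x) = \<delta> x" "\<forall>t\<in>{0..1}. h (t, 0) = \<gamma> 0 \<and> h (t, 1) = \<gamma> 1"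
    unfolding path_homotopic_def homotopic_with_def by blast
  obtain y where y: "continuous_on ({0..1} \<times> {0..1}) y" "\<And>x. x \<in> {0..1} \<times> {0..1} \<Longrightarrow> ppi (y x) = h x"
    by (rule lift_map[of "{0..1} \<times> {0..1}" h])
      (use h(1) in \<open>auto intro!: convex_imp_contractible convex_Times\<close>)
  have slice: "continuous_on {0..1} (\<lambda>t. y (s, t))" "continuous_on {0..1} (\<lambda>t. y (t, s))" if "s \<in> {0..1}" for s
    by (rule continuous_on_compose2[OF y(1)]; use that in \<open>auto intro!: continuous_intros\<close>)+
  have const: "y (1, s) = y (0, s)" if s: "s = 0 \<or> s = 1" for s
    by (rule lift_unique[of "{0..1}" "\<lambda>t. y (t, s)" "\<lambda>_. y (0, s)" 0]) (use slice(2)[of s] y(2) h(4) s in auto)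
  have "\<gamma> 0 = \<one>\<^bsub>PSL2\<^esub>" by (rule lifted_pathin[OF c])
  then obtain n where n: "cz n + y (0, 0) = 0" using shift_lift[of "y (0, 0)"] y(2)[of "(0, 0)"] h(2) by auto
  have "lifted \<gamma> (\<lambda>t. cz n + y (0, t))" "lifted \<delta> (\<lambda>t. cz n + y (1, t))"
    using n y(2) h(2,3) slice const by (auto simp: lifted_def ppi_cz intro!: continuous_intros)
  then show "\<exists>c'. lifted \<delta> c' \<and> c' 1 = c 1" using lifted_unique[OF c] const by auto
next
  assume "\<exists>c'. lifted \<delta> c' \<and> c' 1 = c 1"
  then obtain c' where c': "lifted \<delta> c'" "c' 1 = c 1" by blast
  \<comment> \<open>The straight-line homotopy in the coordinates \<open>th\<close> and
    \<open>be\<close>.\<close>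
  define k where "k z = Cov ((1 - fst z) * th (c (snd z)) + fst z * th (c' (snd z)))
    (of_real (1 - fst z) * be (c (snd z)) + of_real (fst z) * be (c' (snd z)))" for z :: "real \<times> real"
  have cc: "continuous_on ({0..1} \<times> {0..1}) (\<lambda>z :: real \<times> real. c (snd z))" "continuous_on ({0..1} \<times> {0..1}) (\<lambda>z :: real \<times> real. c' (snd z))"
    using c c'(1) by (auto simp: lifted_def intro!: continuous_on_compose2[of "{0..1}" c] continuous_on_compose2[of "{0..1}" c'] continuous_intros)
  have k: "continuous_on ({0..1} \<times> {0..1}) k"
    unfolding k_def by (intro continuous_intros cc)
  have same: "k (s, t) = c t" if "c' t = c t" for s t
    by (intro cov_eqI) (simp_all add: k_def that algebra_simps)
  show "path_homotopic PSL2_top \<gamma> \<delta>"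
    unfolding path_homotopic_def
  proof (subst homotopic_with)
    show "\<exists>h :: real \<times> real \<Rightarrow> _. continuous_map (prod_topology (top_of_set {0..1}) (top_of_set {0..1})) PSL2_top h \<and>
        (\<forall>x\<in>topspace (top_of_set {0..1}). h (0, x) = \<gamma> x) \<and> (\<forall>x\<in>topspace (top_of_set {0..1}). h (1, x) = \<delta> x) \<and>
        (\<forall>t\<in>{0..1}. h (t, 0) = \<gamma> 0 \<and> h (t, 1) = \<gamma> 1)"
    proof (intro exI[of _ "\<lambda>z. ppi (k z)"] conjI ballI)
      show "continuous_map (prod_topology (top_of_set {0..1}) (top_of_set {0..1})) PSL2_top (\<lambda>z. ppi (k z))"
        using continuous_map_ppi[OF k] by simp
      fix t :: real
      have "c' 0 = c 0" using c c' by (simp add: lifted_def)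
      then show "ppi (k (t, 0)) = \<gamma> 0" "ppi (k (t, 1)) = \<gamma> 1" using same c c' by (auto simp: lifted_def)
    next
      fix t :: real assume "t \<in> topspace (top_of_set {0..1})"
      moreover have "k (0, t) = c t" "k (1, t) = c' t" by (intro cov_eqI; simp add: k_def)+
      ultimately show "ppi (k (0, t)) = \<gamma> t" "ppi (k (1, t)) = \<delta> t" using c c' by (auto simp: lifted_def)
    qed
  qed auto
qed

lemma path_class_lifted: "lifted \<gamma> c \<Longrightarrow> path_class PSL2_top \<gamma> = Lam (c 1)"
  by (auto simp: path_class_def Lam_def path_homotopic_lifted)

lemma lifted_ray: "lifted (\<lambda>t. ppi (Cov (t * th y) (of_real t * be y))) (\<lambda>t. Cov (t * th y) (of_real t * be y))"
  by (auto simp: lifted_def zero_cov_def intro!: continuous_intros)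

lemma Lam_nonempty: "Lam y \<noteq> {}"
  using lifted_ray[of y] by (auto simp: Lam_def) (metis cov.collapse mult_1 of_real_1)

lemma Lam_inj: "Lam x = Lam y \<Longrightarrow> x = y"
proof -
  assume eq: "Lam x = Lam y"
  obtain \<gamma> where "\<gamma> \<in> Lam x" using Lam_nonempty by blast
  moreover from this have "\<gamma> \<in> Lam y" by (simp only: eq)
  ultimately show ?thesis unfolding Lam_def using lifted_unique by blast
qed

lemma carrier_cover: "carrier SL2_cover = range Lam"
proof -
  have "path_class PSL2_top ` {\<gamma>. pathin PSL2_top \<gamma> \<and> \<gamma> 0 = \<one>\<^bsub>PSL2\<^esub>} = range Lam"
  proof (intro equalityI subsetI)
    fix P assume "P \<in> range Lam"
    then obtain y where y: "P = Lam y" by blast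
    let ?g = "\<lambda>t. ppi (Cov (t * th y) (of_real t * be y))"
    have "P = path_class PSL2_top ?g" using path_class_lifted[OF lifted_ray[of y]] y by simp
    then show "P \<in> path_class PSL2_top ` {\<gamma>. pathin PSL2_top \<gamma> \<and> \<gamma> 0 = \<one>\<^bsub>PSL2\<^esub>}"
      using lifted_pathin[OF lifted_ray[of y]] by blast
  next
    fix P assume "P \<in> path_class PSL2_top ` {\<gamma>. pathin PSL2_top \<gamma> \<and> \<gamma> 0 = \<one>\<^bsub>PSL2\<^esub>}"
    then show "P \<in> range Lam" using lifted_exists path_class_lifted by blast
  qed
  then show ?thesis by (simp add: SL2_cover_def universal_cover_def)
qed

lemma Lam_mult [simp]: "Lam x \<otimes>\<^bsub>SL2_cover\<^esub> Lam y = Lam (x + y)"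
proof -
  have 1: "lifted (\<lambda>t. \<alpha> t \<otimes>\<^bsub>PSL2\<^esub> \<beta> t) (\<lambda>t. a t + b t)" if "lifted \<alpha> a" "lifted \<beta> b" for \<alpha> \<beta> a b
    using that by (auto simp: lifted_def intro!: continuous_intros)
  have "{\<gamma>. \<exists>\<alpha>\<in>Lam x. \<exists>\<beta>\<in>Lam y. path_homotopic PSL2_top (\<lambda>t. \<alpha> t \<otimes>\<^bsub>PSL2\<^esub> \<beta> t) \<gamma>} = Lam (x + y)"
  proof (intro equalityI subsetI)
    fix \<gamma> assume "\<gamma> \<in> {\<gamma>. \<exists>\<alpha>\<in>Lam x. \<exists>\<beta>\<in>Lam y. path_homotopic PSL2_top (\<lambda>t. \<alpha> t \<otimes>\<^bsub>PSL2\<^esub> \<beta> t) \<gamma>}"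
    then obtain \<alpha> \<beta> a b where "lifted \<alpha> a" "lifted \<beta> b" "a 1 = x" "b 1 = y" "path_homotopic PSL2_top (\<lambda>t. \<alpha> t \<otimes>\<^bsub>PSL2\<^esub> \<beta> t) \<gamma>"
      by (auto simp: Lam_def)
    then show "\<gamma> \<in> Lam (x + y)" using path_homotopic_lifted[OF 1] by (fastforce simp: Lam_def)
  next
    fix \<gamma> assume g: "\<gamma> \<in> Lam (x + y)"
    obtain \<alpha> \<beta> where "\<alpha> \<in> Lam x" "\<beta> \<in> Lam y" using Lam_nonempty by blast
    moreover from this have "path_homotopic PSL2_top (\<lambda>t. \<alpha> t \<otimes>\<^bsub>PSL2\<^esub> \<beta> t) \<gamma>"
      using g path_homotopic_lifted[OF 1] by (fastforce simp: Lam_def)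
    ultimately show "\<gamma> \<in> {\<gamma>. \<exists>\<alpha>\<in>Lam x. \<exists>\<beta>\<in>Lam y. path_homotopic PSL2_top (\<lambda>t. \<alpha> t \<otimes>\<^bsub>PSL2\<^esub> \<beta> t) \<gamma>}" by blast
  qed
  then show ?thesis by (simp add: SL2_cover_def universal_cover_def)
qed

lemma Lam_0: "\<one>\<^bsub>SL2_cover\<^esub> = Lam 0"
  using path_class_lifted[of "\<lambda>_. ppi 0" "\<lambda>_. 0"] by (simp add: SL2_cover_def universal_cover_def lifted_def ppi_0)

lemma cover_proj_Lam [simp]: "cover_proj (Lam y) = ppi y"
proof -
  have "(\<lambda>\<gamma>. \<gamma> 1) ` Lam y = {ppi y}"
    using Lam_nonempty[of y] by (auto simp: Lam_def lifted_def image_def)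
  then show ?thesis by (simp add: cover_proj_def)
qed

interpretation cover: group SL2_cover
proof (rule groupI)
  fix P assume "P \<in> carrier SL2_cover"
  then obtain y where "P = Lam y" by (auto simp: carrier_cover)
  then show "\<exists>Q\<in>carrier SL2_cover. Q \<otimes>\<^bsub>SL2_cover\<^esub> P = \<one>\<^bsub>SL2_cover\<^esub>"
    by (intro bexI[of _ "Lam (- y)"]) (simp_all add: carrier_cover Lam_0)
qed (auto simp: carrier_cover Lam_0 add.assoc)

lemma Lam_closed [simp]: "Lam y \<in> carrier SL2_cover"
  by (simp add: carrier_cover)

lemma Lam_inv [simp]: "inv\<^bsub>SL2_cover\<^esub> (Lam y) = Lam (- y)"
  by (rule cover.inv_equality) (simp_all add: Lam_0)

lemma Lam_pow: "Lam (cz 1) [^]\<^bsub>SL2_cover\<^esub> (n :: int) = Lam (cz n)"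
proof -
  have nat: "Lam (cz 1) [^]\<^bsub>SL2_cover\<^esub> (k :: nat) = Lam (cz (int k))" for k
    by (induction k) (simp_all add: Lam_0 cz_0 cz_add add.commute)
  show ?thesis
    by (cases n rule: int_cases2) (simp_all add: nat int_pow_int cover.int_pow_neg_int cz_uminus)
qed

subsection \<open>The exponential map\<close>

lemma mat2_sq: "trace (X :: real^2^2) = 0 \<Longrightarrow> X ** X = (- det X) *\<^sub>R mat 1"
proof -
  assume "trace X = 0"
  then have "X $ 2 $ 2 = - X $ 1 $ 1" by (simp add: trace_def sum_2)
  then show ?thesis by (simp add: mat2_eq_iff det_2 algebra_simps)
qed

text \<open>By Cayley-Hamilton a traceless X has the scalar square D, so the exponential series
  splits into an even part at 1 and an odd part at X.\<close>

lemma mat_exp_sums: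
  assumes X: "trace X = 0" "D = - det X"
    and A: "(\<lambda>k. if even k then D ^ (k div 2) / fact k else 0) sums A"
    and B: "(\<lambda>k. if even k then 0 else D ^ (k div 2) / fact k) sums B"
  shows "mat_exp X = A *\<^sub>R mat 1 + B *\<^sub>R X"
proof -
  have XX: "X ** X = D *\<^sub>R mat 1" using mat2_sq[OF X(1)] X(2) by simp
  have sc: "X ** (r *\<^sub>R Y) = r *\<^sub>R (X ** Y)" for r and Y :: "real^2^2" by (simp add: mat2_eq_iff algebra_simps)
  have P: "((**) X ^^ k) (mat 1) = D ^ (k div 2) *\<^sub>R (if even k then mat 1 else X)" for k
    by (induction k) (auto simp: sc XX elim!: evenE oddE)
  have "(\<lambda>k. (if even k then D ^ (k div 2) / fact k else 0) *\<^sub>R mat 1 + (if even k then 0 else D ^ (k div 2) / fact k) *\<^sub>R X)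
      sums (A *\<^sub>R mat 1 + B *\<^sub>R X)"
    by (intro sums_add sums_scaleR_left A B)
  moreover have "(\<lambda>k. (if even k then D ^ (k div 2) / fact k else 0) *\<^sub>R mat 1 + (if even k then 0 else D ^ (k div 2) / fact k) *\<^sub>R X)
     = (\<lambda>k. inverse (fact k) *\<^sub>R (((**) X ^^ k) (mat 1)))"
    by (auto simp: P divide_inverse mult.commute)
  ultimately show ?thesis by (simp add: mat_exp_def sums_iff)
qed

lemma mat_exp_hyp:
  assumes X: "trace X = 0" "r\<^sup>2 = - det X" "r \<noteq> 0" shows "mat_exp X = cosh r *\<^sub>R mat 1 + (sinh r / r) *\<^sub>R X"
proof (rule mat_exp_sums[OF X(1,2)])
  have p: "(r\<^sup>2) ^ (k div 2) = r ^ k" if "even k" for k using that by (auto elim!: evenE simp flip: power_mult)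
  have "(\<lambda>k. if even k then (r\<^sup>2) ^ (k div 2) / fact k else 0) = (\<lambda>n. if even n then r ^ n /\<^sub>R fact n else 0)"
    by (auto simp: p divide_inverse mult.commute)
  then show "(\<lambda>k. if even k then (r\<^sup>2) ^ (k div 2) / fact k else 0) sums cosh r" using cosh_converges[of r] by simp
  have q: "(r\<^sup>2) ^ (k div 2) = r ^ k / r" if "odd k" for k using that X(3) by (auto elim!: oddE simp flip: power_mult)
  have "(\<lambda>k. if even k then 0 else (r\<^sup>2) ^ (k div 2) / fact k) = (\<lambda>n. (if even n then 0 else r ^ n /\<^sub>R fact n) / r)"
    by (auto simp: q divide_inverse mult_ac)
  then show "(\<lambda>k. if even k then 0 else (r\<^sup>2) ^ (k div 2) / fact k) sums (sinh r / r)"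
    using sums_divide[OF sinh_converges[of r], of r] by simp
qed

lemma mat_exp_ell:
  assumes X: "trace X = 0" "- (r\<^sup>2) = - det X" "r \<noteq> 0" shows "mat_exp X = cos r *\<^sub>R mat 1 + (sin r / r) *\<^sub>R X"
proof (rule mat_exp_sums[OF X(1,2)])
  have p: "(- (r\<^sup>2)) ^ (k div 2) = (-1) ^ (k div 2) * r ^ k" if "even k" for k
    using that by (auto elim!: evenE simp: power_mult power_minus[of "r\<^sup>2"])
  have "(\<lambda>k. if even k then (- (r\<^sup>2)) ^ (k div 2) / fact k else 0) = (\<lambda>n. cos_coeff n *\<^sub>R r ^ n)"
    by (auto simp: p cos_coeff_def)
  then show "(\<lambda>k. if even k then (- (r\<^sup>2)) ^ (k div 2) / fact k else 0) sums cos r" using cos_converges[of r] by simp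
  have q: "(- (r\<^sup>2)) ^ (k div 2) = (-1) ^ ((k - Suc 0) div 2) * r ^ k / r" if "odd k" for k
    using that X(3) by (auto elim!: oddE simp: power_mult power_minus[of "r\<^sup>2"])
  have "(\<lambda>k. if even k then 0 else (- (r\<^sup>2)) ^ (k div 2) / fact k) = (\<lambda>n. (sin_coeff n *\<^sub>R r ^ n) / r)"
    by (auto simp: q sin_coeff_def)
  then show "(\<lambda>k. if even k then 0 else (- (r\<^sup>2)) ^ (k div 2) / fact k) sums (sin r / r)"
    using sums_divide[OF sin_converges[of r], of r] by simp
qed

lemma mat_exp_nil:
  assumes X: "trace X = 0" "det X = 0" shows "mat_exp X = mat 1 + X"
proof -
  have 1: "(\<lambda>k::nat. if even k then 0 ^ (k div 2) / fact k else 0 :: real) = (\<lambda>k. if k = 0 then 1 else 0)"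
    by (rule ext) (auto elim!: evenE)
  have 2: "(\<lambda>k::nat. if even k then 0 else 0 ^ (k div 2) / fact k :: real) = (\<lambda>k. if k = 1 then 1 else 0)"
    by (rule ext) (auto elim!: oddE)
  have "mat_exp X = 1 *\<^sub>R mat 1 + 1 *\<^sub>R X"
    by (rule mat_exp_sums[of X 0, unfolded 1 2])
      (use X sums_single[of 0 "\<lambda>_. 1 :: real"] sums_single[of 1 "\<lambda>_. 1 :: real"] in simp_all)
  then show ?thesis by simp
qed

lemma det_pencil: "trace (X :: real^2^2) = 0 \<Longrightarrow> det (a *\<^sub>R mat 1 + b *\<^sub>R X) = a\<^sup>2 + det X * b\<^sup>2"
proof -
  assume "trace X = 0"
  then have "X $ 2 $ 2 = - X $ 1 $ 1" by (simp add: trace_def sum_2)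
  then show ?thesis by (simp add: det_2 power2_eq_square algebra_simps)
qed

text \<open>The three types of one-parameter groups under one formula: continuous coefficients,
  determinant 1, and the value for nilpotent X.\<close>

lemma mat_exp_ray:
  assumes X: "trace X = 0"
  obtains A B :: "real \<Rightarrow> real" where "continuous_on UNIV A" "continuous_on UNIV B" "\<And>t. mat_exp (t *\<^sub>R X) = A t *\<^sub>R mat 1 + B t *\<^sub>R X"
    "\<And>t. (A t)\<^sup>2 + det X * (B t)\<^sup>2 = 1" "det X = 0 \<Longrightarrow> A 1 = 1 \<and> B 1 = 1"
proof -
  have X': "trace (t *\<^sub>R X) = 0" "det (t *\<^sub>R X) = t\<^sup>2 * det X" for t
    using X by (simp_all add: trace_def sum_2 det_2 power2_eq_square algebra_simps flip: distrib_left)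
  have zero: "mat_exp (0 *\<^sub>R X) = mat 1" using mat_exp_nil[OF X'(1)[of 0]] X'(2)[of 0] by simp
  consider "det X = 0" | "det X < 0" | "det X > 0" by linarith
  then show ?thesis
  proof cases
    case 1
    show ?thesis by (rule that[of "\<lambda>_. 1" "\<lambda>t. t"]) (use 1 mat_exp_nil[OF X'(1)] X'(2) in \<open>auto intro: continuous_intros\<close>)
  next
    case 2
    define r where "r = sqrt (- det X)"
    have r: "r > 0" "r\<^sup>2 = - det X" using 2 by (simp_all add: r_def)
    show ?thesis
    proof (rule that[of "\<lambda>t. cosh (t * r)" "\<lambda>t. sinh (t * r) / r"])
      fix t
      show "mat_exp (t *\<^sub>R X) = cosh (t * r) *\<^sub>R mat 1 + (sinh (t * r) / r) *\<^sub>R X"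
        using mat_exp_hyp[OF X'(1), of "t * r" t] r zero by (cases "t = 0") (auto simp: X'(2) power_mult_distrib)
      show "(cosh (t * r))\<^sup>2 + det X * (sinh (t * r) / r)\<^sup>2 = 1"
        using r cosh_square_eq[of "t * r"] 2 by (simp add: power_divide)
    qed (use r 2 in \<open>auto intro!: continuous_intros\<close>)
  next
    case 3
    define r where "r = sqrt (det X)"
    have r: "r > 0" "r\<^sup>2 = det X" using 3 by (simp_all add: r_def)
    show ?thesis
    proof (rule that[of "\<lambda>t. cos (t * r)" "\<lambda>t. sin (t * r) / r"])
      fix t
      show "mat_exp (t *\<^sub>R X) = cos (t * r) *\<^sub>R mat 1 + (sin (t * r) / r) *\<^sub>R X"
        using mat_exp_ell[OF X'(1), of "t * r" t] r zero by (cases "t = 0") (auto simp: X'(2) power_mult_distrib)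
      show "(cos (t * r))\<^sup>2 + det X * (sin (t * r) / r)\<^sup>2 = 1"
        using r 3 by (simp add: power_divide)
    qed (use r 3 in \<open>auto intro!: continuous_intros\<close>)
  qed
qed

lemma cover_exp_Lam:
  assumes X: "trace X = 0" obtains y where "cover_exp X = Lam y" "ppi y = psl (mat_exp X)"
proof -
  obtain A B where AB: "continuous_on UNIV A" "continuous_on UNIV B" "\<And>t. mat_exp (t *\<^sub>R X) = A t *\<^sub>R mat 1 + B t *\<^sub>R X"
    "\<And>t. (A t)\<^sup>2 + det X * (B t)\<^sup>2 = 1" using mat_exp_ray[OF X] by metis
  have "continuous_on {0..1} (\<lambda>t. A t *\<^sub>R mat 1 + B t *\<^sub>R X)"
    by (intro continuous_intros continuous_on_subset[OF AB(1)] continuous_on_subset[OF AB(2)]) auto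
  then have "continuous_map (top_of_set {0..1}) (top_of_set (carrier SL2)) (\<lambda>t. mat_exp (t *\<^sub>R X))"
    using AB(4) by (auto simp: AB(3) SL2_def det_pencil[OF X])
  from continuous_map_compose[OF this continuous_map_psl]
  have p: "pathin PSL2_top (\<lambda>t. psl (mat_exp (t *\<^sub>R X)))" by (simp add: pathin_def o_def)
  have "mat_exp (0 *\<^sub>R X) = mat 1" using mat_exp_nil[of "0 :: real^2^2"] by (simp add: trace_def det_2)
  then obtain c where c: "lifted (\<lambda>t. psl (mat_exp (t *\<^sub>R X))) c"
    using lifted_exists[OF p] by (auto simp: ppi_def cmat_0 simp flip: ppi_0)
  show ?thesis
  proof (rule that[of "c 1"])
    show "cover_exp X = Lam (c 1)" using path_class_lifted[OF c] by (simp add: cover_exp_def)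
    have "psl (mat_exp (1 *\<^sub>R X)) = ppi (c 1)" using c unfolding lifted_def by (metis atLeastAtMost_iff order_refl zero_le_one)
    then show "ppi (c 1) = psl (mat_exp X)" by simp
  qed
qed

lemma cover_z_Lam: "cover_z = Lam (cz 1)"
proof -
  let ?X = "vector [vector [0, pi], vector [- pi, 0]] :: real^2^2"
  have X: "trace ?X = 0" "det ?X = pi\<^sup>2" by (simp_all add: trace_def sum_2 det_2 power2_eq_square)
  have e: "mat_exp (t *\<^sub>R ?X) = cmat (Cov (t * pi) 0)" for t
  proof (cases "t = 0")
    case True
    then show ?thesis using mat_exp_nil[of "0 :: real^2^2"] by (simp add: trace_def det_2 cmat_0 flip: zero_cov_def)
  next
    case False
    have "mat_exp (t *\<^sub>R ?X) = cos (t * pi) *\<^sub>R mat 1 + (sin (t * pi) / (t * pi)) *\<^sub>R (t *\<^sub>R ?X)"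
      by (rule mat_exp_ell) (use False in \<open>simp_all add: trace_def sum_2 det_2 power2_eq_square\<close>)
    then show ?thesis using False by (simp add: mat2_eq_iff al_def)
  qed
  have "lifted (\<lambda>t. psl (mat_exp (t *\<^sub>R ?X))) (\<lambda>t. Cov (t * pi) 0)"
    by (auto simp: lifted_def e ppi_def zero_cov_def intro!: continuous_intros)
  from path_class_lifted[OF this] show ?thesis
    by (simp add: cover_z_def cover_exp_def cz_def)
qed

lemma cover_exp_para:
  assumes e: "e = 1 \<or> e = -1"
  shows "trace (cmat (para e c) - mat 1) = 0" "det (cmat (para e c) - mat 1) = 0" "cover_exp (cmat (para e c) - mat 1) = Lam (para e c)"
proof -
  let ?X = "cmat (para e c) - mat 1"
  have ae: "\<bar>e\<bar> = 1" using e by auto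
  show t: "trace ?X = 0" using ae by (simp add: trace_def sum_2)
  have "(cmod c)\<^sup>2 = (Re c)\<^sup>2 + (Im c)\<^sup>2" "e\<^sup>2 = 1" using e by (auto simp: cmod_power2)
  then have "(e * cmod c)\<^sup>2 = (Re c)\<^sup>2 + (Im c)\<^sup>2" by (simp add: power_mult_distrib)
  then show d: "det ?X = 0" using ae by (simp add: det_2 power2_eq_square algebra_simps)
  have "mat_exp (t *\<^sub>R ?X) = cmat (para e (of_real t * c))" if "t \<in> {0..1}" for t
  proof -
    have "trace (t *\<^sub>R ?X) = t * trace ?X" "det (t *\<^sub>R ?X) = t\<^sup>2 * det ?X"
      by (simp_all add: trace_def sum_2 det_2 power2_eq_square algebra_simps del: al_para)
    then have "mat_exp (t *\<^sub>R ?X) = mat 1 + t *\<^sub>R ?X" using t d by (intro mat_exp_nil) auto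
    then show ?thesis using that ae by (simp add: mat2_eq_iff norm_mult algebra_simps)
  qed
  then have "lifted (\<lambda>t. psl (mat_exp (t *\<^sub>R ?X))) (\<lambda>t. para e (of_real t * c))"
    by (auto simp: lifted_def ppi_def intro!: continuous_intros)
  from path_class_lifted[OF this] show "cover_exp ?X = Lam (para e c)" by (simp add: cover_exp_def)
qed

lemma cmat_para_trace: "\<bar>e\<bar> = 1 \<Longrightarrow> trace (cmat (para e c)) = 2"
  by (simp add: trace_def sum_2)

text \<open>For uniqueness, comparing traces shows that the coefficient A of the identity in exp X
  is 1 or -1, so \<open>det X * B\<^sup>2 = 0\<close>. Since B is not 0, X is nilpotent and is
  recovered from exp X = 1 + X.\<close>

lemma parabolic_lift_para:
  assumes e: "e = 1 \<or> e = -1" and c: "c \<noteq> 0"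
  shows "parabolic_lift (ppi (para e c)) = Lam (para e c)"
  unfolding parabolic_lift_def
proof (rule the_equality)
  show "Lam (para e c) \<in> cover_exp ` sl2_algebra \<and> cover_proj (Lam (para e c)) = ppi (para e c)"
    using cover_exp_para[OF e, of c] by (auto simp: sl2_algebra_def intro!: image_eqI[of _ _ "cmat (para e c) - mat 1"])
  fix u assume "u \<in> cover_exp ` sl2_algebra \<and> cover_proj u = ppi (para e c)"
  then obtain X where X: "trace X = 0" "u = cover_exp X" and u: "cover_proj u = ppi (para e c)" by (auto simp: sl2_algebra_def)
  obtain y where y: "cover_exp X = Lam y" "ppi y = psl (mat_exp X)" using cover_exp_Lam[OF X(1)] .
  then have "psl (mat_exp X) = psl (cmat (para e c))" using u X(2) by (simp add: ppi_def)
  then obtain s :: real where s: "s = 1 \<or> s = -1" "mat_exp X = s *\<^sub>R cmat (para e c)"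
    unfolding psl_mat by (metis scaleR_one scaleR_minus1_left)
  have ae: "\<bar>e\<bar> = 1" using e by auto
  obtain A B where AB: "mat_exp X = A *\<^sub>R mat 1 + B *\<^sub>R X" "A\<^sup>2 + det X * B\<^sup>2 = 1" "det X = 0 \<Longrightarrow> A = 1 \<and> B = 1"
    using mat_exp_ray[OF X(1)] by (metis scaleR_one)
  have "X $ 2 $ 2 = - X $ 1 $ 1" using X(1) by (simp add: trace_def sum_2)
  then have "A + B * X $ 1 $ 1 = s * (1 + Re c)" "A - B * X $ 1 $ 1 = s * (1 - Re c)"
    using s(2) AB(1) ae by (simp_all add: mat2_eq_iff)
  then have A: "A = s" by (simp add: distrib_left right_diff_distrib)
  then have "det X * B\<^sup>2 = 0" using AB(2) s(1) by auto
  moreover have "B \<noteq> 0"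
  proof
    assume "B = 0"
    then have "s *\<^sub>R cmat (para e c) = s *\<^sub>R mat 1" using AB(1) s(2) A by simp
    then have "cmat (para e c) = cmat 0" using s(1) by (auto simp: cmat_0)
    then have "mbe (cmat (para e c)) = mbe (cmat 0)" by simp
    then show False using c by simp
  qed
  ultimately have "A = 1" "B = 1" using AB(3) by auto
  then have "X = cmat (para e c) - mat 1" using AB(1) s(2) A by simp
  then show "u = Lam (para e c)" using cover_exp_para(3)[OF e] X(2) by simp
qed

lemma parabolic_iff: "parabolic P \<longleftrightarrow> (\<exists>e c. (e = 1 \<or> e = -1) \<and> c \<noteq> 0 \<and> P = ppi (para e c))"
proof
  assume P: "parabolic P"
  then obtain y where y: "P = ppi y" by (auto simp: parabolic_def carrier_PSL2)
  have tr: "trace (cmat y) = 2 * Re (al y)" "trace (- cmat y) = - 2 * Re (al y)" by (simp_all add: trace_def sum_2)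
  have r: "\<bar>Re (al y)\<bar> = 1"
    using P tr by (auto simp: parabolic_def y ppi_def psl_eq abs_mult)
  then obtain m where m: "Re (al (cz m + y)) = \<bar>Re (al y)\<bar>" "\<bar>th (cz m + y)\<bar> < pi / 2"
    using shift_Re_pos[of y] by (metis abs_zero zero_neq_one)
  define x where "x = cz m + y"
  have x: "Re (al x) = 1" "\<bar>th x\<bar> < pi / 2" "P = ppi x" using m r by (simp_all add: x_def y ppi_cz del: cz_plus_simps)
  have "x \<noteq> 0" using P x(3) by (auto simp: parabolic_def ppi_0)
  have "th x \<noteq> 0"
  proof
    assume "th x = 0"
    then have "cmod (al x) = 1" using x(1) by (simp add: Re_al)
    then have "be x = 0" using cmod_al_sq[of x] by simp
    then show False using \<open>x \<noteq> 0\<close> \<open>th x = 0\<close> cov_eqI[of x 0] by simp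
  qed
  then have "\<exists>e. (e = 1 \<or> e = -1) \<and> x = para e (be x)"
    using para_char_pos[of x] para_char_neg[of x] x by (cases "th x > 0") (auto simp: abs_less_iff)
  then obtain e where e: "e = 1 \<or> e = -1" "x = para e (be x)" by blast
  then have "be x \<noteq> 0" using \<open>x \<noteq> 0\<close> by auto
  then show "\<exists>e c. (e = 1 \<or> e = -1) \<and> c \<noteq> 0 \<and> P = ppi (para e c)" using e x(3) by metis
next
  assume "\<exists>e c. (e = 1 \<or> e = -1) \<and> c \<noteq> 0 \<and> P = ppi (para e c)"
  then obtain e c where e: "e = 1 \<or> e = -1" "c \<noteq> 0" "P = ppi (para e c)" by blast
  have "ppi (para e c) \<noteq> ppi 0"
  proof
    assume "ppi (para e c) = ppi 0"
    then obtain n where "para e c = cz n" by (auto simp: ppi_eq_iff)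
    then have "be (para e c) = 0" by simp
    then show False using e by simp
  qed
  moreover have "\<bar>trace (cmat (para e c))\<bar> = 2" using e cmat_para_trace[of e] by auto
  moreover have "cmat (para e c) \<in> ppi (para e c)" by (simp add: ppi_def psl_eq)
  ultimately show "parabolic P" unfolding parabolic_def e(3) ppi_0[symmetric] using ppi_closed by blast
qed

lemma ppi_para_inj:
  assumes "e = 1 \<or> e = -1" "e' = 1 \<or> e' = -1" "ppi (para e c) = ppi (para e' c')"
  shows "para e c = para e' c'"
proof -
  obtain n where n: "para e c = cz n + para e' c'" using assms(3) ppi_eq_iff by blast
  have ae: "\<bar>e\<bar> = 1" "\<bar>e'\<bar> = 1" using assms by auto
  have "sg n = 1" using arg_cong[OF n, of "\<lambda>y. Re (al y)"] ae by simp
  then have "even n" by (auto simp: sg_def split: if_splits)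
  have "\<bar>th (para e c)\<bar> < pi / 2" "\<bar>th (para e' c')\<bar> < pi / 2"
    using abs_arctan_less[of "cmod c"] abs_arctan_less[of "cmod c'"] ae by (simp_all add: th_para abs_mult)
  then have "\<bar>of_int n * pi\<bar> < pi" using arg_cong[OF n, of th] unfolding cz_plus_simps by linarith
  then have "\<bar>of_int n :: real\<bar> * pi < 1 * pi" by (simp add: abs_mult)
  then have "\<bar>of_int n :: real\<bar> < 1" by (rule mult_right_less_imp_less) simp
  then have "n = 0" by linarith
  then show ?thesis using n by (simp add: cz_0)
qed

lemma para_sign_unique: "e = 1 \<or> e = -1 \<Longrightarrow> e' = 1 \<or> e' = -1 \<Longrightarrow> c \<noteq> 0 \<Longrightarrow> para e c = para e' c' \<Longrightarrow> e = e'"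
proof -
  assume a: "e = 1 \<or> e = -1" "e' = 1 \<or> e' = -1" "c \<noteq> 0" "para e c = para e' c'"
  have "c' = c" using arg_cong[OF a(4), of be] by simp
  then show ?thesis using a th_para_bounds[OF a(3)] by auto
qed

text \<open>Non-trivial parabolics of one sign form a single class by
  \<open>conjugate_between\<close>, and by \<open>cjg_para\<close> conjugation keeps the
  sign.\<close>

lemma sign_parabolic:
  assumes e: "e = 1 \<or> e = -1" and c: "c \<noteq> 0"
  shows "positive_parabolic (ppi (para e c)) \<longleftrightarrow> e = 1" "negative_parabolic (ppi (para e c)) \<longleftrightarrow> e = -1"
proof -
  have par: "parabolic (ppi (para e c))" using assms parabolic_iff by blast
  have M: "vector [vector [1, 1], vector [0, 1]] = cmat (tri 1 1)" "vector [vector [1, - 1], vector [0, 1]] = cmat (tri 1 (- 1))"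
    by (simp_all add: mat2_eq_iff)
  define u where "u = be (tri 1 1)"
  have u: "tri 1 1 = para 1 u" "u \<noteq> 0"
    using tri_1_para[of 1] unfolding u_def by (simp_all del: be_tri) (simp add: complex_eq_iff)
  have mt: "tri 1 (-1) = - tri 1 1" using uminus_tri[of 1 1] by simp
  have cj: "psl_conjugate (ppi (para e c)) (ppi y) \<longleftrightarrow> (\<exists>g. ppi (para e c) = ppi (cjg g y))" for y
    by (auto simp: psl_conjugate_def carrier_PSL2 cjg_def)
  have pos: "\<exists>g. cjg g (para 1 a) = para 1 b" if "a \<noteq> 0" "b \<noteq> 0" for a b
    using that th_para_bounds(1)[of a] th_para_bounds(1)[of b] pi_gt_zero
    by (intro conjugate_between) (auto simp: Up_def Dn_def)
  have one: "(\<exists>g. ppi (para e c) = ppi (cjg g (para s v))) \<longleftrightarrow> e = s" if s: "s = 1 \<or> s = -1" "v \<noteq> 0" for s v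
  proof
    assume "\<exists>g. ppi (para e c) = ppi (cjg g (para s v))"
    then obtain g where g: "ppi (para e c) = ppi (cjg g (para s v))" by blast
    then have "ppi (para e c) = ppi (para s (be (cjg g (para s v))))" unfolding cjg_para[OF s, of g, symmetric] .
    then show "e = s" using ppi_para_inj para_sign_unique e s c by metis
  next
    assume es: "e = s"
    show "\<exists>g. ppi (para e c) = ppi (cjg g (para s v))"
    proof (cases "e = 1")
      case True then show ?thesis using pos[OF s(2) c] es by metis
    next
      case False
      then have m: "e = -1" "s = -1" using e es by auto
      obtain g where "cjg g (para 1 (- v)) = para 1 (- c)" using pos[of "- v" "- c"] s(2) c by auto
      then have "cjg g (- para 1 (- v)) = - para 1 (- c)" by (simp add: cjg_uminus)
      then show ?thesis unfolding m using uminus_para[of 1] by (metis minus_minus)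
    qed
  qed
  show "positive_parabolic (ppi (para e c)) \<longleftrightarrow> e = 1"
    using one[of 1 u] u(2) cj[of "tri 1 1"] par by (simp add: positive_parabolic_def M u(1) flip: ppi_def)
  have "tri 1 (-1) = para (-1) (- u)" using uminus_para[of 1 u] by (simp add: mt u(1))
  then show "negative_parabolic (ppi (para e c)) \<longleftrightarrow> e = -1"
    using one[of "-1" "- u"] u(2) cj[of "tri 1 (-1)"] par by (simp add: negative_parabolic_def M(2) flip: ppi_def)
qed

section \<open>Representations of the surface group\<close>

definition evalw :: "('x \<Rightarrow> cov) \<Rightarrow> 'x word \<Rightarrow> cov" where
  "evalw v u = sum_list (map (\<lambda>(x, b). if b then v x else - v x) u)"

lemma evalw_simps [simp]: "evalw v [] = 0" "evalw v ((x, b) # u) = (if b then v x else - v x) + evalw v u"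
  by (simp_all add: evalw_def)

lemma evalw_append: "evalw v (u @ w) = evalw v u + evalw v w"
  by (simp add: evalw_def)

lemma evalw_cong: "u \<in> words X \<Longrightarrow> (\<And>x. x \<in> X \<Longrightarrow> v x = v' x) \<Longrightarrow> evalw v u = evalw v' u"
  by (induction u) (auto simp: words_def)

lemma evalw_ppi_cong: "u \<in> words X \<Longrightarrow> (\<And>x. x \<in> X \<Longrightarrow> ppi (v x) = ppi (v' x)) \<Longrightarrow> ppi (evalw v u) = ppi (evalw v' u)"
  by (induction u) (auto simp: words_def simp flip: ppi_mult ppi_inv)

lemma evalw_cjg: "evalw (\<lambda>x. cjg w (v x)) u = cjg w (evalw v u)"
  by (induction u) (auto simp: cjg_plus cjg_uminus)

lemma words_append [simp]: "u @ v \<in> words X \<longleftrightarrow> u \<in> words X \<and> v \<in> words X"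
  by (auto simp: words_def)

lemma words_Nil [simp]: "[] \<in> words X" and words_Cons [simp]: "(x, b) # u \<in> words X \<longleftrightarrow> x \<in> X \<and> u \<in> words X"
  by (auto simp: words_def)

lemma pres_eq_words: "pres_eq X R u v \<Longrightarrow> R \<subseteq> words X \<Longrightarrow> u \<in> words X \<and> v \<in> words X"
  by (induction rule: pres_eq.induct) auto

lemma pres_eq_append:
  assumes "pres_eq X R u v" "w \<in> words X" shows "pres_eq X R (w @ u) (w @ v)" "pres_eq X R (u @ w) (v @ w)"
proof -
  show "pres_eq X R (w @ u) (w @ v)" using assms
  proof (induction rule: pres_eq.induct)
    case (cancel u v x b)
    then show ?case using pres_eq.cancel[of "w @ u" X v x R b] by simp
  next
    case (relator u v r)
    then show ?case using pres_eq.relator[of "w @ u" X v r R] by simp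
  qed (auto intro: pres_eq.intros)
  show "pres_eq X R (u @ w) (v @ w)" using assms
  proof (induction rule: pres_eq.induct)
    case (cancel u v x b)
    then show ?case using pres_eq.cancel[of u X "v @ w" x R b] by simp
  next
    case (relator u v r)
    then show ?case using pres_eq.relator[of u X "v @ w" r R] by simp
  qed (auto intro: pres_eq.intros)
qed

lemma pres_class_eq_iff: "u \<in> words X \<Longrightarrow> v \<in> words X \<Longrightarrow> pres_class X R u = pres_class X R v \<longleftrightarrow> pres_eq X R u v"
  by (auto simp: pres_class_def intro: pres_eq.intros)

lemma pres_eq_evalw:
  assumes "pres_eq X R u w" "\<And>r. r \<in> R \<Longrightarrow> ppi (evalw v r) = \<one>\<^bsub>PSL2\<^esub>"
  shows "ppi (evalw v u) = ppi (evalw v w)"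
  using assms
proof (induction rule: pres_eq.induct)
  case (relator u w r)
  then show ?case by (simp add: evalw_append flip: ppi_mult)
qed (auto simp: evalw_append)

lemma mult_presented_group:
  assumes "R \<subseteq> words X" "u \<in> words X" "v \<in> words X"
  shows "pres_class X R u \<otimes>\<^bsub>presented_group X R\<^esub> pres_class X R v = pres_class X R (u @ v)"
proof -
  have "pres_eq X R (u @ v) w" if "pres_eq X R u u'" "pres_eq X R v v'" "pres_eq X R (u' @ v') w" for u' v' w
    using that pres_eq_append[of X R] pres_eq_words[OF _ assms(1)] assms by (meson pres_eq.trans)
  then show ?thesis using assms
    by (auto simp: presented_group_def pres_class_def intro: pres_eq.refl)
qed

text \<open>A representation is encoded by lifts of the images of the generators; the value on a
  class is read off from any representative once the relators are sent to central elements.\<close>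

definition hom_of :: "'x set \<Rightarrow> 'x word set \<Rightarrow> ('x \<Rightarrow> cov) \<Rightarrow> 'x word set \<Rightarrow> (real^2^2) set" where
  "hom_of X R v = (\<lambda>P\<in>carrier (presented_group X R). ppi (evalw v (SOME u. u \<in> words X \<and> P = pres_class X R u)))"

lemma carrier_presented_group: "carrier (presented_group X R) = pres_class X R ` words X"
  by (simp add: presented_group_def)

lemma hom_of_class:
  assumes "\<And>r. r \<in> R \<Longrightarrow> ppi (evalw v r) = \<one>\<^bsub>PSL2\<^esub>" "u \<in> words X"
  shows "hom_of X R v (pres_class X R u) = ppi (evalw v u)"
proof -
  let ?w = "SOME w. w \<in> words X \<and> pres_class X R u = pres_class X R w"
  have "?w \<in> words X \<and> pres_class X R u = pres_class X R ?w"
    by (rule someI[of "\<lambda>w. w \<in> words X \<and> pres_class X R u = pres_class X R w" u]) (use assms in simp)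
  then have "pres_eq X R u ?w" using pres_class_eq_iff assms(2) by blast
  then have "ppi (evalw v u) = ppi (evalw v ?w)" by (rule pres_eq_evalw) (rule assms(1))
  then show ?thesis using assms(2) by (simp add: hom_of_def carrier_presented_group)
qed

lemma hom_of_hom:
  assumes "\<And>r. r \<in> R \<Longrightarrow> ppi (evalw v r) = \<one>\<^bsub>PSL2\<^esub>" "R \<subseteq> words X"
  shows "hom_of X R v \<in> hom (presented_group X R) PSL2 \<inter> extensional (carrier (presented_group X R))"
proof
  show "hom_of X R v \<in> extensional (carrier (presented_group X R))" by (simp add: hom_of_def)
  show "hom_of X R v \<in> hom (presented_group X R) PSL2"
    by (rule homI) (auto simp: carrier_presented_group hom_of_class[OF assms(1)] mult_presented_group[OF assms(2)] evalw_append)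
qed

lemma hom_unique:
  assumes \<phi>: "\<phi> \<in> hom (presented_group X R) PSL2 \<inter> extensional (carrier (presented_group X R))" and R: "R \<subseteq> words X"
    and v: "\<And>x. x \<in> X \<Longrightarrow> \<phi> (pres_class X R [(x, True)]) = ppi (v x)"
  shows "r \<in> R \<Longrightarrow> ppi (evalw v r) = \<one>\<^bsub>PSL2\<^esub>" "\<phi> = hom_of X R v"
proof -
  let ?c = "pres_class X R"
  have mul: "\<phi> (?c (u @ w)) = \<phi> (?c u) \<otimes>\<^bsub>PSL2\<^esub> \<phi> (?c w)" if "u \<in> words X" "w \<in> words X" for u w
    using \<phi> that by (simp add: hom_mult carrier_presented_group flip: mult_presented_group[OF R])
  have car: "\<phi> (?c u) \<in> carrier PSL2" if "u \<in> words X" for u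
    using \<phi> that by (auto simp: hom_def carrier_presented_group)
  have one: "\<phi> (?c []) = \<one>\<^bsub>PSL2\<^esub>"
    using mul[of "[]" "[]"] car[of "[]"] by (simp add: PSL2.l_cancel_one')
  have gen: "\<phi> (?c [(x, b)]) = ppi (if b then v x else - v x)" if x: "x \<in> X" for x b
  proof (cases b)
    case False
    have "?c ([(x, False)] @ [(x, True)]) = ?c []"
      using x pres_eq.cancel[of "[]" X "[]" x R False] by (subst pres_class_eq_iff) auto
    then have "\<phi> (?c [(x, False)]) \<otimes>\<^bsub>PSL2\<^esub> ppi (v x) = \<one>\<^bsub>PSL2\<^esub>"
      using mul[of "[(x, False)]" "[(x, True)]"] x v one by simp
    then have "inv\<^bsub>PSL2\<^esub> (ppi (v x)) = \<phi> (?c [(x, False)])"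
      using car[of "[(x, False)]"] x by (intro PSL2.inv_equality) auto
    then show ?thesis using False by simp
  qed (use v x in simp)
  have ev: "\<phi> (?c u) = ppi (evalw v u)" if "u \<in> words X" for u using that
  proof (induction u)
    case (Cons a u)
    obtain x b where "a = (x, b)" by (cases a)
    then show ?case using Cons mul[of "[a]" u] gen[of x b] by simp
  qed (simp add: one ppi_0)
  have rel: "ppi (evalw v r) = \<one>\<^bsub>PSL2\<^esub>" if r: "r \<in> R" for r
  proof -
    have w: "r \<in> words X" using r R by blast
    have "?c r = ?c []" using pres_eq.relator[of "[]" X "[]" r R] r w by (subst pres_class_eq_iff) auto
    then show ?thesis using ev[OF w] one by simp
  qed
  then show "r \<in> R \<Longrightarrow> ppi (evalw v r) = \<one>\<^bsub>PSL2\<^esub>" .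
  show "\<phi> = hom_of X R v"
    by (rule extensionalityI[of _ "carrier (presented_group X R)"])
      (use \<phi> hom_of_hom[OF rel R] ev hom_of_class[OF rel] in \<open>auto simp: carrier_presented_group\<close>)
qed

lemma hom_of_cong:
  assumes "\<And>x. x \<in> X \<Longrightarrow> ppi (v x) = ppi (v' x)" shows "hom_of X R v = hom_of X R v'"
proof -
  have "ppi (evalw v (SOME u. u \<in> words X \<and> P = pres_class X R u)) = ppi (evalw v' (SOME u. u \<in> words X \<and> P = pres_class X R u))"
    if "P \<in> carrier (presented_group X R)" for P
  proof -
    have "(SOME u. u \<in> words X \<and> P = pres_class X R u) \<in> words X \<and> P = pres_class X R (SOME u. u \<in> words X \<and> P = pres_class X R u)"
      by (rule someI_ex) (use that in \<open>auto simp: carrier_presented_group\<close>)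
    then show ?thesis using assms evalw_ppi_cong by blast
  qed
  then show ?thesis unfolding hom_of_def by (rule restrict_ext)
qed

subsection \<open>The surface relator\<close>

lemma relator_words: "surface_relator g p \<in> words (surface_gens g p)"
  by (auto simp: surface_relator_def words_def surface_gens_def)

definition vv :: "(nat \<Rightarrow> real) \<Rightarrow> (nat \<Rightarrow> cov \<times> cov) \<Rightarrow> (nat \<Rightarrow> complex) \<Rightarrow> surface_gen \<Rightarrow> cov" where
  "vv s u c x = (case x of GenA j \<Rightarrow> fst (u j) | GenB j \<Rightarrow> snd (u j) | GenC i \<Rightarrow> para (s i) (c i))"

lemma evalw_relator: "evalw v (surface_relator g p) =
    cp (\<lambda>j. (v (GenA j), v (GenB j))) 0 g + sum_list (map (\<lambda>i. v (GenC i)) [0..<p])"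
proof -
  have "evalw v (concat (map (\<lambda>j. [(GenA j, True), (GenB j, True), (GenA j, False), (GenB j, False)]) [0..<g])) =
    cp (\<lambda>j. (v (GenA j), v (GenB j))) 0 g"
    by (induction g) (simp_all add: evalw_append cmt_def, simp only: diff_conv_add_uminus add.assoc)
  then show ?thesis by (simp add: surface_relator_def evalw_append) (simp add: evalw_def o_def)
qed

lemma sum_list_pp: "sum_list (map (\<lambda>i. para (s i) (c i)) [0..<p]) = pp s c 0 p"
  by (induction p) simp_all

abbreviation relators :: "nat \<Rightarrow> nat \<Rightarrow> surface_gen word set" where "relators g p \<equiv> {surface_relator g p}"

definition rep :: "nat \<Rightarrow> nat \<Rightarrow> (surface_gen \<Rightarrow> cov) \<Rightarrow> surface_rep" where
  "rep g p v = hom_of (surface_gens g p) (relators g p) v"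

lemma rep_surface_elem:
  assumes "evalw v (surface_relator g p) = cz n" "x \<in> surface_gens g p"
  shows "rep g p v (surface_elem g p x) = ppi (v x)"
  using hom_of_class[of "relators g p" v "[(x, True)]" "surface_gens g p"] assms ppi_cz[of n 0]
  by (simp add: rep_def surface_elem_def ppi_0)

lemma rep_unique:
  assumes "\<phi> \<in> hom (surface_group g p) PSL2 \<inter> extensional (carrier (surface_group g p))"
    and "\<And>x. x \<in> surface_gens g p \<Longrightarrow> \<phi> (surface_elem g p x) = ppi (v x)"
  shows "\<phi> = rep g p v" "\<exists>n. evalw v (surface_relator g p) = cz n"
proof -
  note u = hom_unique[of \<phi> "surface_gens g p" "relators g p" v]
  show "\<phi> = rep g p v" unfolding rep_def
    by (rule u(2)) (use assms relator_words in \<open>auto simp: surface_group_def surface_elem_def\<close>)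
  have "ppi (evalw v (surface_relator g p)) = \<one>\<^bsub>PSL2\<^esub>"
    by (rule u(1)) (use assms relator_words in \<open>auto simp: surface_group_def surface_elem_def\<close>)
  then show "\<exists>n. evalw v (surface_relator g p) = cz n" by (auto simp: ppi_eq_iff simp flip: ppi_0)
qed

lemma rep_hom:
  assumes "evalw v (surface_relator g p) = cz n"
  shows "rep g p v \<in> hom (surface_group g p) PSL2 \<inter> extensional (carrier (surface_group g p))"
  unfolding rep_def surface_group_def
  by (rule hom_of_hom) (use assms relator_words ppi_cz[of n 0] in \<open>auto simp: ppi_0\<close>)

subsection \<open>The representation space\<close>

lemma surface_elem_closed: "x \<in> surface_gens g p \<Longrightarrow> surface_elem g p x \<in> carrier (surface_group g p)"
  by (auto simp: surface_elem_def surface_group_def carrier_presented_group)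

lemma GenC_gens [simp]: "GenC i \<in> surface_gens g p \<longleftrightarrow> i < p" "GenA j \<in> surface_gens g p \<longleftrightarrow> j < g" "GenB j \<in> surface_gens g p \<longleftrightarrow> j < g"
  by (auto simp: surface_gens_def)

lemma type_preserving_closed:
  "\<phi> \<in> type_preserving g p \<Longrightarrow> x \<in> carrier (surface_group g p) \<Longrightarrow> \<phi> x \<in> carrier PSL2"
  by (auto simp: type_preserving_def hom_def)

lemma topspace_rep_space: "topspace (rep_space g p) = type_preserving g p"
proof -
  let ?G = "carrier (surface_group g p)"
  have "\<phi> \<in> topspace (compact_open_topology (discrete_topology ?G) PSL2_top)" if "\<phi> \<in> type_preserving g p" for \<phi>
  proof -
    \<comment> \<open>The empty compact set yields a subbasic open set that contains every
      continuous map.\<close>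
    let ?B = "{f \<in> extensional ?G. continuous_map (discrete_topology ?G) PSL2_top f \<and> f ` {} \<subseteq> topspace PSL2_top}"
    have "\<phi> \<in> ?B" using that by (auto simp: type_preserving_def hom_def)
    moreover have "openin (compact_open_topology (discrete_topology ?G) PSL2_top) ?B"
      unfolding compact_open_topology_def
      by (rule topology_generated_by_Basis, rule CollectI, rule exI[of _ "{}"], rule exI[of _ "topspace PSL2_top"]) (use openin_topspace[of PSL2_top] in simp)
    ultimately show ?thesis by (meson openin_subset subsetD)
  qed
  then show ?thesis by (auto simp: rep_space_def)
qed

lemma continuous_map_eval:
  assumes "x \<in> carrier (surface_group g p)" shows "continuous_map (rep_space g p) PSL2_top (\<lambda>\<phi>. \<phi> x)"
  unfolding continuous_map_def
proof (intro conjI allI impI)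
  let ?G = "carrier (surface_group g p)"
  show "(\<lambda>\<phi>. \<phi> x) \<in> topspace (rep_space g p) \<rightarrow> topspace PSL2_top"
    using assms by (auto simp: topspace_rep_space type_preserving_def hom_def)
  fix U assume U: "openin PSL2_top U"
  have "openin (compact_open_topology (discrete_topology ?G) PSL2_top)
     {f \<in> extensional ?G. continuous_map (discrete_topology ?G) PSL2_top f \<and> f ` {x} \<subseteq> U}"
    unfolding compact_open_topology_def
    by (rule topology_generated_by_Basis) (use U assms in \<open>auto intro!: exI[of _ "{x}"] exI[of _ U]\<close>)
  moreover have "{\<phi> \<in> topspace (rep_space g p). \<phi> x \<in> U} =
     {f \<in> extensional ?G. continuous_map (discrete_topology ?G) PSL2_top f \<and> f ` {x} \<subseteq> U} \<inter> type_preserving g p"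
    unfolding topspace_rep_space by (auto simp: type_preserving_def hom_def)
  ultimately show "openin (rep_space g p) {\<phi> \<in> topspace (rep_space g p). \<phi> x \<in> U}"
    unfolding rep_space_def by (auto simp: openin_subtopology)
qed

text \<open>Compact subsets of a discrete space are finite, so the compact-open topology is that of
  pointwise convergence.\<close>

lemma continuous_map_into_rep_space:
  assumes "\<And>x. x \<in> carrier (surface_group g p) \<Longrightarrow> continuous_map X PSL2_top (\<lambda>z. F z x)"
    and F: "\<And>z. z \<in> topspace X \<Longrightarrow> F z \<in> type_preserving g p"
  shows "continuous_map X (rep_space g p) F"
  unfolding rep_space_def
proof (rule continuous_map_into_subtopology)
  let ?G = "carrier (surface_group g p)"
  show "continuous_map X (compact_open_topology (discrete_topology ?G) PSL2_top) F"
    unfolding compact_open_topology_def topspace_discrete_topology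
  proof (rule continuous_on_generated_topo)
    fix V assume "V \<in> {{f \<in> extensional ?G. continuous_map (discrete_topology ?G) PSL2_top f \<and> f ` K \<subseteq> U} |K U.
        compactin (discrete_topology ?G) K \<and> openin PSL2_top U}"
    then obtain K U where V: "V = {f \<in> extensional ?G. continuous_map (discrete_topology ?G) PSL2_top f \<and> f ` K \<subseteq> U}"
      and K: "finite K" "K \<subseteq> ?G" and U: "openin PSL2_top U" by (auto simp: compactin_discrete_topology)
    have "F z \<in> extensional ?G \<and> F z \<in> ?G \<rightarrow> carrier PSL2" if "z \<in> topspace X" for z
      using F[OF that] type_preserving_closed by (auto simp: type_preserving_def)
    then have "F -` V \<inter> topspace X = topspace X \<inter> (\<Inter>x\<in>K. {z \<in> topspace X. F z x \<in> U})"
      unfolding V by auto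
    moreover have "openin X {z \<in> topspace X. F z x \<in> U}" if "x \<in> K" for x
      using assms(1)[of x] that K U by (auto simp: continuous_map_def)
    ultimately show "openin X (F -` V \<inter> topspace X)"
      using K(1) by (cases "K = {}") (auto intro!: openin_Int openin_INT)
  next
    show "F ` topspace X \<subseteq> \<Union> {{f \<in> extensional ?G. continuous_map (discrete_topology ?G) PSL2_top f \<and> f ` K \<subseteq> U} |K U.
        compactin (discrete_topology ?G) K \<and> openin PSL2_top U}"
    proof -
      have "type_preserving g p \<subseteq> topspace (compact_open_topology (discrete_topology ?G) PSL2_top)"
        using topspace_rep_space[of g p] unfolding rep_space_def topspace_subtopology by blast
      then show ?thesis
        using F unfolding compact_open_topology_def topspace_discrete_topology topology_generated_by_topspace by blast
    qed
  qed
qed (use F in auto)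

section \<open>Level sets of Euler class and sign\<close>

definition Phi :: "nat \<Rightarrow> nat \<Rightarrow> (nat \<Rightarrow> real) \<Rightarrow> (nat \<Rightarrow> cov \<times> cov) \<times> (nat \<Rightarrow> complex) \<Rightarrow> surface_rep" where
  "Phi g p s z = rep g p (vv s (fst z) (snd z))"

definition Lev :: "nat \<Rightarrow> nat \<Rightarrow> (nat \<Rightarrow> real) \<Rightarrow> int \<Rightarrow> surface_rep set" where
  "Lev g p s n = Phi g p s ` Om g p s n"

lemma evalw_vv: "evalw (vv s u c) (surface_relator g p) = cp u 0 g + pp s c 0 p"
  by (simp add: evalw_relator vv_def sum_list_pp)

lemma rep_in_Lev:
  assumes s: "signs s p" and v: "evalw v (surface_relator g p) = cz n" "\<And>i. i < p \<Longrightarrow> v (GenC i) = para (s i) (be (v (GenC i))) \<and> be (v (GenC i)) \<noteq> 0"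
  shows "rep g p v \<in> Lev g p s n"
proof -
  \<comment> \<open>Membership in \<open>Om\<close> asks for non-zero entries at all indices, hence
    the value 1 from p on.\<close>
  define u c where "u j = (v (GenA j), v (GenB j))" and "c i = (if i < p then be (v (GenC i)) else 1)" for i j
  let ?w = "vv s u c"
  have eq: "?w x = v x" if "x \<in> surface_gens g p" for x
    using that v(2) by (auto simp: surface_gens_def vv_def u_def c_def)
  have "evalw ?w (surface_relator g p) = cz n"
    using evalw_cong[OF relator_words eq] v(1) by simp
  then have "cp u 0 g + pp s c 0 p = cz n" by (simp only: evalw_vv)
  then have "(u, c) \<in> Om g p s n" using v(2) by (simp add: Om_def) (simp add: c_def)
  moreover have "rep g p v = Phi g p s (u, c)"
    unfolding Phi_def rep_def fst_conv snd_conv by (rule hom_of_cong) (simp add: eq)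
  ultimately show ?thesis by (auto simp: Lev_def)
qed

lemma Lev_rep:
  assumes "\<phi> \<in> Lev g p s n"
  obtains u c where "(u, c) \<in> Om g p s n" "\<phi> = rep g p (vv s u c)"
    "evalw (vv s u c) (surface_relator g p) = cz n"
    "\<And>x. x \<in> surface_gens g p \<Longrightarrow> \<phi> (surface_elem g p x) = ppi (vv s u c x)"
proof -
  obtain u c where z: "(u, c) \<in> Om g p s n" "\<phi> = rep g p (vv s u c)"
    using assms by (auto simp: Lev_def Phi_def)
  then have "evalw (vv s u c) (surface_relator g p) = cz n" by (simp add: evalw_vv Om_def)
  then show ?thesis using that z rep_surface_elem by metis
qed

lemma signs_cases: "signs s p \<Longrightarrow> i < p \<Longrightarrow> s i = 1 \<or> s i = -1"
  by (simp add: signs_def)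

lemma Lev_type_preserving:
  assumes "signs s p" shows "Lev g p s n \<subseteq> type_preserving g p"
proof
  fix \<phi> assume "\<phi> \<in> Lev g p s n"
  then obtain u c where z: "(u, c) \<in> Om g p s n" "\<phi> = rep g p (vv s u c)"
    "evalw (vv s u c) (surface_relator g p) = cz n"
    "\<And>x. x \<in> surface_gens g p \<Longrightarrow> \<phi> (surface_elem g p x) = ppi (vv s u c x)" by (rule Lev_rep) blast
  have "parabolic (\<phi> (surface_elem g p (GenC i)))" if i: "i < p" for i
  proof -
    have "\<phi> (surface_elem g p (GenC i)) = ppi (para (s i) (c i))" using z(4)[of "GenC i"] i by (simp add: vv_def)
    moreover have "c i \<noteq> 0" using z(1) by (simp add: Om_def)
    ultimately show ?thesis unfolding parabolic_iff using signs_cases[OF assms i] by blast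
  qed
  then show "\<phi> \<in> type_preserving g p" using rep_hom[OF z(3)] z(2) by (simp add: type_preserving_def)
qed

lemma Lev_cover:
  assumes "\<phi> \<in> type_preserving g p" obtains s n where "signs s p" "\<phi> \<in> Lev g p s n"
proof -
  have h: "\<phi> \<in> hom (surface_group g p) PSL2 \<inter> extensional (carrier (surface_group g p))"
    and par: "\<And>i. i < p \<Longrightarrow> parabolic (\<phi> (surface_elem g p (GenC i)))" using assms by (auto simp: type_preserving_def)
  have "\<exists>e c. (e = 1 \<or> e = -1) \<and> c \<noteq> 0 \<and> \<phi> (surface_elem g p (GenC i)) = ppi (para e c)" if "i < p" for i
    using par[OF that] parabolic_iff by blast
  then obtain s c where sc: "\<And>i. i < p \<Longrightarrow> (s i = 1 \<or> s i = -1) \<and> c i \<noteq> 0 \<and> \<phi> (surface_elem g p (GenC i)) = ppi (para (s i) (c i))"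
    by metis
  have "\<exists>y. \<phi> (surface_elem g p x) = ppi y" if "x \<in> surface_gens g p" for x
  proof -
    have "\<phi> (surface_elem g p x) \<in> carrier PSL2" using type_preserving_closed[OF assms surface_elem_closed[OF that]] .
    then show ?thesis by (auto simp: carrier_PSL2)
  qed
  then obtain v0 where v0: "\<And>x. x \<in> surface_gens g p \<Longrightarrow> \<phi> (surface_elem g p x) = ppi (v0 x)" by metis
  define v where "v x = (case x of GenC i \<Rightarrow> para (s i) (c i) | _ \<Rightarrow> v0 x)" for x
  have v: "\<phi> (surface_elem g p x) = ppi (v x)" if "x \<in> surface_gens g p" for x
    using that v0 sc by (cases x) (auto simp: v_def)
  obtain n where "evalw v (surface_relator g p) = cz n" using rep_unique(2)[OF h v] by blast
  moreover have s: "signs s p" using sc by (simp add: signs_def)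
  ultimately have "rep g p v \<in> Lev g p s n" using sc by (intro rep_in_Lev) (auto simp: v_def)
  then show ?thesis using that s rep_unique(1)[OF h v] by simp
qed

lemma continuous_map_euclidean_plus:
  assumes "continuous_map X euclidean f" "continuous_map X euclidean g" shows "continuous_map X euclidean (\<lambda>x. f x + g x :: cov)"
proof -
  have 1: "continuous_map X euclidean (\<lambda>x. (f x, g x))" using continuous_map_pairedI[OF assms] by simp
  have "continuous_map euclidean euclidean (\<lambda>z :: cov \<times> cov. fst z + snd z)"
    unfolding continuous_map_iff_continuous2 by (intro continuous_intros)
  from continuous_map_compose[OF 1 this] show ?thesis by (simp add: o_def)
qed

lemma continuous_map_evalw:
  assumes "\<And>x. x \<in> X \<Longrightarrow> continuous_map T euclidean (\<lambda>z. V z x)" "u \<in> words X"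
  shows "continuous_map T euclidean (\<lambda>z. evalw (V z) u)"
  using assms(2)
proof (induction u)
  case (Cons a u)
  obtain x b where a: "a = (x, b)" by (cases a)
  have 1: "continuous_map T euclidean (\<lambda>z. V z x)" using Cons.prems assms(1) a by simp
  have "continuous_map euclidean euclidean (uminus :: cov \<Rightarrow> cov)"
    unfolding continuous_map_iff_continuous2 by (intro continuous_intros)
  from continuous_map_compose[OF 1 this] have "continuous_map T euclidean (\<lambda>z. if b then V z x else - V z x)"
    using 1 by (cases b) (simp_all add: o_def)
  then show ?case using Cons a by (auto intro: continuous_map_euclidean_plus)
qed simp

lemma continuous_map_Phi:
  assumes "signs s p" shows "continuous_map (top_of_set (Om g p s n)) (rep_space g p) (Phi g p s)"
proof (rule continuous_map_into_rep_space)
  fix z assume "z \<in> topspace (top_of_set (Om g p s n))"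
  then show "Phi g p s z \<in> type_preserving g p" using Lev_type_preserving[OF assms, of g n] by (auto simp: Lev_def)
next
  fix P assume "P \<in> carrier (surface_group g p)"
  then obtain w where w: "w \<in> words (surface_gens g p)" "P = pres_class (surface_gens g p) (relators g p) w"
    by (auto simp: surface_group_def carrier_presented_group)
  let ?V = "\<lambda>z. vv s (fst z) (snd z)"
  have f: "continuous_on (Om g p s n) (\<lambda>z. fst z j)" "continuous_on (Om g p s n) (\<lambda>z. snd z i)" for i j
    by (rule continuous_on_coord, rule continuous_on_fst continuous_on_snd, rule continuous_on_id)+
  have "continuous_on (Om g p s n) (\<lambda>z. ?V z x)" for x
    by (cases x) (simp_all add: vv_def f continuous_on_fst continuous_on_snd continuous_on_para)
  then have "continuous_map (top_of_set (Om g p s n)) euclidean (\<lambda>z. evalw (?V z) w)"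
    by (intro continuous_map_evalw[OF _ w(1)]) simp
  then have c: "continuous_map (top_of_set (Om g p s n)) PSL2_top (\<lambda>z. ppi (evalw (?V z) w))"
    by (intro continuous_map_ppi) simp
  have "Phi g p s z P = ppi (evalw (?V z) w)" if "z \<in> Om g p s n" for z
  proof -
    have "evalw (?V z) (surface_relator g p) = cz n" using that by (simp add: evalw_vv Om_def)
    then show ?thesis unfolding Phi_def rep_def w(2)
      by (intro hom_of_class w) (use ppi_cz[of n 0] in \<open>simp add: ppi_0\<close>)
  qed
  then show "continuous_map (top_of_set (Om g p s n)) PSL2_top (\<lambda>z. Phi g p s z P)"
    by (intro continuous_map_eq[OF c]) simp
qed

subsection \<open>Invariants\<close>

lemma Lev_sign:
  assumes "signs s p" "\<phi> \<in> Lev g p s n"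
  shows "sign_vec g p \<phi> = (\<lambda>i\<in>{..<p}. if s i = 1 then 1 else - 1)"
  unfolding sign_vec_def
proof (rule restrict_ext)
  fix i assume i: "i \<in> {..<p}"
  obtain u c where "(u, c) \<in> Om g p s n"
    "\<And>x. x \<in> surface_gens g p \<Longrightarrow> \<phi> (surface_elem g p x) = ppi (vv s u c x)"
    by (rule Lev_rep[OF assms(2)]) blast
  from this(1) this(2)[of "GenC i"] have z: "c i \<noteq> 0" "\<phi> (surface_elem g p (GenC i)) = ppi (para (s i) (c i))"
    using i by (simp_all add: Om_def vv_def)
  then show "(if positive_parabolic (\<phi> (surface_elem g p (GenC i))) then 1
     else if negative_parabolic (\<phi> (surface_elem g p (GenC i))) then - 1 else 0) = (if s i = 1 then 1 else - 1 :: int)"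
    using sign_parabolic[of "s i" "c i"] signs_cases[OF assms(1), of i] i z(2) by auto
qed

lemma ordered_prod_Lam:
  assumes "\<And>i. i < n \<Longrightarrow> F i = Lam (f i)"
  shows "ordered_prod SL2_cover F n = Lam (sum_list (map f [0..<n]))"
proof -
  have "foldr (\<otimes>\<^bsub>SL2_cover\<^esub>) (map F xs) \<one>\<^bsub>SL2_cover\<^esub> = Lam (sum_list (map f xs))" if "set xs \<subseteq> {..<n}" for xs
    using that by (induction xs) (auto simp: Lam_0 assms)
  then show ?thesis by (simp add: ordered_prod_def atLeast0LessThan)
qed

lemma group_commutator_Lam: "group_commutator SL2_cover (Lam a) (Lam b) = Lam (cmt a b)"
  by (simp add: group_commutator_def cmt_def)

lemma sum_list_cp: "sum_list (map (\<lambda>j. cmt (fst (u j)) (snd (u j))) [0..<g]) = cp u 0 g"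
  by (induction g) simp_all

text \<open>Commutators do not depend on the lifts, so the model solution computes the product for
  all lifts at once; injectivity of \<open>Lam\<close> makes the exponent unique.\<close>

lemma Lev_euler:
  assumes s: "signs s p" and "\<phi> \<in> Lev g p s n"
  shows "rel_euler_class g p \<phi> = n"
proof -
  obtain u c where z: "(u, c) \<in> Om g p s n"
    "\<And>x. x \<in> surface_gens g p \<Longrightarrow> \<phi> (surface_elem g p x) = ppi (vv s u c x)"
    using Lev_rep[OF assms(2)] by metis
  have C: "parabolic_lift (\<phi> (surface_elem g p (GenC i))) = Lam (para (s i) (c i))" if "i < p" for i
    using z(2)[of "GenC i"] parabolic_lift_para[of "s i" "c i"] signs_cases[OF s that] z(1) that by (auto simp: vv_def Om_def)
  have AB: "\<phi> (surface_elem g p (GenA j)) = ppi (fst (u j))" "\<phi> (surface_elem g p (GenB j)) = ppi (snd (u j))" if "j < g" for j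
    using z(2)[of "GenA j"] z(2)[of "GenB j"] that by (simp_all add: vv_def)
  let ?lift = "\<lambda>\<alpha> \<beta>. \<forall>j<g. \<alpha> j \<in> carrier SL2_cover \<and> cover_proj (\<alpha> j) = \<phi> (surface_elem g p (GenA j)) \<and>
    \<beta> j \<in> carrier SL2_cover \<and> cover_proj (\<beta> j) = \<phi> (surface_elem g p (GenB j))"
  have val: "ordered_prod SL2_cover (\<lambda>j. group_commutator SL2_cover (\<alpha> j) (\<beta> j)) g \<otimes>\<^bsub>SL2_cover\<^esub>
       ordered_prod SL2_cover (\<lambda>i. parabolic_lift (\<phi> (surface_elem g p (GenC i)))) p = Lam (cz n)" if ab: "?lift \<alpha> \<beta>" for \<alpha> \<beta>
  proof -
    have "group_commutator SL2_cover (\<alpha> j) (\<beta> j) = Lam (cmt (fst (u j)) (snd (u j)))" if j: "j < g" for j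
    proof -
      obtain a b where a: "\<alpha> j = Lam a" "\<beta> j = Lam b" using ab j by (auto simp: carrier_cover)
      then have "ppi a = ppi (fst (u j))" "ppi b = ppi (snd (u j))" using ab j AB[OF j] by auto
      then obtain k l where "a = cz k + fst (u j)" "b = cz l + snd (u j)" unfolding ppi_eq_iff by blast
      then show ?thesis by (simp add: a group_commutator_Lam)
    qed
    then show ?thesis using z(1) C
      by (simp add: ordered_prod_Lam[of g _ "\<lambda>j. cmt (fst (u j)) (snd (u j))"] ordered_prod_Lam[of p _ "\<lambda>i. para (s i) (c i)"] sum_list_cp sum_list_pp Om_def)
  qed
  have ex: "?lift (\<lambda>j. Lam (fst (u j))) (\<lambda>j. Lam (snd (u j)))" by (simp add: AB)
  show ?thesis unfolding rel_euler_class_def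
  proof (rule the_equality)
    show "\<forall>\<alpha> \<beta>. ?lift \<alpha> \<beta> \<longrightarrow> ordered_prod SL2_cover (\<lambda>j. group_commutator SL2_cover (\<alpha> j) (\<beta> j)) g \<otimes>\<^bsub>SL2_cover\<^esub>
       ordered_prod SL2_cover (\<lambda>i. parabolic_lift (\<phi> (surface_elem g p (GenC i)))) p = cover_z [^]\<^bsub>SL2_cover\<^esub> n"
      using val by (simp add: cover_z_Lam Lam_pow)
    fix m :: int assume "\<forall>\<alpha> \<beta>. ?lift \<alpha> \<beta> \<longrightarrow> ordered_prod SL2_cover (\<lambda>j. group_commutator SL2_cover (\<alpha> j) (\<beta> j)) g \<otimes>\<^bsub>SL2_cover\<^esub>
       ordered_prod SL2_cover (\<lambda>i. parabolic_lift (\<phi> (surface_elem g p (GenC i)))) p = cover_z [^]\<^bsub>SL2_cover\<^esub> m"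
    then have "Lam (cz n) = Lam (cz m)" using ex val[OF ex] by (simp add: cover_z_Lam Lam_pow)
    then show "m = n" using Lam_inj cz_inj by blast
  qed
qed

lemma Lev_conj:
  assumes s: "signs s p" and \<phi>: "\<phi> \<in> Lev g p s n" and h: "h \<in> carrier PSL2"
  shows "conj_rep g p h \<phi> \<in> Lev g p s n"
proof -
  obtain w where w: "h = ppi w" using h by (auto simp: carrier_PSL2)
  obtain u c where z: "(u, c) \<in> Om g p s n" "\<phi> = rep g p (vv s u c)"
    "evalw (vv s u c) (surface_relator g p) = cz n"
    by (rule Lev_rep[OF \<phi>]) blast
  let ?v = "vv s u c"
  let ?w = "\<lambda>x. cjg w (?v x)"
  have ew: "evalw ?w (surface_relator g p) = cz n" using z(3) by (simp add: evalw_cjg)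
  have rel: "ppi (evalw ?v r) = \<one>\<^bsub>PSL2\<^esub>" "ppi (evalw ?w r) = \<one>\<^bsub>PSL2\<^esub>" if "r \<in> relators g p" for r
    using that z(3) ew ppi_cz[of n 0] by (auto simp: ppi_0)
  have "conj_rep g p h \<phi> = rep g p ?w"
  proof (rule extensionalityI[of _ "carrier (surface_group g p)"])
    show "conj_rep g p h \<phi> \<in> extensional (carrier (surface_group g p))" by (simp add: conj_rep_def)
    show "rep g p ?w \<in> extensional (carrier (surface_group g p))" using rep_hom[OF ew] by simp
    fix P assume P: "P \<in> carrier (surface_group g p)"
    then obtain d where d: "d \<in> words (surface_gens g p)" "P = pres_class (surface_gens g p) (relators g p) d"
      by (auto simp: surface_group_def carrier_presented_group)
    have "rep g p ?w P = ppi (cjg w (evalw ?v d))" "\<phi> P = ppi (evalw ?v d)"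
      unfolding z(2) rep_def d(2) evalw_cjg[symmetric] by (rule hom_of_class; use rel d in blast)+
    then show "conj_rep g p h \<phi> P = rep g p ?w P" using P by (simp add: conj_rep_def w cjg_def)
  qed
  moreover have "rep g p ?w \<in> Lev g p s n"
  proof (rule rep_in_Lev[OF s ew])
    fix i assume i: "i < p"
    have "c i \<noteq> 0" using z(1) by (simp add: Om_def)
    then show "?w (GenC i) = para (s i) (be (?w (GenC i))) \<and> be (?w (GenC i)) \<noteq> 0"
      using cjg_para[OF signs_cases[OF s i], of "c i" w] be_cjg_para_nz[OF signs_cases[OF s i], of "c i" w] by (simp add: vv_def)
  qed
  ultimately show ?thesis by simp
qed

subsection \<open>Level sets are open and connected\<close>

text \<open>Among all lifts of a parabolic element, the window for \<open>th\<close> singles out the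
  lift in the image of the exponential map and its sign; both are therefore open conditions.\<close>

lemma para_char:
  assumes "parabolic (ppi y)" "s = 1 \<or> s = -1" "0 < s * th y" "s * th y < pi / 2"
  shows "y = para s (be y) \<and> be y \<noteq> 0"
proof -
  obtain e c where e: "e = 1 \<or> e = -1" "c \<noteq> 0" "ppi y = ppi (para e c)" using assms(1) parabolic_iff by blast
  then obtain k where "y = cz k + para e c" using ppi_eq_iff by blast
  moreover have "\<bar>e\<bar> = 1" using e by auto
  ultimately have "\<bar>Re (al y)\<bar> = 1" by simp
  moreover have "cos (th y) > 0" using assms by (intro cos_gt_zero_pi) auto
  then have "Re (al y) > 0" by (simp add: Re_al_pos_cos)
  ultimately have "Re (al y) = 1" by simp
  then have "y = para s (be y)" using assms para_char_pos[of y] para_char_neg[of y] by auto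
  moreover from this have "be y \<noteq> 0" using assms(3) by (metis less_irrefl mult_zero_right para_0 th_zero)
  ultimately show ?thesis by simp
qed

lemma finite_surface_gens: "finite (surface_gens g p)"
  by (simp add: surface_gens_def)

text \<open>Local sections lift the images of the generators continuously near a given
  representation, and both invariants become conditions on angles of these lifts.\<close>

lemma open_Lev:
  assumes s: "signs s p" shows "openin (rep_space g p) (Lev g p s n)"
proof (subst openin_subopen, intro ballI)
  fix \<phi>0 assume \<phi>0: "\<phi>0 \<in> Lev g p s n"
  let ?G = "surface_gens g p" and ?R = "rep_space g p"
  obtain u c where z: "(u, c) \<in> Om g p s n" "evalw (vv s u c) (surface_relator g p) = cz n"
    "\<And>x. x \<in> ?G \<Longrightarrow> \<phi>0 (surface_elem g p x) = ppi (vv s u c x)"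
    using Lev_rep[OF \<phi>0] by metis
  define v0 where "v0 = vv s u c"
  have "\<forall>x. \<exists>N sec. openin PSL2_top N \<and> ppi (v0 x) \<in> N \<and> continuous_map (subtopology PSL2_top N) euclidean sec \<and> sec (ppi (v0 x)) = v0 x \<and> (\<forall>P\<in>N. ppi (sec P) = P)"
    using local_section by metis
  then obtain N sec where N: "\<And>x. openin PSL2_top (N x)" "\<And>x. ppi (v0 x) \<in> N x" "\<And>x. continuous_map (subtopology PSL2_top (N x)) euclidean (sec x)"
    "\<And>x. sec x (ppi (v0 x)) = v0 x" "\<And>x P. P \<in> N x \<Longrightarrow> ppi (sec x P) = P" by metis
  define V where "V \<phi> x = sec x (\<phi> (surface_elem g p x))" for \<phi> :: surface_rep and x
  define O1 where "O1 = topspace ?R \<inter> (\<Inter>x\<in>?G. {\<phi> \<in> topspace ?R. \<phi> (surface_elem g p x) \<in> N x})"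
  have "openin ?R {\<phi> \<in> topspace ?R. \<phi> (surface_elem g p x) \<in> N x}" if "x \<in> ?G" for x
    using continuous_map_eval[OF surface_elem_closed[OF that]] N(1) by (auto simp: continuous_map_def)
  then have O1: "openin ?R O1" unfolding O1_def
    using finite_surface_gens by (cases "?G = {}") (auto intro!: openin_Int openin_INT)
  define T where "T = subtopology ?R O1"
  have top: "topspace T = O1" using O1 by (simp add: T_def O1_def Int_absorb1)
  have Vc: "continuous_map T euclidean (\<lambda>\<phi>. V \<phi> x)" if x: "x \<in> ?G" for x
  proof -
    have "continuous_map T (subtopology PSL2_top (N x)) (\<lambda>\<phi>. \<phi> (surface_elem g p x))"
      using continuous_map_from_subtopology[OF continuous_map_eval[OF surface_elem_closed[OF x]], of O1] x
      by (auto simp: continuous_map_in_subtopology T_def O1_def)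
    from continuous_map_compose[OF this N(3)] show ?thesis by (simp add: o_def V_def)
  qed
  have th: "continuous_map T euclidean (\<lambda>\<phi>. th (F \<phi>))" if "continuous_map T euclidean F" for F
  proof -
    have "continuous_map euclidean euclidean th" unfolding continuous_map_iff_continuous2 by (intro continuous_intros)
    from continuous_map_compose[OF that this] show ?thesis by (simp add: o_def)
  qed
  define E where "E = (\<lambda>\<phi>. th (evalw (V \<phi>) (surface_relator g p)))"
  have Ec: "continuous_map T euclidean E" unfolding E_def by (intro th continuous_map_evalw[OF Vc relator_words])
  \<comment> \<open>The relator takes central values, so its \<open>th\<close> lies in pi Z and an
    open window of half-width pi isolates n.\<close>
  define A where "A = {\<phi> \<in> O1. E \<phi> \<in> {of_int n * pi - pi<..<of_int n * pi + pi}}"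
  \<comment> \<open>The window of \<open>para_char\<close> for the sign \<open>s i\<close>.\<close>
  define C where "C i = {\<phi> \<in> O1. th (V \<phi> (GenC i)) \<in> {t. 0 < s i * t \<and> s i * t < pi / 2}}" for i
  have "openin T A" using Ec unfolding continuous_map_def top A_def by (simp del: greaterThanLessThan_iff)
  moreover have "openin T (C i)" if "i < p" for i
  proof -
    have "open {t :: real. 0 < s i * t \<and> s i * t < pi / 2}" by (intro open_Collect_conj open_Collect_less continuous_intros)
    then show ?thesis using th[OF Vc[of "GenC i"]] that unfolding continuous_map_def top C_def by (simp del: mem_Collect_eq)
  qed
  ultimately have "openin T (A \<inter> (O1 \<inter> (\<Inter>i\<in>{..<p}. C i)))"
    using openin_topspace[of T] unfolding top by (cases "p = 0") (auto intro!: openin_Int openin_INT)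
  then have op: "openin ?R (A \<inter> (O1 \<inter> (\<Inter>i\<in>{..<p}. C i)))" unfolding T_def using O1 openin_trans_full by blast
  have "\<phi>0 \<in> A \<inter> (O1 \<inter> (\<Inter>i\<in>{..<p}. C i))"
  proof -
    have tp: "\<phi>0 \<in> topspace ?R" using \<phi>0 Lev_type_preserving[OF s] topspace_rep_space by blast
    have V0: "V \<phi>0 x = v0 x" if "x \<in> ?G" for x using z(3)[OF that] N(4)[of x] by (simp add: V_def v0_def)
    have O: "\<phi>0 \<in> O1" using tp z(3) N(2) by (auto simp: O1_def v0_def)
    have "evalw (V \<phi>0) (surface_relator g p) = cz n"
      using evalw_cong[OF relator_words V0] z(2) by (simp add: v0_def)
    then have "E \<phi>0 = of_int n * pi" by (simp add: E_def)
    then have "\<phi>0 \<in> A" using O by (simp add: A_def)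
    moreover have "\<phi>0 \<in> C i" if "i < p" for i
    proof -
      have "V \<phi>0 (GenC i) = para (s i) (c i)" "c i \<noteq> 0" using V0[of "GenC i"] that z(1) by (simp_all add: v0_def vv_def Om_def)
      then show ?thesis using O th_para_bounds[of "c i"] signs_cases[OF s that] by (auto simp: C_def)
    qed
    ultimately show ?thesis using O by blast
  qed
  moreover have "A \<inter> (O1 \<inter> (\<Inter>i\<in>{..<p}. C i)) \<subseteq> Lev g p s n"
  proof
    fix \<phi> assume \<phi>: "\<phi> \<in> A \<inter> (O1 \<inter> (\<Inter>i\<in>{..<p}. C i))"
    then have tp: "\<phi> \<in> type_preserving g p" by (auto simp: O1_def topspace_rep_space)
    have V: "\<phi> (surface_elem g p x) = ppi (V \<phi> x)" if "x \<in> ?G" for x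
      using \<phi> N(5) that by (auto simp: O1_def V_def)
    have h: "\<phi> \<in> hom (surface_group g p) PSL2 \<inter> extensional (carrier (surface_group g p))" using tp by (simp add: type_preserving_def)
    obtain m where m: "evalw (V \<phi>) (surface_relator g p) = cz m" using rep_unique(2)[OF h V] by blast
    have "E \<phi> = of_int m * pi" by (simp add: E_def m)
    then have "of_int n * pi - pi < of_int m * pi" "of_int m * pi < of_int n * pi + pi" using \<phi> by (simp_all add: A_def)
    then have "(of_int n - 1) * pi < of_int m * pi" "of_int m * pi < (of_int n + 1) * pi" by (simp_all add: algebra_simps)
    then have "of_int n - 1 < (of_int m :: real)" "of_int m < (of_int n + 1 :: real)" using pi_gt_zero by (simp_all add: mult_less_cancel_right)
    then have "m = n" by linarith
    moreover have "V \<phi> (GenC i) = para (s i) (be (V \<phi> (GenC i))) \<and> be (V \<phi> (GenC i)) \<noteq> 0" if i: "i < p" for i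
    proof (rule para_char[OF _ signs_cases[OF s i]])
      have "parabolic (\<phi> (surface_elem g p (GenC i)))" using i tp by (simp add: type_preserving_def)
      then show "parabolic (ppi (V \<phi> (GenC i)))" using V[of "GenC i"] i by simp
    qed (use \<phi> i in \<open>auto simp: C_def\<close>)
    ultimately have "rep g p (V \<phi>) \<in> Lev g p s n" using m by (intro rep_in_Lev[OF s]) auto
    moreover have "\<phi> = rep g p (V \<phi>)" by (rule rep_unique(1)[OF h]) (rule V)
    ultimately show "\<phi> \<in> Lev g p s n" by (rule ssubst[rotated])
  qed
  ultimately show "\<exists>T. openin ?R T \<and> \<phi>0 \<in> T \<and> T \<subseteq> Lev g p s n" using op by blast
qed

text \<open>A separation would be a continuous Boolean function on \<open>Om\<close> that depends
  only on the representation in PSL(2,R), hence a constant one by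
  \<open>Omfun_const\<close>.\<close>

lemma connected_Lev:
  assumes s: "signs s p" "p \<ge> 1" "g = 0 \<longrightarrow> p \<ge> 3"
  shows "connectedin (rep_space g p) (Lev g p s n)"
  unfolding connectedin
proof (intro conjI notI)
  show "Lev g p s n \<subseteq> topspace (rep_space g p)" using Lev_type_preserving[OF s(1)] topspace_rep_space by blast
  assume "\<exists>E1 E2. openin (rep_space g p) E1 \<and> openin (rep_space g p) E2 \<and> Lev g p s n \<subseteq> E1 \<union> E2 \<and>
      E1 \<inter> E2 \<inter> Lev g p s n = {} \<and> E1 \<inter> Lev g p s n \<noteq> {} \<and> E2 \<inter> Lev g p s n \<noteq> {}"
  then obtain E1 E2 where E: "openin (rep_space g p) E1" "openin (rep_space g p) E2" "Lev g p s n \<subseteq> E1 \<union> E2"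
    "E1 \<inter> E2 \<inter> Lev g p s n = {}" "E1 \<inter> Lev g p s n \<noteq> {}" "E2 \<inter> Lev g p s n \<noteq> {}" by blast
  define f where "f z \<longleftrightarrow> Phi g p s z \<in> E1" for z
  have pre: "openin (top_of_set (Om g p s n)) {z \<in> Om g p s n. Phi g p s z \<in> E}" if "openin (rep_space g p) E" for E
    using continuous_map_Phi[OF s(1), of g n] that by (simp add: continuous_map_def)
  have "continuous_map (top_of_set (Om g p s n)) euclidean f" unfolding continuous_map_def
  proof (intro conjI allI impI)
    fix U :: "bool set"
    have b: "b \<in> U \<longleftrightarrow> b \<and> True \<in> U \<or> \<not> b \<and> False \<in> U" for b by (cases b) auto
    have e2: "Phi g p s z \<in> E2 \<longleftrightarrow> \<not> f z" if "z \<in> Om g p s n" for z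
      using that E(3,4) by (auto simp: f_def Lev_def)
    have "{z \<in> topspace (top_of_set (Om g p s n)). f z \<in> U} =
      (if True \<in> U then {z \<in> Om g p s n. Phi g p s z \<in> E1} else {}) \<union> (if False \<in> U then {z \<in> Om g p s n. Phi g p s z \<in> E2} else {})"
      unfolding f_def[symmetric] by (subst b) (auto simp: e2)
    also have "openin (top_of_set (Om g p s n)) \<dots>" using pre E(1,2) by (auto intro: openin_Un)
    finally show "openin (top_of_set (Om g p s n)) {z \<in> topspace (top_of_set (Om g p s n)). f z \<in> U}" .
  qed auto
  then have "continuous_on (Om g p s n) f" by simp
  moreover have "f (u', c') = f (u, c)"
    if sh: "\<forall>j<g. \<exists>l m. u' j = (cz l + fst (u j), cz m + snd (u j))" "\<forall>i<p. c' i = c i" for u c u' c'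
  proof -
    have "ppi (fst (u' j)) = ppi (fst (u j)) \<and> ppi (snd (u' j)) = ppi (snd (u j))" if j: "j < g" for j
    proof -
      obtain l m where "u' j = (cz l + fst (u j), cz m + snd (u j))" using sh(1) j by blast
      then show ?thesis by (simp add: ppi_cz)
    qed
    then have "ppi (vv s u' c' x) = ppi (vv s u c x)" if "x \<in> surface_gens g p" for x
      using that \<open>\<forall>i<p. c' i = c i\<close> by (auto simp: surface_gens_def vv_def)
    then have "Phi g p s (u', c') = Phi g p s (u, c)" unfolding Phi_def rep_def fst_conv snd_conv by (rule hom_of_cong)
    then show ?thesis by (simp add: f_def)
  qed
  ultimately have f: "Omfun g p s n f" by (simp add: Omfun_def)
  obtain z1 z2 where z: "z1 \<in> Om g p s n" "Phi g p s z1 \<in> E1" "z2 \<in> Om g p s n" "Phi g p s z2 \<in> E2"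
    using E(5,6) by (auto simp: Lev_def)
  have "f z1 = f z2" by (rule Omfun_const[OF s f z(1,3)])
  then have "Phi g p s z2 \<in> E1" using z by (simp add: f_def)
  then show False using E(4) z by (auto simp: Lev_def)
qed

section \<open>Components of the character space\<close>

abbreviation sgv :: "nat \<Rightarrow> (nat \<Rightarrow> int) set" where "sgv p \<equiv> {..<p} \<rightarrow>\<^sub>E {1, - 1}"

definition L :: "nat \<Rightarrow> nat \<Rightarrow> int \<times> (nat \<Rightarrow> int) \<Rightarrow> surface_rep set" where
  "L g p x = Lev g p (\<lambda>i. real_of_int (snd x i)) (fst x)"

lemma signs_of_int: "\<sigma> \<in> sgv p \<Longrightarrow> signs (\<lambda>i. real_of_int (\<sigma> i)) p"
  by (force simp: signs_def PiE_iff)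

lemma PiE_sign_restrict: "\<sigma> \<in> sgv p \<Longrightarrow> (\<lambda>i\<in>{..<p}. if real_of_int (\<sigma> i) = 1 then 1 else - 1) = \<sigma>"
  by (rule extensionalityI[of _ "{..<p}"]) (auto simp: PiE_iff)

lemma L_iff:
  assumes "\<sigma> \<in> sgv p"
  shows "\<phi> \<in> L g p (n, \<sigma>) \<longleftrightarrow> \<phi> \<in> type_preserving g p \<and> rel_euler_class g p \<phi> = n \<and> sign_vec g p \<phi> = \<sigma>"
proof
  note s = signs_of_int[OF assms]
  assume "\<phi> \<in> L g p (n, \<sigma>)"
  then have "\<phi> \<in> Lev g p (\<lambda>i. real_of_int (\<sigma> i)) n" by (simp add: L_def)
  then show "\<phi> \<in> type_preserving g p \<and> rel_euler_class g p \<phi> = n \<and> sign_vec g p \<phi> = \<sigma>"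
    using Lev_type_preserving[OF s] Lev_euler[OF s] Lev_sign[OF s] PiE_sign_restrict[OF assms] by auto
next
  assume \<phi>: "\<phi> \<in> type_preserving g p \<and> rel_euler_class g p \<phi> = n \<and> sign_vec g p \<phi> = \<sigma>"
  then obtain s m where s: "signs s p" "\<phi> \<in> Lev g p s m" using Lev_cover by blast
  have m: "m = n" "\<sigma> = (\<lambda>i\<in>{..<p}. if s i = 1 then 1 else - 1)" using Lev_euler[OF s] Lev_sign[OF s] \<phi> by auto
  obtain u c where z: "(u, c) \<in> Om g p s m" "\<phi> = rep g p (vv s u c)"
    "evalw (vv s u c) (surface_relator g p) = cz m" by (rule Lev_rep[OF s(2)]) blast
  have "rep g p (vv s u c) \<in> Lev g p (\<lambda>i. real_of_int (\<sigma> i)) m"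
  proof (rule rep_in_Lev[OF signs_of_int[OF assms] z(3)])
    fix i assume i: "i < p"
    then have "real_of_int (\<sigma> i) = s i" using signs_cases[OF s(1) i] by (auto simp: m)
    then show "vv s u c (GenC i) = para (real_of_int (\<sigma> i)) (be (vv s u c (GenC i))) \<and>
        be (vv s u c (GenC i)) \<noteq> 0" using z(1) by (simp add: vv_def Om_def)
  qed
  then show "\<phi> \<in> L g p (n, \<sigma>)" by (simp add: L_def z(2) m(1))
qed

lemma sign_vec_PiE:
  assumes "\<phi> \<in> type_preserving g p" shows "sign_vec g p \<phi> \<in> sgv p"
proof -
  obtain s m where s: "signs s p" "\<phi> \<in> Lev g p s m" using Lev_cover[OF assms] .
  show ?thesis unfolding Lev_sign[OF s] by auto
qed

lemma cnt_p_plus: "cnt (\<lambda>i. real_of_int (\<sigma> i)) p 1 = int (p_plus p \<sigma>)" "cnt (\<lambda>i. real_of_int (\<sigma> i)) p (-1) = int (p_minus p \<sigma>)"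
proof -
  have "(real_of_int x = 1) = (x = 1)" "(real_of_int x = - 1) = (x = - 1)" for x by linarith+
  then show "cnt (\<lambda>i. real_of_int (\<sigma> i)) p 1 = int (p_plus p \<sigma>)" "cnt (\<lambda>i. real_of_int (\<sigma> i)) p (-1) = int (p_minus p \<sigma>)"
    by (simp_all add: cnt_def p_plus_def p_minus_def)
qed

lemma p_plus_minus:
  assumes "\<sigma> \<in> sgv p" shows "p_plus p \<sigma> + p_minus p \<sigma> = p"
proof -
  have "{i. i < p \<and> \<sigma> i = 1} \<union> {i. i < p \<and> \<sigma> i = - 1} = {..<p}" using assms by (force simp: PiE_iff)
  moreover have "card ({i. i < p \<and> \<sigma> i = 1} \<union> {i. i < p \<and> \<sigma> i = - 1}) = p_plus p \<sigma> + p_minus p \<sigma>"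
    unfolding p_plus_def p_minus_def by (rule card_Un_disjoint) auto
  ultimately show ?thesis by simp
qed

lemma L_nonempty:
  assumes "p \<ge> 1" "g = 0 \<longrightarrow> p \<ge> 3" "\<sigma> \<in> sgv p"
  shows "L g p (n, \<sigma>) \<noteq> {} \<longleftrightarrow> (n, \<sigma>) \<in> admissible_pairs g p"
proof -
  let ?a = "p_plus p \<sigma>" and ?b = "p_minus p \<sigma>"
  have "int ?a + int ?b = int p" using p_plus_minus[OF assms(3)] by linarith
  then have eq: "2 - 2 * int g - int ?b \<le> n \<and> n \<le> 2 * int g - 2 + int ?a \<longleftrightarrow> euler_char g p + int ?a \<le> n \<and> n \<le> - euler_char g p - int ?b"
    unfolding euler_char_def by linarith
  have nat: "int k = 1 \<longleftrightarrow> k = 1" "int k = 0 \<longleftrightarrow> k = 0" for k by auto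
  have "L g p (n, \<sigma>) \<noteq> {} \<longleftrightarrow> Om g p (\<lambda>i. real_of_int (\<sigma> i)) n \<noteq> {}" by (simp add: L_def Lev_def)
  also have "\<dots> \<longleftrightarrow> euler_char g p + int ?a \<le> n \<and> n \<le> - euler_char g p - int ?b \<or>
     g = 0 \<and> (n = 0 \<and> (?a = 1 \<or> ?b = 1) \<or> n = 1 \<and> ?b = 0 \<or> n = - 1 \<and> ?a = 0)"
    using Om_nonempty[OF signs_of_int[OF assms(3)] assms(1,2), of n] unfolding cnt_p_plus eq nat .
  also have "\<dots> \<longleftrightarrow> (n, \<sigma>) \<in> admissible_pairs g p"
    unfolding admissible_pairs_def mem_Collect_eq prod.case using assms(3) by blast
  finally show ?thesis .
qed

lemma orbit_self:
  assumes "\<phi> \<in> type_preserving g p" shows "\<phi> \<in> conj_orbit g p \<phi>"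
proof -
  have "conj_rep g p (ppi 0) \<phi> = \<phi>"
  proof (rule extensionalityI[of _ "carrier (surface_group g p)"])
    fix P assume "P \<in> carrier (surface_group g p)"
    then show "conj_rep g p (ppi 0) \<phi> P = \<phi> P"
      using type_preserving_closed[OF assms] by (simp add: conj_rep_def ppi_0)
  qed (use assms in \<open>auto simp: conj_rep_def type_preserving_def\<close>)
  then show ?thesis unfolding conj_orbit_def by (metis imageI ppi_closed)
qed

lemma orbit_L: "\<sigma> \<in> sgv p \<Longrightarrow> \<phi> \<in> L g p (n, \<sigma>) \<Longrightarrow> conj_orbit g p \<phi> \<subseteq> L g p (n, \<sigma>)"
  using Lev_conj[OF signs_of_int] by (auto simp: conj_orbit_def L_def)

lemma topspace_character_space: "topspace (character_space g p) = conj_orbit g p ` type_preserving g p"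
  by (simp add: character_space_def topspace_rep_space)

lemma characters_with_L:
  assumes "\<sigma> \<in> sgv p" shows "characters_with g p (n, \<sigma>) = conj_orbit g p ` L g p (n, \<sigma>)"
proof (intro equalityI subsetI)
  fix c assume "c \<in> characters_with g p (n, \<sigma>)"
  then obtain \<phi> where "c = conj_orbit g p \<phi>" "\<phi> \<in> type_preserving g p" "\<forall>\<phi>\<in>c. rel_euler_class g p \<phi> = n \<and> sign_vec g p \<phi> = \<sigma>"
    by (auto simp: characters_with_def topspace_character_space)
  then show "c \<in> conj_orbit g p ` L g p (n, \<sigma>)" using orbit_self L_iff[OF assms] by blast
next
  fix c assume "c \<in> conj_orbit g p ` L g p (n, \<sigma>)"
  then obtain \<phi> where \<phi>: "c = conj_orbit g p \<phi>" "\<phi> \<in> L g p (n, \<sigma>)" by blast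
  then have "c \<subseteq> L g p (n, \<sigma>)" using orbit_L[OF assms] by blast
  then show "c \<in> characters_with g p (n, \<sigma>)"
    using \<phi> L_iff[OF assms] by (auto simp: characters_with_def topspace_character_space)
qed

lemma orbit_in_L:
  assumes "\<sigma> \<in> sgv p" "\<phi> \<in> type_preserving g p" "conj_orbit g p \<phi> \<in> conj_orbit g p ` L g p (n, \<sigma>)"
  shows "\<phi> \<in> L g p (n, \<sigma>)"
  using orbit_self[OF assms(2)] orbit_L[OF assms(1)] assms(3) by blast

text \<open>The level set is a union of conjugation orbits, so it is the full preimage of its image
  in the quotient.\<close>

lemma characters_with_open:
  assumes \<sigma>: "\<sigma> \<in> sgv p" shows "openin (character_space g p) (characters_with g p (n, \<sigma>))"
proof -
  have tp: "L g p (n, \<sigma>) \<subseteq> type_preserving g p" using L_iff[OF \<sigma>] by blast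
  have "{\<phi> \<in> type_preserving g p. conj_orbit g p \<phi> \<in> conj_orbit g p ` L g p (n, \<sigma>)} = L g p (n, \<sigma>)"
    using tp orbit_in_L[OF \<sigma>] by blast
  moreover have "openin (rep_space g p) (L g p (n, \<sigma>))" unfolding L_def by (simp add: open_Lev signs_of_int[OF \<sigma>])
  ultimately show ?thesis unfolding characters_with_L[OF \<sigma>] character_space_def openin_quotient_topology topspace_rep_space
    using tp by auto
qed

lemma characters_with_connected:
  assumes "p \<ge> 1" "g = 0 \<longrightarrow> p \<ge> 3" "\<sigma> \<in> sgv p"
  shows "connectedin (character_space g p) (characters_with g p (n, \<sigma>))"
proof -
  have "continuous_map (rep_space g p) (character_space g p) (conj_orbit g p)"
    unfolding continuous_map_def character_space_def by (auto simp: openin_quotient_topology)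
  moreover have "connectedin (rep_space g p) (L g p (n, \<sigma>))"
    unfolding L_def using connected_Lev[OF signs_of_int[OF assms(3)] assms(1,2)] by simp
  ultimately show ?thesis unfolding characters_with_L[OF assms(3)] by (rule connectedin_continuous_map_image)
qed

text \<open>Each member is also closed, its complement being the union of the other members.\<close>

lemma connected_components_partition:
  assumes "\<Union>\<C> = topspace X" and C: "\<And>C. C \<in> \<C> \<Longrightarrow> openin X C \<and> connectedin X C \<and> C \<noteq> {}" and "disjoint \<C>"
  shows "connected_components_of X = \<C>"
proof -
  have *: "connected_component_of_set X y = C" if "C \<in> \<C>" "y \<in> C" for C y
  proof
    show "C \<subseteq> connected_component_of_set X y"
      by (rule connected_component_of_maximal) (use C[OF that(1)] that(2) in auto)
    have "topspace X - C = \<Union>(\<C> - {C})" using assms(1,3) that(1) by (auto simp: disjoint_def)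
    moreover have "openin X (\<Union>(\<C> - {C}))" using C by blast
    ultimately have cl: "closedin X C" using C[OF that(1)] by (simp add: closedin_def openin_subset)
    have "connected_component_of_set X y \<subseteq> C \<or> disjnt (connected_component_of_set X y) C"
      using connectedin_clopen_cases[OF connectedin_connected_component_of cl] C[OF that(1)] by blast
    moreover have "y \<in> connected_component_of_set X y"
      using C[OF that(1)] that openin_subset by (fastforce simp: connected_component_of_refl)
    ultimately show "connected_component_of_set X y \<subseteq> C" using that(2) by (auto simp: disjnt_def)
  qed
  show ?thesis unfolding connected_components_of_def assms(1)[symmetric]
  proof (intro equalityI subsetI)
    fix C assume "C \<in> \<C>"
    then show "C \<in> connected_component_of_set X ` \<Union> \<C>" using * C by (metis UnionI ex_in_conv image_eqI)
  qed (use * in auto)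
qed

subsection \<open>Counting\<close>

lemma card_signs: "card {\<sigma> \<in> sgv p. p_plus p \<sigma> = k} = p choose k"
proof -
  have "bij_betw (\<lambda>\<sigma>. {i. i < p \<and> \<sigma> i = 1}) {\<sigma> \<in> sgv p. p_plus p \<sigma> = k} {B. B \<subseteq> {..<p} \<and> card B = k}"
  proof (rule bij_betw_byWitness[where f' = "\<lambda>B. \<lambda>i\<in>{..<p}. if i \<in> B then 1 else - 1"])
    show "\<forall>\<sigma>\<in>{\<sigma> \<in> sgv p. p_plus p \<sigma> = k}. (\<lambda>i\<in>{..<p}. if i \<in> {i. i < p \<and> \<sigma> i = 1} then 1 else - 1) = \<sigma>"
      by (intro ballI extensionalityI[of _ "{..<p}"]) (auto simp: PiE_iff)
    show inv: "\<forall>B\<in>{B. B \<subseteq> {..<p} \<and> card B = k}. {i. i < p \<and> (\<lambda>i\<in>{..<p}. if i \<in> B then 1 else - 1 :: int) i = 1} = B" by auto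
    show "(\<lambda>\<sigma>. {i. i < p \<and> \<sigma> i = 1}) ` {\<sigma> \<in> sgv p. p_plus p \<sigma> = k} \<subseteq> {B. B \<subseteq> {..<p} \<and> card B = k}"
      by (auto simp: p_plus_def)
    show "(\<lambda>B. \<lambda>i\<in>{..<p}. if i \<in> B then 1 else - 1) ` {B. B \<subseteq> {..<p} \<and> card B = k} \<subseteq> {\<sigma> \<in> sgv p. p_plus p \<sigma> = k}"
      using inv unfolding p_plus_def by fastforce
  qed
  then show ?thesis by (simp add: bij_betw_same_card n_subsets)
qed

lemma finite_signs: "finite (sgv p)"
  by (intro finite_PiE) auto

lemma card_Sigma_signs:
  assumes "finite N" "finite K"
  shows "card {(n, \<sigma>). n \<in> N \<and> \<sigma> \<in> sgv p \<and> int (p_plus p \<sigma>) \<in> {a n..b n}} =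
    (\<Sum>n\<in>(N :: int set). \<Sum>k = max (a n) 0..min (b n) (int p). p choose nat k)"
proof -
  let ?S = "sgv p"
  have one: "card {\<sigma> \<in> ?S. int (p_plus p \<sigma>) \<in> {l..h}} = (\<Sum>k = max l 0..min h (int p). p choose nat k)" for l h
  proof -
    have le: "int (p_plus p \<sigma>) \<le> int p" if "\<sigma> \<in> ?S" for \<sigma> using p_plus_minus[OF that] by linarith
    have "{\<sigma> \<in> ?S. int (p_plus p \<sigma>) \<in> {l..h}} = (\<Union>k\<in>{max l 0..min h (int p)}. {\<sigma> \<in> ?S. p_plus p \<sigma> = nat k})"
    proof (intro equalityI subsetI)
      fix \<sigma> assume "\<sigma> \<in> {\<sigma> \<in> ?S. int (p_plus p \<sigma>) \<in> {l..h}}"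
      then show "\<sigma> \<in> (\<Union>k\<in>{max l 0..min h (int p)}. {\<sigma> \<in> ?S. p_plus p \<sigma> = nat k})"
        using le[of \<sigma>] by (intro UN_I[of "int (p_plus p \<sigma>)"]) simp_all
    next
      fix \<sigma> assume "\<sigma> \<in> (\<Union>k\<in>{max l 0..min h (int p)}. {\<sigma> \<in> ?S. p_plus p \<sigma> = nat k})"
      then obtain k where k: "max l 0 \<le> k" "k \<le> min h (int p)" "\<sigma> \<in> ?S" "p_plus p \<sigma> = nat k" by (auto simp del: PiE_iff)
      then show "\<sigma> \<in> {\<sigma> \<in> ?S. int (p_plus p \<sigma>) \<in> {l..h}}" by simp
    qed
    also have "card \<dots> = (\<Sum>k = max l 0..min h (int p). card {\<sigma> \<in> ?S. p_plus p \<sigma> = nat k})"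
      by (rule card_UN_disjoint) (use finite_signs in auto)
    finally show ?thesis by (simp add: card_signs)
  qed
  have "{(n, \<sigma>). n \<in> N \<and> \<sigma> \<in> ?S \<and> int (p_plus p \<sigma>) \<in> {a n..b n}} = Sigma N (\<lambda>n. {\<sigma> \<in> ?S. int (p_plus p \<sigma>) \<in> {a n..b n}})" by auto
  then show ?thesis using assms(1) finite_signs one by (simp add: card_SigmaI)
qed

lemma card_admissible:
  assumes "p \<ge> 1" "g = 0 \<longrightarrow> p \<ge> 3"
  shows "finite (admissible_pairs g p)" "card (admissible_pairs g p) =
     (\<Sum>n = euler_char g p .. - euler_char g p.
        \<Sum>k = max (n + int p + euler_char g p) 0 .. min (n - euler_char g p) (int p). p choose nat k) + (if g = 0 then 2 * p + 2 else 0)"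
proof -
  let ?S = "sgv p" and ?x = "euler_char g p"
  define A1 where "A1 = {(n, \<sigma>). n \<in> {?x..-?x} \<and> \<sigma> \<in> ?S \<and> int (p_plus p \<sigma>) \<in> {n + int p + ?x..n - ?x}}"
  define A2 where "A2 = {(n :: int, \<sigma>). \<sigma> \<in> ?S \<and> g = 0 \<and> (n = 0 \<and> (p_minus p \<sigma> = 1 \<or> p_plus p \<sigma> = 1) \<or> n = 1 \<and> p_minus p \<sigma> = 0 \<or> n = - 1 \<and> p_plus p \<sigma> = 0)}"
  have pm: "int (p_minus p \<sigma>) = int p - int (p_plus p \<sigma>)" "p_plus p \<sigma> \<le> p" if "\<sigma> \<in> ?S" for \<sigma> using p_plus_minus[OF that] by linarith+
  have un: "admissible_pairs g p = A1 \<union> A2"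
  proof (rule Set.set_eqI)
    fix x :: "int \<times> (nat \<Rightarrow> int)"
    obtain n \<sigma> where x: "x = (n, \<sigma>)" by (cases x)
    have "\<sigma> \<in> ?S \<Longrightarrow> (?x + int (p_plus p \<sigma>) \<le> n \<and> n \<le> - ?x - int (p_minus p \<sigma>)) \<longleftrightarrow>
      (n \<in> {?x..-?x} \<and> int (p_plus p \<sigma>) \<in> {n + int p + ?x..n - ?x})"
      unfolding atLeastAtMost_iff using pm[of \<sigma>] by linarith
    then show "x \<in> admissible_pairs g p \<longleftrightarrow> x \<in> A1 \<union> A2"
      unfolding x admissible_pairs_def A1_def A2_def Un_iff mem_Collect_eq prod.case by blast
  qed
  \<comment> \<open>For g = 0, membership in \<open>A1\<close> bounds \<open>p_plus\<close> by n + 2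
    from below and by n + p - 2 from above. This excludes 1 and p - 1 for n = 0, the value p for n =
    1, and the value 0 for n = -1.\<close>
  have dis: "A1 \<inter> A2 = {}"
  proof -
    have False if "(n, \<sigma>) \<in> A1" "(n, \<sigma>) \<in> A2" for n \<sigma>
    proof -
      have S: "\<sigma> \<in> ?S" using that by (simp add: A1_def)
      show False using that pm[OF S] assms
        unfolding A1_def A2_def mem_Collect_eq prod.case atLeastAtMost_iff euler_char_def by (elim conjE disjE) linarith+
    qed
    then show ?thesis by fast
  qed
  have f1: "finite A1" unfolding A1_def
    by (rule finite_subset[of _ "{?x..-?x} \<times> ?S"]) (use finite_signs in auto)
  \<comment> \<open>The origin of 2 p + 2: the four pieces have p, p, 1 and 1 elements. The first
    two are disjoint since p - 1 differs from 1.\<close>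
  have A2: "A2 = (if g = 0 then {0} \<times> {\<sigma> \<in> ?S. p_plus p \<sigma> = p - 1} \<union> {0} \<times> {\<sigma> \<in> ?S. p_plus p \<sigma> = 1} \<union>
     {1} \<times> {\<sigma> \<in> ?S. p_plus p \<sigma> = p} \<union> {-1} \<times> {\<sigma> \<in> ?S. p_plus p \<sigma> = 0} else {})"
  proof (cases "g = 0")
    case True
    have "p_minus p \<sigma> = 1 \<longleftrightarrow> p_plus p \<sigma> = p - 1" "p_minus p \<sigma> = 0 \<longleftrightarrow> p_plus p \<sigma> = p" if "\<sigma> \<in> ?S" for \<sigma>
      using p_plus_minus[OF that] assms by linarith+
    then show ?thesis using True unfolding A2_def by auto
  qed (simp add: A2_def)
  have f: "finite {\<sigma> \<in> ?S. p_plus p \<sigma> = k}" for k using finite_signs by simp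
  have f2: "finite A2" unfolding A2 using f by simp
  show "finite (admissible_pairs g p)" unfolding un using f1 f2 by simp
  have "card A2 = (if g = 0 then 2 * p + 2 else 0)"
  proof (cases "g = 0")
    case True
    have "p choose (p - 1) = p" using assms binomial_symmetric[of 1 p] by simp
    then have c: "card ({0 :: int} \<times> {\<sigma> \<in> ?S. p_plus p \<sigma> = p - 1} \<union> {0} \<times> {\<sigma> \<in> ?S. p_plus p \<sigma> = 1}) = p + p"
      using f assms True by (subst card_Un_disjoint) (auto simp: card_cartesian_product card_signs)
    show ?thesis using True f c unfolding A2
      by (simp add: card_Un_disjoint[of _ "{-1} \<times> _"] card_Un_disjoint[of _ "{1} \<times> _"] card_cartesian_product card_signs Int_Un_distrib2 Times_Int_Times)
  qed (simp add: A2)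
  moreover have "card A1 = (\<Sum>n = ?x .. - ?x. \<Sum>k = max (n + int p + ?x) 0 .. min (n - ?x) (int p). p choose nat k)"
    unfolding A1_def by (rule card_Sigma_signs) auto
  ultimately show "card (admissible_pairs g p) =
     (\<Sum>n = ?x .. - ?x. \<Sum>k = max (n + int p + ?x) 0 .. min (n - ?x) (int p). p choose nat k) + (if g = 0 then 2 * p + 2 else 0)"
    unfolding un using card_Un_disjoint[OF f1 f2 dis] by simp
qed

theorem corollary1p6:
  fixes g p :: nat
  assumes "p \<ge> 1" and "g = 0 \<longrightarrow> p \<ge> 3"
  shows "bij_betw (characters_with g p) (admissible_pairs g p)
           (connected_components_of (character_space g p))
       \<and> finite (connected_components_of (character_space g p))
       \<and> card (connected_components_of (character_space g p)) =
           (\<Sum>n = euler_char g p .. - euler_char g p.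
              \<Sum>k = max (n + int p + euler_char g p) 0 .. min (n - euler_char g p) (int p).
                p choose nat k)
           + (if g = 0 then 2 * p + 2 else 0)"
proof -
  let ?A = "admissible_pairs g p" and ?X = "character_space g p"
  have sg: "\<sigma> \<in> {..<p} \<rightarrow>\<^sub>E {1, - 1}" if "(n, \<sigma>) \<in> ?A" for n \<sigma> using that by (simp add: admissible_pairs_def)
  have ne: "characters_with g p x \<noteq> {}" if "x \<in> ?A" for x
    using that L_nonempty[OF assms sg] characters_with_L[OF sg] by (cases x) auto
  \<comment> \<open>A character in both sets contains a representation, whose invariants are then
    equal to both pairs.\<close>
  have inj: "x = y" if xy: "x \<in> ?A" "y \<in> ?A" "characters_with g p x \<inter> characters_with g p y \<noteq> {}" for x y
  proof -
    obtain c where c: "c \<in> characters_with g p x" "c \<in> characters_with g p y" using xy(3) by blast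
    then obtain \<phi> where "\<phi> \<in> type_preserving g p" "c = conj_orbit g p \<phi>"
      by (auto simp: characters_with_def topspace_character_space)
    then have "\<phi> \<in> c" using orbit_self by blast
    then show ?thesis using c by (auto simp: characters_with_def)
  qed
  have comp: "connected_components_of ?X = characters_with g p ` ?A"
  proof (rule connected_components_partition)
    show "\<Union> (characters_with g p ` ?A) = topspace ?X"
    proof (intro equalityI subsetI)
      fix c assume "c \<in> topspace ?X"
      then obtain \<phi> where \<phi>: "\<phi> \<in> type_preserving g p" "c = conj_orbit g p \<phi>" by (auto simp: topspace_character_space)
      let ?n = "rel_euler_class g p \<phi>" and ?s = "sign_vec g p \<phi>"
      have "\<phi> \<in> L g p (?n, ?s)" using L_iff[OF sign_vec_PiE[OF \<phi>(1)]] \<phi>(1) by blast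
      then have "(?n, ?s) \<in> ?A" "c \<in> characters_with g p (?n, ?s)"
        using L_nonempty[OF assms sign_vec_PiE[OF \<phi>(1)]] characters_with_L[OF sign_vec_PiE[OF \<phi>(1)]] \<phi>(2) by blast+
      then show "c \<in> \<Union> (characters_with g p ` ?A)" by blast
    qed (auto simp: characters_with_def)
    fix C assume "C \<in> characters_with g p ` ?A"
    then obtain n \<sigma> where "(n, \<sigma>) \<in> ?A" "C = characters_with g p (n, \<sigma>)" by auto
    then show "openin ?X C \<and> connectedin ?X C \<and> C \<noteq> {}"
      using characters_with_open[OF sg] characters_with_connected[OF assms sg] ne by blast
  next
    show "disjoint (characters_with g p ` ?A)" using inj by (auto simp: disjoint_def) blast+
  qed
  have bij: "bij_betw (characters_with g p) ?A (connected_components_of ?X)"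
    unfolding comp bij_betw_def using inj ne by (auto intro!: inj_onI)
  then show ?thesis using card_admissible[OF assms] bij_betw_finite[OF bij] bij_betw_same_card[OF bij] by simp
qed

end
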